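(* If $k$ is a field, $c\ge1$ is an integer, and $A$ is an exterior algebra $$A=k\langle X_1,\dots,X_c\rangle/(X_i^2,\ X_iX_j+X_jX_i),$$ then there are isomorphisms of vector spaces $$\widehat{\mathrm{HH}}_n(A,A)\cong\widehat{\mathrm{HH}}_{-(n+1)}(A,A),\qquad \widehat{\mathrm{HH}}^n(A,A)\cong\widehat{\mathrm{HH}}^{-(n+1)}(A,A)$$ for all $n\in\mathbb{Z}$.
   Context: The relations of $A$ are $X_i^2=0$ for all $i$ and $X_iX_j+X_jX_i=0$ for $i\ne j$. $A^e=A\otimes_kA^{op}$ is the enveloping algebra, which is selfinjective here; a bimodule $B$ is a left $A^e$-module via $(\lambda\otimes\lambda')b=\lambda b\lambda'$ and a right $A^e$-module via $b(\lambda\otimes\lambda')=\lambda'b\lambda$. A complete resolution of $A$ over $A^e$ is an acyclic complex $\mathbb{T}$ of finitely generated projective left $A^e$-modules, indexed by $\mathbb{Z}$, such that $\mathrm{Hom}_{A^e}(\mathbb{T},A^e)$ is acyclic and such that there are a projective resolution $\mathbb{P}$ of $A$ and a chain map $f\colon\mathbb{T}\to\mathbb{P}$ with $f_n$ bijective for $n\ge 0$. For $n\in\mathbb{Z}$ and a bimodule $B$, the Tate-Hochschild groups are $\widehat{\mathrm{HH}}^n(A,B)=H^n(\mathrm{Hom}_{A^e}(\mathbb{T},B))$ and $\widehat{\mathrm{HH}}_n(A,B)=H_n(B\otimes_{A^e}\mathbb{T})$. *)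

theory Defs
  imports "HOL-Algebra.Module" "HOL-Algebra.QuotRing"
begin

section \<open>Modules over a ring that need not be commutative\<close>

text \<open>
  The locale \<^locale>\<open>module\<close> of the library requires a commutative base ring.  A right
  \<open>R\<close>-module is represented by the same record type \<open>('r, 'm) module\<close>, with
  \<open>r \<odot> m\<close> standing for \<open>m \<cdot> r\<close>; it is a left module over the opposite ring.
\<close>

locale left_module = R?: ring R + M?: abelian_group M
    for R :: "('r, 'x) ring_scheme" (structure) and M :: "('r, 'm, 'y) module_scheme" (structure) +
  assumes smult_closed:
      "\<lbrakk>a \<in> carrier R; x \<in> carrier M\<rbrakk> \<Longrightarrow> a \<odot>\<^bsub>M\<^esub> x \<in> carrier M"
    and smult_l_distr:
      "\<lbrakk>a \<in> carrier R; b \<in> carrier R; x \<in> carrier M\<rbrakk>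
        \<Longrightarrow> (a \<oplus> b) \<odot>\<^bsub>M\<^esub> x = a \<odot>\<^bsub>M\<^esub> x \<oplus>\<^bsub>M\<^esub> b \<odot>\<^bsub>M\<^esub> x"
    and smult_r_distr:
      "\<lbrakk>a \<in> carrier R; x \<in> carrier M; y \<in> carrier M\<rbrakk>
        \<Longrightarrow> a \<odot>\<^bsub>M\<^esub> (x \<oplus>\<^bsub>M\<^esub> y) = a \<odot>\<^bsub>M\<^esub> x \<oplus>\<^bsub>M\<^esub> a \<odot>\<^bsub>M\<^esub> y"
    and smult_assoc1:
      "\<lbrakk>a \<in> carrier R; b \<in> carrier R; x \<in> carrier M\<rbrakk>
        \<Longrightarrow> (a \<otimes> b) \<odot>\<^bsub>M\<^esub> x = a \<odot>\<^bsub>M\<^esub> (b \<odot>\<^bsub>M\<^esub> x)"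
    and smult_one:
      "x \<in> carrier M \<Longrightarrow> \<one> \<odot>\<^bsub>M\<^esub> x = x"

definition opposite :: "('k, 'a) module \<Rightarrow> ('k, 'a) module" where
  "opposite A = A\<lparr>mult := (\<lambda>x y. y \<otimes>\<^bsub>A\<^esub> x)\<rparr>"

definition regular_module :: "('r, 'x) ring_scheme \<Rightarrow> ('r, 'r) module" where
  "regular_module R = ring.extend (ring.truncate R) (module.fields (\<lambda>r x. r \<otimes>\<^bsub>R\<^esub> x))"

definition linear_maps ::
  "('r, 'x) ring_scheme \<Rightarrow> ('r, 'm) module \<Rightarrow> ('r, 'n) module \<Rightarrow> ('m \<Rightarrow> 'n) set" where
  "linear_maps R M N =
    {f \<in> carrier M \<rightarrow> carrier N.
       (\<forall>x\<in>carrier M. \<forall>y\<in>carrier M. f (x \<oplus>\<^bsub>M\<^esub> y) = f x \<oplus>\<^bsub>N\<^esub> f y) \<and>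
       (\<forall>r\<in>carrier R. \<forall>x\<in>carrier M. f (r \<odot>\<^bsub>M\<^esub> x) = r \<odot>\<^bsub>N\<^esub> f x)}"

definition isomorphic_modules ::
  "('r, 'x) ring_scheme \<Rightarrow> ('r, 'm) module \<Rightarrow> ('r, 'n) module \<Rightarrow> bool" where
  "isomorphic_modules R M N \<longleftrightarrow>
    (\<exists>h\<in>linear_maps R M N. bij_betw h (carrier M) (carrier N))"

definition module_span :: "('r, 'x) ring_scheme \<Rightarrow> ('r, 'm) module \<Rightarrow> 'm set \<Rightarrow> 'm set" where
  "module_span R M S = \<Inter>{H. submodule H R M \<and> S \<subseteq> H}"

definition finitely_generated :: "('r, 'x) ring_scheme \<Rightarrow> ('r, 'm) module \<Rightarrow> bool" where
  "finitely_generated R M \<longleftrightarrow>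
    (\<exists>S. finite S \<and> S \<subseteq> carrier M \<and> module_span R M S = carrier M)"

text \<open>
  Quotient by a submodule \<open>N\<close>.  If \<open>M\<close> is a \<open>k\<close>-algebra and \<open>N\<close> a two-sided
  ideal, this is the quotient algebra: the ring structure is that of \<open>M Quot N\<close>.
\<close>

definition quotient_module :: "('r, 'm) module \<Rightarrow> 'm set \<Rightarrow> ('r, 'm set) module" where
  "quotient_module M N =
    ring.extend (M Quot N) (module.fields (\<lambda>r K. \<Union>x\<in>K. N +>\<^bsub>M\<^esub> (r \<odot>\<^bsub>M\<^esub> x)))"

text \<open>
  The free module on a set \<open>S\<close>: finitely supported functions on \<open>S\<close>, extended by zero to
  the whole type.  The fields \<open>mult\<close> and \<open>one\<close> of the record play no role for modules.
\<close>

definition support :: "('r, 'x) ring_scheme \<Rightarrow> ('b \<Rightarrow> 'r) \<Rightarrow> 'b set" where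
  "support R f = {x. f x \<noteq> \<zero>\<^bsub>R\<^esub>}"

definition free_module :: "('r, 'x) ring_scheme \<Rightarrow> 'b set \<Rightarrow> ('r, 'b \<Rightarrow> 'r) module" where
  "free_module R S =
    \<lparr>carrier = {f. range f \<subseteq> carrier R \<and> finite (support R f) \<and> support R f \<subseteq> S},
     mult = undefined, one = undefined,
     zero = (\<lambda>x. \<zero>\<^bsub>R\<^esub>), add = (\<lambda>f g x. f x \<oplus>\<^bsub>R\<^esub> g x),
     smult = (\<lambda>r f x. r \<otimes>\<^bsub>R\<^esub> f x)\<rparr>"

definition basis_vector :: "('r, 'x) ring_scheme \<Rightarrow> 'b \<Rightarrow> 'b \<Rightarrow> 'r" where
  "basis_vector R x = (\<lambda>y. if y = x then \<one>\<^bsub>R\<^esub> else \<zero>\<^bsub>R\<^esub>)"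

definition free_module_map ::
  "('r, 'x) ring_scheme \<Rightarrow> ('b \<Rightarrow> 'c) \<Rightarrow> ('b \<Rightarrow> 'r) \<Rightarrow> 'c \<Rightarrow> 'r" where
  "free_module_map R \<phi> f = (\<lambda>y. \<Oplus>\<^bsub>R\<^esub>x\<in>{x \<in> support R f. \<phi> x = y}. f x)"

text \<open>
  A module is projective iff it is a direct summand (a retract) of a free module.  Taking the
  basis in the carrier type \<open>'m\<close> of \<open>P\<close> is no restriction: \<open>P\<close> is projective iff the
  canonical map onto \<open>P\<close> from the free module on \<open>carrier P\<close> splits.
\<close>

definition projective_module :: "('r, 'x) ring_scheme \<Rightarrow> ('r, 'm) module \<Rightarrow> bool" where
  "projective_module R P \<longleftrightarrow> left_module R P \<and>
    (\<exists>S :: 'm set. \<exists>i\<in>linear_maps R P (free_module R S).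
       \<exists>p\<in>linear_maps R (free_module R S) P. \<forall>x\<in>carrier P. p (i x) = x)"


section \<open>The exterior algebra and its enveloping algebra\<close>

text \<open>
  A \<open>k\<close>-algebra is given by a record \<open>('k, 'a) module\<close> in which all fields are used.
\<close>

definition monoid_algebra ::
  "('k, 'x) ring_scheme \<Rightarrow> ('b, 'y) monoid_scheme \<Rightarrow> ('k, 'b \<Rightarrow> 'k) module" where
  "monoid_algebra k G = (free_module k (carrier G))
    \<lparr>mult := (\<lambda>f g w. \<Oplus>\<^bsub>k\<^esub>p\<in>{p \<in> support k f \<times> support k g. fst p \<otimes>\<^bsub>G\<^esub> snd p = w}.
               f (fst p) \<otimes>\<^bsub>k\<^esub> g (snd p)),
     one := basis_vector k \<one>\<^bsub>G\<^esub>\<rparr>"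

definition free_algebra :: "('k, 'x) ring_scheme \<Rightarrow> 'b set \<Rightarrow> ('k, 'b list \<Rightarrow> 'k) module" where
  "free_algebra k S = monoid_algebra k \<lparr>carrier = lists S, mult = (@), one = []\<rparr>"

type_synonym 'k exterior = "(nat list \<Rightarrow> 'k) set"

definition exterior_algebra :: "('k, 'x) ring_scheme \<Rightarrow> nat \<Rightarrow> ('k, 'k exterior) module" where
  "exterior_algebra k c =
    (let F = free_algebra k {1..c}; \<xi> = (\<lambda>i. basis_vector k [i])
     in quotient_module F (Idl\<^bsub>F\<^esub>
          ({\<xi> i \<otimes>\<^bsub>F\<^esub> \<xi> i |i. i \<in> {1..c}} \<union>
           {\<xi> i \<otimes>\<^bsub>F\<^esub> \<xi> j \<oplus>\<^bsub>F\<^esub> \<xi> j \<otimes>\<^bsub>F\<^esub> \<xi> i |i j. i \<in> {1..c} \<and> j \<in> {1..c} \<and> i \<noteq> j})))"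

definition bilinear_relations ::
  "('k, 'x) ring_scheme \<Rightarrow> ('k, 'm) module \<Rightarrow> ('k, 'n) module \<Rightarrow> ('m \<times> 'n \<Rightarrow> 'k) set" where
  "bilinear_relations k M N =
    (let F = free_module k (carrier M \<times> carrier N); e = (\<lambda>x y. basis_vector k (x, y))
     in {e (x \<oplus>\<^bsub>M\<^esub> x') y \<ominus>\<^bsub>F\<^esub> (e x y \<oplus>\<^bsub>F\<^esub> e x' y) |x x' y.
           x \<in> carrier M \<and> x' \<in> carrier M \<and> y \<in> carrier N} \<union>
        {e x (y \<oplus>\<^bsub>N\<^esub> y') \<ominus>\<^bsub>F\<^esub> (e x y \<oplus>\<^bsub>F\<^esub> e x y') |x y y'.
           x \<in> carrier M \<and> y \<in> carrier N \<and> y' \<in> carrier N} \<union>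
        {e (a \<odot>\<^bsub>M\<^esub> x) y \<ominus>\<^bsub>F\<^esub> (a \<odot>\<^bsub>F\<^esub> e x y) |a x y.
           a \<in> carrier k \<and> x \<in> carrier M \<and> y \<in> carrier N} \<union>
        {e x (a \<odot>\<^bsub>N\<^esub> y) \<ominus>\<^bsub>F\<^esub> (a \<odot>\<^bsub>F\<^esub> e x y) |a x y.
           a \<in> carrier k \<and> x \<in> carrier M \<and> y \<in> carrier N})"

text \<open>
  \<open>A \<otimes>\<^sub>k B\<close> for \<open>k\<close>-algebras \<open>A\<close> and \<open>B\<close>.  The multiplication
  \<open>(a \<otimes> b)(a' \<otimes> b') = aa' \<otimes> bb'\<close> is induced by that of the monoid algebra of the
  multiplicative monoid \<open>A \<times> B\<close>, in which the span of the bilinear relations is an ideal.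
\<close>

definition tensor_algebra ::
  "('k, 'x) ring_scheme \<Rightarrow> ('k, 'a) module \<Rightarrow> ('k, 'b) module
    \<Rightarrow> ('k, ('a \<times> 'b \<Rightarrow> 'k) set) module" where
  "tensor_algebra k A B = quotient_module (monoid_algebra k (A \<times>\<times> B))
    (module_span k (free_module k (carrier A \<times> carrier B)) (bilinear_relations k A B))"

type_synonym ('k, 'a) enveloping = "('a \<times> 'a \<Rightarrow> 'k) set"

definition enveloping_algebra ::
  "('k, 'x) ring_scheme \<Rightarrow> ('k, 'a) module \<Rightarrow> ('k, ('k, 'a) enveloping) module" where
  "enveloping_algebra k A = tensor_algebra k A (opposite A)"

text \<open>
  The bimodule \<open>A\<close> as a left module, \<open>(\<lambda> \<otimes> \<lambda>')b = \<lambda>b\<lambda>'\<close>, and as a right module,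
  \<open>b(\<lambda> \<otimes> \<lambda>') = \<lambda>'b\<lambda>\<close>, over the enveloping algebra.  An element of the latter is a class
  of formal sums, and the value of the action does not depend on the representative \<open>f\<close>.
\<close>

definition regular_left ::
  "('k, 'x) ring_scheme \<Rightarrow> ('k, 'a) module \<Rightarrow> (('k, 'a) enveloping, 'a) module" where
  "regular_left k A = ring.extend (ring.truncate A) (module.fields
    (\<lambda>z b. THE y. \<exists>f\<in>z. y =
       (\<Oplus>\<^bsub>A\<^esub>p\<in>support k f. f p \<odot>\<^bsub>A\<^esub> (fst p \<otimes>\<^bsub>A\<^esub> b \<otimes>\<^bsub>A\<^esub> snd p))))"

definition regular_right ::
  "('k, 'x) ring_scheme \<Rightarrow> ('k, 'a) module \<Rightarrow> (('k, 'a) enveloping, 'a) module" where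
  "regular_right k A = ring.extend (ring.truncate A) (module.fields
    (\<lambda>z b. THE y. \<exists>f\<in>z. y =
       (\<Oplus>\<^bsub>A\<^esub>p\<in>support k f. f p \<odot>\<^bsub>A\<^esub> (snd p \<otimes>\<^bsub>A\<^esub> b \<otimes>\<^bsub>A\<^esub> fst p))))"


section \<open>Hom and tensor product over a \<open>k\<close>-algebra\<close>

text \<open>
  The \<open>k\<close>-vector space underlying a (left or right) module over a \<open>k\<close>-algebra \<open>E\<close>:
  \<open>a \<in> k\<close> acts as \<open>a \<cdot> 1\<^sub>E\<close>.
\<close>

definition restrict_scalars :: "('k, 'e) module \<Rightarrow> ('e, 'm) module \<Rightarrow> ('k, 'm) module" where
  "restrict_scalars E M = ring.extend (ring.truncate M) (module.fields
    (\<lambda>a m. (a \<odot>\<^bsub>E\<^esub> \<one>\<^bsub>E\<^esub>) \<odot>\<^bsub>M\<^esub> m))"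

text \<open>
  Elements of \<open>Hom\<^sub>E(M, N)\<close> are taken to be \<open>undefined\<close> off \<open>carrier M\<close>, so that equality
  of homomorphisms is equality of functions.
\<close>

definition hom_space ::
  "('k, 'e) module \<Rightarrow> ('e, 'm) module \<Rightarrow> ('e, 'n) module \<Rightarrow> ('k, 'm \<Rightarrow> 'n) module" where
  "hom_space E M N =
    \<lparr>carrier = linear_maps E M N \<inter> extensional (carrier M),
     mult = undefined, one = undefined,
     zero = (\<lambda>x\<in>carrier M. \<zero>\<^bsub>N\<^esub>),
     add = (\<lambda>f g. \<lambda>x\<in>carrier M. f x \<oplus>\<^bsub>N\<^esub> g x),
     smult = (\<lambda>a f. \<lambda>x\<in>carrier M. a \<odot>\<^bsub>restrict_scalars E N\<^esub> f x)\<rparr>"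

definition precompose :: "('e, 'm) module \<Rightarrow> ('m \<Rightarrow> 'm) \<Rightarrow> ('m \<Rightarrow> 'n) \<Rightarrow> 'm \<Rightarrow> 'n" where
  "precompose M d g = (\<lambda>x\<in>carrier M. g (d x))"

text \<open>\<open>B \<otimes>\<^sub>E M\<close> for a right \<open>E\<close>-module \<open>B\<close> and a left \<open>E\<close>-module \<open>M\<close>.\<close>

definition tensor_relations ::
  "('k, 'x) ring_scheme \<Rightarrow> ('k, 'e) module \<Rightarrow> ('e, 'b) module \<Rightarrow> ('e, 'm) module
    \<Rightarrow> ('b \<times> 'm \<Rightarrow> 'k) set" where
  "tensor_relations k E B M =
    (let F = free_module k (carrier B \<times> carrier M)
     in module_span k F
          (bilinear_relations k (restrict_scalars E B) (restrict_scalars E M) \<union>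
           {basis_vector k (r \<odot>\<^bsub>B\<^esub> b, m) \<ominus>\<^bsub>F\<^esub> basis_vector k (b, r \<odot>\<^bsub>M\<^esub> m) |r b m.
              r \<in> carrier E \<and> b \<in> carrier B \<and> m \<in> carrier M}))"

definition tensor_space ::
  "('k, 'x) ring_scheme \<Rightarrow> ('k, 'e) module \<Rightarrow> ('e, 'b) module \<Rightarrow> ('e, 'm) module
    \<Rightarrow> ('k, ('b \<times> 'm \<Rightarrow> 'k) set) module" where
  "tensor_space k E B M =
    quotient_module (free_module k (carrier B \<times> carrier M)) (tensor_relations k E B M)"

text \<open>The map \<open>id \<otimes> d\<close> from \<open>B \<otimes>\<^sub>E M\<close> to \<open>B \<otimes>\<^sub>E N\<close>, for \<open>d\<close> from \<open>M\<close> to \<open>N\<close>.\<close>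

definition tensor_map ::
  "('k, 'x) ring_scheme \<Rightarrow> ('k, 'e) module \<Rightarrow> ('e, 'b) module \<Rightarrow> ('e, 'n) module
    \<Rightarrow> ('m \<Rightarrow> 'n) \<Rightarrow> ('b \<times> 'm \<Rightarrow> 'k) set \<Rightarrow> ('b \<times> 'n \<Rightarrow> 'k) set" where
  "tensor_map k E B N d z =
    (\<Union>f\<in>z. tensor_relations k E B N +>\<^bsub>free_module k (carrier B \<times> carrier N)\<^esub>
               free_module_map k (map_prod id d) f)"


section \<open>Complexes and complete resolutions\<close>

text \<open>
  Chain complexes are indexed by \<^typ>\<open>int\<close>, with \<open>d n\<close> mapping \<open>C n\<close> to \<open>C (n - 1)\<close>.
\<close>

definition chain_complex ::
  "('r, 'x) ring_scheme \<Rightarrow> (int \<Rightarrow> ('r, 'm) module) \<Rightarrow> (int \<Rightarrow> 'm \<Rightarrow> 'm) \<Rightarrow> bool" where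
  "chain_complex R C d \<longleftrightarrow>
    (\<forall>n. left_module R (C n)) \<and>
    (\<forall>n. d n \<in> linear_maps R (C n) (C (n - 1))) \<and>
    (\<forall>n. \<forall>x\<in>carrier (C n). d (n - 1) (d n x) = \<zero>\<^bsub>C (n - 2)\<^esub>)"

definition cycles :: "('r, 'm) module \<Rightarrow> ('s, 'n) module \<Rightarrow> ('m \<Rightarrow> 'n) \<Rightarrow> 'm set" where
  "cycles V W g = {v \<in> carrier V. g v = \<zero>\<^bsub>W\<^esub>}"

text \<open>Exactness and homology at the middle term of \<open>U \<rightarrow> V \<rightarrow> W\<close>, with maps \<open>f\<close> and \<open>g\<close>.\<close>

definition exact_at ::
  "('r, 'l) module \<Rightarrow> ('r, 'm) module \<Rightarrow> ('r, 'n) module \<Rightarrow> ('l \<Rightarrow> 'm) \<Rightarrow> ('m \<Rightarrow> 'n) \<Rightarrow> bool" where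
  "exact_at U V W f g \<longleftrightarrow> f ` carrier U = cycles V W g"

definition homology_at ::
  "('r, 'l) module \<Rightarrow> ('r, 'm) module \<Rightarrow> ('r, 'n) module \<Rightarrow> ('l \<Rightarrow> 'm) \<Rightarrow> ('m \<Rightarrow> 'n)
    \<Rightarrow> ('r, 'm set) module" where
  "homology_at U V W f g = quotient_module (V\<lparr>carrier := cycles V W g\<rparr>) (f ` carrier U)"

definition projective_resolution ::
  "('r, 'x) ring_scheme \<Rightarrow> ('r, 'a) module \<Rightarrow> (int \<Rightarrow> ('r, 'm) module) \<Rightarrow> (int \<Rightarrow> 'm \<Rightarrow> 'm)
    \<Rightarrow> ('m \<Rightarrow> 'a) \<Rightarrow> bool" where
  "projective_resolution R A P \<delta> \<epsilon> \<longleftrightarrow>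
    chain_complex R P \<delta> \<and>
    (\<forall>n. projective_module R (P n)) \<and>
    (\<forall>n<0. carrier (P n) = {\<zero>\<^bsub>P n\<^esub>}) \<and>
    (\<forall>n>0. exact_at (P (n + 1)) (P n) (P (n - 1)) (\<delta> (n + 1)) (\<delta> n)) \<and>
    \<epsilon> \<in> linear_maps R (P 0) A \<and>
    exact_at (P 1) (P 0) A (\<delta> 1) \<epsilon> \<and>
    \<epsilon> ` carrier (P 0) = carrier A"

definition chain_map ::
  "('r, 'x) ring_scheme \<Rightarrow> (int \<Rightarrow> ('r, 'm) module) \<Rightarrow> (int \<Rightarrow> 'm \<Rightarrow> 'm)
    \<Rightarrow> (int \<Rightarrow> ('r, 'n) module) \<Rightarrow> (int \<Rightarrow> 'n \<Rightarrow> 'n) \<Rightarrow> (int \<Rightarrow> 'm \<Rightarrow> 'n) \<Rightarrow> bool" where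
  "chain_map R C d D \<delta> f \<longleftrightarrow>
    (\<forall>n. f n \<in> linear_maps R (C n) (D n)) \<and>
    (\<forall>n. \<forall>x\<in>carrier (C n). f (n - 1) (d n x) = \<delta> n (f n x))"

text \<open>
  The resolution \<open>P\<close> may be taken in the carrier type \<open>'m\<close> of \<open>T\<close> without loss of
  generality, since \<open>P n\<close> is in bijection with \<open>T n\<close> for \<open>n \<ge> 0\<close> and is zero for \<open>n < 0\<close>.
\<close>

definition complete_resolution ::
  "('k, 'x) ring_scheme \<Rightarrow> ('k, 'a) module \<Rightarrow> (int \<Rightarrow> (('k, 'a) enveloping, 'm) module)
    \<Rightarrow> (int \<Rightarrow> 'm \<Rightarrow> 'm) \<Rightarrow> bool" where
  "complete_resolution k A T d \<longleftrightarrow>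
    (let E = enveloping_algebra k A; E' = regular_module E in
      chain_complex E T d \<and>
      (\<forall>n. finitely_generated E (T n) \<and> projective_module E (T n)) \<and>
      (\<forall>n. exact_at (T (n + 1)) (T n) (T (n - 1)) (d (n + 1)) (d n)) \<and>
      (\<forall>n. exact_at (hom_space E (T (n - 1)) E') (hom_space E (T n) E') (hom_space E (T (n + 1)) E')
             (precompose (T n) (d n)) (precompose (T (n + 1)) (d (n + 1)))) \<and>
      (\<exists>(P :: int \<Rightarrow> (('k, 'a) enveloping, 'm) module) \<delta> \<epsilon> f.
         projective_resolution E (regular_left k A) P \<delta> \<epsilon> \<and>
         chain_map E T d P \<delta> f \<and>
         (\<forall>n\<ge>0. bij_betw (f n) (carrier (T n)) (carrier (P n)))))"


section \<open>Tate-Hochschild homology and cohomology\<close>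

text \<open>
  The groups with coefficients in the bimodule \<open>A\<close>, computed from a complete resolution
  \<open>(T, d)\<close> of \<open>A\<close>, as \<open>k\<close>-vector spaces.
\<close>

definition tate_hochschild_homology ::
  "('k, 'x) ring_scheme \<Rightarrow> ('k, 'a) module \<Rightarrow> (int \<Rightarrow> (('k, 'a) enveloping, 'm) module)
    \<Rightarrow> (int \<Rightarrow> 'm \<Rightarrow> 'm) \<Rightarrow> int \<Rightarrow> ('k, ('a \<times> 'm \<Rightarrow> 'k) set set) module" where
  "tate_hochschild_homology k A T d n =
    (let E = enveloping_algebra k A; B = regular_right k A in
      homology_at (tensor_space k E B (T (n + 1))) (tensor_space k E B (T n))
        (tensor_space k E B (T (n - 1)))
        (tensor_map k E B (T n) (d (n + 1))) (tensor_map k E B (T (n - 1)) (d n)))"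

definition tate_hochschild_cohomology ::
  "('k, 'x) ring_scheme \<Rightarrow> ('k, 'a) module \<Rightarrow> (int \<Rightarrow> (('k, 'a) enveloping, 'm) module)
    \<Rightarrow> (int \<Rightarrow> 'm \<Rightarrow> 'm) \<Rightarrow> int \<Rightarrow> ('k, ('m \<Rightarrow> 'a) set) module" where
  "tate_hochschild_cohomology k A T d n =
    (let E = enveloping_algebra k A; B = regular_left k A in
      homology_at (hom_space E (T (n - 1)) B) (hom_space E (T n) B) (hom_space E (T (n + 1)) B)
        (precompose (T n) (d n)) (precompose (T (n + 1)) (d (n + 1))))"

end

theory Submission
  imports Defs
begin

text \<open>
  The coefficient \<open>lam\<close> of the top monomial is a Frobenius form on \<open>A\<close>, and its Nakayama automorphism
  \<open>nu\<close>, \<open>lam (a b) = lam (nu (b) a)\<close>, satisfies \<open>nu (nu (a)) = a\<close>.  For a finitely generated projective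
  bimodule \<open>P\<close>, the action of the Casimir element of \<open>A\<close> identifies the coinvariants
  \<open>P / (a p - p nu (a))\<close> with the invariants \<open>{p. a p = p a}\<close>, and \<open>lam\<close> identifies \<open>Hom (P, A)\<close> with the
  \<open>k\<close>-dual of these coinvariants.  Hence the \<open>n\<close>-th cohomology of \<open>Hom (T, A)\<close> has the dimension of
  the \<open>n\<close>-th homology of the coinvariants of \<open>T\<close>.  Balancing the two variables of \<open>Hom (T, T)\<close> shows that
  it is also isomorphic to the homology of the invariants of \<open>T\<close>, hence of the coinvariants, in degree
  \<open>-n - 1\<close>; comparing the two gives the symmetry.  The same argument for the bimodule \<open>A\<close> with the right
  action twisted by \<open>nu\<close> gives the symmetry of homology, since then the twists cancel and the coinvariants
  of \<open>T\<close> are \<open>A \<otimes> T\<close> over the enveloping algebra.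
\<close>

section \<open>Left modules\<close>

text \<open>The obstacle is that \<open>A\<close> need not be symmetric. Under \<open>nu\<close> a
  word of length \<open>m\<close> is multiplied by \<open>(-1)^(m(c+1))\<close>, so for even
  \<open>c\<close> each generator changes sign, and \<open>lam\<close> pairs cohomology with
  homology twisted by \<open>nu\<close> instead of plain homology. The twist does no harm because
  the dual of the coinvariants and the norm onto the invariants involve the same twisted
  coinvariants, which serve as an intermediary only. That \<open>nu\<close> is an involution allows
  it to be used as a twist of the coefficients which cancels itself. The isomorphism built here is
  not natural: a finite-dimensional space is compared with its dual through a chosen basis. The
  index \<open>-n - 1\<close> comes from balancing. Since \<open>A\<close> is the image of
  \<open>d 0\<close>, a cocycle from \<open>T n\<close> to \<open>A\<close> is a stable map from
  degree \<open>n\<close> to degree \<open>0\<close>. Moving both degrees by \<open>-n\<close> gives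
  a stable map from degree \<open>0\<close> to degree \<open>-n\<close>, and composing it with
  \<open>d (-n)\<close> gives a map from \<open>A\<close> to \<open>T (-n - 1)\<close>.\<close>

lemma abelian_group_cong:
  assumes "abelian_group M" "carrier N = carrier M" "add N = add M" "zero N = zero M"
  shows "abelian_group N"
proof -
  interpret M: abelian_group M by fact
  show ?thesis
    by (rule abelian_groupI) (use assms(2-4) M.l_neg M.add.inv_closed in \<open>auto simp: M.a_ac intro: M.a_comm\<close>)
qed

lemma left_moduleI:
  fixes R (structure) and M (structure)
  assumes "ring R" "abelian_group M"
    and "\<And>a x. \<lbrakk>a \<in> carrier R; x \<in> carrier M\<rbrakk> \<Longrightarrow> a \<odot>\<^bsub>M\<^esub> x \<in> carrier M"
    and "\<And>a b x. \<lbrakk>a \<in> carrier R; b \<in> carrier R; x \<in> carrier M\<rbrakk>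
      \<Longrightarrow> (a \<oplus> b) \<odot>\<^bsub>M\<^esub> x = a \<odot>\<^bsub>M\<^esub> x \<oplus>\<^bsub>M\<^esub> b \<odot>\<^bsub>M\<^esub> x"
    and "\<And>a x y. \<lbrakk>a \<in> carrier R; x \<in> carrier M; y \<in> carrier M\<rbrakk>
      \<Longrightarrow> a \<odot>\<^bsub>M\<^esub> (x \<oplus>\<^bsub>M\<^esub> y) = a \<odot>\<^bsub>M\<^esub> x \<oplus>\<^bsub>M\<^esub> a \<odot>\<^bsub>M\<^esub> y"
    and "\<And>a b x. \<lbrakk>a \<in> carrier R; b \<in> carrier R; x \<in> carrier M\<rbrakk>
      \<Longrightarrow> (a \<otimes> b) \<odot>\<^bsub>M\<^esub> x = a \<odot>\<^bsub>M\<^esub> (b \<odot>\<^bsub>M\<^esub> x)"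
    and "\<And>x. x \<in> carrier M \<Longrightarrow> \<one> \<odot>\<^bsub>M\<^esub> x = x"
  shows "left_module R M"
  using assms by (simp add: left_module_def left_module_axioms_def)

text \<open>Fixes the record type without extension fields, at which \<open>linear_maps\<close> and
  \<open>quotient_module\<close> are typed.\<close>

locale lmod = left_module R M
  for R :: "('r, 'x) ring_scheme" (structure) and M :: "('r, 'm) module" (structure)

context lmod
begin

lemmas [simp] = smult_closed smult_one

lemma add_idem_zero: "\<lbrakk>x \<in> carrier M; x \<oplus>\<^bsub>M\<^esub> x = x\<rbrakk> \<Longrightarrow> x = \<zero>\<^bsub>M\<^esub>"
  using M.add.l_cancel_one[of x x] by simp

lemma smult_r_zero [simp]: "a \<in> carrier R \<Longrightarrow> a \<odot>\<^bsub>M\<^esub> \<zero>\<^bsub>M\<^esub> = \<zero>\<^bsub>M\<^esub>"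
  using smult_r_distr[of a "\<zero>\<^bsub>M\<^esub>" "\<zero>\<^bsub>M\<^esub>"] by (intro add_idem_zero) simp_all

lemma smult_l_zero [simp]: "x \<in> carrier M \<Longrightarrow> \<zero> \<odot>\<^bsub>M\<^esub> x = \<zero>\<^bsub>M\<^esub>"
  using smult_l_distr[of \<zero> \<zero> x] by (intro add_idem_zero) simp_all

lemma smult_l_minus:
  assumes "a \<in> carrier R" "x \<in> carrier M" shows "(\<ominus> a) \<odot>\<^bsub>M\<^esub> x = \<ominus>\<^bsub>M\<^esub> (a \<odot>\<^bsub>M\<^esub> x)"
proof -
  have "(\<ominus> a) \<odot>\<^bsub>M\<^esub> x \<oplus>\<^bsub>M\<^esub> a \<odot>\<^bsub>M\<^esub> x = \<zero>\<^bsub>M\<^esub>"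
    using smult_l_distr[of "\<ominus> a" a x] assms by (simp add: R.l_neg)
  then show ?thesis using assms M.minus_equality[symmetric] by simp
qed

lemma smult_r_minus:
  assumes "a \<in> carrier R" "x \<in> carrier M" shows "a \<odot>\<^bsub>M\<^esub> (\<ominus>\<^bsub>M\<^esub> x) = \<ominus>\<^bsub>M\<^esub> (a \<odot>\<^bsub>M\<^esub> x)"
proof -
  have "a \<odot>\<^bsub>M\<^esub> (\<ominus>\<^bsub>M\<^esub> x) \<oplus>\<^bsub>M\<^esub> a \<odot>\<^bsub>M\<^esub> x = \<zero>\<^bsub>M\<^esub>"
    using smult_r_distr[of a "\<ominus>\<^bsub>M\<^esub> x" x] assms by (simp add: M.l_neg)
  then show ?thesis using assms M.minus_equality[symmetric] by simp
qed

lemma smult_r_diff: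
  "\<lbrakk>a \<in> carrier R; x \<in> carrier M; y \<in> carrier M\<rbrakk>
    \<Longrightarrow> a \<odot>\<^bsub>M\<^esub> (x \<ominus>\<^bsub>M\<^esub> y) = a \<odot>\<^bsub>M\<^esub> x \<ominus>\<^bsub>M\<^esub> a \<odot>\<^bsub>M\<^esub> y"
  by (simp add: a_minus_def smult_r_distr smult_r_minus)

lemma smult_finsum:
  "\<lbrakk>finite I; a \<in> carrier R; f \<in> I \<rightarrow> carrier M\<rbrakk>
    \<Longrightarrow> a \<odot>\<^bsub>M\<^esub> (\<Oplus>\<^bsub>M\<^esub>i\<in>I. f i) = (\<Oplus>\<^bsub>M\<^esub>i\<in>I. a \<odot>\<^bsub>M\<^esub> f i)"
  by (induction I rule: finite_induct) (auto simp: Pi_def smult_r_distr)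

lemma diff_eq_zero_iff:
  "\<lbrakk>x \<in> carrier M; y \<in> carrier M\<rbrakk> \<Longrightarrow> x \<ominus>\<^bsub>M\<^esub> y = \<zero>\<^bsub>M\<^esub> \<longleftrightarrow> x = y"
  by (metis M.add.inv_closed M.minus_equality M.minus_minus M.r_neg a_minus_def)

lemma add_diff_cancel:
  "\<lbrakk>x \<in> carrier M; y \<in> carrier M\<rbrakk> \<Longrightarrow> (x \<ominus>\<^bsub>M\<^esub> y) \<oplus>\<^bsub>M\<^esub> y = x"
  by (simp add: a_minus_def M.add.m_assoc M.l_neg)

text \<open>Negation is scaling by \<open>-1\<close>, so closure under it follows from
  \<open>sm\<close>.\<close>

lemma submodule_intro:
  assumes "H \<subseteq> carrier M" "\<zero>\<^bsub>M\<^esub> \<in> H"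
    and "\<And>x y. \<lbrakk>x \<in> H; y \<in> H\<rbrakk> \<Longrightarrow> x \<oplus>\<^bsub>M\<^esub> y \<in> H"
    and sm: "\<And>a x. \<lbrakk>a \<in> carrier R; x \<in> H\<rbrakk> \<Longrightarrow> a \<odot>\<^bsub>M\<^esub> x \<in> H"
  shows "submodule H R M"
proof -
  have "\<ominus>\<^bsub>M\<^esub> x \<in> H" if "x \<in> H" for x
  proof -
    have "\<ominus>\<^bsub>M\<^esub> x = (\<ominus> \<one>) \<odot>\<^bsub>M\<^esub> x" using that assms(1) by (subst smult_l_minus) auto
    then show ?thesis using sm[OF _ that, of "\<ominus> \<one>"] by simp
  qed
  then show ?thesis
    using assms by (intro submodule.intro subgroup.intro submodule_axioms.intro)
      (auto simp: a_inv_def[symmetric])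
qed

lemma submodule_carrier: "submodule (carrier M) R M"
  by (rule submodule_intro) auto

lemma submodule_zero: "submodule {\<zero>\<^bsub>M\<^esub>} R M"
  by (rule submodule_intro) auto

end

lemma submoduleD:
  assumes "submodule H R M"
  shows submodule_subset: "H \<subseteq> carrier M"
    and submodule_mem: "\<And>x. x \<in> H \<Longrightarrow> x \<in> carrier M"
    and submodule_zero_closed: "\<zero>\<^bsub>M\<^esub> \<in> H"
    and submodule_add_closed: "\<And>x y. \<lbrakk>x \<in> H; y \<in> H\<rbrakk> \<Longrightarrow> x \<oplus>\<^bsub>M\<^esub> y \<in> H"
    and submodule_minus_closed: "\<And>x. x \<in> H \<Longrightarrow> \<ominus>\<^bsub>M\<^esub> x \<in> H"
    and submodule_diff_closed: "\<And>x y. \<lbrakk>x \<in> H; y \<in> H\<rbrakk> \<Longrightarrow> x \<ominus>\<^bsub>M\<^esub> y \<in> H"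
    and submodule_smult_closed: "\<And>a x. \<lbrakk>a \<in> carrier R; x \<in> H\<rbrakk> \<Longrightarrow> a \<odot>\<^bsub>M\<^esub> x \<in> H"
proof -
  interpret H: submodule H R M by fact
  show "H \<subseteq> carrier M" "\<And>x. x \<in> H \<Longrightarrow> x \<in> carrier M" "\<zero>\<^bsub>M\<^esub> \<in> H"
    "\<And>x y. \<lbrakk>x \<in> H; y \<in> H\<rbrakk> \<Longrightarrow> x \<oplus>\<^bsub>M\<^esub> y \<in> H" "\<And>x. x \<in> H \<Longrightarrow> \<ominus>\<^bsub>M\<^esub> x \<in> H"
    "\<And>x y. \<lbrakk>x \<in> H; y \<in> H\<rbrakk> \<Longrightarrow> x \<ominus>\<^bsub>M\<^esub> y \<in> H"
    "\<And>a x. \<lbrakk>a \<in> carrier R; x \<in> H\<rbrakk> \<Longrightarrow> a \<odot>\<^bsub>M\<^esub> x \<in> H"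
    using H.subset H.one_closed H.m_closed H.m_inv_closed H.smult_closed
    by (auto simp: a_inv_def a_minus_def)
qed

lemma (in lmod) submodule_finsum:
  assumes "submodule H R M" "finite I" "\<And>i. i \<in> I \<Longrightarrow> f i \<in> H"
  shows "(\<Oplus>\<^bsub>M\<^esub>i\<in>I. f i) \<in> H"
  using assms(2,3)
proof (induction I rule: finite_induct)
  case empty
  show ?case using submodule_zero_closed[OF assms(1)] by simp
next
  case (insert i I)
  have "(\<Oplus>\<^bsub>M\<^esub>i\<in>insert i I. f i) = f i \<oplus>\<^bsub>M\<^esub> (\<Oplus>\<^bsub>M\<^esub>i\<in>I. f i)"
    using insert submodule_mem[OF assms(1)] by (intro M.finsum_insert) auto
  then show ?case using insert submodule_add_closed[OF assms(1)] by auto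
qed

lemma (in lmod) span_submodule:
  assumes "S \<subseteq> carrier M"
  shows "submodule (module_span R M S) R M"
proof (rule submodule_intro)
  show "module_span R M S \<subseteq> carrier M"
    unfolding module_span_def using submodule_carrier assms by auto
qed (auto simp: module_span_def submodule_zero_closed submodule_add_closed submodule_smult_closed)

lemma span_superset: "S \<subseteq> module_span R M S"
  by (auto simp: module_span_def)

lemma span_least: "\<lbrakk>submodule H R M; S \<subseteq> H\<rbrakk> \<Longrightarrow> module_span R M S \<subseteq> H"
  by (auto simp: module_span_def)

lemma (in lmod) submodule_restrict:
  assumes "submodule H R M"
  shows "left_module R (M\<lparr>carrier := H\<rparr>)"
proof (rule left_moduleI)
  show "abelian_group (M\<lparr>carrier := H\<rparr>)"
  proof (rule abelian_groupI, simp_all)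
    show "\<exists>y\<in>H. y \<oplus>\<^bsub>M\<^esub> x = \<zero>\<^bsub>M\<^esub>" if "x \<in> H" for x
      using that submodule_minus_closed[OF assms that] submodule_mem[OF assms that] M.l_neg by blast
  qed (use submoduleD[OF assms] M.a_ac in \<open>auto intro: M.a_assoc M.a_comm\<close>)
qed (use submoduleD[OF assms] in \<open>auto simp: smult_l_distr smult_r_distr smult_assoc1 R.ring_axioms\<close>)

section \<open>Linear maps\<close>

lemma linear_mapsI:
  assumes "\<And>x. x \<in> carrier M \<Longrightarrow> f x \<in> carrier N"
    and "\<And>x y. \<lbrakk>x \<in> carrier M; y \<in> carrier M\<rbrakk> \<Longrightarrow> f (x \<oplus>\<^bsub>M\<^esub> y) = f x \<oplus>\<^bsub>N\<^esub> f y"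
    and "\<And>r x. \<lbrakk>r \<in> carrier R; x \<in> carrier M\<rbrakk> \<Longrightarrow> f (r \<odot>\<^bsub>M\<^esub> x) = r \<odot>\<^bsub>N\<^esub> f x"
  shows "f \<in> linear_maps R M N"
  using assms by (auto simp: linear_maps_def)

lemma linear_mapsD:
  assumes "f \<in> linear_maps R M N"
  shows lin_closed: "\<And>x. x \<in> carrier M \<Longrightarrow> f x \<in> carrier N"
    and lin_add: "\<And>x y. \<lbrakk>x \<in> carrier M; y \<in> carrier M\<rbrakk> \<Longrightarrow> f (x \<oplus>\<^bsub>M\<^esub> y) = f x \<oplus>\<^bsub>N\<^esub> f y"
    and lin_smult: "\<And>r x. \<lbrakk>r \<in> carrier R; x \<in> carrier M\<rbrakk> \<Longrightarrow> f (r \<odot>\<^bsub>M\<^esub> x) = r \<odot>\<^bsub>N\<^esub> f x"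
  using assms by (auto simp: linear_maps_def)

locale lmap = M?: lmod R M + N?: lmod R N
  for R (structure) and M (structure) and N (structure) +
  fixes f
  assumes map: "f \<in> linear_maps R M N"
begin

lemmas [simp] = lin_closed[OF map]
lemmas [simp] = lin_add[OF map]
lemmas [simp] = lin_smult[OF map]

lemma map_zero [simp]: "f \<zero>\<^bsub>M\<^esub> = \<zero>\<^bsub>N\<^esub>"
  using lin_add[OF map, of "\<zero>\<^bsub>M\<^esub>" "\<zero>\<^bsub>M\<^esub>"] by (intro N.add_idem_zero) simp_all

lemma map_minus [simp]:
  assumes "x \<in> carrier M" shows "f (\<ominus>\<^bsub>M\<^esub> x) = \<ominus>\<^bsub>N\<^esub> f x"
proof -
  have "f (\<ominus>\<^bsub>M\<^esub> x) \<oplus>\<^bsub>N\<^esub> f x = \<zero>\<^bsub>N\<^esub>"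
    using lin_add[OF map, of "\<ominus>\<^bsub>M\<^esub> x" x] assms by (simp add: M.M.l_neg)
  then show ?thesis using assms by (intro N.M.minus_equality[symmetric]) simp_all
qed

lemma map_diff [simp]:
  "\<lbrakk>x \<in> carrier M; y \<in> carrier M\<rbrakk> \<Longrightarrow> f (x \<ominus>\<^bsub>M\<^esub> y) = f x \<ominus>\<^bsub>N\<^esub> f y"
  by (simp add: a_minus_def)

lemma map_finsum:
  "\<lbrakk>finite I; g \<in> I \<rightarrow> carrier M\<rbrakk> \<Longrightarrow> f (\<Oplus>\<^bsub>M\<^esub>i\<in>I. g i) = (\<Oplus>\<^bsub>N\<^esub>i\<in>I. f (g i))"
  by (induction I rule: finite_induct) (auto simp: Pi_def)

lemma vimage_submodule:
  assumes "submodule H R N"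
  shows "submodule {x \<in> carrier M. f x \<in> H} R M"
  by (rule M.submodule_intro) (use submoduleD[OF assms] in auto)

lemma image_submodule:
  assumes "submodule H R M"
  shows "submodule (f ` H) R N"
proof (rule N.submodule_intro)
  show "f ` H \<subseteq> carrier N" using submodule_mem[OF assms] by auto
  show "\<zero>\<^bsub>N\<^esub> \<in> f ` H" using submodule_zero_closed[OF assms] map_zero by force
next
  fix x y assume "x \<in> f ` H" "y \<in> f ` H"
  then obtain u v where "u \<in> H" "v \<in> H" "x = f u" "y = f v" by auto
  then show "x \<oplus>\<^bsub>N\<^esub> y \<in> f ` H"
    using submoduleD[OF assms] by (intro image_eqI[of _ _ "u \<oplus>\<^bsub>M\<^esub> v"]) auto
next
  fix a x assume "a \<in> carrier R" "x \<in> f ` H"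
  then obtain u where "u \<in> H" "x = f u" by auto
  then show "a \<odot>\<^bsub>N\<^esub> x \<in> f ` H"
    using submoduleD[OF assms] \<open>a \<in> carrier R\<close> by (intro image_eqI[of _ _ "a \<odot>\<^bsub>M\<^esub> u"]) auto
qed

end

lemma linear_maps_comp:
  "\<lbrakk>f \<in> linear_maps R M N; g \<in> linear_maps R N P\<rbrakk> \<Longrightarrow> (\<lambda>x. g (f x)) \<in> linear_maps R M P"
  by (auto simp: linear_maps_def Pi_def)

lemma linear_maps_cong:
  assumes "f \<in> linear_maps R M N" "\<And>x. x \<in> carrier M \<Longrightarrow> f x = g x" "left_module R M"
  shows "g \<in> linear_maps R M N"
proof -
  interpret lmod R M by (rule lmod.intro) fact
  note [simp] = assms(2)[symmetric] linear_mapsD[OF assms(1)]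
  show ?thesis by (rule linear_mapsI) simp_all
qed

lemma linear_maps_add:
  assumes "left_module R N" "f \<in> linear_maps R M N" "g \<in> linear_maps R M N"
  shows "(\<lambda>x. f x \<oplus>\<^bsub>N\<^esub> g x) \<in> linear_maps R M N"
proof -
  interpret lmod R N by (rule lmod.intro) fact
  note [simp] = linear_mapsD[OF assms(2)] linear_mapsD[OF assms(3)]
  show ?thesis by (rule linear_mapsI) (auto simp: M.a_ac smult_r_distr)
qed

lemma linear_maps_diff:
  assumes "left_module R N" "f \<in> linear_maps R M N" "g \<in> linear_maps R M N"
  shows "(\<lambda>x. f x \<ominus>\<^bsub>N\<^esub> g x) \<in> linear_maps R M N"
proof -
  interpret lmod R N by (rule lmod.intro) fact
  note [simp] = linear_mapsD[OF assms(2)] linear_mapsD[OF assms(3)]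
  show ?thesis
    by (rule linear_mapsI) (auto simp: M.a_ac smult_r_diff M.minus_add a_minus_def smult_r_distr smult_r_minus)
qed

lemma linear_maps_zero:
  assumes "left_module R N"
  shows "(\<lambda>x. \<zero>\<^bsub>N\<^esub>) \<in> linear_maps R M N"
proof -
  interpret lmod R N by (rule lmod.intro) fact
  show ?thesis by (rule linear_mapsI) auto
qed

lemma linear_maps_finsum:
  assumes "left_module R N" "finite I" "\<And>i. i \<in> I \<Longrightarrow> f i \<in> linear_maps R M N"
  shows "(\<lambda>x. \<Oplus>\<^bsub>N\<^esub>i\<in>I. f i x) \<in> linear_maps R M N"
proof -
  interpret lmod R N by (rule lmod.intro) fact
  note [simp] = linear_mapsD[OF assms(3)]
  show ?thesis
  proof (rule linear_mapsI)
    fix x y assume xy: "x \<in> carrier M" "y \<in> carrier M"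
    have "(\<Oplus>\<^bsub>N\<^esub>i\<in>I. f i (x \<oplus>\<^bsub>M\<^esub> y)) = (\<Oplus>\<^bsub>N\<^esub>i\<in>I. f i x \<oplus>\<^bsub>N\<^esub> f i y)"
      using xy by (intro M.finsum_cong') auto
    also have "\<dots> = (\<Oplus>\<^bsub>N\<^esub>i\<in>I. f i x) \<oplus>\<^bsub>N\<^esub> (\<Oplus>\<^bsub>N\<^esub>i\<in>I. f i y)"
      using xy by (intro M.finsum_addf) auto
    finally show "(\<Oplus>\<^bsub>N\<^esub>i\<in>I. f i (x \<oplus>\<^bsub>M\<^esub> y)) = (\<Oplus>\<^bsub>N\<^esub>i\<in>I. f i x) \<oplus>\<^bsub>N\<^esub> (\<Oplus>\<^bsub>N\<^esub>i\<in>I. f i y)" .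
  qed (auto simp: smult_finsum[OF assms(2)] intro!: M.finsum_closed intro: M.finsum_cong')
qed

section \<open>Free modules\<close>

lemma free_module_simps [simp]:
  "zero (free_module R S) = (\<lambda>x. \<zero>\<^bsub>R\<^esub>)"
  "add (free_module R S) = (\<lambda>f g x. f x \<oplus>\<^bsub>R\<^esub> g x)"
  "smult (free_module R S) = (\<lambda>r f x. r \<otimes>\<^bsub>R\<^esub> f x)"
  by (simp_all add: free_module_def)

lemma free_module_carrier:
  "f \<in> carrier (free_module R S) \<longleftrightarrow>
    (\<forall>x. f x \<in> carrier R) \<and> finite (support R f) \<and> support R f \<subseteq> S"
  by (auto simp: free_module_def)

lemma (in ring) support_add:
  "support R (\<lambda>x. f x \<oplus> g x) \<subseteq> support R f \<union> support R g"
  by (auto simp: support_def)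

lemma (in ring) support_smult: "a \<in> carrier R \<Longrightarrow> support R (\<lambda>x. a \<otimes> f x) \<subseteq> support R f"
  by (auto simp: support_def)

lemma (in ring) free_left_module: "left_module R (free_module R S)"
proof (rule left_moduleI)
  let ?F = "free_module R S"
  show "abelian_group ?F"
  proof (rule abelian_groupI)
    fix f g assume fg: "f \<in> carrier ?F" "g \<in> carrier ?F"
    then show "f \<oplus>\<^bsub>?F\<^esub> g \<in> carrier ?F"
      using support_add[of f g] by (auto simp: free_module_carrier intro: finite_subset)
    show "f \<oplus>\<^bsub>?F\<^esub> g = g \<oplus>\<^bsub>?F\<^esub> f"
      using fg by (auto simp: free_module_carrier a_comm)
  next
    fix f assume f: "f \<in> carrier ?F"
    have "support R (\<lambda>x. \<ominus> f x) = support R f"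
      using f by (auto simp: support_def free_module_carrier)
    then show "\<exists>g\<in>carrier ?F. g \<oplus>\<^bsub>?F\<^esub> f = \<zero>\<^bsub>?F\<^esub>"
      using f by (intro bexI[of _ "\<lambda>x. \<ominus> f x"]) (auto simp: free_module_carrier l_neg)
  qed (auto simp: free_module_carrier a_assoc support_def)
  fix a f assume a: "a \<in> carrier R" "f \<in> carrier ?F"
  then show "a \<odot>\<^bsub>?F\<^esub> f \<in> carrier ?F"
    using support_smult[of a f] by (auto simp: free_module_carrier intro: finite_subset)
qed (auto simp: free_module_carrier ring_axioms l_distr r_distr m_assoc)

lemma (in ring) basis_vector_closed [simp]:
  "x \<in> S \<Longrightarrow> basis_vector R x \<in> carrier (free_module R S)"
  by (auto simp: free_module_carrier basis_vector_def support_def)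

text \<open>Induction on the support: one coefficient is set to zero and added back as a multiple of
  a basis vector.\<close>

lemma (in ring) free_module_induct [consumes 1, case_names zero add]:
  assumes f: "f \<in> carrier (free_module R S)"
    and zero: "P (\<lambda>x. \<zero>)"
    and add: "\<And>f r x. \<lbrakk>f \<in> carrier (free_module R S); P f; r \<in> carrier R; x \<in> S\<rbrakk>
      \<Longrightarrow> P (\<lambda>y. f y \<oplus> r \<otimes> basis_vector R x y)"
  shows "P f"
proof -
  have "finite F \<Longrightarrow> (\<And>f. \<lbrakk>f \<in> carrier (free_module R S); support R f = F\<rbrakk> \<Longrightarrow> P f)" for F
  proof (induction F rule: finite_induct)
    case empty
    then have "f = (\<lambda>x. \<zero>)" by (auto simp: support_def)
    then show ?case using zero by simp
  next
    case (insert x F)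
    define g where "g = f(x := \<zero>)"
    have s: "support R g = F" using insert by (auto simp: g_def support_def)
    have g: "g \<in> carrier (free_module R S)"
      using insert s by (auto simp: free_module_carrier g_def)
    have eq: "f = (\<lambda>y. g y \<oplus> f x \<otimes> basis_vector R x y)"
      using insert.prems by (auto simp: g_def basis_vector_def free_module_carrier)
    show ?case
      by (subst eq, rule add[OF g insert.IH[OF g s]]) (use insert.prems in \<open>auto simp: free_module_carrier\<close>)
  qed
  then show ?thesis using f by (auto simp: free_module_carrier)
qed

text \<open>The sum runs over the support as in \<open>regular_left\<close> and
  \<open>regular_right\<close>, so those actions become instances of it by unfolding.\<close>

definition lin_ext :: "('r, 'x) ring_scheme \<Rightarrow> ('r, 'm) module \<Rightarrow> ('b \<Rightarrow> 'm) \<Rightarrow> ('b \<Rightarrow> 'r) \<Rightarrow> 'm" where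
  "lin_ext R V \<beta> f = (\<Oplus>\<^bsub>V\<^esub>x\<in>support R f. f x \<odot>\<^bsub>V\<^esub> \<beta> x)"

context lmod
begin

text \<open>Terms outside the support vanish. A common finite index set is what makes the sums for
  \<open>f\<close>, \<open>g\<close> and \<open>f + g\<close> comparable.\<close>

lemma lin_ext_superset:
  assumes "finite F" "support R f \<subseteq> F" "\<And>x. x \<in> F \<Longrightarrow> \<beta> x \<in> carrier M" "\<And>x. f x \<in> carrier R"
  shows "lin_ext R M \<beta> f = (\<Oplus>\<^bsub>M\<^esub>x\<in>F. f x \<odot>\<^bsub>M\<^esub> \<beta> x)"
  unfolding lin_ext_def
  by (rule M.add.finprod_mono_neutral_cong_left) (use assms in \<open>auto simp: support_def\<close>)

lemma lin_ext_linear: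
  assumes "\<And>x. x \<in> S \<Longrightarrow> \<beta> x \<in> carrier M"
  shows "lin_ext R M \<beta> \<in> linear_maps R (free_module R S) M"
proof (rule linear_mapsI)
  fix f assume f: "f \<in> carrier (free_module R S)"
  then show "lin_ext R M \<beta> f \<in> carrier M"
    using assms by (auto simp: lin_ext_def free_module_carrier intro!: M.finsum_closed)
  fix r assume r: "r \<in> carrier R"
  have "lin_ext R M \<beta> (r \<odot>\<^bsub>free_module R S\<^esub> f) = (\<Oplus>\<^bsub>M\<^esub>x\<in>support R f. (r \<otimes> f x) \<odot>\<^bsub>M\<^esub> \<beta> x)"
    using f r R.support_smult[OF r, of f] assms
    by (subst lin_ext_superset[of "support R f"]) (auto simp: free_module_carrier)
  also have "\<dots> = (\<Oplus>\<^bsub>M\<^esub>x\<in>support R f. r \<odot>\<^bsub>M\<^esub> (f x \<odot>\<^bsub>M\<^esub> \<beta> x))"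
    using f r assms by (intro M.finsum_cong') (auto simp: free_module_carrier smult_assoc1)
  also have "\<dots> = r \<odot>\<^bsub>M\<^esub> lin_ext R M \<beta> f"
    unfolding lin_ext_def using f r assms by (intro smult_finsum[symmetric]) (auto simp: free_module_carrier)
  finally show "lin_ext R M \<beta> (r \<odot>\<^bsub>free_module R S\<^esub> f) = r \<odot>\<^bsub>M\<^esub> lin_ext R M \<beta> f" .
next
  fix f g assume fg: "f \<in> carrier (free_module R S)" "g \<in> carrier (free_module R S)"
  let ?F = "support R f \<union> support R g"
  have "lin_ext R M \<beta> (f \<oplus>\<^bsub>free_module R S\<^esub> g) = (\<Oplus>\<^bsub>M\<^esub>x\<in>?F. (f x \<oplus> g x) \<odot>\<^bsub>M\<^esub> \<beta> x)"
    using fg R.support_add[of f g] assms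
    by (subst lin_ext_superset[of ?F]) (auto simp: free_module_carrier)
  also have "\<dots> = (\<Oplus>\<^bsub>M\<^esub>x\<in>?F. f x \<odot>\<^bsub>M\<^esub> \<beta> x \<oplus>\<^bsub>M\<^esub> g x \<odot>\<^bsub>M\<^esub> \<beta> x)"
    using fg assms by (intro M.finsum_cong') (auto simp: free_module_carrier smult_l_distr subset_iff)
  also have "\<dots> = (\<Oplus>\<^bsub>M\<^esub>x\<in>?F. f x \<odot>\<^bsub>M\<^esub> \<beta> x) \<oplus>\<^bsub>M\<^esub> (\<Oplus>\<^bsub>M\<^esub>x\<in>?F. g x \<odot>\<^bsub>M\<^esub> \<beta> x)"
    using fg assms by (intro M.finsum_addf) (auto simp: free_module_carrier subset_iff)
  also have "(\<Oplus>\<^bsub>M\<^esub>x\<in>?F. f x \<odot>\<^bsub>M\<^esub> \<beta> x) = lin_ext R M \<beta> f"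
    using fg assms by (intro lin_ext_superset[symmetric]) (auto simp: free_module_carrier subset_iff)
  also have "(\<Oplus>\<^bsub>M\<^esub>x\<in>?F. g x \<odot>\<^bsub>M\<^esub> \<beta> x) = lin_ext R M \<beta> g"
    using fg assms by (intro lin_ext_superset[symmetric]) (auto simp: free_module_carrier subset_iff)
  finally show "lin_ext R M \<beta> (f \<oplus>\<^bsub>free_module R S\<^esub> g) = lin_ext R M \<beta> f \<oplus>\<^bsub>M\<^esub> lin_ext R M \<beta> g" .
qed

lemma lin_ext_basis [simp]:
  assumes "\<beta> x \<in> carrier M"
  shows "lin_ext R M \<beta> (basis_vector R x) = \<beta> x"
proof -
  have "lin_ext R M \<beta> (basis_vector R x) = (\<Oplus>\<^bsub>M\<^esub>y\<in>{x}. basis_vector R x y \<odot>\<^bsub>M\<^esub> \<beta> y)"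
    by (rule lin_ext_superset) (use assms in \<open>auto simp: support_def basis_vector_def\<close>)
  also have "\<dots> = \<beta> x" using assms by (simp add: basis_vector_def)
  finally show ?thesis .
qed

lemma free_linear_eq:
  assumes g: "g \<in> linear_maps R (free_module R S) M" and h: "h \<in> linear_maps R (free_module R S) M"
    and "\<And>x. x \<in> S \<Longrightarrow> g (basis_vector R x) = h (basis_vector R x)"
    and "f \<in> carrier (free_module R S)"
  shows "g f = h f"
proof -
  interpret g: lmap R "free_module R S" M g
    using g by (intro lmap.intro lmap_axioms.intro lmod.intro R.free_left_module left_module_axioms)
  interpret h: lmap R "free_module R S" M h
    using h by (intro lmap.intro lmap_axioms.intro lmod.intro R.free_left_module left_module_axioms)
  show ?thesis using assms(4)
  proof (induction f rule: R.free_module_induct)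
    case zero
    show ?case using g.map_zero h.map_zero by simp
  next
    case (add f r x)
    then show ?case
      using lin_add[OF g, of f "r \<odot>\<^bsub>free_module R S\<^esub> basis_vector R x"]
        lin_add[OF h, of f "r \<odot>\<^bsub>free_module R S\<^esub> basis_vector R x"] assms(3)[of x]
        lin_smult[OF g, of r "basis_vector R x"] lin_smult[OF h, of r "basis_vector R x"]
        R.basis_vector_closed[of x S] left_module.smult_closed[OF R.free_left_module, of r "basis_vector R x" S]
      by simp
  qed
qed

lemma lin_ext_unique:
  assumes "h \<in> linear_maps R (free_module R S) M" "f \<in> carrier (free_module R S)"
  shows "h f = lin_ext R M (\<lambda>x. h (basis_vector R x)) f"
  by (rule free_linear_eq[OF assms(1) lin_ext_linear _ assms(2)])
    (simp_all add: linear_mapsD[OF assms(1)])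

end

lemma (in ring) free_module_map_superset:
  assumes "finite F" "support R f \<subseteq> F" "\<And>x. f x \<in> carrier R"
  shows "free_module_map R \<phi> f y = (\<Oplus>x\<in>{x \<in> F. \<phi> x = y}. f x)"
  unfolding free_module_map_def
  by (rule add.finprod_mono_neutral_cong_left) (use assms in \<open>auto simp: support_def\<close>)

lemma (in ring) free_module_map_linear:
  assumes "\<And>x. x \<in> S \<Longrightarrow> \<phi> x \<in> S'"
  shows "free_module_map R \<phi> \<in> linear_maps R (free_module R S) (free_module R S')"
proof (rule linear_mapsI)
  fix f assume f: "f \<in> carrier (free_module R S)"
  have "support R (free_module_map R \<phi> f) \<subseteq> \<phi> ` support R f"
  proof
    fix y assume "y \<in> support R (free_module_map R \<phi> f)"
    then have "{x \<in> support R f. \<phi> x = y} \<noteq> {}"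
      by (metis (mono_tags) finsum_empty free_module_map_def mem_Collect_eq support_def)
    then show "y \<in> \<phi> ` support R f" by blast
  qed
  then show "free_module_map R \<phi> f \<in> carrier (free_module R S')"
    using f assms by (auto simp: free_module_carrier free_module_map_def
      intro!: finsum_closed intro: finite_subset)
  fix r assume r: "r \<in> carrier R"
  show "free_module_map R \<phi> (r \<odot>\<^bsub>free_module R S\<^esub> f) = r \<odot>\<^bsub>free_module R S'\<^esub> free_module_map R \<phi> f"
  proof
    fix y
    have "free_module_map R \<phi> (r \<odot>\<^bsub>free_module R S\<^esub> f) y = (\<Oplus>x\<in>{x \<in> support R f. \<phi> x = y}. r \<otimes> f x)"
      using f r support_smult[OF r, of f]
      by (subst free_module_map_superset[of "support R f"]) (auto simp: free_module_carrier)
    also have "\<dots> = r \<otimes> (\<Oplus>x\<in>{x \<in> support R f. \<phi> x = y}. f x)"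
      using f r by (intro finsum_rdistr[symmetric]) (auto simp: free_module_carrier)
    finally show "free_module_map R \<phi> (r \<odot>\<^bsub>free_module R S\<^esub> f) y
        = (r \<odot>\<^bsub>free_module R S'\<^esub> free_module_map R \<phi> f) y"
      by (simp add: free_module_map_def)
  qed
next
  fix f g assume fg: "f \<in> carrier (free_module R S)" "g \<in> carrier (free_module R S)"
  let ?F = "support R f \<union> support R g"
  show "free_module_map R \<phi> (f \<oplus>\<^bsub>free_module R S\<^esub> g)
    = free_module_map R \<phi> f \<oplus>\<^bsub>free_module R S'\<^esub> free_module_map R \<phi> g"
  proof
    fix y
    have "free_module_map R \<phi> (f \<oplus>\<^bsub>free_module R S\<^esub> g) y = (\<Oplus>x\<in>{x \<in> ?F. \<phi> x = y}. f x \<oplus> g x)"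
      using fg support_add[of f g] by (subst free_module_map_superset[of ?F]) (auto simp: free_module_carrier)
    also have "\<dots> = (\<Oplus>x\<in>{x \<in> ?F. \<phi> x = y}. f x) \<oplus> (\<Oplus>x\<in>{x \<in> ?F. \<phi> x = y}. g x)"
      using fg by (intro finsum_addf) (auto simp: free_module_carrier)
    also have "(\<Oplus>x\<in>{x \<in> ?F. \<phi> x = y}. f x) = free_module_map R \<phi> f y"
      using fg by (intro free_module_map_superset[symmetric]) (auto simp: free_module_carrier)
    also have "(\<Oplus>x\<in>{x \<in> ?F. \<phi> x = y}. g x) = free_module_map R \<phi> g y"
      using fg by (intro free_module_map_superset[symmetric]) (auto simp: free_module_carrier)
    finally show "free_module_map R \<phi> (f \<oplus>\<^bsub>free_module R S\<^esub> g) y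
      = (free_module_map R \<phi> f \<oplus>\<^bsub>free_module R S'\<^esub> free_module_map R \<phi> g) y" by simp
  qed
qed

lemma (in ring) free_module_map_basis [simp]:
  "free_module_map R \<phi> (basis_vector R x) = basis_vector R (\<phi> x)"
proof
  fix y
  have "free_module_map R \<phi> (basis_vector R x) y = (\<Oplus>x'\<in>{x' \<in> {x}. \<phi> x' = y}. basis_vector R x x')"
    by (rule free_module_map_superset) (auto simp: support_def basis_vector_def)
  also have "{x' \<in> {x}. \<phi> x' = y} = (if \<phi> x = y then {x} else {})" by auto
  finally show "free_module_map R \<phi> (basis_vector R x) y = basis_vector R (\<phi> x) y"
    by (auto simp: basis_vector_def)
qed

section \<open>Quotients\<close>

lemma quotient_module_simps:
  "carrier (quotient_module M N) = carrier (M Quot N)"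
  "mult (quotient_module M N) = rcoset_mult M N"
  "one (quotient_module M N) = N +>\<^bsub>M\<^esub> \<one>\<^bsub>M\<^esub>"
  "zero (quotient_module M N) = N"
  "add (quotient_module M N) = set_add M"
  "smult (quotient_module M N) = (\<lambda>r K. \<Union>x\<in>K. N +>\<^bsub>M\<^esub> (r \<odot>\<^bsub>M\<^esub> x))"
  by (simp_all add: quotient_module_def ring.extend_def module.fields_def FactRing_def)

locale submod = lmod R M for R (structure) and M (structure) +
  fixes H
  assumes sub: "submodule H R M"
begin

sublocale S: abelian_subgroup H M
proof (rule abelian_subgroupI3)
  show "additive_subgroup H M"
    using sub by (simp add: additive_subgroup_def submodule_def)
qed (rule M.abelian_group_axioms)

lemma quot_carrier: "carrier (quotient_module M H) = (\<lambda>x. H +>\<^bsub>M\<^esub> x) ` carrier M"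
  by (auto simp: quotient_module_simps FactRing_def A_RCOSETS_def' a_r_coset_def')

lemma mem_coset_iff: "x \<in> carrier M \<Longrightarrow> y \<in> H +>\<^bsub>M\<^esub> x \<longleftrightarrow> y \<in> carrier M \<and> y \<ominus>\<^bsub>M\<^esub> x \<in> H"
  using S.a_rcos_module[of x y] S.a_elemrcos_carrier[of x y] by (auto simp: a_minus_def)

lemma coset_self: "x \<in> carrier M \<Longrightarrow> x \<in> H +>\<^bsub>M\<^esub> x"
  by (rule S.a_rcos_self)

lemma coset_eq_iff:
  assumes "x \<in> carrier M" "y \<in> carrier M"
  shows "H +>\<^bsub>M\<^esub> x = H +>\<^bsub>M\<^esub> y \<longleftrightarrow> x \<ominus>\<^bsub>M\<^esub> y \<in> H"
  using assms mem_coset_iff[of y x] coset_self[of x] S.a_repr_independence'[of x y] by auto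

lemma coset_eq_H_iff: "x \<in> carrier M \<Longrightarrow> H +>\<^bsub>M\<^esub> x = H \<longleftrightarrow> x \<in> H"
  using S.a_rcos_self[of x] S.a_rcos_const[of x] by auto

lemma coset_add:
  "\<lbrakk>x \<in> carrier M; y \<in> carrier M\<rbrakk>
    \<Longrightarrow> (H +>\<^bsub>M\<^esub> x) \<oplus>\<^bsub>quotient_module M H\<^esub> (H +>\<^bsub>M\<^esub> y) = H +>\<^bsub>M\<^esub> (x \<oplus>\<^bsub>M\<^esub> y)"
  by (simp add: quotient_module_simps S.a_rcos_sum)

text \<open>\<open>quotient_module\<close> scales a coset through the union over all its
  representatives. The union is nonempty and its members coincide, because scaling maps
  \<open>H\<close> into itself.\<close>

lemma coset_smult:
  assumes r: "r \<in> carrier R" and x: "x \<in> carrier M"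
  shows "r \<odot>\<^bsub>quotient_module M H\<^esub> (H +>\<^bsub>M\<^esub> x) = H +>\<^bsub>M\<^esub> (r \<odot>\<^bsub>M\<^esub> x)"
proof -
  have "H +>\<^bsub>M\<^esub> (r \<odot>\<^bsub>M\<^esub> y) = H +>\<^bsub>M\<^esub> (r \<odot>\<^bsub>M\<^esub> x)" if "y \<in> H +>\<^bsub>M\<^esub> x" for y
  proof -
    have y: "y \<in> carrier M" "y \<ominus>\<^bsub>M\<^esub> x \<in> H" using that mem_coset_iff[OF x, of y] by auto
    then have "r \<odot>\<^bsub>M\<^esub> y \<ominus>\<^bsub>M\<^esub> r \<odot>\<^bsub>M\<^esub> x \<in> H"
      using submodule_smult_closed[OF sub r y(2)] smult_r_diff[OF r y(1) x] by simp
    then show ?thesis using coset_eq_iff[of "r \<odot>\<^bsub>M\<^esub> y" "r \<odot>\<^bsub>M\<^esub> x"] r x y by simp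
  qed
  then have "(\<Union>y\<in>H +>\<^bsub>M\<^esub> x. H +>\<^bsub>M\<^esub> (r \<odot>\<^bsub>M\<^esub> y)) = (\<Union>y\<in>H +>\<^bsub>M\<^esub> x. H +>\<^bsub>M\<^esub> (r \<odot>\<^bsub>M\<^esub> x))"
    by (intro SUP_cong refl)
  also have "\<dots> = H +>\<^bsub>M\<^esub> (r \<odot>\<^bsub>M\<^esub> x)"
    using coset_self[OF x] by (simp only: UN_constant split: if_splits) blast
  finally show ?thesis by (simp only: quotient_module_simps)
qed

lemma quot_zero [simp]: "zero (quotient_module M H) = H"
  by (simp add: quotient_module_simps)

lemma coset_zero [simp]: "H +>\<^bsub>M\<^esub> \<zero>\<^bsub>M\<^esub> = H"
  using coset_eq_H_iff[of "\<zero>\<^bsub>M\<^esub>"] S.zero_closed by simp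

lemma coset_closed [simp]: "x \<in> carrier M \<Longrightarrow> H +>\<^bsub>M\<^esub> x \<in> carrier (quotient_module M H)"
  by (simp add: quot_carrier)

lemma quot_cases:
  assumes "X \<in> carrier (quotient_module M H)"
  obtains x where "x \<in> carrier M" "X = H +>\<^bsub>M\<^esub> x"
  using assms unfolding quot_carrier by auto

lemma quot_left_module: "left_module R (quotient_module M H)"
proof (rule left_moduleI)
  let ?Q = "quotient_module M H"
  show "abelian_group ?Q"
  proof (rule abelian_groupI)
    fix X assume "X \<in> carrier ?Q"
    then obtain x where x: "x \<in> carrier M" "X = H +>\<^bsub>M\<^esub> x" by (rule quot_cases)
    then show "\<exists>Y\<in>carrier ?Q. Y \<oplus>\<^bsub>?Q\<^esub> X = \<zero>\<^bsub>?Q\<^esub>"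
      using coset_add[of "\<ominus>\<^bsub>M\<^esub> x" x]
      by (intro bexI[of _ "H +>\<^bsub>M\<^esub> (\<ominus>\<^bsub>M\<^esub> x)"]) (simp_all add: M.l_neg)
    show "\<zero>\<^bsub>?Q\<^esub> \<oplus>\<^bsub>?Q\<^esub> X = X"
      using x coset_add[of "\<zero>\<^bsub>M\<^esub>" x] by simp
  next
    show "\<zero>\<^bsub>?Q\<^esub> \<in> carrier ?Q"
      using coset_closed[of "\<zero>\<^bsub>M\<^esub>"] by simp
  next
    fix X Y assume "X \<in> carrier ?Q" "Y \<in> carrier ?Q"
    then obtain x y where xy: "x \<in> carrier M" "X = H +>\<^bsub>M\<^esub> x" "y \<in> carrier M" "Y = H +>\<^bsub>M\<^esub> y"
      by (meson quot_cases)
    then show "X \<oplus>\<^bsub>?Q\<^esub> Y \<in> carrier ?Q" by (simp add: coset_add)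
    show "X \<oplus>\<^bsub>?Q\<^esub> Y = Y \<oplus>\<^bsub>?Q\<^esub> X" using xy by (simp add: coset_add M.a_comm)
    fix Z assume "Z \<in> carrier ?Q"
    then obtain z where "z \<in> carrier M" "Z = H +>\<^bsub>M\<^esub> z" by (rule quot_cases)
    then show "X \<oplus>\<^bsub>?Q\<^esub> Y \<oplus>\<^bsub>?Q\<^esub> Z = X \<oplus>\<^bsub>?Q\<^esub> (Y \<oplus>\<^bsub>?Q\<^esub> Z)"
      using xy by (simp add: coset_add M.a_assoc)
  qed
qed (auto elim!: quot_cases simp: coset_add coset_smult smult_l_distr smult_r_distr smult_assoc1 R.ring_axioms)

lemma coset_linear: "(\<lambda>x. H +>\<^bsub>M\<^esub> x) \<in> linear_maps R M (quotient_module M H)"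
  by (rule linear_mapsI) (simp_all add: coset_add coset_smult)

end

section \<open>Isomorphisms of subquotients\<close>

text \<open>
  \<open>Z / B \<cong> Z' / B'\<close>, expressed by a linear relation between \<open>Z\<close> and \<open>Z'\<close>: this avoids choosing
  lifts, and relations compose and can be inverted without well-definedness arguments.
\<close>

definition iso_relation ::
  "('k, 'x) ring_scheme \<Rightarrow> ('k, 'v) module \<Rightarrow> 'v set \<Rightarrow> 'v set
    \<Rightarrow> ('k, 'w) module \<Rightarrow> 'w set \<Rightarrow> 'w set \<Rightarrow> ('v \<Rightarrow> 'w \<Rightarrow> bool) \<Rightarrow> bool" where
  "iso_relation k V Z B V' Z' B' Q \<longleftrightarrow>
     (\<forall>v v'. Q v v' \<longrightarrow> v \<in> Z \<and> v' \<in> Z') \<and>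
     (\<forall>v v' w w'. Q v v' \<longrightarrow> Q w w' \<longrightarrow> Q (v \<oplus>\<^bsub>V\<^esub> w) (v' \<oplus>\<^bsub>V'\<^esub> w')) \<and>
     (\<forall>a v v'. a \<in> carrier k \<longrightarrow> Q v v' \<longrightarrow> Q (a \<odot>\<^bsub>V\<^esub> v) (a \<odot>\<^bsub>V'\<^esub> v')) \<and>
     (\<forall>v\<in>Z. \<exists>v'. Q v v') \<and> (\<forall>v'\<in>Z'. \<exists>v. Q v v') \<and>
     (\<forall>v v'. Q v v' \<longrightarrow> (v \<in> B \<longleftrightarrow> v' \<in> B'))"

definition subquotient_iso ::
  "('k, 'x) ring_scheme \<Rightarrow> ('k, 'v) module \<Rightarrow> 'v set \<Rightarrow> 'v set
    \<Rightarrow> ('k, 'w) module \<Rightarrow> 'w set \<Rightarrow> 'w set \<Rightarrow> bool" where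
  "subquotient_iso k V Z B V' Z' B' \<longleftrightarrow> (\<exists>Q. iso_relation k V Z B V' Z' B' Q)"

lemma iso_relationD:
  assumes "iso_relation k V Z B V' Z' B' Q"
  shows "\<And>v v'. Q v v' \<Longrightarrow> v \<in> Z \<and> v' \<in> Z'"
    "\<And>v v' w w'. \<lbrakk>Q v v'; Q w w'\<rbrakk> \<Longrightarrow> Q (v \<oplus>\<^bsub>V\<^esub> w) (v' \<oplus>\<^bsub>V'\<^esub> w')"
    "\<And>a v v'. \<lbrakk>a \<in> carrier k; Q v v'\<rbrakk> \<Longrightarrow> Q (a \<odot>\<^bsub>V\<^esub> v) (a \<odot>\<^bsub>V'\<^esub> v')"
    "\<And>v. v \<in> Z \<Longrightarrow> \<exists>v'. Q v v'" "\<And>v'. v' \<in> Z' \<Longrightarrow> \<exists>v. Q v v'"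
    "\<And>v v'. Q v v' \<Longrightarrow> v \<in> B \<longleftrightarrow> v' \<in> B'"
proof -
  note * = assms[unfolded iso_relation_def]
  show "\<And>v v'. Q v v' \<Longrightarrow> v \<in> Z \<and> v' \<in> Z'"
    "\<And>v v' w w'. \<lbrakk>Q v v'; Q w w'\<rbrakk> \<Longrightarrow> Q (v \<oplus>\<^bsub>V\<^esub> w) (v' \<oplus>\<^bsub>V'\<^esub> w')"
    "\<And>a v v'. \<lbrakk>a \<in> carrier k; Q v v'\<rbrakk> \<Longrightarrow> Q (a \<odot>\<^bsub>V\<^esub> v) (a \<odot>\<^bsub>V'\<^esub> v')"
    "\<And>v. v \<in> Z \<Longrightarrow> \<exists>v'. Q v v'" "\<And>v'. v' \<in> Z' \<Longrightarrow> \<exists>v. Q v v'"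
    "\<And>v v'. Q v v' \<Longrightarrow> v \<in> B \<longleftrightarrow> v' \<in> B'"
    subgoal using * by presburger
    subgoal using * by presburger
    subgoal using * by presburger
    subgoal using * by simp
    subgoal using * by simp
    subgoal using * by simp
    done
qed

lemma subquotient_isoI:
  assumes "\<And>v v'. Q v v' \<Longrightarrow> v \<in> Z \<and> v' \<in> Z'"
    and "\<And>v v' w w'. \<lbrakk>Q v v'; Q w w'\<rbrakk> \<Longrightarrow> Q (v \<oplus>\<^bsub>V\<^esub> w) (v' \<oplus>\<^bsub>V'\<^esub> w')"
    and "\<And>a v v'. \<lbrakk>a \<in> carrier k; Q v v'\<rbrakk> \<Longrightarrow> Q (a \<odot>\<^bsub>V\<^esub> v) (a \<odot>\<^bsub>V'\<^esub> v')"
    and "\<And>v. v \<in> Z \<Longrightarrow> \<exists>v'. Q v v'" "\<And>v'. v' \<in> Z' \<Longrightarrow> \<exists>v. Q v v'"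
    and "\<And>v v'. \<lbrakk>Q v v'; v \<in> B\<rbrakk> \<Longrightarrow> v' \<in> B'"
    and "\<And>v v'. \<lbrakk>Q v v'; v' \<in> B'\<rbrakk> \<Longrightarrow> v \<in> B"
  shows "subquotient_iso k V Z B V' Z' B'"
  unfolding subquotient_iso_def iso_relation_def
proof (intro exI[of _ Q] conjI)
  show "\<forall>v v' w w'. Q v v' \<longrightarrow> Q w w' \<longrightarrow> Q (v \<oplus>\<^bsub>V\<^esub> w) (v' \<oplus>\<^bsub>V'\<^esub> w')"
    by (intro allI impI assms(2))
  show "\<forall>a v v'. a \<in> carrier k \<longrightarrow> Q v v' \<longrightarrow> Q (a \<odot>\<^bsub>V\<^esub> v) (a \<odot>\<^bsub>V'\<^esub> v')"
    by (intro allI impI assms(3))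
qed (use assms(1,4-7) in blast)+

lemma subquotient_iso_sym:
  assumes "subquotient_iso k V Z B V' Z' B'"
  shows "subquotient_iso k V' Z' B' V Z B"
proof -
  obtain Q where "iso_relation k V Z B V' Z' B' Q" using assms by (auto simp: subquotient_iso_def)
  note Q = iso_relationD[OF this]
  show ?thesis
  proof (rule subquotient_isoI[where Q = "\<lambda>x y. Q y x"])
    show "\<And>v v' w w'. \<lbrakk>Q v' v; Q w' w\<rbrakk> \<Longrightarrow> Q (v' \<oplus>\<^bsub>V\<^esub> w') (v \<oplus>\<^bsub>V'\<^esub> w)" by (rule Q(2))
    show "\<And>a v v'. \<lbrakk>a \<in> carrier k; Q v' v\<rbrakk> \<Longrightarrow> Q (a \<odot>\<^bsub>V\<^esub> v') (a \<odot>\<^bsub>V'\<^esub> v)" by (rule Q(3))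
  qed (use Q(1) Q(4-6) in blast)+
qed

lemma subquotient_iso_trans:
  assumes "subquotient_iso k V Z B V' Z' B'" "subquotient_iso k V' Z' B' V'' Z'' B''"
  shows "subquotient_iso k V Z B V'' Z'' B''"
proof -
  obtain Q where "iso_relation k V Z B V' Z' B' Q" using assms(1) by (auto simp: subquotient_iso_def)
  note Q = iso_relationD[OF this]
  obtain P where "iso_relation k V' Z' B' V'' Z'' B'' P" using assms(2) by (auto simp: subquotient_iso_def)
  note P = iso_relationD[OF this]
  show ?thesis
  proof (rule subquotient_isoI[where Q = "\<lambda>x z. \<exists>y. Q x y \<and> P y z"])
    fix v v' w w' assume "\<exists>y. Q v y \<and> P y v'" "\<exists>y. Q w y \<and> P y w'"
    then obtain y z where "Q v y" "P y v'" "Q w z" "P z w'" by auto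
    then show "\<exists>y. Q (v \<oplus>\<^bsub>V\<^esub> w) y \<and> P y (v' \<oplus>\<^bsub>V''\<^esub> w')"
      by (intro exI[of _ "y \<oplus>\<^bsub>V'\<^esub> z"] conjI Q(2) P(2))
  next
    fix a v v' assume "a \<in> carrier k" "\<exists>y. Q v y \<and> P y v'"
    then show "\<exists>y. Q (a \<odot>\<^bsub>V\<^esub> v) y \<and> P y (a \<odot>\<^bsub>V''\<^esub> v')" using Q(3) P(3) by meson
  next
    show "\<exists>v'. \<exists>y. Q v y \<and> P y v'" if "v \<in> Z" for v
      using Q(4)[OF that] Q(1) P(4) by meson
    show "\<exists>v. \<exists>y. Q v y \<and> P y v'" if "v' \<in> Z''" for v'
      using P(5)[OF that] P(1) Q(5) by meson
  qed (use Q(1) P(1) Q(6) P(6) in blast)+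
qed

text \<open>Subtraction goes through an inverse that is chosen inside the carrier, so
  \<open>a_minus\<close> is not literally the same operation in a module and in its restriction to a
  submodule. Addition is; stated with it, equality of cosets can be carried from one to the
  other.\<close>

lemma (in submod) coset_eq_iff_add:
  assumes "x \<in> carrier M" "y \<in> carrier M"
  shows "H +>\<^bsub>M\<^esub> x = H +>\<^bsub>M\<^esub> y \<longleftrightarrow> (\<exists>b\<in>H. x = b \<oplus>\<^bsub>M\<^esub> y)"
proof
  assume "H +>\<^bsub>M\<^esub> x = H +>\<^bsub>M\<^esub> y"
  then show "\<exists>b\<in>H. x = b \<oplus>\<^bsub>M\<^esub> y"
    using assms by (intro bexI[of _ "x \<ominus>\<^bsub>M\<^esub> y"]) (auto simp: add_diff_cancel coset_eq_iff)
next
  assume "\<exists>b\<in>H. x = b \<oplus>\<^bsub>M\<^esub> y"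
  then obtain b where b: "b \<in> H" "x = b \<oplus>\<^bsub>M\<^esub> y" by auto
  then have "x \<ominus>\<^bsub>M\<^esub> y = b"
    using assms submodule_mem[OF sub] by (simp add: a_minus_def M.a_assoc M.r_neg)
  then show "H +>\<^bsub>M\<^esub> x = H +>\<^bsub>M\<^esub> y" using b assms by (simp add: coset_eq_iff)
qed

text \<open>A coset is sent to the coset of a partner of one of its elements. Related pairs can be
  subtracted, and partners lie in \<open>B\<close> and \<open>B'\<close> at the same time; this
  gives well-definedness and injectivity together, in the form \<open>rel\<close>. Totality on both
  sides gives the existence of values and surjectivity.\<close>

lemma subquotient_iso_imp_isomorphic:
  assumes V: "left_module k V" "submodule Z k V" "submodule B k V" "B \<subseteq> Z"
    and V': "left_module k V'" "submodule Z' k V'" "submodule B' k V'" "B' \<subseteq> Z'"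
    and iso: "subquotient_iso k V Z B V' Z' B'"
  shows "isomorphic_modules k (quotient_module (V\<lparr>carrier := Z\<rparr>) B) (quotient_module (V'\<lparr>carrier := Z'\<rparr>) B')"
proof -
  interpret V: lmod k V using V(1) by (rule lmod.intro)
  interpret V': lmod k V' using V'(1) by (rule lmod.intro)
  let ?W = "V\<lparr>carrier := Z\<rparr>" and ?W' = "V'\<lparr>carrier := Z'\<rparr>"
  have W: "left_module k ?W" by (rule V.submodule_restrict[OF V(2)])
  have W': "left_module k ?W'" by (rule V'.submodule_restrict[OF V'(2)])
  interpret W: lmod k ?W using W by (rule lmod.intro)
  interpret W': lmod k ?W' using W' by (rule lmod.intro)
  have "submodule B k ?W"
    by (rule W.submodule_intro) (use V(4) submoduleD[OF V(3)] in auto)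
  then interpret Q: submod k ?W B
    by (intro submod.intro submod_axioms.intro lmod.intro W)
  have "submodule B' k ?W'"
    by (rule W'.submodule_intro) (use V'(4) submoduleD[OF V'(3)] in auto)
  then interpret Q': submod k ?W' B'
    by (intro submod.intro submod_axioms.intro lmod.intro W')
  obtain Q where "iso_relation k V Z B V' Z' B' Q" using iso by (auto simp: subquotient_iso_def)
  note Q = iso_relationD(1)[OF this] and Q_add = iso_relationD(2)[OF this]
    and Q_smult = iso_relationD(3)[OF this] and Q_total = iso_relationD(4,5)[OF this]
    and Q_B = iso_relationD(6)[OF this]
  have carr: "v \<in> carrier V" if "v \<in> Z" for v using submodule_mem[OF V(2) that] .
  have carr': "v \<in> carrier V'" if "v \<in> Z'" for v using submodule_mem[OF V'(2) that] .
  have Q_diff: "Q (v \<ominus>\<^bsub>V\<^esub> w) (v' \<ominus>\<^bsub>V'\<^esub> w')" if "Q v v'" "Q w w'" for v v' w w'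
  proof -
    have "(\<ominus>\<^bsub>k\<^esub> \<one>\<^bsub>k\<^esub>) \<odot>\<^bsub>V\<^esub> w = \<ominus>\<^bsub>V\<^esub> w" "(\<ominus>\<^bsub>k\<^esub> \<one>\<^bsub>k\<^esub>) \<odot>\<^bsub>V'\<^esub> w' = \<ominus>\<^bsub>V'\<^esub> w'"
      using Q[OF that(2)] carr carr' by (auto simp: V.smult_l_minus V'.smult_l_minus)
    then show ?thesis
      using Q_add[OF that(1) Q_smult[OF _ that(2), of "\<ominus>\<^bsub>k\<^esub> \<one>\<^bsub>k\<^esub>"]] by (simp add: a_minus_def)
  qed
  have rel: "B +>\<^bsub>?W\<^esub> v = B +>\<^bsub>?W\<^esub> w \<longleftrightarrow> B' +>\<^bsub>?W'\<^esub> v' = B' +>\<^bsub>?W'\<^esub> w'"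
    if "Q v v'" "Q w w'" for v v' w w'
  proof -
    have m: "v \<in> Z" "w \<in> Z" "v' \<in> Z'" "w' \<in> Z'" using Q that by auto
    interpret BV: submod k V B
      by (intro submod.intro submod_axioms.intro lmod.intro V)
    interpret BV': submod k V' B'
      by (intro submod.intro submod_axioms.intro lmod.intro V')
    have "B +>\<^bsub>?W\<^esub> v = B +>\<^bsub>?W\<^esub> w \<longleftrightarrow> v \<ominus>\<^bsub>V\<^esub> w \<in> B"
      using Q.coset_eq_iff_add[of v w] BV.coset_eq_iff_add[of v w] BV.coset_eq_iff[of v w] m carr by simp
    moreover have "B' +>\<^bsub>?W'\<^esub> v' = B' +>\<^bsub>?W'\<^esub> w' \<longleftrightarrow> v' \<ominus>\<^bsub>V'\<^esub> w' \<in> B'"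
      using Q'.coset_eq_iff_add[of v' w'] BV'.coset_eq_iff_add[of v' w'] BV'.coset_eq_iff[of v' w'] m carr' by simp
    ultimately show ?thesis using Q_B[OF Q_diff[OF that]] by simp
  qed
  define h where "h X = B' +>\<^bsub>?W'\<^esub> (SOME v'. \<exists>v\<in>X. Q v v')" for X
  have h: "h (B +>\<^bsub>?W\<^esub> v) = B' +>\<^bsub>?W'\<^esub> v'" if "Q v v'" for v v'
  proof -
    have v: "v \<in> Z" using Q that by auto
    have "\<exists>v'. \<exists>u\<in>B +>\<^bsub>?W\<^esub> v. Q u v'"
      using that Q.coset_self[of v] v by auto
    then obtain u where u: "u \<in> B +>\<^bsub>?W\<^esub> v" "Q u (SOME v'. \<exists>u\<in>B +>\<^bsub>?W\<^esub> v. Q u v')"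
      using someI_ex[of "\<lambda>v'. \<exists>u\<in>B +>\<^bsub>?W\<^esub> v. Q u v'"] by blast
    have "B +>\<^bsub>?W\<^esub> v = B +>\<^bsub>?W\<^esub> u"
      using Q.S.a_repr_independence'[OF u(1)] v by simp
    then show ?thesis unfolding h_def using rel[OF that u(2)] by simp
  qed
  have "h \<in> linear_maps k (quotient_module ?W B) (quotient_module ?W' B')"
  proof (rule linear_mapsI)
    fix X assume "X \<in> carrier (quotient_module ?W B)"
    then obtain v where v: "v \<in> Z" "X = B +>\<^bsub>?W\<^esub> v" by (rule Q.quot_cases) simp
    obtain v' where v': "Q v v'" using Q_total v by auto
    then show "h X \<in> carrier (quotient_module ?W' B')"
      using h[OF v'] v Q[OF v'] Q'.coset_closed[of v'] by simp
    fix r assume r: "r \<in> carrier k"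
    show "h (r \<odot>\<^bsub>quotient_module ?W B\<^esub> X) = r \<odot>\<^bsub>quotient_module ?W' B'\<^esub> h X"
      using h[OF v'] v Q[OF v'] h[OF Q_smult[OF r v']] Q.coset_smult[OF r, of v] Q'.coset_smult[OF r, of v']
      by simp
  next
    fix X Y assume XY: "X \<in> carrier (quotient_module ?W B)" "Y \<in> carrier (quotient_module ?W B)"
    obtain v where v1: "v \<in> Z" "X = B +>\<^bsub>?W\<^esub> v" using XY(1) by (rule Q.quot_cases) simp
    obtain w where v2: "w \<in> Z" "Y = B +>\<^bsub>?W\<^esub> w" using XY(2) by (rule Q.quot_cases) simp
    note v = v1 v2
    obtain v' w' where v': "Q v v'" "Q w w'" using Q_total(1)[OF v1(1)] Q_total(1)[OF v2(1)] by auto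
    then show "h (X \<oplus>\<^bsub>quotient_module ?W B\<^esub> Y) = h X \<oplus>\<^bsub>quotient_module ?W' B'\<^esub> h Y"
      using v Q[OF v'(1)] Q[OF v'(2)] h[OF v'(1)] h[OF v'(2)] h[OF Q_add[OF v']]
        Q.coset_add[of v w] Q'.coset_add[of v' w'] by simp
  qed
  moreover have "bij_betw h (carrier (quotient_module ?W B)) (carrier (quotient_module ?W' B'))"
  proof (rule bij_betwI')
    fix X Y assume XY: "X \<in> carrier (quotient_module ?W B)" "Y \<in> carrier (quotient_module ?W B)"
    obtain v where v1: "v \<in> Z" "X = B +>\<^bsub>?W\<^esub> v" using XY(1) by (rule Q.quot_cases) simp
    obtain w where v2: "w \<in> Z" "Y = B +>\<^bsub>?W\<^esub> w" using XY(2) by (rule Q.quot_cases) simp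
    note v = v1 v2
    obtain v' w' where v': "Q v v'" "Q w w'" using Q_total(1)[OF v1(1)] Q_total(1)[OF v2(1)] by auto
    then show "h X = h Y \<longleftrightarrow> X = Y"
      using v h[OF v'(1)] h[OF v'(2)] rel[OF v'] by simp
  next
    fix X assume "X \<in> carrier (quotient_module ?W B)"
    then obtain v where v: "v \<in> Z" "X = B +>\<^bsub>?W\<^esub> v" by (rule Q.quot_cases) simp
    obtain v' where v': "Q v v'" using Q_total v by auto
    then show "h X \<in> carrier (quotient_module ?W' B')"
      using h[OF v'] v Q[OF v'] Q'.coset_closed[of v'] by simp
  next
    fix X' assume "X' \<in> carrier (quotient_module ?W' B')"
    then obtain v' where v': "v' \<in> Z'" "X' = B' +>\<^bsub>?W'\<^esub> v'" by (rule Q'.quot_cases) simp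
    obtain v where v: "Q v v'" using Q_total v' by auto
    then show "\<exists>X\<in>carrier (quotient_module ?W B). X' = h X"
      using h[OF v] v' Q[OF v] Q.coset_closed[of v] by (intro bexI[of _ "B +>\<^bsub>?W\<^esub> v"]) simp_all
  qed
  ultimately show ?thesis unfolding isomorphic_modules_def by blast
qed

lemma (in abelian_group) minus_eq_zero_iff:
  "\<lbrakk>x \<in> carrier G; y \<in> carrier G\<rbrakk> \<Longrightarrow> x \<ominus> y = \<zero> \<longleftrightarrow> x = y"
  by (metis add.inv_closed minus_equality minus_minus r_neg minus_eq)

section \<open>Functionals on finitely generated vector spaces\<close>

lemma regular_module_simps [simp]:
  "carrier (regular_module R) = carrier R" "add (regular_module R) = add R"
  "zero (regular_module R) = zero R" "smult (regular_module R) = mult R"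
  "one (regular_module R) = one R" "mult (regular_module R) = mult R"
  by (simp_all add: regular_module_def ring.extend_def module.fields_def ring.truncate_def fun_eq_iff)

lemma regular_left_module:
  assumes "ring R" shows "left_module R (regular_module R)"
proof -
  interpret ring R by fact
  show ?thesis
    by (rule left_moduleI)
      (auto simp: l_distr r_distr m_assoc ring_axioms
        intro: abelian_group_cong[OF abelian_group_axioms])
qed

abbreviation functionals :: "('k, 'x) ring_scheme \<Rightarrow> ('k, 'v) module \<Rightarrow> ('v \<Rightarrow> 'k) set" where
  "functionals k V \<equiv> linear_maps k V (regular_module k)"

locale vspace = R?: field k + lmod k M for k (structure) and M (structure)
begin

section \<open>Extension of functionals by one vector\<close>

definition adjoin :: "'c set \<Rightarrow> 'c \<Rightarrow> 'c set" where
  "adjoin H s = {h \<oplus>\<^bsub>M\<^esub> c \<odot>\<^bsub>M\<^esub> s |h c. h \<in> H \<and> c \<in> carrier k}"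

lemma adjoin_submodule:
  assumes H: "submodule H k M" and s: "s \<in> carrier M"
  shows "submodule (adjoin H s) k M"
proof (rule submodule_intro)
  note [simp] = submodule_mem[OF H] and [intro] = submodule_add_closed[OF H] submodule_smult_closed[OF H]
  show "adjoin H s \<subseteq> carrier M" using s by (auto simp: adjoin_def)
  show "\<zero>\<^bsub>M\<^esub> \<in> adjoin H s"
    using s submodule_zero_closed[OF H] unfolding adjoin_def
    by (intro CollectI exI[of _ "\<zero>\<^bsub>M\<^esub>"] exI[of _ "\<zero>\<^bsub>k\<^esub>"]) simp
next
  fix x y assume "x \<in> adjoin H s" "y \<in> adjoin H s"
  then obtain h c h' c' where "h \<in> H" "h' \<in> H" "c \<in> carrier k" "c' \<in> carrier k"
    "x = h \<oplus>\<^bsub>M\<^esub> c \<odot>\<^bsub>M\<^esub> s" "y = h' \<oplus>\<^bsub>M\<^esub> c' \<odot>\<^bsub>M\<^esub> s" by (auto simp: adjoin_def)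
  then show "x \<oplus>\<^bsub>M\<^esub> y \<in> adjoin H s"
    using s submodule_mem[OF H] submodule_add_closed[OF H] unfolding adjoin_def
    by (intro CollectI exI[of _ "h \<oplus>\<^bsub>M\<^esub> h'"] exI[of _ "c \<oplus> c'"]) (auto simp: smult_l_distr M.a_ac)
next
  fix a x assume a: "a \<in> carrier k" "x \<in> adjoin H s"
  then obtain h c where "h \<in> H" "c \<in> carrier k" "x = h \<oplus>\<^bsub>M\<^esub> c \<odot>\<^bsub>M\<^esub> s" by (auto simp: adjoin_def)
  then show "a \<odot>\<^bsub>M\<^esub> x \<in> adjoin H s"
    using s a submodule_mem[OF H] submodule_smult_closed[OF H] unfolding adjoin_def
    by (intro CollectI exI[of _ "a \<odot>\<^bsub>M\<^esub> h"] exI[of _ "a \<otimes> c"]) (auto simp: smult_r_distr smult_assoc1)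
qed

lemma adjoin_superset:
  assumes H: "submodule H k M" and s: "s \<in> carrier M"
  shows "H \<subseteq> adjoin H s" "s \<in> adjoin H s"
proof -
  show "H \<subseteq> adjoin H s"
  proof
    fix h assume "h \<in> H"
    then show "h \<in> adjoin H s" unfolding adjoin_def
      using s submodule_mem[OF H] by (intro CollectI exI[of _ h] exI[of _ "\<zero>"]) simp
  qed
  show "s \<in> adjoin H s" unfolding adjoin_def
    using s submodule_zero_closed[OF H] by (intro CollectI exI[of _ "\<zero>\<^bsub>M\<^esub>"] exI[of _ "\<one>"]) simp
qed

text \<open>A nonzero difference of the two coefficients would be invertible, which would put
  \<open>s\<close> into \<open>H\<close>.\<close>

lemma adjoin_unique:
  assumes H: "submodule H k M" and s: "s \<in> carrier M" "s \<notin> H"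
    and h: "h \<in> H" "h' \<in> H" "c \<in> carrier k" "c' \<in> carrier k"
    and eq: "h \<oplus>\<^bsub>M\<^esub> c \<odot>\<^bsub>M\<^esub> s = h' \<oplus>\<^bsub>M\<^esub> c' \<odot>\<^bsub>M\<^esub> s"
  shows "c = c'" "h = h'"
proof -
  note m = submodule_mem[OF H]
  have e: "(c \<ominus> c') \<odot>\<^bsub>M\<^esub> s = h' \<ominus>\<^bsub>M\<^esub> h"
  proof -
    have "c \<odot>\<^bsub>M\<^esub> s = (h' \<oplus>\<^bsub>M\<^esub> c' \<odot>\<^bsub>M\<^esub> s) \<ominus>\<^bsub>M\<^esub> h"
      using eq[symmetric] m[OF h(1)] m[OF h(2)] s h by (simp add: a_minus_def M.a_ac M.r_neg M.r_neg1 M.r_neg2)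
    then show ?thesis using m[OF h(1)] m[OF h(2)] s h
      by (simp add: a_minus_def smult_l_distr smult_l_minus M.a_ac M.r_neg M.r_neg1 M.r_neg2)
  qed
  show cc: "c = c'"
  proof (rule ccontr)
    assume "c \<noteq> c'"
    then have ne: "c \<ominus> c' \<noteq> \<zero>" using h R.minus_eq_zero_iff by simp
    then have u: "c \<ominus> c' \<in> Units k" using h by (simp add: field_Units)
    have "inv (c \<ominus> c') \<odot>\<^bsub>M\<^esub> ((c \<ominus> c') \<odot>\<^bsub>M\<^esub> s) \<in> H"
      unfolding e using u h submodule_smult_closed[OF H] submodule_diff_closed[OF H] by simp
    then have "s \<in> H" using u s h by (simp add: smult_assoc1[symmetric])
    then show False using s by simp
  qed
  show "h = h'" using eq s h m[OF h(1)] m[OF h(2)] by (simp add: cc)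
qed

text \<open>By \<open>adjoin_unique\<close> an element of \<open>adjoin H s\<close> has well-defined
  components, so the value at \<open>s\<close> can be prescribed freely.\<close>

lemma extend_functional:
  assumes H: "submodule H k M" and s: "s \<in> carrier M" "s \<notin> H" and t: "t \<in> carrier k"
    and f: "f \<in> functionals k (M\<lparr>carrier := H\<rparr>)"
  shows "\<exists>g\<in>functionals k (M\<lparr>carrier := adjoin H s\<rparr>). (\<forall>x\<in>H. g x = f x) \<and> g s = t"
proof -
  note f' = linear_mapsD[OF f, simplified]
  define g where "g x = (THE y. \<exists>h\<in>H. \<exists>c\<in>carrier k. x = h \<oplus>\<^bsub>M\<^esub> c \<odot>\<^bsub>M\<^esub> s \<and> y = f h \<oplus> c \<otimes> t)" for x
  have g: "g (h \<oplus>\<^bsub>M\<^esub> c \<odot>\<^bsub>M\<^esub> s) = f h \<oplus> c \<otimes> t" if "h \<in> H" "c \<in> carrier k" for h c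
    unfolding g_def
    by (rule the_equality) (use that adjoin_unique[OF H s] in blast)+
  note m = submodule_mem[OF H]
  have "g \<in> functionals k (M\<lparr>carrier := adjoin H s\<rparr>)"
  proof (rule linear_mapsI, simp_all)
    fix x assume "x \<in> adjoin H s"
    then obtain h c where x: "h \<in> H" "c \<in> carrier k" "x = h \<oplus>\<^bsub>M\<^esub> c \<odot>\<^bsub>M\<^esub> s" by (auto simp: adjoin_def)
    then show "g x \<in> carrier k" using g t f'(1) by simp
    fix r assume r: "r \<in> carrier k"
    have "r \<odot>\<^bsub>M\<^esub> x = r \<odot>\<^bsub>M\<^esub> h \<oplus>\<^bsub>M\<^esub> (r \<otimes> c) \<odot>\<^bsub>M\<^esub> s"
      using x r s m by (simp add: smult_r_distr smult_assoc1)
    then show "g (r \<odot>\<^bsub>M\<^esub> x) = r \<otimes> g x"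
      using x r t g f' submodule_smult_closed[OF H] by (simp add: r_distr m_assoc)
  next
    fix x y assume "x \<in> adjoin H s" "y \<in> adjoin H s"
    then obtain h c h' c' where x: "h \<in> H" "h' \<in> H" "c \<in> carrier k" "c' \<in> carrier k"
      "x = h \<oplus>\<^bsub>M\<^esub> c \<odot>\<^bsub>M\<^esub> s" "y = h' \<oplus>\<^bsub>M\<^esub> c' \<odot>\<^bsub>M\<^esub> s" by (auto simp: adjoin_def)
    then have "x \<oplus>\<^bsub>M\<^esub> y = (h \<oplus>\<^bsub>M\<^esub> h') \<oplus>\<^bsub>M\<^esub> (c \<oplus> c') \<odot>\<^bsub>M\<^esub> s"
      using s m by (simp add: smult_l_distr M.a_ac)
    then show "g (x \<oplus>\<^bsub>M\<^esub> y) = g x \<oplus> g y"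
      using x t g f' submodule_add_closed[OF H] by (simp add: l_distr R.a_ac)
  qed
  moreover have "g x = f x" if "x \<in> H" for x
    using g[OF that R.zero_closed] s t m[OF that] f' that by simp
  moreover have "g s = t"
  proof -
    have "f \<zero>\<^bsub>M\<^esub> = \<zero>"
      using f'(3)[of "\<zero>" "\<zero>\<^bsub>M\<^esub>"] submodule_zero_closed[OF H] f'(1) by simp
    then show ?thesis using g[OF submodule_zero_closed[OF H] R.one_closed] s t by simp
  qed
  ultimately show ?thesis by blast
qed

text \<open>The functional on \<open>B + k z\<close> that is zero on \<open>B\<close> and one at
  \<open>z\<close> is extended over a finite generating set, one generator at a time. Generators
  already in the domain are skipped, the others receive the value zero.\<close>

lemma functional_separation:
  assumes fg: "finitely_generated k M" and B: "submodule B k M" and z: "z \<in> carrier M" "z \<notin> B"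
  shows "\<exists>g\<in>functionals k M. (\<forall>x\<in>B. g x = \<zero>) \<and> g z = \<one>"
proof -
  have "(\<lambda>x. \<zero>) \<in> functionals k (M\<lparr>carrier := B\<rparr>)"
    by (rule linear_mapsI) auto
  from extend_functional[OF B z R.one_closed this]
  obtain f where f: "f \<in> functionals k (M\<lparr>carrier := adjoin B z\<rparr>)" "\<forall>x\<in>B. f x = \<zero>" "f z = \<one>"
    by auto
  have ext: "\<exists>H g. submodule H k M \<and> adjoin B z \<subseteq> H \<and> S \<subseteq> H \<and>
      g \<in> functionals k (M\<lparr>carrier := H\<rparr>) \<and> (\<forall>x\<in>adjoin B z. g x = f x)"
    if "finite S" "S \<subseteq> carrier M" for S
    using that
  proof (induction S rule: finite_induct)
    case empty
    show ?case using f(1) adjoin_submodule[OF B z(1)] by blast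
  next
    case (insert s S)
    then obtain H g where H: "submodule H k M" "adjoin B z \<subseteq> H" "S \<subseteq> H"
      "g \<in> functionals k (M\<lparr>carrier := H\<rparr>)" "\<forall>x\<in>adjoin B z. g x = f x" by auto
    show ?case
    proof (cases "s \<in> H")
      case True
      then show ?thesis using H by blast
    next
      case False
      have s: "s \<in> carrier M" using insert by simp
      from extend_functional[OF H(1) s False R.zero_closed H(4)]
      obtain g' where "g' \<in> functionals k (M\<lparr>carrier := adjoin H s\<rparr>)" "\<forall>x\<in>H. g' x = g x" by auto
      then show ?thesis
        using H adjoin_submodule[OF H(1) s] adjoin_superset[OF H(1) s]
        by (intro exI[of _ "adjoin H s"] exI[of _ g']) auto
    qed
  qed
  obtain S where S: "finite S" "S \<subseteq> carrier M" "module_span k M S = carrier M"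
    using fg by (auto simp: finitely_generated_def)
  from ext[OF S(1,2)] obtain H g where H: "submodule H k M" "adjoin B z \<subseteq> H" "S \<subseteq> H"
    "g \<in> functionals k (M\<lparr>carrier := H\<rparr>)" "\<forall>x\<in>adjoin B z. g x = f x" by auto
  have "H = carrier M" using S(3) span_least[OF H(1,3)] submodule_subset[OF H(1)] by auto
  then show ?thesis
    using H f adjoin_superset[OF B z(1)] by (intro bexI[of _ g]) auto
qed

text \<open>For a dual family this is the projection onto the common kernel of the functionals along
  the span of \<open>W\<close>. That it lies in \<open>B\<close> says that \<open>W\<close>
  represents \<open>y\<close> modulo \<open>B\<close>.\<close>

definition residue :: "'c set \<Rightarrow> ('c \<Rightarrow> 'c \<Rightarrow> 'a) \<Rightarrow> 'c \<Rightarrow> 'c" where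
  "residue W \<phi> y = y \<ominus>\<^bsub>M\<^esub> (\<Oplus>\<^bsub>M\<^esub>w\<in>W. \<phi> w y \<odot>\<^bsub>M\<^esub> w)"

lemma residue_linear:
  assumes "finite W" "W \<subseteq> carrier M" "\<And>w. w \<in> W \<Longrightarrow> \<phi> w \<in> functionals k M"
  shows "residue W \<phi> \<in> linear_maps k M M"
  unfolding residue_def
proof (rule linear_maps_diff)
  show "left_module k M" ..
  show "(\<lambda>x. x) \<in> linear_maps k M M" by (rule linear_mapsI) auto
  show "(\<lambda>x. \<Oplus>\<^bsub>M\<^esub>w\<in>W. \<phi> w x \<odot>\<^bsub>M\<^esub> w) \<in> linear_maps k M M"
  proof (rule linear_maps_finsum[OF _ assms(1)])
    show "left_module k M" ..
    fix w assume w: "w \<in> W"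
    note [simp] = linear_mapsD[OF assms(3)[OF w], simplified]
    show "(\<lambda>x. \<phi> w x \<odot>\<^bsub>M\<^esub> w) \<in> linear_maps k M M"
      by (rule linear_mapsI) (use w assms(2) in \<open>auto simp: smult_l_distr smult_assoc1\<close>)
  qed
qed

text \<open>A basis of \<open>Z\<close> modulo \<open>B\<close> together with dual functionals on the whole space.\<close>

definition dual_family :: "'c set \<Rightarrow> 'c set \<Rightarrow> 'c set \<Rightarrow> ('c \<Rightarrow> 'c \<Rightarrow> 'a) \<Rightarrow> bool" where
  "dual_family B Z W \<phi> \<longleftrightarrow> finite W \<and> W \<subseteq> Z \<and>
     (\<forall>w\<in>W. \<phi> w \<in> functionals k M \<and> (\<forall>b\<in>B. \<phi> w b = \<zero>) \<and>
        (\<forall>v\<in>W. \<phi> w v = (if v = w then \<one> else \<zero>))) \<and>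
     (\<forall>z\<in>Z. residue W \<phi> z \<in> B)"

lemma functional_finsum:
  assumes "g \<in> functionals k M" "finite W" "\<And>w. w \<in> W \<Longrightarrow> c w \<in> carrier k" "\<And>w. w \<in> W \<Longrightarrow> x w \<in> carrier M"
  shows "g (\<Oplus>\<^bsub>M\<^esub>w\<in>W. c w \<odot>\<^bsub>M\<^esub> x w) = (\<Oplus>w\<in>W. c w \<otimes> g (x w))"
proof -
  interpret g: lmap k M "regular_module k" g
    by (intro lmap.intro lmap_axioms.intro lmod.intro regular_left_module R.ring_axioms assms(1) left_module_axioms)
  have "g (\<Oplus>\<^bsub>M\<^esub>w\<in>W. c w \<odot>\<^bsub>M\<^esub> x w) = (\<Oplus>\<^bsub>regular_module k\<^esub>w\<in>W. g (c w \<odot>\<^bsub>M\<^esub> x w))"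
    using assms by (intro g.map_finsum) auto
  \<comment> \<open>\<open>finsum\<close> sees only the carrier, the addition and the zero, which
    \<open>regular_module k\<close> shares with \<open>k\<close>.\<close>
  also have "\<dots> = (\<Oplus>w\<in>W. g (c w \<odot>\<^bsub>M\<^esub> x w))"
    by (simp add: finsum_def finprod_def)
  also have "\<dots> = (\<Oplus>w\<in>W. c w \<otimes> g (x w))"
    using assms(3,4) linear_mapsD[OF assms(1), simplified] by (intro R.finsum_cong') auto
  finally show ?thesis .
qed

lemma finsum_delta:
  assumes "finite W" "v \<in> W" "\<And>w. w \<in> W \<Longrightarrow> c w \<in> carrier k"
  shows "(\<Oplus>w\<in>W. c w \<otimes> (if w = v then \<one> else \<zero>)) = c v"
proof -
  have "(\<Oplus>w\<in>W. c w \<otimes> (if w = v then \<one> else \<zero>)) = (\<Oplus>w\<in>W. if v = w then c w else \<zero>)"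
    using assms by (intro R.finsum_cong') auto
  also have "\<dots> = c v" using assms by (intro R.add.finprod_singleton) auto
  finally show ?thesis .
qed

text \<open>By duality the subtracted combination takes the same value under \<open>\<phi> w\<close>
  as \<open>x\<close> itself.\<close>

lemma functional_residue:
  assumes "dual_family B Z W \<phi>" "w \<in> W" "Z \<subseteq> carrier M" "x \<in> carrier M"
  shows "\<phi> w (residue W \<phi> x) = \<zero>"
proof -
  note D = assms(1)[unfolded dual_family_def]
  have w: "\<phi> w \<in> functionals k M" using D assms by blast
  interpret w: lmap k M "regular_module k" "\<phi> w"
    by (intro lmap.intro lmap_axioms.intro lmod.intro regular_left_module R.ring_axioms w left_module_axioms)
  have cl: "\<phi> v x \<in> carrier k" if "v \<in> W" for v
    using D that assms(4) lin_closed[of "\<phi> v" k M "regular_module k" x] by auto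
  have mem: "v \<in> carrier M" if "v \<in> W" for v using D that assms(3) by auto
  have fin: "finite W" using D by blast
  have "\<phi> w (\<Oplus>\<^bsub>M\<^esub>v\<in>W. \<phi> v x \<odot>\<^bsub>M\<^esub> v) = (\<Oplus>v\<in>W. \<phi> v x \<otimes> \<phi> w v)"
    using functional_finsum[OF w fin, of "\<lambda>v. \<phi> v x" "\<lambda>v. v"] cl mem by simp
  also have "\<dots> = (\<Oplus>v\<in>W. \<phi> v x \<otimes> (if v = w then \<one> else \<zero>))"
    using D assms(2) cl by (intro R.finsum_cong') auto
  also have "\<dots> = \<phi> w x" using cl fin assms(2) by (intro finsum_delta) auto
  finally have e: "\<phi> w (\<Oplus>\<^bsub>M\<^esub>v\<in>W. \<phi> v x \<odot>\<^bsub>M\<^esub> v) = \<phi> w x" .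
  have "(\<Oplus>\<^bsub>M\<^esub>v\<in>W. \<phi> v x \<odot>\<^bsub>M\<^esub> v) \<in> carrier M" using cl mem by (intro M.finsum_closed) auto
  then have "\<phi> w (residue W \<phi> x) = \<phi> w x \<ominus>\<^bsub>regular_module k\<^esub> \<phi> w x"
    unfolding residue_def using assms(4) e by simp
  also have "\<dots> = \<zero>" using cl[OF assms(2)] w.N.diff_eq_zero_iff[of "\<phi> w x" "\<phi> w x"] by simp
  finally show ?thesis .
qed

lemma residue_trivial:
  assumes "finite W" "W \<subseteq> carrier M" "x \<in> carrier M" "\<And>w. w \<in> W \<Longrightarrow> \<phi> w x = \<zero>"
  shows "residue W \<phi> x = x"
proof -
  have "(\<Oplus>\<^bsub>M\<^esub>w\<in>W. \<phi> w x \<odot>\<^bsub>M\<^esub> w) = (\<Oplus>\<^bsub>M\<^esub>w\<in>W. \<zero>\<^bsub>M\<^esub>)"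
    using assms by (intro M.finsum_cong') auto
  then show ?thesis using assms by (simp add: residue_def a_minus_def)
qed

text \<open>Elimination along a finite generating set \<open>S\<close>: a family is kept for the
  intersection of \<open>Z\<close> with the span of \<open>S\<close>. One more vector enlarges this
  intersection by at most one dimension, so at most one new member is called for. It is the residue
  \<open>r\<close> of an element of \<open>Z1\<close> that is not yet represented modulo
  \<open>B\<close>.\<close>

lemma dual_family_exists:
  assumes fg: "finitely_generated k M" and B: "submodule B k M" and Z: "submodule Z k M"
  shows "\<exists>W \<phi>. dual_family B Z W \<phi>"
proof -
  have "\<exists>W \<phi>. dual_family B (Z \<inter> module_span k M S) W \<phi>" if "finite S" "S \<subseteq> carrier M" for S
    using that
  proof (induction S rule: finite_induct)
    case empty
    have "module_span k M {} \<subseteq> {\<zero>\<^bsub>M\<^esub>}" by (rule span_least[OF submodule_zero]) simp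
    then have "z \<ominus>\<^bsub>M\<^esub> \<zero>\<^bsub>M\<^esub> \<in> B" if "z \<in> module_span k M {}" for z
      using submodule_diff_closed[OF B submodule_zero_closed[OF B] submodule_zero_closed[OF B]] that by auto
    then have "dual_family B (Z \<inter> module_span k M {}) {} (\<lambda>_ _. \<zero>)"
      by (simp add: dual_family_def residue_def)
    then show ?case by blast
  next
    case (insert s S)
    then obtain W \<phi> where D: "dual_family B (Z \<inter> module_span k M S) W \<phi>" by auto
    note D' = D[unfolded dual_family_def]
    define Z0 where "Z0 = Z \<inter> module_span k M S"
    define Z1 where "Z1 = Z \<inter> module_span k M (insert s S)"
    have s: "s \<in> carrier M" and S: "S \<subseteq> carrier M" using insert by auto
    have sp: "submodule (module_span k M S) k M" "submodule (module_span k M (insert s S)) k M"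
      using s S by (auto intro: span_submodule)
    have "module_span k M S \<subseteq> module_span k M (insert s S)"
      by (rule span_least[OF sp(2)]) (use span_superset[of "insert s S"] in auto)
    then have Z01: "Z0 \<subseteq> Z1" by (auto simp: Z0_def Z1_def)
    have Z1: "submodule Z1 k M"
      by (rule submodule_intro) (use submoduleD[OF Z] submoduleD[OF sp(2)] in \<open>auto simp: Z1_def\<close>)
    note Z1' = submoduleD[OF Z1]
    have fin: "finite W" and W: "W \<subseteq> Z0" "W \<subseteq> carrier M"
      and phi: "\<And>w. w \<in> W \<Longrightarrow> \<phi> w \<in> functionals k M"
      using D' Z1'(1) Z01 by (auto simp: Z0_def)
    have rl: "residue W \<phi> \<in> linear_maps k M M" by (rule residue_linear[OF fin W(2) phi])
    interpret rl: lmap k M M "residue W \<phi>"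
      by (intro lmap.intro lmap_axioms.intro lmod.intro rl left_module_axioms)
    have phi_cl: "\<phi> w x \<in> carrier k" if "w \<in> W" "x \<in> carrier M" for w x
      using lin_closed[OF phi[OF that(1)] that(2)] by simp
    have rZ1: "residue W \<phi> z \<in> Z1" if "z \<in> Z1" for z
      unfolding residue_def using that Z1' W Z01 phi_cl
      by (intro Z1'(6) submodule_finsum[OF Z1 fin]) auto
    show ?case
    proof (cases "\<forall>z\<in>Z1. residue W \<phi> z \<in> B")
      case True
      then have "dual_family B Z1 W \<phi>"
        using D' Z01 unfolding dual_family_def Z0_def by blast
      then show ?thesis unfolding Z1_def by blast
    next
      case False
      then obtain z where z: "z \<in> Z1" "residue W \<phi> z \<notin> B" by blast
      define r where "r = residue W \<phi> z"
      have r: "r \<in> Z1" "r \<in> carrier M" "r \<notin> B" using z rZ1 Z1' by (auto simp: r_def)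
      have Z0c: "Z0 \<subseteq> carrier M" using Z01 Z1' by auto
      have phir: "\<phi> w r = \<zero>" if "w \<in> W" for w
        unfolding r_def by (rule functional_residue[OF D that]) (use Z0c z Z1' in \<open>auto simp: Z0_def\<close>)
      have rr: "residue W \<phi> r = r" by (rule residue_trivial[where \<phi> = \<phi>, OF fin W(2) r(2) phir])
      obtain g where g: "g \<in> functionals k M" "\<And>x. x \<in> B \<Longrightarrow> g x = \<zero>" "g r = \<one>"
        using functional_separation[OF fg B r(2,3)] by auto
      note g' = linear_mapsD[OF g(1), simplified]
      \<comment> \<open>The functional \<open>g\<close> separates \<open>r\<close> from
        \<open>B\<close> but may be nonzero on \<open>W\<close>. Composing with the residue repairs
        this, since the residues of members of \<open>W\<close> lie in \<open>B\<close>. On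
        \<open>B\<close> and at \<open>r\<close> the residue is the identity, so the values there
        are kept.\<close>
      define h where "h x = g (residue W \<phi> x)" for x
      have h: "h \<in> functionals k M" unfolding h_def by (rule linear_maps_comp[OF rl g(1)])
      have hB: "h b = \<zero>" if "b \<in> B" for b
      proof -
        have "residue W \<phi> b = b"
          by (rule residue_trivial[OF fin W(2)]) (use D' that submodule_mem[OF B] in auto)
        then show ?thesis using g(2)[OF that] by (simp add: h_def)
      qed
      have hW: "h v = \<zero>" if "v \<in> W" for v
      proof -
        have "residue W \<phi> v \<in> B" using D' that W by (auto simp: Z0_def)
        then show ?thesis using g(2) by (simp add: h_def)
      qed
      have hr: "h r = \<one>" by (simp add: h_def rr g(3))
      have rW: "r \<notin> W" using hW hr by auto
      define \<psi> where "\<psi> = \<phi>(r := h)"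
      have res: "residue (insert r W) \<psi> y = residue W \<phi> y \<ominus>\<^bsub>M\<^esub> h y \<odot>\<^bsub>M\<^esub> r" if "y \<in> carrier M" for y
      proof -
        have "(\<Oplus>\<^bsub>M\<^esub>w\<in>insert r W. \<psi> w y \<odot>\<^bsub>M\<^esub> w) = \<psi> r y \<odot>\<^bsub>M\<^esub> r \<oplus>\<^bsub>M\<^esub> (\<Oplus>\<^bsub>M\<^esub>w\<in>W. \<psi> w y \<odot>\<^bsub>M\<^esub> w)"
          by (rule M.finsum_insert)
            (use fin rW r that phi_cl W lin_closed[OF h that] in \<open>auto simp: \<psi>_def\<close>)
        also have "(\<Oplus>\<^bsub>M\<^esub>w\<in>W. \<psi> w y \<odot>\<^bsub>M\<^esub> w) = (\<Oplus>\<^bsub>M\<^esub>w\<in>W. \<phi> w y \<odot>\<^bsub>M\<^esub> w)"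
          by (rule M.finsum_cong') (use rW phi_cl W that in \<open>auto simp: \<psi>_def\<close>)
        finally have e: "(\<Oplus>\<^bsub>M\<^esub>w\<in>insert r W. \<psi> w y \<odot>\<^bsub>M\<^esub> w) = h y \<odot>\<^bsub>M\<^esub> r \<oplus>\<^bsub>M\<^esub> (\<Oplus>\<^bsub>M\<^esub>w\<in>W. \<phi> w y \<odot>\<^bsub>M\<^esub> w)"
          by (simp add: \<psi>_def)
        have "(\<Oplus>\<^bsub>M\<^esub>w\<in>W. \<phi> w y \<odot>\<^bsub>M\<^esub> w) \<in> carrier M" using phi_cl W that by (intro M.finsum_closed) auto
        moreover have "h y \<odot>\<^bsub>M\<^esub> r \<in> carrier M" using lin_closed[OF h that] r by simp
        ultimately show ?thesis
          using that unfolding residue_def e by (simp add: a_minus_def M.minus_add M.a_ac)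
      qed
      obtain x c where x: "x \<in> module_span k M S" "c \<in> carrier k" "r = x \<oplus>\<^bsub>M\<^esub> c \<odot>\<^bsub>M\<^esub> s"
        and span_adj: "module_span k M (insert s S) \<subseteq> adjoin (module_span k M S) s"
      proof -
        have "module_span k M (insert s S) \<subseteq> adjoin (module_span k M S) s"
          by (rule span_least[OF adjoin_submodule[OF sp(1) s]])
            (use adjoin_superset[OF sp(1) s] span_superset[of S] in auto)
        moreover have "r \<in> module_span k M (insert s S)" using r by (simp add: Z1_def)
        ultimately show thesis using that unfolding adjoin_def by blast
      qed
      have spm: "y \<in> carrier M" if "y \<in> module_span k M S" for y using submodule_mem[OF sp(1) that] .
      \<comment> \<open>Without an \<open>s\<close>-component \<open>r\<close> would lie in
        \<open>Z0\<close>, whose residues are in \<open>B\<close>; but the residue of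
        \<open>r\<close> is \<open>r\<close>.\<close>
      have "c \<noteq> \<zero>"
      proof
        assume "c = \<zero>"
        then have "r \<in> Z0" using x s r spm by (auto simp: Z0_def Z1_def)
        then have "residue W \<phi> r \<in> B" using D' by (auto simp: Z0_def)
        then show False using rr r by simp
      qed
      then have c: "c \<in> Units k" using x by (simp add: field_Units)
      have main: "residue (insert r W) \<psi> y \<in> B" if y: "y \<in> Z1" for y
      proof -
        obtain x' c' where y': "x' \<in> module_span k M S" "c' \<in> carrier k" "y = x' \<oplus>\<^bsub>M\<^esub> c' \<odot>\<^bsub>M\<^esub> s"
          using y span_adj unfolding Z1_def adjoin_def by blast
        \<comment> \<open>Chosen so that \<open>y - t r\<close> has no \<open>s\<close>-component
          and is covered by the induction hypothesis.\<close>
        define t where "t = c' \<otimes> inv c"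
        have t: "t \<in> carrier k" "t \<otimes> c = c'" using c y' x(2) by (auto simp: t_def R.m_assoc)
        define y0 where "y0 = y \<ominus>\<^bsub>M\<^esub> t \<odot>\<^bsub>M\<^esub> r"
        have ym: "y \<in> carrier M" using y Z1' by auto
        have "y0 = x' \<ominus>\<^bsub>M\<^esub> t \<odot>\<^bsub>M\<^esub> x"
          using x y' t s spm[OF x(1)] spm[OF y'(1)] unfolding y0_def
          by (simp add: smult_r_distr smult_assoc1[symmetric] a_minus_def M.minus_add M.a_ac M.r_neg M.r_neg1 M.r_neg2)
        then have "y0 \<in> module_span k M S"
          using x y' t submoduleD[OF sp(1)] by simp
        moreover have "y0 \<in> Z1" using y r t Z1' by (simp add: y0_def)
        ultimately have y0: "residue W \<phi> y0 \<in> B" using D' by (auto simp: Z1_def)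
        have ry: "residue W \<phi> y0 = residue W \<phi> y \<ominus>\<^bsub>M\<^esub> t \<odot>\<^bsub>M\<^esub> r"
          using ym r t rr by (simp add: y0_def)
        have e: "residue W \<phi> y = residue W \<phi> y0 \<oplus>\<^bsub>M\<^esub> t \<odot>\<^bsub>M\<^esub> r"
          using ry ym r t add_diff_cancel[of "residue W \<phi> y" "t \<odot>\<^bsub>M\<^esub> r"] by simp
        have "h y = t"
          unfolding h_def e using y0 submodule_mem[OF B y0] r t g g' by simp
        then show ?thesis using res[OF ym] ry y0 by simp
      qed
      have "dual_family B Z1 (insert r W) \<psi>"
        unfolding dual_family_def
      proof (intro conjI ballI)
        show "finite (insert r W)" "insert r W \<subseteq> Z1" using fin r W Z01 by auto
        fix w assume w: "w \<in> insert r W"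
        show "\<psi> w \<in> functionals k M" using w h phi by (auto simp: \<psi>_def)
        show "\<psi> w b = \<zero>" if "b \<in> B" for b
          using w hB[OF that] D' that by (auto simp: \<psi>_def)
        show "\<psi> w v = (if v = w then \<one> else \<zero>)" if "v \<in> insert r W" for v
          using w that D' hW hr rW phir by (auto simp: \<psi>_def)
      qed (use main in auto)
      then show ?thesis unfolding Z1_def by blast
    qed
  qed
  moreover obtain S where "finite S" "S \<subseteq> carrier M" "module_span k M S = carrier M"
    using fg by (auto simp: finitely_generated_def)
  moreover have "Z \<inter> carrier M = Z" using submodule_subset[OF Z] by auto
  ultimately show ?thesis by metis
qed

text \<open>On \<open>Z\<close> an element differs from its expansion along \<open>W\<close> by an
  element of \<open>B\<close>, where \<open>f\<close> vanishes.\<close>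

lemma functional_expand:
  assumes D: "dual_family B Z W \<phi>" "Z \<subseteq> carrier M" and f: "f \<in> functionals k M" "\<And>b. b \<in> B \<Longrightarrow> f b = \<zero>"
    and z: "z \<in> Z"
  shows "f z = (\<Oplus>w\<in>W. \<phi> w z \<otimes> f w)"
proof -
  note D' = D(1)[unfolded dual_family_def]
  interpret f: lmap k M "regular_module k" f
    by (intro lmap.intro lmap_axioms.intro lmod.intro regular_left_module R.ring_axioms f left_module_axioms)
  have cl: "\<phi> w z \<in> carrier k" if "w \<in> W" for w
    using D' that z assms(2) lin_closed[of "\<phi> w" k M "regular_module k" z] by auto
  have mem: "w \<in> carrier M" if "w \<in> W" for w using D' that assms(2) by auto
  have fin: "finite W" using D' by blast
  have s: "(\<Oplus>\<^bsub>M\<^esub>w\<in>W. \<phi> w z \<odot>\<^bsub>M\<^esub> w) \<in> carrier M" using cl mem by (intro M.finsum_closed) auto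
  have "f (residue W \<phi> z) = \<zero>" using D' z f(2) by blast
  then have "f z \<ominus>\<^bsub>regular_module k\<^esub> f (\<Oplus>\<^bsub>M\<^esub>w\<in>W. \<phi> w z \<odot>\<^bsub>M\<^esub> w) = \<zero>\<^bsub>regular_module k\<^esub>"
    using z s D(2) by (auto simp: residue_def)
  then have "f z = f (\<Oplus>\<^bsub>M\<^esub>w\<in>W. \<phi> w z \<odot>\<^bsub>M\<^esub> w)"
    using z s D(2) f.N.diff_eq_zero_iff[of "f z" "f (\<Oplus>\<^bsub>M\<^esub>w\<in>W. \<phi> w z \<odot>\<^bsub>M\<^esub> w)"] f.map lin_closed[OF f(1)] by auto
  then show ?thesis using functional_finsum[OF f(1) fin, of "\<lambda>w. \<phi> w z" "\<lambda>w. w"] cl mem by simp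
qed

end

section \<open>Algebras and spaces of linear maps\<close>

locale k_algebra = K?: field k + KM?: lmod k E + A?: ring E
  for k :: "'k ring" and E :: "('k, 'e) module" (structure) +
  assumes smult_mult_left:
      "\<lbrakk>r \<in> carrier k; x \<in> carrier E; y \<in> carrier E\<rbrakk> \<Longrightarrow> (r \<odot> x) \<otimes> y = r \<odot> (x \<otimes> y)"
    and smult_mult_right:
      "\<lbrakk>r \<in> carrier k; x \<in> carrier E; y \<in> carrier E\<rbrakk> \<Longrightarrow> x \<otimes> (r \<odot> y) = r \<odot> (x \<otimes> y)"

lemma restrict_scalars_simps [simp]:
  "carrier (restrict_scalars E M) = carrier M" "add (restrict_scalars E M) = add M"
  "zero (restrict_scalars E M) = zero M"
  "smult (restrict_scalars E M) = (\<lambda>a m. (a \<odot>\<^bsub>E\<^esub> \<one>\<^bsub>E\<^esub>) \<odot>\<^bsub>M\<^esub> m)"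
  by (simp_all add: restrict_scalars_def ring.extend_def module.fields_def ring.truncate_def fun_eq_iff)

lemma a_minus_restrict_scalars [simp]: "a_minus (restrict_scalars E M) = a_minus M"
  by (simp add: fun_eq_iff a_minus_def a_inv_def m_inv_def)

lemma hom_space_simps [simp]:
  "carrier (hom_space E M N) = linear_maps E M N \<inter> extensional (carrier M)"
  "zero (hom_space E M N) = (\<lambda>x\<in>carrier M. \<zero>\<^bsub>N\<^esub>)"
  "add (hom_space E M N) = (\<lambda>f g. \<lambda>x\<in>carrier M. f x \<oplus>\<^bsub>N\<^esub> g x)"
  "smult (hom_space E M N) = (\<lambda>a f. \<lambda>x\<in>carrier M. (a \<odot>\<^bsub>E\<^esub> \<one>\<^bsub>E\<^esub>) \<odot>\<^bsub>N\<^esub> f x)"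
  by (simp_all add: hom_space_def)

context k_algebra
begin

abbreviation scal :: "'k \<Rightarrow> 'e" where
  "scal r \<equiv> r \<odot> \<one>"

lemma scal_mult: "\<lbrakk>r \<in> carrier k; x \<in> carrier E\<rbrakk> \<Longrightarrow> scal r \<otimes> x = r \<odot> x"
  by (simp add: smult_mult_left)

lemma scal_mult_right: "\<lbrakk>r \<in> carrier k; x \<in> carrier E\<rbrakk> \<Longrightarrow> x \<otimes> scal r = r \<odot> x"
  by (simp add: smult_mult_right)

lemma scal_comm: "\<lbrakk>r \<in> carrier k; x \<in> carrier E\<rbrakk> \<Longrightarrow> scal r \<otimes> x = x \<otimes> scal r"
  by (simp add: scal_mult scal_mult_right)

lemma restrict_scalars_module:
  assumes "left_module E M" shows "left_module k (restrict_scalars E M)"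
proof -
  interpret M: lmod E M using assms by (rule lmod.intro)
  show ?thesis
  proof (rule left_moduleI)
    show "abelian_group (restrict_scalars E M)"
      by (rule abelian_group_cong[OF M.M.abelian_group_axioms]) simp_all
  qed (auto simp: K.ring_axioms KM.smult_l_distr KM.smult_assoc1 M.smult_l_distr M.smult_r_distr
      M.smult_assoc1[symmetric] scal_mult)
qed

lemma linear_maps_restrict_scalars:
  "f \<in> linear_maps E M N \<Longrightarrow> f \<in> linear_maps k (restrict_scalars E M) (restrict_scalars E N)"
  by (rule linear_mapsI) (auto simp: linear_mapsD)

text \<open>Scalars of \<open>k\<close> are central in \<open>E\<close>, so acting by them commutes
  with the action of \<open>E\<close>.\<close>

lemma linear_maps_scal:
  assumes N: "left_module E N" and r: "r \<in> carrier k" and f: "f \<in> linear_maps E M N"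
  shows "(\<lambda>x. scal r \<odot>\<^bsub>N\<^esub> f x) \<in> linear_maps E M N"
proof -
  interpret N: lmod E N using N by (rule lmod.intro)
  show ?thesis
  proof (rule linear_mapsI)
    fix a x assume a: "a \<in> carrier E" "x \<in> carrier M"
    have "scal r \<odot>\<^bsub>N\<^esub> (a \<odot>\<^bsub>N\<^esub> f x) = (scal r \<otimes> a) \<odot>\<^bsub>N\<^esub> f x"
      using a r lin_closed[OF f] by (simp add: N.smult_assoc1)
    also have "\<dots> = a \<odot>\<^bsub>N\<^esub> (scal r \<odot>\<^bsub>N\<^esub> f x)"
      using a r lin_closed[OF f] by (simp add: N.smult_assoc1[symmetric] scal_comm)
    finally show "scal r \<odot>\<^bsub>N\<^esub> f (a \<odot>\<^bsub>M\<^esub> x) = a \<odot>\<^bsub>N\<^esub> (scal r \<odot>\<^bsub>N\<^esub> f x)"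
      using a lin_smult[OF f] by simp
  qed (use r linear_mapsD[OF f] in \<open>auto simp: N.smult_r_distr\<close>)
qed

lemma restrict_linear_map:
  assumes "left_module E M" "f \<in> linear_maps E M N"
  shows "restrict f (carrier M) \<in> carrier (hom_space E M N)"
  using linear_maps_cong[OF assms(2) _ assms(1), of "restrict f (carrier M)"] by simp

lemma hom_space_module:
  assumes M: "left_module E M" and N: "left_module E N"
  shows "left_module k (hom_space E M N)"
proof -
  interpret M: lmod E M using M by (rule lmod.intro)
  interpret N: lmod E N using N by (rule lmod.intro)
  let ?H = "hom_space E M N"
  have ext: "f = g" if "f \<in> extensional (carrier M)" "g \<in> extensional (carrier M)"
    "\<And>x. x \<in> carrier M \<Longrightarrow> f x = g x" for f g
    using that by (rule extensionalityI)
  have add: "f \<oplus>\<^bsub>?H\<^esub> g \<in> carrier ?H" if "f \<in> carrier ?H" "g \<in> carrier ?H" for f g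
    using restrict_linear_map[OF M linear_maps_add[OF N, of f M g]] that by simp
  have smult: "r \<odot>\<^bsub>?H\<^esub> f \<in> carrier ?H" if "r \<in> carrier k" "f \<in> carrier ?H" for r f
    using restrict_linear_map[OF M linear_maps_scal[OF N, of r f M]] that by simp
  have zero: "\<zero>\<^bsub>?H\<^esub> \<in> carrier ?H"
    using restrict_linear_map[OF M linear_maps_zero[OF N]] by simp
  note cl = lin_closed[of _ E M N]
  show ?thesis
  proof (rule left_moduleI)
    show "abelian_group ?H"
    proof (rule abelian_groupI)
      fix f assume f: "f \<in> carrier ?H"
      have "(\<ominus>\<^bsub>k\<^esub> \<one>\<^bsub>k\<^esub>) \<odot>\<^bsub>?H\<^esub> f \<oplus>\<^bsub>?H\<^esub> f = \<zero>\<^bsub>?H\<^esub>"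
        using f by (auto simp: fun_eq_iff KM.smult_l_minus N.smult_l_minus N.M.l_neg cl restrict_def)
      then show "\<exists>g\<in>carrier ?H. g \<oplus>\<^bsub>?H\<^esub> f = \<zero>\<^bsub>?H\<^esub>"
        using smult[OF _ f, of "\<ominus>\<^bsub>k\<^esub> \<one>\<^bsub>k\<^esub>"] by blast
      show "\<zero>\<^bsub>?H\<^esub> \<oplus>\<^bsub>?H\<^esub> f = f"
        using f by (intro ext) (auto simp: cl)
    qed (use add zero in \<open>auto intro!: restrict_ext simp: cl N.M.a_ac\<close>)
    fix f assume f: "f \<in> carrier ?H"
    show "\<one>\<^bsub>k\<^esub> \<odot>\<^bsub>?H\<^esub> f = f" using f by (intro ext) (auto simp: cl)
  qed (use smult in \<open>auto intro!: restrict_ext simp: K.ring_axioms cl KM.smult_l_distr KM.smult_assoc1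
      N.smult_l_distr N.smult_r_distr N.smult_assoc1[symmetric] scal_mult\<close>)
qed

lemma hom_cycles_iff:
  assumes "\<And>x. x \<in> carrier M' \<Longrightarrow> d x \<in> carrier M"
  shows "g \<in> cycles (hom_space E M N) (hom_space E M' N) (precompose M' d) \<longleftrightarrow>
    g \<in> linear_maps E M N \<and> g \<in> extensional (carrier M) \<and> (\<forall>x\<in>carrier M'. g (d x) = \<zero>\<^bsub>N\<^esub>)"
  by (auto simp: cycles_def precompose_def fun_eq_iff restrict_def)

text \<open>Restricting \<open>u\<close> to \<open>carrier M'\<close> makes it an element of
  \<open>hom_space\<close> and leaves \<open>u (d x)\<close> unchanged.\<close>

lemma hom_boundaries_iff:
  assumes "left_module E M'" "left_module E M" "d \<in> linear_maps E M M'"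
  shows "g \<in> precompose M d ` carrier (hom_space E M' N) \<longleftrightarrow>
    g \<in> extensional (carrier M) \<and> (\<exists>u\<in>linear_maps E M' N. \<forall>x\<in>carrier M. g x = u (d x))"
proof
  assume "g \<in> precompose M d ` carrier (hom_space E M' N)"
  then obtain u where u: "u \<in> linear_maps E M' N" "g = precompose M d u" by auto
  then show "g \<in> extensional (carrier M) \<and> (\<exists>u\<in>linear_maps E M' N. \<forall>x\<in>carrier M. g x = u (d x))"
    by (auto simp: precompose_def)
next
  assume "g \<in> extensional (carrier M) \<and> (\<exists>u\<in>linear_maps E M' N. \<forall>x\<in>carrier M. g x = u (d x))"
  then obtain u where u: "g \<in> extensional (carrier M)" "u \<in> linear_maps E M' N"
    "\<And>x. x \<in> carrier M \<Longrightarrow> g x = u (d x)" by auto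
  have "g = precompose M d (restrict u (carrier M'))"
    by (rule extensionalityI[OF u(1)]) (use u lin_closed[OF assms(3)] in \<open>auto simp: precompose_def\<close>)
  then show "g \<in> precompose M d ` carrier (hom_space E M' N)"
    using restrict_linear_map[OF assms(1) u(2)] by blast
qed

lemma precompose_linear:
  assumes "left_module E M'" "left_module E M" "d \<in> linear_maps E M M'"
  shows "precompose M d \<in> linear_maps k (hom_space E M' N) (hom_space E M N)"
proof (rule linear_mapsI)
  fix u assume "u \<in> carrier (hom_space E M' N)"
  then show "precompose M d u \<in> carrier (hom_space E M N)"
    using restrict_linear_map[OF assms(2) linear_maps_comp[OF assms(3), of u N]]
    by (simp add: precompose_def)
qed (auto simp: precompose_def fun_eq_iff lin_closed[OF assms(3)])

end

lemma (in lmap) cycles_submodule: "submodule (cycles M N f) R M"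
  using vimage_submodule[OF N.submodule_zero] by (simp add: cycles_def)

lemma lmapI: "\<lbrakk>left_module R M; left_module R N; f \<in> linear_maps R M N\<rbrakk> \<Longrightarrow> lmap R M N f"
  by (intro lmap.intro lmap_axioms.intro lmod.intro)

lemma homology_isomorphic:
  assumes "left_module k V" "left_module k U" "left_module k W"
    and "f \<in> linear_maps k U V" "g \<in> linear_maps k V W" "\<And>u. u \<in> carrier U \<Longrightarrow> g (f u) = \<zero>\<^bsub>W\<^esub>"
    and "left_module k V'" "left_module k U'" "left_module k W'"
    and "f' \<in> linear_maps k U' V'" "g' \<in> linear_maps k V' W'" "\<And>u. u \<in> carrier U' \<Longrightarrow> g' (f' u) = \<zero>\<^bsub>W'\<^esub>"
    and "subquotient_iso k V (cycles V W g) (f ` carrier U) V' (cycles V' W' g') (f' ` carrier U')"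
  shows "isomorphic_modules k (homology_at U V W f g) (homology_at U' V' W' f' g')"
proof -
  interpret f: lmap k U V f by (rule lmapI) fact+
  interpret g: lmap k V W g by (rule lmapI) fact+
  interpret f': lmap k U' V' f' by (rule lmapI) fact+
  interpret g': lmap k V' W' g' by (rule lmapI) fact+
  show ?thesis unfolding homology_at_def
    by (rule subquotient_iso_imp_isomorphic)
      (use assms f.image_submodule[OF f.M.submodule_carrier] f'.image_submodule[OF f'.M.submodule_carrier]
        g.cycles_submodule g'.cycles_submodule in \<open>auto simp: cycles_def\<close>)
qed

lemma (in lmod) diff_closed [simp]:
  "\<lbrakk>x \<in> carrier M; y \<in> carrier M\<rbrakk> \<Longrightarrow> x \<ominus>\<^bsub>M\<^esub> y \<in> carrier M"
  by (simp add: a_minus_def)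

lemma (in lmod) diff_zero: "x \<in> carrier M \<Longrightarrow> x \<ominus>\<^bsub>M\<^esub> \<zero>\<^bsub>M\<^esub> = x"
  using add_diff_cancel[of x "\<zero>\<^bsub>M\<^esub>"] by simp

section \<open>Balancing the two variables\<close>

text \<open>
  \<open>T\<close> is an acyclic complex, \<open>Q\<close> a second complex with the same differentials, and \<open>A\<close> is the
  cokernel of \<open>d 1\<close> on either of them; the assumptions on lifting and extension express that the
  terms are projective and injective relative to each other.
  A map \<open>f\<close> in \<open>stable_cocycles i j\<close> represents the map from the image of \<open>d i\<close> to the image
  of \<open>d j\<close> with \<open>d i x \<mapsto> d j (f x)\<close>, and it lies in \<open>stable_boundaries i j\<close> if this map
  factors through \<open>T (i - 1)\<close>.
\<close>

locale balanced = k_algebra k E for k and E :: "('k, 'e) module" (structure) +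
  fixes T Q :: "int \<Rightarrow> ('e, 'm) module" and d :: "int \<Rightarrow> 'm \<Rightarrow> 'm"
    and A AQ :: "('e, 'a) module" and \<eta> :: "'m \<Rightarrow> 'a" and pt :: 'a
  assumes T_mod: "left_module E (T i)" and Q_mod: "left_module E (Q i)"
    and A_mod: "left_module E A" and AQ_mod: "left_module E AQ"
    and Q_carrier: "carrier (Q i) = carrier (T i)" "zero (Q i) = zero (T i)"
    and dT: "d i \<in> linear_maps E (T i) (T (i - 1))" and dQ: "d i \<in> linear_maps E (Q i) (Q (i - 1))"
    and exact: "x \<in> carrier (T i) \<Longrightarrow> d i x = \<zero>\<^bsub>T (i - 1)\<^esub> \<longleftrightarrow> x \<in> d (i + 1) ` carrier (T (i + 1))"
    and lift: "\<lbrakk>g \<in> linear_maps E (T i) (Q j); \<And>x. x \<in> carrier (T i) \<Longrightarrow> g x \<in> d (j + 1) ` carrier (Q (j + 1))\<rbrakk>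
      \<Longrightarrow> \<exists>f\<in>linear_maps E (T i) (Q (j + 1)). \<forall>x\<in>carrier (T i). d (j + 1) (f x) = g x"
    and extend: "\<lbrakk>g \<in> linear_maps E (T i) (Q j); \<And>x. x \<in> carrier (T (i + 1)) \<Longrightarrow> g (d (i + 1) x) = \<zero>\<^bsub>Q j\<^esub>\<rbrakk>
      \<Longrightarrow> \<exists>f\<in>linear_maps E (T (i - 1)) (Q j). \<forall>x\<in>carrier (T i). f (d i x) = g x"
    and eta: "\<eta> \<in> linear_maps E (T 0) A" and eta_Q: "\<eta> \<in> linear_maps E (Q 0) AQ"
    and AQ_carrier: "carrier AQ = carrier A" "zero AQ = zero A"
    and eta_onto: "\<eta> ` carrier (T 0) = carrier A"
    and eta_kernel: "x \<in> carrier (T 0) \<Longrightarrow> \<eta> x = \<zero>\<^bsub>A\<^esub> \<longleftrightarrow> x \<in> d 1 ` carrier (T 1)"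
    and lift_eta: "h \<in> linear_maps E (T i) AQ
      \<Longrightarrow> \<exists>f\<in>linear_maps E (T i) (Q 0). \<forall>x\<in>carrier (T i). \<eta> (f x) = h x"
    and pt: "pt \<in> carrier A"
    and generator: "\<lbrakk>p \<in> linear_maps E A (Q j); q \<in> linear_maps E A (Q j); p pt = q pt; a \<in> carrier A\<rbrakk>
      \<Longrightarrow> p a = q a"
begin

lemma dT1: "d (i + 1) \<in> linear_maps E (T (i + 1)) (T i)"
  using dT[of "i + 1"] by simp

lemma dQ1: "d (i + 1) \<in> linear_maps E (Q (i + 1)) (Q i)"
  using dQ[of "i + 1"] by simp

lemma dd: "x \<in> carrier (T (i + 1)) \<Longrightarrow> d i (d (i + 1) x) = \<zero>\<^bsub>T (i - 1)\<^esub>"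
  using exact[of "d (i + 1) x" i] lin_closed[OF dT1, of x i] by auto

lemma eta_d: "x \<in> carrier (T 1) \<Longrightarrow> \<eta> (d 1 x) = \<zero>\<^bsub>A\<^esub>"
  using eta_kernel[of "d 1 x"] lin_closed[OF dT1[of 0], of x] by auto

lemma lmodT: "lmod E (T i)" and lmodQ: "lmod E (Q i)" and lmodA: "lmod E A" and lmodAQ: "lmod E AQ"
  by (intro lmod.intro T_mod Q_mod A_mod AQ_mod)+

definition stable_cocycles :: "int \<Rightarrow> int \<Rightarrow> ('m \<Rightarrow> 'm) set" where
  "stable_cocycles i j = {f \<in> carrier (hom_space E (T i) (Q j)).
     \<forall>x\<in>carrier (T (i + 1)). d j (f (d (i + 1) x)) = \<zero>\<^bsub>Q (j - 1)\<^esub>}"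

definition stable_boundaries :: "int \<Rightarrow> int \<Rightarrow> ('m \<Rightarrow> 'm) set" where
  "stable_boundaries i j = {f \<in> carrier (hom_space E (T i) (Q j)).
     \<exists>u\<in>linear_maps E (T (i - 1)) (Q j). \<forall>x\<in>carrier (T i). d j (f x) = d j (u (d i x))}"

abbreviation stably_iso where
  "stably_iso i j i' j' \<equiv> subquotient_iso k
     (hom_space E (T i) (Q j)) (stable_cocycles i j) (stable_boundaries i j)
     (hom_space E (T i') (Q j')) (stable_cocycles i' j') (stable_boundaries i' j')"

lemma stable_cocycles_submodule: "submodule (stable_cocycles i j) k (hom_space E (T i) (Q j))"
proof -
  interpret H: lmod k "hom_space E (T i) (Q j)"
    by (rule lmod.intro[OF hom_space_module[OF T_mod Q_mod]])
  interpret P: lmod E "Q (j - 1)" by (rule lmodQ)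
  note cT = lin_closed[OF dT1[of i]]
  show ?thesis
  proof (rule H.submodule_intro)
    show "\<zero>\<^bsub>hom_space E (T i) (Q j)\<^esub> \<in> stable_cocycles i j"
    proof -
      interpret dj: lmap E "Q j" "Q (j - 1)" "d j" by (rule lmapI[OF Q_mod Q_mod dQ])
      show ?thesis using H.M.zero_closed cT by (auto simp: stable_cocycles_def)
    qed
  next
    fix f g assume fg: "f \<in> stable_cocycles i j" "g \<in> stable_cocycles i j"
    then have "f \<oplus>\<^bsub>hom_space E (T i) (Q j)\<^esub> g \<in> carrier (hom_space E (T i) (Q j))"
      using H.M.a_closed by (auto simp: stable_cocycles_def simp del: hom_space_simps)
    then show "f \<oplus>\<^bsub>hom_space E (T i) (Q j)\<^esub> g \<in> stable_cocycles i j"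
      using fg cT by (auto simp: stable_cocycles_def lin_add[OF dQ] lin_closed[of _ E "T i" "Q j"])
  next
    fix r f assume f: "r \<in> carrier k" "f \<in> stable_cocycles i j"
    then have "r \<odot>\<^bsub>hom_space E (T i) (Q j)\<^esub> f \<in> carrier (hom_space E (T i) (Q j))"
      using H.smult_closed by (auto simp: stable_cocycles_def simp del: hom_space_simps)
    then show "r \<odot>\<^bsub>hom_space E (T i) (Q j)\<^esub> f \<in> stable_cocycles i j"
      using f cT by (auto simp: stable_cocycles_def lin_smult[OF dQ] lin_closed[of _ E "T i" "Q j"])
  qed (auto simp: stable_cocycles_def)
qed

text \<open>Stable maps do not change when both sides are replaced by their syzygies. The composite
  \<open>f d\<close> takes values in the kernel of \<open>d j\<close>, so it lifts to
  \<open>f'\<close>; conversely \<open>d f'\<close> vanishes on the image of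
  \<open>d (i + 2)\<close>, so it extends along \<open>d (i + 1)\<close> to \<open>f\<close>. The
  relation is the commuting square \<open>f d = d f'\<close>.\<close>

lemma stable_step: "stably_iso i j (i + 1) (j + 1)"
proof (rule subquotient_isoI[where Q = "\<lambda>f f'. f \<in> stable_cocycles i j \<and>
    f' \<in> stable_cocycles (i + 1) (j + 1) \<and> (\<forall>x\<in>carrier (T (i + 1)). f (d (i + 1) x) = d (j + 1) (f' x))"])
  note cT = lin_closed[OF dT1[of i]] and cT2 = lin_closed[OF dT1[of "i + 1"]]
  interpret Qj: lmod E "Q j" by (rule lmodQ)
  interpret Qj1: lmod E "Q (j + 1)" by (rule lmodQ)
  interpret dj: lmap E "Q j" "Q (j - 1)" "d j" by (rule lmapI[OF Q_mod Q_mod dQ])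
  interpret dj1: lmap E "Q (j + 1)" "Q j" "d (j + 1)" by (rule lmapI[OF Q_mod Q_mod dQ1])
  have exQ: "x \<in> carrier (Q j) \<Longrightarrow> d j x = \<zero>\<^bsub>Q (j - 1)\<^esub> \<Longrightarrow> x \<in> d (j + 1) ` carrier (Q (j + 1))" for x
    using exact[of x j] by (simp add: Q_carrier)
  have ddQ: "x \<in> carrier (Q (j + 1)) \<Longrightarrow> d j (d (j + 1) x) = \<zero>\<^bsub>Q (j - 1)\<^esub>" for x
    using dd[of x j] by (simp add: Q_carrier)
  {
    fix f f' g g' assume "f \<in> stable_cocycles i j \<and>
      f' \<in> stable_cocycles (i + 1) (j + 1) \<and> (\<forall>x\<in>carrier (T (i + 1)). f (d (i + 1) x) = d (j + 1) (f' x))"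
      and "g \<in> stable_cocycles i j \<and>
      g' \<in> stable_cocycles (i + 1) (j + 1) \<and> (\<forall>x\<in>carrier (T (i + 1)). g (d (i + 1) x) = d (j + 1) (g' x))"
    then show "f \<oplus>\<^bsub>hom_space E (T i) (Q j)\<^esub> g \<in> stable_cocycles i j \<and>
       f' \<oplus>\<^bsub>hom_space E (T (i + 1)) (Q (j + 1))\<^esub> g' \<in> stable_cocycles (i + 1) (j + 1) \<and>
       (\<forall>x\<in>carrier (T (i + 1)). (f \<oplus>\<^bsub>hom_space E (T i) (Q j)\<^esub> g) (d (i + 1) x)
          = d (j + 1) ((f' \<oplus>\<^bsub>hom_space E (T (i + 1)) (Q (j + 1))\<^esub> g') x))"
    proof (intro conjI ballI)
      assume *: "f \<in> stable_cocycles i j \<and>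
        f' \<in> stable_cocycles (i + 1) (j + 1) \<and> (\<forall>x\<in>carrier (T (i + 1)). f (d (i + 1) x) = d (j + 1) (f' x))"
        "g \<in> stable_cocycles i j \<and>
        g' \<in> stable_cocycles (i + 1) (j + 1) \<and> (\<forall>x\<in>carrier (T (i + 1)). g (d (i + 1) x) = d (j + 1) (g' x))"
      show "f \<oplus>\<^bsub>hom_space E (T i) (Q j)\<^esub> g \<in> stable_cocycles i j"
        using * by (intro submodule_add_closed[OF stable_cocycles_submodule]) auto
      show "f' \<oplus>\<^bsub>hom_space E (T (i + 1)) (Q (j + 1))\<^esub> g' \<in> stable_cocycles (i + 1) (j + 1)"
        using * by (intro submodule_add_closed[OF stable_cocycles_submodule]) auto
      fix x assume x: "x \<in> carrier (T (i + 1))"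
      have "f' x \<in> carrier (Q (j + 1))" "g' x \<in> carrier (Q (j + 1))"
        using * x lin_closed[of _ E "T (i + 1)" "Q (j + 1)"] by (auto simp: stable_cocycles_def)
      then show "(f \<oplus>\<^bsub>hom_space E (T i) (Q j)\<^esub> g) (d (i + 1) x)
          = d (j + 1) ((f' \<oplus>\<^bsub>hom_space E (T (i + 1)) (Q (j + 1))\<^esub> g') x)"
        using * x cT by simp
    qed
  next
    fix r f f' assume r: "r \<in> carrier k" and "f \<in> stable_cocycles i j \<and>
      f' \<in> stable_cocycles (i + 1) (j + 1) \<and> (\<forall>x\<in>carrier (T (i + 1)). f (d (i + 1) x) = d (j + 1) (f' x))"
    then show "r \<odot>\<^bsub>hom_space E (T i) (Q j)\<^esub> f \<in> stable_cocycles i j \<and>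
       r \<odot>\<^bsub>hom_space E (T (i + 1)) (Q (j + 1))\<^esub> f' \<in> stable_cocycles (i + 1) (j + 1) \<and>
       (\<forall>x\<in>carrier (T (i + 1)). (r \<odot>\<^bsub>hom_space E (T i) (Q j)\<^esub> f) (d (i + 1) x)
          = d (j + 1) ((r \<odot>\<^bsub>hom_space E (T (i + 1)) (Q (j + 1))\<^esub> f') x))"
    proof (intro conjI ballI)
      assume *: "f \<in> stable_cocycles i j \<and>
        f' \<in> stable_cocycles (i + 1) (j + 1) \<and> (\<forall>x\<in>carrier (T (i + 1)). f (d (i + 1) x) = d (j + 1) (f' x))"
      show "r \<odot>\<^bsub>hom_space E (T i) (Q j)\<^esub> f \<in> stable_cocycles i j"
        using * r by (intro submodule_smult_closed[OF stable_cocycles_submodule]) auto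
      show "r \<odot>\<^bsub>hom_space E (T (i + 1)) (Q (j + 1))\<^esub> f' \<in> stable_cocycles (i + 1) (j + 1)"
        using * r by (intro submodule_smult_closed[OF stable_cocycles_submodule]) auto
      fix x assume x: "x \<in> carrier (T (i + 1))"
      have "f' x \<in> carrier (Q (j + 1))"
        using * x lin_closed[of _ E "T (i + 1)" "Q (j + 1)"] by (auto simp: stable_cocycles_def)
      then show "(r \<odot>\<^bsub>hom_space E (T i) (Q j)\<^esub> f) (d (i + 1) x)
          = d (j + 1) ((r \<odot>\<^bsub>hom_space E (T (i + 1)) (Q (j + 1))\<^esub> f') x)"
        using * x cT r by simp
    qed
  next
    fix f assume f: "f \<in> stable_cocycles i j"
    have fl: "f \<in> linear_maps E (T i) (Q j)" using f by (simp add: stable_cocycles_def)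
    obtain f' where f': "f' \<in> linear_maps E (T (i + 1)) (Q (j + 1))"
      "\<And>x. x \<in> carrier (T (i + 1)) \<Longrightarrow> d (j + 1) (f' x) = f (d (i + 1) x)"
      using lift[OF linear_maps_comp[OF dT1[of i] fl]] exQ lin_closed[OF fl] cT f
      by (auto simp: stable_cocycles_def)
    have "restrict f' (carrier (T (i + 1))) \<in> stable_cocycles (i + 1) (j + 1)"
      using restrict_linear_map[OF T_mod f'(1)] f'(2) cT2 dd[of _ "i + 1"] fl
        lmap.map_zero[OF lmapI[OF T_mod Q_mod fl]]
      by (auto simp: stable_cocycles_def)
    then show "\<exists>f'. f \<in> stable_cocycles i j \<and>
      f' \<in> stable_cocycles (i + 1) (j + 1) \<and> (\<forall>x\<in>carrier (T (i + 1)). f (d (i + 1) x) = d (j + 1) (f' x))"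
      using f f'(2) by (intro exI[of _ "restrict f' (carrier (T (i + 1)))"]) auto
  next
    fix f' assume f': "f' \<in> stable_cocycles (i + 1) (j + 1)"
    have fl: "f' \<in> linear_maps E (T (i + 1)) (Q (j + 1))" using f' by (simp add: stable_cocycles_def)
    obtain f where f: "f \<in> linear_maps E (T i) (Q j)"
      "\<And>x. x \<in> carrier (T (i + 1)) \<Longrightarrow> f (d (i + 1) x) = d (j + 1) (f' x)"
      using extend[OF linear_maps_comp[OF fl dQ1[of j]]] f' by (auto simp: stable_cocycles_def)
    have "restrict f (carrier (T i)) \<in> stable_cocycles i j"
      using restrict_linear_map[OF T_mod f(1)] f(2) cT ddQ lin_closed[OF fl]
      by (auto simp: stable_cocycles_def)
    then show "\<exists>f. f \<in> stable_cocycles i j \<and>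
      f' \<in> stable_cocycles (i + 1) (j + 1) \<and> (\<forall>x\<in>carrier (T (i + 1)). f (d (i + 1) x) = d (j + 1) (f' x))"
      using f' f(2) cT by (intro exI[of _ "restrict f (carrier (T i))"]) auto
  next
    fix f f' assume rel: "f \<in> stable_cocycles i j \<and>
      f' \<in> stable_cocycles (i + 1) (j + 1) \<and> (\<forall>x\<in>carrier (T (i + 1)). f (d (i + 1) x) = d (j + 1) (f' x))"
    have fl: "f \<in> linear_maps E (T i) (Q j)" "f' \<in> linear_maps E (T (i + 1)) (Q (j + 1))"
      using rel by (auto simp: stable_cocycles_def)
    {
      assume "f \<in> stable_boundaries i j"
      then obtain u where u: "u \<in> linear_maps E (T (i - 1)) (Q j)"
        "\<And>x. x \<in> carrier (T i) \<Longrightarrow> d j (f x) = d j (u (d i x))" by (auto simp: stable_boundaries_def)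
      note ud = linear_maps_comp[OF dT[of i] u(1)]
      \<comment> \<open>\<open>f - u d\<close> takes values in the kernel of \<open>d j\<close> and
        lifts to a homotopy \<open>h\<close>. Then \<open>d f' = f d = d h d\<close>, so
        \<open>h\<close> is the required factorisation.\<close>
      have "f x \<ominus>\<^bsub>Q j\<^esub> u (d i x) \<in> d (j + 1) ` carrier (Q (j + 1))" if "x \<in> carrier (T i)" for x
        using that lin_closed[OF fl(1)] lin_closed[OF ud] u(2)[OF that] dj.N.diff_eq_zero_iff
        by (intro exQ) (auto simp: lin_closed[OF dQ])
      then obtain h where h: "h \<in> linear_maps E (T i) (Q (j + 1))"
        "\<And>x. x \<in> carrier (T i) \<Longrightarrow> d (j + 1) (h x) = f x \<ominus>\<^bsub>Q j\<^esub> u (d i x)"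
        using lift[OF linear_maps_diff[OF Q_mod fl(1) ud]] by auto
      have "d (j + 1) (f' x) = d (j + 1) (h (d (i + 1) x))" if "x \<in> carrier (T (i + 1))" for x
      proof -
        have "d (j + 1) (h (d (i + 1) x)) = f (d (i + 1) x) \<ominus>\<^bsub>Q j\<^esub> u (\<zero>\<^bsub>T (i - 1)\<^esub>)"
          using h(2)[OF cT[OF that]] dd[OF that] by simp
        then show ?thesis
          using that rel lmap.map_zero[OF lmapI[OF T_mod Q_mod u(1)]] lin_closed[OF fl(1)] cT
          by (simp add: Qj.diff_zero lin_closed[OF linear_maps_comp[OF fl(2) dQ1[of j]]])
      qed
      then show "f' \<in> stable_boundaries (i + 1) (j + 1)"
        using rel h(1) by (auto simp: stable_boundaries_def stable_cocycles_def)
    next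
      assume "f' \<in> stable_boundaries (i + 1) (j + 1)"
      then obtain u where u: "u \<in> linear_maps E (T i) (Q (j + 1))"
        "\<And>x. x \<in> carrier (T (i + 1)) \<Longrightarrow> d (j + 1) (f' x) = d (j + 1) (u (d (i + 1) x))"
        by (auto simp: stable_boundaries_def)
      note ud = linear_maps_comp[OF u(1) dQ1[of j]]
      \<comment> \<open>Dually, \<open>f - d u\<close> vanishes on the image of
        \<open>d (i + 1)\<close> and extends along \<open>d i\<close> to \<open>v\<close>; applying
        \<open>d j\<close> removes the term \<open>d u\<close>.\<close>
      obtain v where v: "v \<in> linear_maps E (T (i - 1)) (Q j)"
        "\<And>x. x \<in> carrier (T i) \<Longrightarrow> v (d i x) = f x \<ominus>\<^bsub>Q j\<^esub> d (j + 1) (u x)"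
      proof -
        have "f (d (i + 1) x) \<ominus>\<^bsub>Q j\<^esub> d (j + 1) (u (d (i + 1) x)) = \<zero>\<^bsub>Q j\<^esub>" if "x \<in> carrier (T (i + 1))" for x
          using u(2)[OF that] rel that Qj.diff_eq_zero_iff lin_closed[OF fl(1)] cT lin_closed[OF ud] by auto
        then show thesis using extend[OF linear_maps_diff[OF Q_mod fl(1) ud]] that by auto
      qed
      have "d j (f x) = d j (v (d i x))" if "x \<in> carrier (T i)" for x
        using that v(2)[OF that] lin_closed[OF fl(1)] lin_closed[OF u(1)] ddQ
        by (simp add: a_minus_def)
      then show "f \<in> stable_boundaries i j"
        using rel v(1) by (auto simp: stable_boundaries_def stable_cocycles_def)
    }
  }
qed auto

lemma stable_shift: "stably_iso i j (i + m) (j + m)"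
proof (induction m rule: int_induct[where k = 0])
  case base
  show ?case by (auto intro!: subquotient_isoI[where Q = "\<lambda>f f'. f \<in> stable_cocycles i j \<and> f = f'"]
    submodule_add_closed[OF stable_cocycles_submodule] submodule_smult_closed[OF stable_cocycles_submodule]
    simp del: hom_space_simps)
next
  case (step1 m)
  then show ?case
    using subquotient_iso_trans[OF _ stable_step[of "i + m" "j + m"]] by (simp add: add.assoc)
next
  case (step2 m)
  show ?case
  proof -
    have "stably_iso (i + (m - 1)) (j + (m - 1)) (i + m) (j + m)"
      using stable_step[of "i + (m - 1)" "j + (m - 1)"] by simp
    then show ?thesis using subquotient_iso_trans[OF step2(2) subquotient_iso_sym] by blast
  qed
qed

text \<open>Both kernels are the image of \<open>d 1\<close>. Hence \<open>AQ\<close> is a copy of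
  the image of \<open>d 0\<close>, and maps into it are coded as stable maps into degree
  \<open>0\<close>.\<close>

lemma eta_zero_iff: "y \<in> carrier (Q 0) \<Longrightarrow> \<eta> y = \<zero>\<^bsub>AQ\<^esub> \<longleftrightarrow> d 0 y = \<zero>\<^bsub>Q (- 1)\<^esub>"
  using eta_kernel[of y] exact[of y 0] by (simp add: AQ_carrier Q_carrier)

text \<open>A cocycle \<open>g\<close> with values in \<open>AQ\<close> lifts along
  \<open>\<eta>\<close> to \<open>f\<close> with values in \<open>Q 0\<close>. As
  \<open>\<eta>\<close> and \<open>d 0\<close> have the same kernel, the cocycle condition on
  \<open>g\<close> is the vanishing of \<open>d 0 f d\<close>, and a factorisation of
  \<open>g\<close> through \<open>d n\<close> corresponds to one of \<open>d 0 f\<close>.\<close>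

lemma cohomology_stable:
  "subquotient_iso k (hom_space E (T n) AQ)
     (cycles (hom_space E (T n) AQ) (hom_space E (T (n + 1)) AQ) (precompose (T (n + 1)) (d (n + 1))))
     (precompose (T n) (d n) ` carrier (hom_space E (T (n - 1)) AQ))
     (hom_space E (T n) (Q 0)) (stable_cocycles n 0) (stable_boundaries n 0)"
proof (rule subquotient_isoI[where Q = "\<lambda>g f. f \<in> stable_cocycles n 0 \<and> g \<in> extensional (carrier (T n)) \<and>
    (\<forall>x\<in>carrier (T n). g x = \<eta> (f x))"])
  note cT = lin_closed[OF dT1[of n]]
  interpret e: lmap E "Q 0" AQ \<eta> by (rule lmapI[OF Q_mod AQ_mod eta_Q])
  interpret d0: lmap E "Q 0" "Q (- 1)" "d 0" using lmapI[OF Q_mod Q_mod dQ[of 0]] by simp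
  have cyc: "g \<in> cycles (hom_space E (T n) AQ) (hom_space E (T (n + 1)) AQ) (precompose (T (n + 1)) (d (n + 1)))
     \<longleftrightarrow> g \<in> linear_maps E (T n) AQ \<and> g \<in> extensional (carrier (T n)) \<and>
       (\<forall>x\<in>carrier (T (n + 1)). g (d (n + 1) x) = \<zero>\<^bsub>AQ\<^esub>)" for g
    by (rule hom_cycles_iff) (rule cT)
  have bd: "g \<in> precompose (T n) (d n) ` carrier (hom_space E (T (n - 1)) AQ) \<longleftrightarrow>
    g \<in> extensional (carrier (T n)) \<and> (\<exists>u\<in>linear_maps E (T (n - 1)) AQ. \<forall>x\<in>carrier (T n). g x = u (d n x))" for g
    by (rule hom_boundaries_iff[OF T_mod T_mod dT])
  have fT: "f \<in> linear_maps E (T n) (Q 0)" "\<And>x. x \<in> carrier (T n) \<Longrightarrow> f x \<in> carrier (Q 0)"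
    "\<And>x. x \<in> carrier (T (n + 1)) \<Longrightarrow> d 0 (f (d (n + 1) x)) = \<zero>\<^bsub>Q (- 1)\<^esub>"
    if "f \<in> stable_cocycles n 0" for f
    using that lin_closed[of f E "T n" "Q 0"] by (auto simp: stable_cocycles_def)
  {
    fix g f assume gf: "f \<in> stable_cocycles n 0 \<and> g \<in> extensional (carrier (T n)) \<and>
      (\<forall>x\<in>carrier (T n). g x = \<eta> (f x))"
    have "g \<in> linear_maps E (T n) AQ"
      by (rule linear_maps_cong[OF linear_maps_comp[OF fT(1) eta_Q] _ T_mod]) (use gf in auto)
    moreover have "g (d (n + 1) x) = \<zero>\<^bsub>AQ\<^esub>" if "x \<in> carrier (T (n + 1))" for x
      using gf fT(2,3)[of f] that cT[OF that] eta_zero_iff[of "f (d (n + 1) x)"] by (simp add: Q_carrier)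
    ultimately show "g \<in> cycles (hom_space E (T n) AQ) (hom_space E (T (n + 1)) AQ) (precompose (T (n + 1)) (d (n + 1)))
      \<and> f \<in> stable_cocycles n 0" using gf unfolding cyc by auto
    {
      assume "g \<in> precompose (T n) (d n) ` carrier (hom_space E (T (n - 1)) AQ)"
      then obtain u where u: "u \<in> linear_maps E (T (n - 1)) AQ" "\<And>x. x \<in> carrier (T n) \<Longrightarrow> g x = u (d n x)"
        unfolding bd by auto
      obtain v where v: "v \<in> linear_maps E (T (n - 1)) (Q 0)" "\<And>x. x \<in> carrier (T (n - 1)) \<Longrightarrow> \<eta> (v x) = u x"
        using lift_eta[OF u(1)] by auto
      have "d 0 (f x) = d 0 (v (d n x))" if x: "x \<in> carrier (T n)" for x
      proof -
        have m: "f x \<in> carrier (Q 0)" "v (d n x) \<in> carrier (Q 0)"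
          using x gf fT(2)[of f] lin_closed[OF v(1)] lin_closed[OF dT[of n]] by auto
        have "\<eta> (f x \<ominus>\<^bsub>Q 0\<^esub> v (d n x)) = \<zero>\<^bsub>AQ\<^esub>"
          using m x gf u(2) v(2) lin_closed[OF dT[of n]] e.N.diff_eq_zero_iff by auto
        then have "d 0 (f x \<ominus>\<^bsub>Q 0\<^esub> v (d n x)) = \<zero>\<^bsub>Q (- 1)\<^esub>"
          using m eta_zero_iff[of "f x \<ominus>\<^bsub>Q 0\<^esub> v (d n x)"] lmod.diff_closed[OF lmodQ m] by blast
        then show ?thesis using m d0.N.diff_eq_zero_iff by auto
      qed
      then show "f \<in> stable_boundaries n 0"
        using gf v(1) by (auto simp: stable_boundaries_def stable_cocycles_def)
    next
      assume "f \<in> stable_boundaries n 0"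
      then obtain u where u: "u \<in> linear_maps E (T (n - 1)) (Q 0)" "\<And>x. x \<in> carrier (T n) \<Longrightarrow> d 0 (f x) = d 0 (u (d n x))"
        by (auto simp: stable_boundaries_def)
      have "g x = \<eta> (u (d n x))" if x: "x \<in> carrier (T n)" for x
      proof -
        have m: "f x \<in> carrier (Q 0)" "u (d n x) \<in> carrier (Q 0)"
          using x gf fT(2)[of f] lin_closed[OF u(1)] lin_closed[OF dT[of n]] by auto
        have "d 0 (f x \<ominus>\<^bsub>Q 0\<^esub> u (d n x)) = \<zero>\<^bsub>Q (- 1)\<^esub>"
          using m x u(2) d0.N.diff_eq_zero_iff by auto
        then have "\<eta> (f x \<ominus>\<^bsub>Q 0\<^esub> u (d n x)) = \<zero>\<^bsub>AQ\<^esub>"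
          using m eta_zero_iff[of "f x \<ominus>\<^bsub>Q 0\<^esub> u (d n x)"] lmod.diff_closed[OF lmodQ m] by blast
        then show ?thesis using m x gf e.N.diff_eq_zero_iff by auto
      qed
      then show "g \<in> precompose (T n) (d n) ` carrier (hom_space E (T (n - 1)) AQ)"
        unfolding bd using gf by (intro conjI bexI[OF _ linear_maps_comp[OF u(1) eta_Q]]) auto
    }
  next
    fix g assume "g \<in> cycles (hom_space E (T n) AQ) (hom_space E (T (n + 1)) AQ) (precompose (T (n + 1)) (d (n + 1)))"
    then have g: "g \<in> linear_maps E (T n) AQ" "g \<in> extensional (carrier (T n))"
      "\<And>x. x \<in> carrier (T (n + 1)) \<Longrightarrow> g (d (n + 1) x) = \<zero>\<^bsub>AQ\<^esub>" unfolding cyc by auto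
    obtain f where f: "f \<in> linear_maps E (T n) (Q 0)" "\<And>x. x \<in> carrier (T n) \<Longrightarrow> \<eta> (f x) = g x"
      using lift_eta[OF g(1)] by auto
    have "d 0 (f (d (n + 1) x)) = \<zero>\<^bsub>Q (- 1)\<^esub>" if "x \<in> carrier (T (n + 1))" for x
      using eta_zero_iff[OF lin_closed[OF f(1) cT[OF that]]] f(2)[OF cT[OF that]] g(3)[OF that] by simp
    then have "restrict f (carrier (T n)) \<in> stable_cocycles n 0"
      using restrict_linear_map[OF T_mod f(1)] cT by (auto simp: stable_cocycles_def)
    then show "\<exists>f. f \<in> stable_cocycles n 0 \<and> g \<in> extensional (carrier (T n)) \<and>
      (\<forall>x\<in>carrier (T n). g x = \<eta> (f x))"
      using f g by (intro exI[of _ "restrict f (carrier (T n))"]) auto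
  next
    fix f assume f: "f \<in> stable_cocycles n 0"
    then show "\<exists>g. f \<in> stable_cocycles n 0 \<and> g \<in> extensional (carrier (T n)) \<and>
      (\<forall>x\<in>carrier (T n). g x = \<eta> (f x))"
      by (intro exI[of _ "\<lambda>x\<in>carrier (T n). \<eta> (f x)"]) auto
  next
    fix g f g' f' assume *: "f \<in> stable_cocycles n 0 \<and> g \<in> extensional (carrier (T n)) \<and>
      (\<forall>x\<in>carrier (T n). g x = \<eta> (f x))" "f' \<in> stable_cocycles n 0 \<and> g' \<in> extensional (carrier (T n)) \<and>
      (\<forall>x\<in>carrier (T n). g' x = \<eta> (f' x))"
    then show "f \<oplus>\<^bsub>hom_space E (T n) (Q 0)\<^esub> f' \<in> stable_cocycles n 0 \<and>
      g \<oplus>\<^bsub>hom_space E (T n) AQ\<^esub> g' \<in> extensional (carrier (T n)) \<and>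
      (\<forall>x\<in>carrier (T n). (g \<oplus>\<^bsub>hom_space E (T n) AQ\<^esub> g') x = \<eta> ((f \<oplus>\<^bsub>hom_space E (T n) (Q 0)\<^esub> f') x))"
      using fT(2) by (intro conjI submodule_add_closed[OF stable_cocycles_submodule]) auto
  next
    fix r g f assume "r \<in> carrier k" "f \<in> stable_cocycles n 0 \<and> g \<in> extensional (carrier (T n)) \<and>
      (\<forall>x\<in>carrier (T n). g x = \<eta> (f x))"
    then show "r \<odot>\<^bsub>hom_space E (T n) (Q 0)\<^esub> f \<in> stable_cocycles n 0 \<and>
      r \<odot>\<^bsub>hom_space E (T n) AQ\<^esub> g \<in> extensional (carrier (T n)) \<and>
      (\<forall>x\<in>carrier (T n). (r \<odot>\<^bsub>hom_space E (T n) AQ\<^esub> g) x = \<eta> ((r \<odot>\<^bsub>hom_space E (T n) (Q 0)\<^esub> f) x))"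
      using fT(2) by (intro conjI submodule_smult_closed[OF stable_cocycles_submodule]) auto
  }
qed

text \<open>A map out of \<open>A\<close> is determined by its value at \<open>pt\<close>, so this
  is \<open>Hom(A, Q j)\<close> realised inside \<open>Q j\<close>, with the differential of
  \<open>Q\<close>.\<close>

definition point_values :: "int \<Rightarrow> 'm set" where
  "point_values j = {p pt |p. p \<in> linear_maps E A (Q j)}"

text \<open>\<open>A\<close> is the cokernel of \<open>d 1\<close>, with projection
  \<open>\<eta>\<close>.\<close>

lemma factor_eta:
  assumes Y: "left_module E Y" and g: "g \<in> linear_maps E (T 0) Y"
    and 0: "\<And>x. x \<in> carrier (T 1) \<Longrightarrow> g (d 1 x) = \<zero>\<^bsub>Y\<^esub>"
  shows "\<exists>p\<in>linear_maps E A Y. \<forall>t\<in>carrier (T 0). p (\<eta> t) = g t"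
proof -
  interpret e: lmap E "T 0" A \<eta> by (rule lmapI[OF T_mod A_mod eta])
  interpret g: lmap E "T 0" Y g by (rule lmapI[OF T_mod Y g])
  have eq: "g s = g t" if st: "s \<in> carrier (T 0)" "t \<in> carrier (T 0)" "\<eta> s = \<eta> t" for s t
  proof -
    have "\<eta> (s \<ominus>\<^bsub>T 0\<^esub> t) = \<zero>\<^bsub>A\<^esub>" using that e.N.diff_eq_zero_iff by auto
    then obtain x where "x \<in> carrier (T 1)" "s \<ominus>\<^bsub>T 0\<^esub> t = d 1 x"
      using eta_kernel[of "s \<ominus>\<^bsub>T 0\<^esub> t"] lmod.diff_closed[OF lmodT st(1,2)] by auto
    then have "g (s \<ominus>\<^bsub>T 0\<^esub> t) = \<zero>\<^bsub>Y\<^esub>" using 0 by simp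
    then show ?thesis using that g.N.diff_eq_zero_iff by auto
  qed
  define p where "p a = g (SOME t. t \<in> carrier (T 0) \<and> \<eta> t = a)" for a
  have p: "p (\<eta> t) = g t" if "t \<in> carrier (T 0)" for t
  proof -
    have "\<exists>s. s \<in> carrier (T 0) \<and> \<eta> s = \<eta> t" using that by blast
    from someI_ex[OF this] show ?thesis unfolding p_def using that by (intro eq) auto
  qed
  have ex: "\<exists>t\<in>carrier (T 0). a = \<eta> t" if "a \<in> carrier A" for a
    using that eta_onto by (auto simp: image_iff set_eq_iff)
  have "p \<in> linear_maps E A Y"
  proof (rule linear_mapsI)
    fix a assume "a \<in> carrier A"
    then obtain t where t: "t \<in> carrier (T 0)" "a = \<eta> t" using ex by blast
    then show "p a \<in> carrier Y" using p by simp
    fix r assume "r \<in> carrier E"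
    then show "p (r \<odot>\<^bsub>A\<^esub> a) = r \<odot>\<^bsub>Y\<^esub> p a"
      using t p p[of "r \<odot>\<^bsub>T 0\<^esub> t"] by simp
  next
    fix a b assume "a \<in> carrier A" "b \<in> carrier A"
    then obtain t s where t: "t \<in> carrier (T 0)" "a = \<eta> t" "s \<in> carrier (T 0)" "b = \<eta> s" using ex by meson
    then show "p (a \<oplus>\<^bsub>A\<^esub> b) = p a \<oplus>\<^bsub>Y\<^esub> p b"
      using p p[of "t \<oplus>\<^bsub>T 0\<^esub> s"] by simp
  qed
  then show ?thesis using p by blast
qed

text \<open>A stable cocycle \<open>f\<close> on \<open>T 0\<close> satisfies
  \<open>d f d = 0\<close>, so \<open>d f\<close> factors through the cokernel \<open>A\<close> of
  \<open>d 1\<close>. The factor \<open>p\<close> takes values in cycles one degree lower, and every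
  map of this kind lifts back to some \<open>f\<close>. The \<open>f\<close> whose composite
  \<open>d f\<close> factors through \<open>d 0\<close> match the \<open>p\<close> of the form
  \<open>d q\<close>.\<close>

lemma stable_point_values:
  "subquotient_iso k (hom_space E (T 0) (Q (m + 1))) (stable_cocycles 0 (m + 1)) (stable_boundaries 0 (m + 1))
     (restrict_scalars E (Q m)) {x \<in> point_values m. d m x = \<zero>\<^bsub>Q (m - 1)\<^esub>} (d (m + 1) ` point_values (m + 1))"
proof (rule subquotient_isoI[where Q = "\<lambda>f x. f \<in> stable_cocycles 0 (m + 1) \<and>
    (\<exists>p\<in>linear_maps E A (Q m). x = p pt \<and> (\<forall>t\<in>carrier (T 0). d (m + 1) (f t) = p (\<eta> t)))"])
  interpret Qm: lmod E "Q m" by (rule lmodQ)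
  interpret dm: lmap E "Q m" "Q (m - 1)" "d m" by (rule lmapI[OF Q_mod Q_mod dQ])
  interpret dm1: lmap E "Q (m + 1)" "Q m" "d (m + 1)" by (rule lmapI[OF Q_mod Q_mod dQ1])
  note ec = lin_closed[OF eta]
  have ex: "\<exists>t\<in>carrier (T 0). a = \<eta> t" if "a \<in> carrier A" for a
    using that eta_onto by (auto simp: image_iff set_eq_iff)
  have ddQ: "d m (d (m + 1) x) = \<zero>\<^bsub>Q (m - 1)\<^esub>" if "x \<in> carrier (Q (m + 1))" for x
    using dd[of x m] that by (simp add: Q_carrier)
  have fQ: "f t \<in> carrier (Q (m + 1))" if "f \<in> stable_cocycles 0 (m + 1)" "t \<in> carrier (T 0)" for f t
    using that lin_closed[of f E "T 0" "Q (m + 1)" t] by (simp add: stable_cocycles_def)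
  {
    fix f x assume *: "f \<in> stable_cocycles 0 (m + 1) \<and>
      (\<exists>p\<in>linear_maps E A (Q m). x = p pt \<and> (\<forall>t\<in>carrier (T 0). d (m + 1) (f t) = p (\<eta> t)))"
    then obtain p where p: "p \<in> linear_maps E A (Q m)" "x = p pt"
      "\<And>t. t \<in> carrier (T 0) \<Longrightarrow> d (m + 1) (f t) = p (\<eta> t)" by auto
    obtain t0 where t0: "t0 \<in> carrier (T 0)" "pt = \<eta> t0" using ex[OF pt] by auto
    have fl: "f \<in> linear_maps E (T 0) (Q (m + 1))" using * by (simp add: stable_cocycles_def)
    have "d m x = \<zero>\<^bsub>Q (m - 1)\<^esub>" using p(2) p(3)[OF t0(1)] t0(2) ddQ fQ * t0(1) by metis
    then show "f \<in> stable_cocycles 0 (m + 1) \<and> x \<in> {x \<in> point_values m. d m x = \<zero>\<^bsub>Q (m - 1)\<^esub>}"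
      using * p by (auto simp: point_values_def)
    {
      assume "f \<in> stable_boundaries 0 (m + 1)"
      then obtain u where u: "u \<in> linear_maps E (T (- 1)) (Q (m + 1))"
        "\<And>x. x \<in> carrier (T 0) \<Longrightarrow> d (m + 1) (f x) = d (m + 1) (u (d 0 x))"
        by (auto simp: stable_boundaries_def)
      have ud: "(\<lambda>x. u (d 0 x)) \<in> linear_maps E (T 0) (Q (m + 1))"
        using linear_maps_comp[OF dT[of 0]] u(1) by simp
      have "u (d 0 (d 1 x)) = \<zero>\<^bsub>Q (m + 1)\<^esub>" if "x \<in> carrier (T 1)" for x
        using dd[of x 0] that lmap.map_zero[OF lmapI[OF T_mod Q_mod u(1)]] by simp
      \<comment> \<open>\<open>u d\<close> kills the image of \<open>d 1\<close> and induces
        \<open>q\<close> on \<open>A\<close>; composing with \<open>d\<close> gives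
        \<open>d q = p\<close>.\<close>
      from factor_eta[OF Q_mod ud this] obtain q where q: "q \<in> linear_maps E A (Q (m + 1))"
        "\<And>t. t \<in> carrier (T 0) \<Longrightarrow> q (\<eta> t) = u (d 0 t)" by auto
      have "x = d (m + 1) (q pt)" using p(2,3) t0 u(2) q(2) by simp
      then show "x \<in> d (m + 1) ` point_values (m + 1)" using q(1) by (auto simp: point_values_def)
    next
      assume "x \<in> d (m + 1) ` point_values (m + 1)"
      then obtain q where q: "q \<in> linear_maps E A (Q (m + 1))" "x = d (m + 1) (q pt)"
        by (auto simp: point_values_def)
      \<comment> \<open>Agreement at \<open>pt\<close> is agreement everywhere, by
        \<open>generator\<close>.\<close>
      have pq: "p a = d (m + 1) (q a)" if "a \<in> carrier A" for a
        using generator[OF p(1) linear_maps_comp[OF q(1) dQ1[of m]] _ that] p(2) q(2) by simp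
      have "q (\<eta> (d 1 x)) = \<zero>\<^bsub>Q (m + 1)\<^esub>" if "x \<in> carrier (T 1)" for x
        using eta_d[OF that] lmap.map_zero[OF lmapI[OF A_mod Q_mod q(1)]] by simp
      \<comment> \<open>\<open>q \<eta>\<close> vanishes on the image of \<open>d 1\<close>, so it
        extends along \<open>d 0\<close>.\<close>
      then obtain u where u: "u \<in> linear_maps E (T (- 1)) (Q (m + 1))"
        "\<And>t. t \<in> carrier (T 0) \<Longrightarrow> u (d 0 t) = q (\<eta> t)"
        using extend[OF linear_maps_comp[OF eta q(1)]] by auto
      have "d (m + 1) (f t) = d (m + 1) (u (d 0 t))" if "t \<in> carrier (T 0)" for t
        using p(3)[OF that] pq[OF ec[OF that]] u(2)[OF that] by simp
      then show "f \<in> stable_boundaries 0 (m + 1)"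
        using * u(1) by (auto simp: stable_boundaries_def stable_cocycles_def)
    }
  next
    fix f assume f: "f \<in> stable_cocycles 0 (m + 1)"
    have fl: "f \<in> linear_maps E (T 0) (Q (m + 1))" using f by (simp add: stable_cocycles_def)
    have "d (m + 1) (f (d 1 x)) = \<zero>\<^bsub>Q m\<^esub>" if "x \<in> carrier (T 1)" for x
      using f that by (auto simp: stable_cocycles_def)
    from factor_eta[OF Q_mod linear_maps_comp[OF fl dQ1[of m]] this]
    show "\<exists>x. f \<in> stable_cocycles 0 (m + 1) \<and>
      (\<exists>p\<in>linear_maps E A (Q m). x = p pt \<and> (\<forall>t\<in>carrier (T 0). d (m + 1) (f t) = p (\<eta> t)))"
      using f by force
  next
    fix x assume "x \<in> {x \<in> point_values m. d m x = \<zero>\<^bsub>Q (m - 1)\<^esub>}"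
    then obtain p where p: "p \<in> linear_maps E A (Q m)" "x = p pt" "d m (p pt) = \<zero>\<^bsub>Q (m - 1)\<^esub>"
      by (auto simp: point_values_def)
    \<comment> \<open>\<open>d p\<close> vanishes at \<open>pt\<close>, hence everywhere on
      \<open>A\<close>.\<close>
    have "d m (p a) = \<zero>\<^bsub>Q (m - 1)\<^esub>" if "a \<in> carrier A" for a
      using generator[OF linear_maps_comp[OF p(1) dQ] linear_maps_zero[OF Q_mod] _ that] p(3) by simp
    then have "p (\<eta> t) \<in> d (m + 1) ` carrier (Q (m + 1))" if "t \<in> carrier (T 0)" for t
      using exact[of "p (\<eta> t)" m] lin_closed[OF p(1)] ec[OF that] by (simp add: Q_carrier)
    from lift[OF linear_maps_comp[OF eta p(1)] this]
    obtain f where f: "f \<in> linear_maps E (T 0) (Q (m + 1))" "\<And>t. t \<in> carrier (T 0) \<Longrightarrow> d (m + 1) (f t) = p (\<eta> t)"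
      by auto
    have "restrict f (carrier (T 0)) \<in> stable_cocycles 0 (m + 1)"
      using restrict_linear_map[OF T_mod f(1)] f(2) lin_closed[OF dT1[of 0]] eta_d
        lmap.map_zero[OF lmapI[OF A_mod Q_mod p(1)]] by (auto simp: stable_cocycles_def)
    then show "\<exists>f. f \<in> stable_cocycles 0 (m + 1) \<and>
      (\<exists>p\<in>linear_maps E A (Q m). x = p pt \<and> (\<forall>t\<in>carrier (T 0). d (m + 1) (f t) = p (\<eta> t)))"
      using p f by (intro exI[of _ "restrict f (carrier (T 0))"] conjI bexI[of _ p]) auto
  next
    fix f x g y assume *: "f \<in> stable_cocycles 0 (m + 1) \<and>
      (\<exists>p\<in>linear_maps E A (Q m). x = p pt \<and> (\<forall>t\<in>carrier (T 0). d (m + 1) (f t) = p (\<eta> t)))"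
      "g \<in> stable_cocycles 0 (m + 1) \<and>
      (\<exists>p\<in>linear_maps E A (Q m). y = p pt \<and> (\<forall>t\<in>carrier (T 0). d (m + 1) (g t) = p (\<eta> t)))"
    then obtain p q where p: "p \<in> linear_maps E A (Q m)" "x = p pt"
      "\<And>t. t \<in> carrier (T 0) \<Longrightarrow> d (m + 1) (f t) = p (\<eta> t)"
      "q \<in> linear_maps E A (Q m)" "y = q pt"
      "\<And>t. t \<in> carrier (T 0) \<Longrightarrow> d (m + 1) (g t) = q (\<eta> t)" by auto
    show "f \<oplus>\<^bsub>hom_space E (T 0) (Q (m + 1))\<^esub> g \<in> stable_cocycles 0 (m + 1) \<and>
      (\<exists>p\<in>linear_maps E A (Q m). x \<oplus>\<^bsub>restrict_scalars E (Q m)\<^esub> y = p pt \<and>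
        (\<forall>t\<in>carrier (T 0). d (m + 1) ((f \<oplus>\<^bsub>hom_space E (T 0) (Q (m + 1))\<^esub> g) t) = p (\<eta> t)))"
      using * p fQ
      by (intro conjI submodule_add_closed[OF stable_cocycles_submodule] bexI[OF _ linear_maps_add[OF Q_mod p(1,4)]]) auto
  next
    fix r f x assume r: "r \<in> carrier k" and *: "f \<in> stable_cocycles 0 (m + 1) \<and>
      (\<exists>p\<in>linear_maps E A (Q m). x = p pt \<and> (\<forall>t\<in>carrier (T 0). d (m + 1) (f t) = p (\<eta> t)))"
    then obtain p where p: "p \<in> linear_maps E A (Q m)" "x = p pt"
      "\<And>t. t \<in> carrier (T 0) \<Longrightarrow> d (m + 1) (f t) = p (\<eta> t)" by auto
    show "r \<odot>\<^bsub>hom_space E (T 0) (Q (m + 1))\<^esub> f \<in> stable_cocycles 0 (m + 1) \<and>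
      (\<exists>p\<in>linear_maps E A (Q m). r \<odot>\<^bsub>restrict_scalars E (Q m)\<^esub> x = p pt \<and>
        (\<forall>t\<in>carrier (T 0). d (m + 1) ((r \<odot>\<^bsub>hom_space E (T 0) (Q (m + 1))\<^esub> f) t) = p (\<eta> t)))"
      using * p fQ r
      by (intro conjI submodule_smult_closed[OF stable_cocycles_submodule] bexI[OF _ linear_maps_scal[OF Q_mod r p(1)]]) auto
  }
qed

text \<open>Shifting both degrees by \<open>-n\<close> turns stable maps from degree
  \<open>n\<close> to \<open>0\<close> into stable maps from \<open>0\<close> to \<open>-n\<close>.
  Passing to values at \<open>pt\<close> lowers the degree by one more, whence
  \<open>-n - 1\<close>.\<close>

theorem cohomology_point_values:
  "subquotient_iso k (hom_space E (T n) AQ)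
     (cycles (hom_space E (T n) AQ) (hom_space E (T (n + 1)) AQ) (precompose (T (n + 1)) (d (n + 1))))
     (precompose (T n) (d n) ` carrier (hom_space E (T (n - 1)) AQ))
     (restrict_scalars E (Q (- n - 1)))
     {x \<in> point_values (- n - 1). d (- n - 1) x = \<zero>\<^bsub>Q (- n - 2)\<^esub>} (d (- n) ` point_values (- n))"
proof -
  have "stably_iso n 0 0 (- n)" using stable_shift[of n 0 "- n"] by simp
  from subquotient_iso_trans[OF cohomology_stable this] show ?thesis
  proof (rule subquotient_iso_trans)
    have e: "- n - 1 + 1 = - n" "- n - 1 - 1 = - n - 2" by simp_all
    show "subquotient_iso k (hom_space E (T 0) (Q (- n))) (stable_cocycles 0 (- n)) (stable_boundaries 0 (- n))
      (restrict_scalars E (Q (- n - 1)))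
      {x \<in> point_values (- n - 1). d (- n - 1) x = \<zero>\<^bsub>Q (- n - 2)\<^esub>} (d (- n) ` point_values (- n))"
      using stable_point_values[of "- n - 1"] unfolding e .
  qed
qed

end

section \<open>Frobenius algebras and their enveloping algebras\<close>

text \<open>
  \<open>E\<close> plays the role of \<open>A \<otimes> A\<^sup>o\<^sup>p\<close>, with \<open>J a b\<close> for \<open>a \<otimes> b\<close>.  The families \<open>x\<close>, \<open>y\<close> are dual
  bases for the Frobenius form \<open>lam\<close>, \<open>nu\<close> is the Nakayama automorphism, which is assumed to be
  an involution, and \<open>Lam\<close> is \<open>lam \<otimes> id\<close>.  \<open>AL\<close> is the bimodule \<open>A\<close> as a left \<open>E\<close>-module.
\<close>

locale frobenius_pair = A: k_algebra k A + E: k_algebra k E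
  for k :: "'k ring" and A :: "('k, 'a) module" and E :: "('k, 'e) module" +
  fixes J :: "'a \<Rightarrow> 'a \<Rightarrow> 'e" and I :: "'i set" and x y :: "'i \<Rightarrow> 'a"
    and lam :: "'a \<Rightarrow> 'k" and nu :: "'a \<Rightarrow> 'a" and Lam :: "'e \<Rightarrow> 'a" and AL :: "('e, 'a) module"
  assumes J_left: "b \<in> carrier A \<Longrightarrow> (\<lambda>a. J a b) \<in> linear_maps k A E"
    and J_right: "a \<in> carrier A \<Longrightarrow> J a \<in> linear_maps k A E"
    and J_mult: "\<lbrakk>a \<in> carrier A; b \<in> carrier A; a' \<in> carrier A; b' \<in> carrier A\<rbrakk>
      \<Longrightarrow> J a b \<otimes>\<^bsub>E\<^esub> J a' b' = J (a \<otimes>\<^bsub>A\<^esub> a') (b' \<otimes>\<^bsub>A\<^esub> b)"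
    and J_one: "J \<one>\<^bsub>A\<^esub> \<one>\<^bsub>A\<^esub> = \<one>\<^bsub>E\<^esub>"
    and J_generates: "\<lbrakk>\<And>a b. \<lbrakk>a \<in> carrier A; b \<in> carrier A\<rbrakk> \<Longrightarrow> J a b \<in> H;
       \<And>e f. \<lbrakk>e \<in> carrier E; f \<in> carrier E; e \<in> H; f \<in> H\<rbrakk> \<Longrightarrow> e \<oplus>\<^bsub>E\<^esub> f \<in> H\<rbrakk> \<Longrightarrow> carrier E \<subseteq> H"
    and I: "finite I" and x: "i \<in> I \<Longrightarrow> x i \<in> carrier A" and y: "i \<in> I \<Longrightarrow> y i \<in> carrier A"
    and lam: "lam \<in> functionals k A"
    and dual_y: "a \<in> carrier A \<Longrightarrow> (\<Oplus>\<^bsub>A\<^esub>i\<in>I. lam (a \<otimes>\<^bsub>A\<^esub> x i) \<odot>\<^bsub>A\<^esub> y i) = a"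
    and dual_x: "a \<in> carrier A \<Longrightarrow> (\<Oplus>\<^bsub>A\<^esub>i\<in>I. lam (y i \<otimes>\<^bsub>A\<^esub> a) \<odot>\<^bsub>A\<^esub> x i) = a"
    and nu_closed: "a \<in> carrier A \<Longrightarrow> nu a \<in> carrier A"
    and lam_nu: "\<lbrakk>a \<in> carrier A; b \<in> carrier A\<rbrakk> \<Longrightarrow> lam (a \<otimes>\<^bsub>A\<^esub> b) = lam (b \<otimes>\<^bsub>A\<^esub> nu a)"
    and nu_nu: "a \<in> carrier A \<Longrightarrow> nu (nu a) = a"
    and Lam: "Lam \<in> linear_maps k E A"
    and Lam_J: "\<lbrakk>a \<in> carrier A; b \<in> carrier A\<rbrakk> \<Longrightarrow> Lam (J a b) = lam a \<odot>\<^bsub>A\<^esub> b"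
    and AL_simps: "carrier AL = carrier A" "add AL = add A" "zero AL = zero A"
    and AL_linear: "b \<in> carrier A \<Longrightarrow> (\<lambda>e. e \<odot>\<^bsub>AL\<^esub> b) \<in> linear_maps k E A"
    and AL_J: "\<lbrakk>a \<in> carrier A; b \<in> carrier A; c \<in> carrier A\<rbrakk> \<Longrightarrow> J a b \<odot>\<^bsub>AL\<^esub> c = a \<otimes>\<^bsub>A\<^esub> c \<otimes>\<^bsub>A\<^esub> b"
begin

lemma J_closed [simp]: "\<lbrakk>a \<in> carrier A; b \<in> carrier A\<rbrakk> \<Longrightarrow> J a b \<in> carrier E"
  using lin_closed[OF J_right] .

lemma lam_closed [simp]: "a \<in> carrier A \<Longrightarrow> lam a \<in> carrier k"
  using lin_closed[OF lam] by simp

lemmas [simp] = x y nu_closed J_mult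

lemma E_induct [consumes 1, case_names J add]:
  assumes "e \<in> carrier E" "\<And>a b. \<lbrakk>a \<in> carrier A; b \<in> carrier A\<rbrakk> \<Longrightarrow> P (J a b)"
    and "\<And>e f. \<lbrakk>e \<in> carrier E; f \<in> carrier E; P e; P f\<rbrakk> \<Longrightarrow> P (e \<oplus>\<^bsub>E\<^esub> f)"
  shows "P e"
  using J_generates[of "Collect P"] assms by auto

lemma A_module: "left_module k A" and E_module: "left_module k E"
  by unfold_locales

lemma J_left_lmap: "b \<in> carrier A \<Longrightarrow> lmap k A E (\<lambda>a. J a b)"
  and J_right_lmap: "a \<in> carrier A \<Longrightarrow> lmap k A E (J a)"
  and Lam_lmap: "lmap k E A Lam"
  by (intro lmapI A_module E_module J_left J_right Lam; assumption)+

lemma lam_lmap: "lmap k A (regular_module k) lam"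
  by (intro lmapI A_module lam regular_left_module A.K.ring_axioms)

lemma J_scal: "\<lbrakk>r \<in> carrier k; a \<in> carrier A; b \<in> carrier A\<rbrakk> \<Longrightarrow> J (r \<odot>\<^bsub>A\<^esub> a) b = r \<odot>\<^bsub>E\<^esub> J a b"
  "\<lbrakk>r \<in> carrier k; a \<in> carrier A; b \<in> carrier A\<rbrakk> \<Longrightarrow> J a (r \<odot>\<^bsub>A\<^esub> b) = r \<odot>\<^bsub>E\<^esub> J a b"
  using lin_smult[OF J_left] lin_smult[OF J_right] by auto

lemma scal_J: "r \<in> carrier k \<Longrightarrow> r \<odot>\<^bsub>E\<^esub> \<one>\<^bsub>E\<^esub> = J (r \<odot>\<^bsub>A\<^esub> \<one>\<^bsub>A\<^esub>) \<one>\<^bsub>A\<^esub>"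
  "r \<in> carrier k \<Longrightarrow> r \<odot>\<^bsub>E\<^esub> \<one>\<^bsub>E\<^esub> = J \<one>\<^bsub>A\<^esub> (r \<odot>\<^bsub>A\<^esub> \<one>\<^bsub>A\<^esub>)"
  by (simp_all add: J_scal J_one)

lemma J_finsum_left:
  "\<lbrakk>finite S; \<And>s. s \<in> S \<Longrightarrow> f s \<in> carrier A; b \<in> carrier A\<rbrakk>
    \<Longrightarrow> J (\<Oplus>\<^bsub>A\<^esub>s\<in>S. f s) b = (\<Oplus>\<^bsub>E\<^esub>s\<in>S. J (f s) b)"
  by (rule lmap.map_finsum[OF J_left_lmap]) auto

lemma lam_finsum:
  assumes "finite S" "\<And>s. s \<in> S \<Longrightarrow> r s \<in> carrier k" "\<And>s. s \<in> S \<Longrightarrow> f s \<in> carrier A"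
  shows "lam (\<Oplus>\<^bsub>A\<^esub>s\<in>S. r s \<odot>\<^bsub>A\<^esub> f s) = (\<Oplus>\<^bsub>k\<^esub>s\<in>S. r s \<otimes>\<^bsub>k\<^esub> lam (f s))"
  by (rule vspace.functional_finsum[OF _ lam assms]) (intro vspace.intro lmod.intro A_module A.K.field_axioms)

text \<open>The dual bases recover \<open>u\<close> from the scalars
  \<open>lam (y_i u)\<close>.\<close>

lemma nondegenerate:
  assumes "u \<in> carrier A" "v \<in> carrier A" "\<And>c. c \<in> carrier A \<Longrightarrow> lam (c \<otimes>\<^bsub>A\<^esub> u) = lam (c \<otimes>\<^bsub>A\<^esub> v)"
  shows "u = v"
proof -
  have "u = (\<Oplus>\<^bsub>A\<^esub>i\<in>I. lam (y i \<otimes>\<^bsub>A\<^esub> u) \<odot>\<^bsub>A\<^esub> x i)" using dual_x[OF assms(1)] by simp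
  also have "\<dots> = (\<Oplus>\<^bsub>A\<^esub>i\<in>I. lam (y i \<otimes>\<^bsub>A\<^esub> v) \<odot>\<^bsub>A\<^esub> x i)"
    by (rule A.KM.M.finsum_cong') (use assms in auto)
  also have "\<dots> = v" by (rule dual_x[OF assms(2)])
  finally show ?thesis .
qed

text \<open>Moving \<open>a b\<close> to the other side under \<open>lam\<close> in one go or factor
  by factor gives the two sides, and \<open>lam\<close> is nondegenerate.\<close>

lemma nu_mult: "\<lbrakk>a \<in> carrier A; b \<in> carrier A\<rbrakk> \<Longrightarrow> nu (a \<otimes>\<^bsub>A\<^esub> b) = nu a \<otimes>\<^bsub>A\<^esub> nu b"
  by (rule nondegenerate) (simp_all add: lam_nu[symmetric] A.m_assoc[symmetric])

lemma lam_nu': "\<lbrakk>a \<in> carrier A; b \<in> carrier A\<rbrakk> \<Longrightarrow> lam (a \<otimes>\<^bsub>A\<^esub> b) = lam (nu b \<otimes>\<^bsub>A\<^esub> a)"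
  by (simp add: lam_nu[of "nu b" a] nu_nu)

lemma nu_one: "nu \<one>\<^bsub>A\<^esub> = \<one>\<^bsub>A\<^esub>"
  by (rule nondegenerate) (simp_all add: lam_nu[symmetric])

lemma Lam_mult_left:
  assumes "e \<in> carrier E" "a \<in> carrier A"
  shows "Lam (J \<one>\<^bsub>A\<^esub> a \<otimes>\<^bsub>E\<^esub> e) = Lam e \<otimes>\<^bsub>A\<^esub> a"
proof -
  interpret L: lmap k E A Lam by (rule Lam_lmap)
  show ?thesis using assms(1)
    by (induction e rule: E_induct)
      (use assms(2) in \<open>auto simp: Lam_J A.smult_mult_left E.r_distr A.l_distr\<close>)
qed

lemma Lam_mult_right:
  assumes "e \<in> carrier E" "a \<in> carrier A"
  shows "Lam (e \<otimes>\<^bsub>E\<^esub> J \<one>\<^bsub>A\<^esub> a) = a \<otimes>\<^bsub>A\<^esub> Lam e"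
proof -
  interpret L: lmap k E A Lam by (rule Lam_lmap)
  show ?thesis using assms(1)
    by (induction e rule: E_induct)
      (use assms(2) in \<open>auto simp: Lam_J A.smult_mult_right E.l_distr A.r_distr\<close>)
qed

text \<open>Expansion of the left tensor factor along the dual bases; \<open>Lam\<close> reads off
  the coefficients, which lie in the right factor.\<close>

lemma E_expand:
  assumes "e \<in> carrier E"
  shows "e = (\<Oplus>\<^bsub>E\<^esub>i\<in>I. J (x i) (Lam (J (y i) \<one>\<^bsub>A\<^esub> \<otimes>\<^bsub>E\<^esub> e)))"
  using assms
proof (induction e rule: E_induct)
  case (J a b)
  have "J a b = J (\<Oplus>\<^bsub>A\<^esub>i\<in>I. lam (y i \<otimes>\<^bsub>A\<^esub> a) \<odot>\<^bsub>A\<^esub> x i) b" using dual_x J by simp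
  also have "\<dots> = (\<Oplus>\<^bsub>E\<^esub>i\<in>I. J (lam (y i \<otimes>\<^bsub>A\<^esub> a) \<odot>\<^bsub>A\<^esub> x i) b)"
    using J by (intro J_finsum_left I) auto
  also have "\<dots> = (\<Oplus>\<^bsub>E\<^esub>i\<in>I. J (x i) (Lam (J (y i) \<one>\<^bsub>A\<^esub> \<otimes>\<^bsub>E\<^esub> J a b)))"
    using J by (intro E.KM.M.finsum_cong') (auto simp: J_scal Lam_J)
  finally show ?case .
next
  case (add e f)
  interpret L: lmap k E A Lam by (rule Lam_lmap)
  have "(\<Oplus>\<^bsub>E\<^esub>i\<in>I. J (x i) (Lam (J (y i) \<one>\<^bsub>A\<^esub> \<otimes>\<^bsub>E\<^esub> (e \<oplus>\<^bsub>E\<^esub> f))))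
    = (\<Oplus>\<^bsub>E\<^esub>i\<in>I. J (x i) (Lam (J (y i) \<one>\<^bsub>A\<^esub> \<otimes>\<^bsub>E\<^esub> e)) \<oplus>\<^bsub>E\<^esub> J (x i) (Lam (J (y i) \<one>\<^bsub>A\<^esub> \<otimes>\<^bsub>E\<^esub> f)))"
    using add by (intro E.KM.M.finsum_cong') (auto simp: E.r_distr lin_add[OF J_right])
  also have "\<dots> = (\<Oplus>\<^bsub>E\<^esub>i\<in>I. J (x i) (Lam (J (y i) \<one>\<^bsub>A\<^esub> \<otimes>\<^bsub>E\<^esub> e))) \<oplus>\<^bsub>E\<^esub>
     (\<Oplus>\<^bsub>E\<^esub>i\<in>I. J (x i) (Lam (J (y i) \<one>\<^bsub>A\<^esub> \<otimes>\<^bsub>E\<^esub> f)))"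
    using add by (intro E.KM.M.finsum_addf) auto
  finally show ?case using add by simp
qed

text \<open>Makes identities in \<open>E\<close> checkable in \<open>A\<close>, through the
  coefficients of \<open>E_expand\<close>.\<close>

lemma E_eqI:
  assumes "e \<in> carrier E" "f \<in> carrier E"
    and "\<And>b. b \<in> carrier A \<Longrightarrow> Lam (J b \<one>\<^bsub>A\<^esub> \<otimes>\<^bsub>E\<^esub> e) = Lam (J b \<one>\<^bsub>A\<^esub> \<otimes>\<^bsub>E\<^esub> f)"
  shows "e = f"
proof -
  have "(\<Oplus>\<^bsub>E\<^esub>i\<in>I. J (x i) (Lam (J (y i) \<one>\<^bsub>A\<^esub> \<otimes>\<^bsub>E\<^esub> e)))
      = (\<Oplus>\<^bsub>E\<^esub>i\<in>I. J (x i) (Lam (J (y i) \<one>\<^bsub>A\<^esub> \<otimes>\<^bsub>E\<^esub> f)))"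
    by (rule E.KM.M.finsum_cong') (use assms lin_closed[OF Lam] in auto)
  then show ?thesis using E_expand[OF assms(1)] E_expand[OF assms(2)] by simp
qed

definition casimir :: 'e where
  "casimir = (\<Oplus>\<^bsub>E\<^esub>i\<in>I. J (x i) (y i))"

lemma casimir_closed [simp]: "casimir \<in> carrier E"
  unfolding casimir_def by (rule E.KM.M.finsum_closed) auto

text \<open>For each \<open>i\<close> one has \<open>lam (b x_i u) = lam (nu(u) b x_i)\<close>, and
  the sum against \<open>y_i\<close> is the expansion of \<open>nu(u) b\<close>. Both intertwining
  rules of \<open>casimir\<close> are derived from this value.\<close>

lemma Lam_casimir:
  assumes "b \<in> carrier A" "u \<in> carrier A"
  shows "Lam (J b \<one>\<^bsub>A\<^esub> \<otimes>\<^bsub>E\<^esub> (casimir \<otimes>\<^bsub>E\<^esub> J u \<one>\<^bsub>A\<^esub>)) = nu u \<otimes>\<^bsub>A\<^esub> b"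
proof -
  have "casimir \<otimes>\<^bsub>E\<^esub> J u \<one>\<^bsub>A\<^esub> = (\<Oplus>\<^bsub>E\<^esub>i\<in>I. J (x i) (y i) \<otimes>\<^bsub>E\<^esub> J u \<one>\<^bsub>A\<^esub>)"
    unfolding casimir_def by (rule E.finsum_ldistr) (use I assms in auto)
  then have "J b \<one>\<^bsub>A\<^esub> \<otimes>\<^bsub>E\<^esub> (casimir \<otimes>\<^bsub>E\<^esub> J u \<one>\<^bsub>A\<^esub>)
      = (\<Oplus>\<^bsub>E\<^esub>i\<in>I. J b \<one>\<^bsub>A\<^esub> \<otimes>\<^bsub>E\<^esub> (J (x i) (y i) \<otimes>\<^bsub>E\<^esub> J u \<one>\<^bsub>A\<^esub>))"
    using E.finsum_rdistr[of I "J b \<one>\<^bsub>A\<^esub>" "\<lambda>i. J (x i) (y i) \<otimes>\<^bsub>E\<^esub> J u \<one>\<^bsub>A\<^esub>"] I assms by auto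
  then have "Lam (J b \<one>\<^bsub>A\<^esub> \<otimes>\<^bsub>E\<^esub> (casimir \<otimes>\<^bsub>E\<^esub> J u \<one>\<^bsub>A\<^esub>))
      = (\<Oplus>\<^bsub>A\<^esub>i\<in>I. Lam (J b \<one>\<^bsub>A\<^esub> \<otimes>\<^bsub>E\<^esub> (J (x i) (y i) \<otimes>\<^bsub>E\<^esub> J u \<one>\<^bsub>A\<^esub>)))"
    using lmap.map_finsum[OF Lam_lmap I] assms by auto
  also have "\<dots> = (\<Oplus>\<^bsub>A\<^esub>i\<in>I. lam ((nu u \<otimes>\<^bsub>A\<^esub> b) \<otimes>\<^bsub>A\<^esub> x i) \<odot>\<^bsub>A\<^esub> y i)"
    using assms lam_nu'[of "b \<otimes>\<^bsub>A\<^esub> x _" u]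
    by (intro A.KM.M.finsum_cong') (auto simp: Lam_J A.m_assoc[symmetric])
  also have "\<dots> = nu u \<otimes>\<^bsub>A\<^esub> b" using assms by (intro dual_y) auto
  finally show ?thesis .
qed

lemma Lam_casimir': "b \<in> carrier A \<Longrightarrow> Lam (J b \<one>\<^bsub>A\<^esub> \<otimes>\<^bsub>E\<^esub> casimir) = b"
  using Lam_casimir[of b "\<one>\<^bsub>A\<^esub>"] by (simp add: nu_one J_one)

lemma casimir_left:
  assumes a: "a \<in> carrier A"
  shows "J a \<one>\<^bsub>A\<^esub> \<otimes>\<^bsub>E\<^esub> casimir = J \<one>\<^bsub>A\<^esub> a \<otimes>\<^bsub>E\<^esub> casimir"
proof (rule E_eqI)
  fix b assume b: "b \<in> carrier A"
  have "Lam (J b \<one>\<^bsub>A\<^esub> \<otimes>\<^bsub>E\<^esub> (J \<one>\<^bsub>A\<^esub> a \<otimes>\<^bsub>E\<^esub> casimir)) = Lam (J \<one>\<^bsub>A\<^esub> a \<otimes>\<^bsub>E\<^esub> (J b \<one>\<^bsub>A\<^esub> \<otimes>\<^bsub>E\<^esub> casimir))"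
    using a b by (simp add: E.m_assoc[symmetric])
  also have "\<dots> = b \<otimes>\<^bsub>A\<^esub> a"
    using a b by (subst Lam_mult_left) (simp_all add: Lam_casimir')
  also have "\<dots> = Lam (J (b \<otimes>\<^bsub>A\<^esub> a) \<one>\<^bsub>A\<^esub> \<otimes>\<^bsub>E\<^esub> casimir)"
    using a b by (simp add: Lam_casimir')
  also have "\<dots> = Lam (J b \<one>\<^bsub>A\<^esub> \<otimes>\<^bsub>E\<^esub> (J a \<one>\<^bsub>A\<^esub> \<otimes>\<^bsub>E\<^esub> casimir))"
    using a b by (simp add: E.m_assoc[symmetric])
  finally show "Lam (J b \<one>\<^bsub>A\<^esub> \<otimes>\<^bsub>E\<^esub> (J a \<one>\<^bsub>A\<^esub> \<otimes>\<^bsub>E\<^esub> casimir)) = Lam (J b \<one>\<^bsub>A\<^esub> \<otimes>\<^bsub>E\<^esub> (J \<one>\<^bsub>A\<^esub> a \<otimes>\<^bsub>E\<^esub> casimir))" ..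
qed (use a in auto)

text \<open>Here the Nakayama automorphism enters. Multiplied by \<open>A\<close> from the left the
  Casimir element is invariant without a twist, multiplied from the right it picks up
  \<open>nu\<close>. Acting by it therefore sends coinvariants twisted by \<open>nu\<close> to plain
  invariants.\<close>

lemma casimir_right:
  assumes a: "a \<in> carrier A"
  shows "casimir \<otimes>\<^bsub>E\<^esub> J a \<one>\<^bsub>A\<^esub> = casimir \<otimes>\<^bsub>E\<^esub> J \<one>\<^bsub>A\<^esub> (nu a)"
proof (rule E_eqI)
  fix b assume b: "b \<in> carrier A"
  have "J b \<one>\<^bsub>A\<^esub> \<otimes>\<^bsub>E\<^esub> (casimir \<otimes>\<^bsub>E\<^esub> J \<one>\<^bsub>A\<^esub> (nu a)) = (J b \<one>\<^bsub>A\<^esub> \<otimes>\<^bsub>E\<^esub> casimir) \<otimes>\<^bsub>E\<^esub> J \<one>\<^bsub>A\<^esub> (nu a)"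
    using a b by (simp add: E.m_assoc)
  then show "Lam (J b \<one>\<^bsub>A\<^esub> \<otimes>\<^bsub>E\<^esub> (casimir \<otimes>\<^bsub>E\<^esub> J a \<one>\<^bsub>A\<^esub>)) = Lam (J b \<one>\<^bsub>A\<^esub> \<otimes>\<^bsub>E\<^esub> (casimir \<otimes>\<^bsub>E\<^esub> J \<one>\<^bsub>A\<^esub> (nu a)))"
    using a b by (simp add: Lam_casimir Lam_mult_right Lam_casimir')
qed (use a in auto)

text \<open>\<open>Lam\<close> recovers \<open>v\<close> from the product, because
  \<open>Lam casimir\<close> is \<open>\<one>\<close>.\<close>

lemma casimir_annihilator:
  assumes "v \<in> carrier A" "casimir \<otimes>\<^bsub>E\<^esub> J \<one>\<^bsub>A\<^esub> v = \<zero>\<^bsub>E\<^esub>"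
  shows "v = \<zero>\<^bsub>A\<^esub>"
proof -
  interpret L: lmap k E A Lam by (rule Lam_lmap)
  have "v = Lam (casimir \<otimes>\<^bsub>E\<^esub> J \<one>\<^bsub>A\<^esub> v)"
    using Lam_mult_right[of casimir v] Lam_casimir'[of "\<one>\<^bsub>A\<^esub>"] assms(1) by (simp add: J_one)
  then show ?thesis using assms(2) by simp
qed

text \<open>Invariance replaces multiplication by \<open>J b \<one>\<close> with multiplication by
  \<open>J \<one> b\<close>. So all coefficients of \<open>w\<close> have the form
  \<open>Lam(w) b\<close>, and \<open>w\<close> is determined by \<open>Lam w\<close>.\<close>

lemma casimir_invariant:
  assumes w: "w \<in> carrier E" "\<And>a. a \<in> carrier A \<Longrightarrow> J a \<one>\<^bsub>A\<^esub> \<otimes>\<^bsub>E\<^esub> w = J \<one>\<^bsub>A\<^esub> a \<otimes>\<^bsub>E\<^esub> w"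
  shows "w = casimir \<otimes>\<^bsub>E\<^esub> J \<one>\<^bsub>A\<^esub> (Lam w)"
proof (rule E_eqI)
  have L: "Lam w \<in> carrier A" using lin_closed[OF Lam w(1)] .
  then show "casimir \<otimes>\<^bsub>E\<^esub> J \<one>\<^bsub>A\<^esub> (Lam w) \<in> carrier E" by simp
  fix b assume b: "b \<in> carrier A"
  have "Lam (J b \<one>\<^bsub>A\<^esub> \<otimes>\<^bsub>E\<^esub> (casimir \<otimes>\<^bsub>E\<^esub> J \<one>\<^bsub>A\<^esub> (Lam w))) = Lam ((J b \<one>\<^bsub>A\<^esub> \<otimes>\<^bsub>E\<^esub> casimir) \<otimes>\<^bsub>E\<^esub> J \<one>\<^bsub>A\<^esub> (Lam w))"
    using b L by (simp add: E.m_assoc)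
  then show "Lam (J b \<one>\<^bsub>A\<^esub> \<otimes>\<^bsub>E\<^esub> w) = Lam (J b \<one>\<^bsub>A\<^esub> \<otimes>\<^bsub>E\<^esub> (casimir \<otimes>\<^bsub>E\<^esub> J \<one>\<^bsub>A\<^esub> (Lam w)))"
    using b L w by (simp add: Lam_mult_right Lam_mult_left Lam_casimir')
qed (rule w(1))

text \<open>What is given is linearity in \<open>E\<close> and the action of the
  \<open>J a b\<close>. The module axioms follow because these elements generate \<open>E\<close>
  additively.\<close>

lemma AL_module: "left_module E AL"
proof -
  have cl: "e \<odot>\<^bsub>AL\<^esub> b \<in> carrier A" if "e \<in> carrier E" "b \<in> carrier A" for e b
    using lin_closed[OF AL_linear] that by simp
  have add: "(e \<oplus>\<^bsub>E\<^esub> f) \<odot>\<^bsub>AL\<^esub> b = e \<odot>\<^bsub>AL\<^esub> b \<oplus>\<^bsub>A\<^esub> f \<odot>\<^bsub>AL\<^esub> b"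
    if "e \<in> carrier E" "f \<in> carrier E" "b \<in> carrier A" for e f b
    using lin_add[OF AL_linear] that by simp
  have r: "e \<odot>\<^bsub>AL\<^esub> (b \<oplus>\<^bsub>A\<^esub> c) = e \<odot>\<^bsub>AL\<^esub> b \<oplus>\<^bsub>A\<^esub> e \<odot>\<^bsub>AL\<^esub> c"
    if "e \<in> carrier E" "b \<in> carrier A" "c \<in> carrier A" for e b c
    using that(1)
    by (induction e rule: E_induct)
      (use that in \<open>auto simp: AL_J add cl A.l_distr A.r_distr A.KM.M.a_ac\<close>)
  have assoc1: "(J a b \<otimes>\<^bsub>E\<^esub> f) \<odot>\<^bsub>AL\<^esub> c = J a b \<odot>\<^bsub>AL\<^esub> (f \<odot>\<^bsub>AL\<^esub> c)"
    if "f \<in> carrier E" "a \<in> carrier A" "b \<in> carrier A" "c \<in> carrier A" for f a b c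
    using that(1)
    by (induction f rule: E_induct)
      (use that in \<open>auto simp: AL_J add cl r A.m_assoc E.r_distr\<close>)
  have assoc: "(e \<otimes>\<^bsub>E\<^esub> f) \<odot>\<^bsub>AL\<^esub> c = e \<odot>\<^bsub>AL\<^esub> (f \<odot>\<^bsub>AL\<^esub> c)"
    if "e \<in> carrier E" "f \<in> carrier E" "c \<in> carrier A" for e f c
    using that(1)
    by (induction e rule: E_induct)
      (use that in \<open>auto simp: assoc1 add cl E.l_distr\<close>)
  show ?thesis
  proof (rule left_moduleI)
    show "abelian_group AL"
      by (rule abelian_group_cong[OF A.KM.M.abelian_group_axioms]) (simp_all add: AL_simps)
  qed (auto simp: AL_simps cl add r assoc E.ring_axioms J_one[symmetric] AL_J)
qed

end

section \<open>Dual bases of projective modules\<close>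

definition dual_basis ::
  "('r, 'x) ring_scheme \<Rightarrow> ('r, 'm) module \<Rightarrow> 's set \<Rightarrow> ('s \<Rightarrow> 'm) \<Rightarrow> ('s \<Rightarrow> 'm \<Rightarrow> 'r) \<Rightarrow> bool" where
  "dual_basis R P S q \<phi> \<longleftrightarrow> finite S \<and> q \<in> S \<rightarrow> carrier P \<and>
     (\<forall>s\<in>S. \<phi> s \<in> linear_maps R P (regular_module R)) \<and>
     (\<forall>p\<in>carrier P. (\<Oplus>\<^bsub>P\<^esub>s\<in>S. \<phi> s p \<odot>\<^bsub>P\<^esub> q s) = p)"

lemma dual_basisD:
  assumes "dual_basis R P S q \<phi>"
  shows "finite S" "\<And>s. s \<in> S \<Longrightarrow> q s \<in> carrier P"
    and "\<And>s. s \<in> S \<Longrightarrow> \<phi> s \<in> linear_maps R P (regular_module R)"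
    and "\<And>s p. \<lbrakk>s \<in> S; p \<in> carrier P\<rbrakk> \<Longrightarrow> \<phi> s p \<in> carrier R"
    and "\<And>p. p \<in> carrier P \<Longrightarrow> (\<Oplus>\<^bsub>P\<^esub>s\<in>S. \<phi> s p \<odot>\<^bsub>P\<^esub> q s) = p"
  using assms lin_closed[of "\<phi> _" R P "regular_module R"] by (auto simp: dual_basis_def)

text \<open>The free module of which \<open>P\<close> is a retract may have infinite rank. The
  coordinates of finitely many generators involve a finite set \<open>S\<close> of basis elements,
  and having all coordinates in \<open>S\<close> is preserved by the module operations, so the
  coordinates in \<open>S\<close> suffice.\<close>

lemma projective_dual_basis:
  fixes P :: "('r, 'm) module"
  assumes "finitely_generated R P" "projective_module R P"
  obtains S :: "'m set" and q \<phi> where "dual_basis R P S q \<phi>"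
proof -
  interpret P: lmod R P using assms(2) by (auto simp: projective_module_def intro: lmod.intro)
  obtain S0 :: "'m set" and i p where i: "i \<in> linear_maps R P (free_module R S0)"
    and p: "p \<in> linear_maps R (free_module R S0) P" and pi: "\<And>x. x \<in> carrier P \<Longrightarrow> p (i x) = x"
    using assms(2) by (auto simp: projective_module_def)
  obtain G where G: "finite G" "G \<subseteq> carrier P" "module_span R P G = carrier P"
    using assms(1) by (auto simp: finitely_generated_def)
  interpret i: lmap R P "free_module R S0" i
    by (rule lmapI[OF P.left_module_axioms P.R.free_left_module i])
  have icl: "finite (support R (i x))" "support R (i x) \<subseteq> S0" "i x s \<in> carrier R" if "x \<in> carrier P" for x s
    using lin_closed[OF i that] by (auto simp: free_module_carrier)
  define S where "S = (\<Union>g\<in>G. support R (i g))"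
  have "finite (support R (i g))" "support R (i g) \<subseteq> S0" if "g \<in> G" for g
    using icl(1,2)[of g] G(2) that by auto
  then have S: "finite S" "S \<subseteq> S0" using G(1) unfolding S_def by blast+
  have "submodule {x \<in> carrier P. support R (i x) \<subseteq> S} R P"
  proof (rule P.submodule_intro)
    show "\<zero>\<^bsub>P\<^esub> \<in> {x \<in> carrier P. support R (i x) \<subseteq> S}"
      using i.map_zero by (auto simp: support_def)
  next
    fix x y assume "x \<in> {x \<in> carrier P. support R (i x) \<subseteq> S}" "y \<in> {x \<in> carrier P. support R (i x) \<subseteq> S}"
    then show "x \<oplus>\<^bsub>P\<^esub> y \<in> {x \<in> carrier P. support R (i x) \<subseteq> S}"
      using P.R.support_add[of "i x" "i y"] lin_add[OF i, of x y] by auto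
  next
    fix a x assume "a \<in> carrier R" "x \<in> {x \<in> carrier P. support R (i x) \<subseteq> S}"
    then show "a \<odot>\<^bsub>P\<^esub> x \<in> {x \<in> carrier P. support R (i x) \<subseteq> S}"
      using P.R.support_smult[of a "i x"] lin_smult[OF i, of a x] by auto
  qed auto
  then have "module_span R P G \<subseteq> {x \<in> carrier P. support R (i x) \<subseteq> S}"
    by (rule span_least) (use G in \<open>auto simp: S_def\<close>)
  then have supp: "support R (i x) \<subseteq> S" if "x \<in> carrier P" for x using that G by auto
  have q: "p (basis_vector R s) \<in> carrier P" if "s \<in> S" for s
    using lin_closed[OF p P.R.basis_vector_closed] S that by auto
  have "(\<lambda>x. i x s) \<in> linear_maps R P (regular_module R)" if "s \<in> S" for s
    by (rule linear_mapsI) (use lin_add[OF i] lin_smult[OF i] icl in auto)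
  moreover have "(\<Oplus>\<^bsub>P\<^esub>s\<in>S. i x s \<odot>\<^bsub>P\<^esub> p (basis_vector R s)) = x" if x: "x \<in> carrier P" for x
  proof -
    have "x = lin_ext R P (\<lambda>s. p (basis_vector R s)) (i x)"
      using P.lin_ext_unique[OF p lin_closed[OF i x]] pi[OF x] by simp
    also have "\<dots> = (\<Oplus>\<^bsub>P\<^esub>s\<in>S. i x s \<odot>\<^bsub>P\<^esub> p (basis_vector R s))"
      using S supp[OF x] q icl[OF x] by (intro P.lin_ext_superset) auto
    finally show ?thesis ..
  qed
  ultimately show thesis
    using S q by (intro that[of S "\<lambda>s. p (basis_vector R s)" "\<lambda>s x. i x s"]) (auto simp: dual_basis_def)
qed

lemma orbit_linear:
  assumes "left_module R M" "x \<in> carrier M"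
  shows "(\<lambda>e. e \<odot>\<^bsub>M\<^esub> x) \<in> linear_maps R (regular_module R) M"
proof -
  interpret lmod R M using assms(1) by (rule lmod.intro)
  show ?thesis
    by (rule linear_mapsI) (use assms(2) in \<open>auto simp: smult_l_distr smult_assoc1\<close>)
qed

text \<open>A preimage of \<open>g (q s)\<close> is chosen once for each \<open>s\<close>, and the
  coordinates carry the choice over to all of \<open>P\<close> linearly.\<close>

lemma dual_basis_lift:
  assumes P: "dual_basis R P S q \<phi>" "left_module R P" and X: "left_module R X" and Y: "left_module R Y"
    and h: "h \<in> linear_maps R X Y" and g: "g \<in> linear_maps R P Y"
    and im: "\<And>p. p \<in> carrier P \<Longrightarrow> g p \<in> h ` carrier X"
  shows "\<exists>f\<in>linear_maps R P X. \<forall>p\<in>carrier P. h (f p) = g p"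
proof -
  note P' = dual_basisD[OF P(1)]
  interpret X: lmod R X using X by (rule lmod.intro)
  interpret Y: lmod R Y using Y by (rule lmod.intro)
  interpret P: lmod R P using P(2) by (rule lmod.intro)
  interpret h: lmap R X Y h by (rule lmapI[OF X Y h])
  interpret g: lmap R P Y g by (rule lmapI[OF P(2) Y g])
  have "\<forall>s\<in>S. \<exists>u\<in>carrier X. h u = g (q s)" using im P'(2) by (metis imageE)
  then obtain u where u: "\<And>s. s \<in> S \<Longrightarrow> u s \<in> carrier X" "\<And>s. s \<in> S \<Longrightarrow> h (u s) = g (q s)"
    by metis
  define f where "f p = (\<Oplus>\<^bsub>X\<^esub>s\<in>S. \<phi> s p \<odot>\<^bsub>X\<^esub> u s)" for p
  have "f \<in> linear_maps R P X"
    unfolding f_def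
    by (rule linear_maps_finsum[OF X P'(1)], rule linear_maps_comp[OF P'(3) orbit_linear[OF X u(1)]])
  moreover have "h (f p) = g p" if p: "p \<in> carrier P" for p
  proof -
    have "h (f p) = (\<Oplus>\<^bsub>Y\<^esub>s\<in>S. h (\<phi> s p \<odot>\<^bsub>X\<^esub> u s))"
      unfolding f_def using P' u p by (intro h.map_finsum) auto
    also have "\<dots> = (\<Oplus>\<^bsub>Y\<^esub>s\<in>S. g (\<phi> s p \<odot>\<^bsub>P\<^esub> q s))"
      using P' u p by (intro Y.M.finsum_cong') auto
    also have "\<dots> = g (\<Oplus>\<^bsub>P\<^esub>s\<in>S. \<phi> s p \<odot>\<^bsub>P\<^esub> q s)"
      using P' p by (intro g.map_finsum[symmetric]) auto
    finally show ?thesis using P'(5)[OF p] by simp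
  qed
  ultimately show ?thesis by blast
qed

text \<open>A map into \<open>X\<close> is extended coordinate by coordinate, which reduces the
  question to maps into the ring. In this way acyclicity of \<open>Hom(T, E)\<close> makes every
  finitely generated projective module injective relative to the complex \<open>T\<close>.\<close>

lemma dual_basis_extend:
  assumes X: "dual_basis R X S q \<phi>" "left_module R X" and N: "left_module R N" and M: "left_module R M"
    and d: "d \<in> linear_maps R M N"
    and g: "g \<in> linear_maps R M X" and U: "\<And>x. x \<in> U \<Longrightarrow> x \<in> carrier M \<and> g x = \<zero>\<^bsub>X\<^esub>"
    and ext: "\<And>u. \<lbrakk>u \<in> linear_maps R M (regular_module R); \<And>x. x \<in> U \<Longrightarrow> u x = \<zero>\<^bsub>R\<^esub>\<rbrakk>
      \<Longrightarrow> \<exists>w\<in>linear_maps R N (regular_module R). \<forall>x\<in>carrier M. w (d x) = u x"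
  shows "\<exists>f\<in>linear_maps R N X. \<forall>x\<in>carrier M. f (d x) = g x"
proof -
  note X' = dual_basisD[OF X(1)]
  interpret X: lmod R X using X(2) by (rule lmod.intro)
  note gl = linear_mapsD[OF g]
  have R: "left_module R (regular_module R)" by (rule regular_left_module[OF X.R.ring_axioms])
  have "\<exists>w\<in>linear_maps R N (regular_module R). \<forall>x\<in>carrier M. w (d x) = \<phi> s (g x)" if s: "s \<in> S" for s
    by (rule ext[OF linear_maps_comp[OF g X'(3)[OF s]]])
      (use U lmap.map_zero[OF lmapI[OF X(2) R X'(3)[OF s]]] in auto)
  then obtain w where w: "\<And>s. s \<in> S \<Longrightarrow> w s \<in> linear_maps R N (regular_module R)"
    "\<And>s x. \<lbrakk>s \<in> S; x \<in> carrier M\<rbrakk> \<Longrightarrow> w s (d x) = \<phi> s (g x)" by metis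
  define f where "f p = (\<Oplus>\<^bsub>X\<^esub>s\<in>S. w s p \<odot>\<^bsub>X\<^esub> q s)" for p
  have "f \<in> linear_maps R N X"
    unfolding f_def
    by (rule linear_maps_finsum[OF X(2) X'(1)], rule linear_maps_comp[OF w(1) orbit_linear[OF X(2) X'(2)]])
  moreover have "f (d x) = g x" if x: "x \<in> carrier M" for x
  proof -
    have "f (d x) = (\<Oplus>\<^bsub>X\<^esub>s\<in>S. \<phi> s (g x) \<odot>\<^bsub>X\<^esub> q s)"
      unfolding f_def using X' w x gl by (intro X.M.finsum_cong') auto
    then show ?thesis using X'(5)[OF gl(1)[OF x]] by simp
  qed
  ultimately show ?thesis by blast
qed

section \<open>Twisted coefficients\<close>

text \<open>
  \<open>th\<close> is an involution of \<open>A\<close> and \<open>al = id \<otimes> th\<close>.  The case \<open>th = id\<close> gives cohomology and the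
  case \<open>th = nu\<close> gives homology with coefficients in \<open>A\<close>.
\<close>

locale twisted_pair = frobenius_pair k A E J I x y lam nu Lam AL
  for k :: "'k ring" and A :: "('k, 'a) module" and E :: "('k, 'e) module"
    and J and I :: "'i set" and x y lam nu Lam AL +
  fixes th :: "'a \<Rightarrow> 'a" and al :: "'e \<Rightarrow> 'e"
  assumes th: "th \<in> linear_maps k A A" and th_one: "th \<one>\<^bsub>A\<^esub> = \<one>\<^bsub>A\<^esub>"
    and th_mult: "\<lbrakk>a \<in> carrier A; b \<in> carrier A\<rbrakk> \<Longrightarrow> th (a \<otimes>\<^bsub>A\<^esub> b) = th a \<otimes>\<^bsub>A\<^esub> th b"
    and th_th: "a \<in> carrier A \<Longrightarrow> th (th a) = a"
    and al: "al \<in> linear_maps k E E"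
    and al_J: "\<lbrakk>a \<in> carrier A; b \<in> carrier A\<rbrakk> \<Longrightarrow> al (J a b) = J a (th b)"
begin

lemma th_closed [simp]: "a \<in> carrier A \<Longrightarrow> th a \<in> carrier A"
  and al_closed [simp]: "e \<in> carrier E \<Longrightarrow> al e \<in> carrier E"
  and al_add [simp]: "\<lbrakk>e \<in> carrier E; f \<in> carrier E\<rbrakk> \<Longrightarrow> al (e \<oplus>\<^bsub>E\<^esub> f) = al e \<oplus>\<^bsub>E\<^esub> al f"
  using lin_closed[OF th] lin_closed[OF al] lin_add[OF al] by auto

lemma al_al: "e \<in> carrier E \<Longrightarrow> al (al e) = e"
  by (induction e rule: E_induct) (auto simp: al_J th_th)

lemma al_mult [simp]:
  assumes "e \<in> carrier E" "f \<in> carrier E"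
  shows "al (e \<otimes>\<^bsub>E\<^esub> f) = al e \<otimes>\<^bsub>E\<^esub> al f"
proof -
  have J: "al (J a b \<otimes>\<^bsub>E\<^esub> f) = J a (th b) \<otimes>\<^bsub>E\<^esub> al f" if "a \<in> carrier A" "b \<in> carrier A" for a b
    using assms(2) by (induction f rule: E_induct) (use that in \<open>auto simp: al_J th_mult E.r_distr\<close>)
  show ?thesis
    using assms(1) by (induction e rule: E_induct) (use assms(2) in \<open>auto simp: al_J J E.l_distr\<close>)
qed

lemma al_one: "al \<one>\<^bsub>E\<^esub> = \<one>\<^bsub>E\<^esub>"
  using al_J[of "\<one>\<^bsub>A\<^esub>" "\<one>\<^bsub>A\<^esub>"] by (simp add: J_one th_one)

text \<open>Restriction of scalars along \<open>al\<close>. Carrier and addition stay the same, so a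
  map that is linear between two modules is also linear between their twists.\<close>

definition twist :: "('e, 'm) module \<Rightarrow> ('e, 'm) module" where
  "twist M = M\<lparr>smult := \<lambda>e. smult M (al e)\<rparr>"

lemma twist_simps [simp]:
  "carrier (twist M) = carrier M" "add (twist M) = add M" "zero (twist M) = zero M"
  "smult (twist M) = (\<lambda>e. smult M (al e))"
  by (simp_all add: twist_def)

lemma finsum_twist [simp]: "finsum (twist M) = finsum M"
  by (simp add: fun_eq_iff finsum_def finprod_def)

lemma twist_module: "left_module E M \<Longrightarrow> left_module E (twist M)"
proof -
  assume "left_module E M"
  then interpret M: lmod E M by (rule lmod.intro)
  show ?thesis
  proof (rule left_moduleI)
    show "abelian_group (twist M)" by (rule abelian_group_cong[OF M.M.abelian_group_axioms]) simp_all
  qed (auto simp: E.ring_axioms M.smult_l_distr M.smult_r_distr M.smult_assoc1 al_one)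
qed

lemma twist_linear: "f \<in> linear_maps E M N \<Longrightarrow> f \<in> linear_maps E (twist M) (twist N)"
  by (rule linear_mapsI) (auto simp: linear_mapsD)

lemma al_scal: "r \<in> carrier k \<Longrightarrow> al (r \<odot>\<^bsub>E\<^esub> \<one>\<^bsub>E\<^esub>) = r \<odot>\<^bsub>E\<^esub> \<one>\<^bsub>E\<^esub>"
  using lin_smult[OF al] by (simp add: al_one)

text \<open>Twisting the action spoils the linearity of the coordinates. Composing them with the
  involutive automorphism \<open>al\<close> restores it, and in the twisted action
  \<open>al (\<phi> s p)\<close> acts as \<open>\<phi> s p\<close> did before.\<close>

lemma dual_basis_twist:
  assumes "dual_basis E P S q \<phi>" "left_module E P"
  shows "dual_basis E (twist P) S q (\<lambda>s p. al (\<phi> s p))"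
proof -
  note P = dual_basisD[OF assms(1)]
  interpret P0: lmod E P by (rule lmod.intro[OF assms(2)])
  have "(\<lambda>p. al (\<phi> s p)) \<in> linear_maps E (twist P) (regular_module E)" if s: "s \<in> S" for s
    by (rule linear_mapsI)
      (use linear_mapsD[OF P(3)[OF s]] P(4)[OF s] in \<open>auto simp: al_al\<close>)
  moreover have "(\<Oplus>\<^bsub>P\<^esub>s\<in>S. al (al (\<phi> s p)) \<odot>\<^bsub>P\<^esub> q s) = p" if p: "p \<in> carrier P" for p
  proof -
    have "(\<Oplus>\<^bsub>P\<^esub>s\<in>S. al (al (\<phi> s p)) \<odot>\<^bsub>P\<^esub> q s) = (\<Oplus>\<^bsub>P\<^esub>s\<in>S. \<phi> s p \<odot>\<^bsub>P\<^esub> q s)"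
      by (rule P0.M.finsum_cong') (use P p in \<open>auto simp: al_al\<close>)
    then show ?thesis using P(5)[OF p] by simp
  qed
  ultimately show ?thesis using assms by (auto simp: dual_basis_def)
qed

section \<open>Twisted coinvariants and invariants, and the norm between them\<close>

definition om :: "'a \<Rightarrow> 'a" where
  "om a = th (nu a)"

lemma om_closed [simp]: "a \<in> carrier A \<Longrightarrow> om a \<in> carrier A"
  by (simp add: om_def)

text \<open>In bimodule notation the generators are \<open>a p - p om(a)\<close>. The twist
  \<open>om\<close> combines \<open>th\<close>, which comes from the coefficients, with
  \<open>nu\<close>, which comes from the Frobenius form: it is \<open>nu\<close> for
  \<open>th = id\<close> and the identity for \<open>th = nu\<close>.\<close>

definition coinv_relations :: "('e, 'm) module \<Rightarrow> 'm set" where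
  "coinv_relations P = module_span k (restrict_scalars E P)
     {J a \<one>\<^bsub>A\<^esub> \<odot>\<^bsub>P\<^esub> p \<ominus>\<^bsub>P\<^esub> J \<one>\<^bsub>A\<^esub> (om a) \<odot>\<^bsub>P\<^esub> p |a p. a \<in> carrier A \<and> p \<in> carrier P}"

definition invariants :: "('e, 'm) module \<Rightarrow> 'm set" where
  "invariants P = {p \<in> carrier P. \<forall>a\<in>carrier A. J a \<one>\<^bsub>A\<^esub> \<odot>\<^bsub>P\<^esub> p = J \<one>\<^bsub>A\<^esub> (th a) \<odot>\<^bsub>P\<^esub> p}"

text \<open>Since \<open>al\<close> applies \<open>th\<close> to the right tensor factor, it turns
  the two rules of \<open>casimir\<close> into rules that send coinvariants for \<open>om\<close> to
  invariants for \<open>th\<close>.\<close>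

definition norm_element :: 'e where
  "norm_element = al casimir"

lemma norm_element_closed [simp]: "norm_element \<in> carrier E"
  by (simp add: norm_element_def)

lemma norm_left: "a \<in> carrier A \<Longrightarrow> J a \<one>\<^bsub>A\<^esub> \<otimes>\<^bsub>E\<^esub> norm_element = J \<one>\<^bsub>A\<^esub> (th a) \<otimes>\<^bsub>E\<^esub> norm_element"
  using arg_cong[OF casimir_left[of a], of al] by (simp add: al_J th_one norm_element_def)

lemma norm_right: "a \<in> carrier A \<Longrightarrow> norm_element \<otimes>\<^bsub>E\<^esub> J a \<one>\<^bsub>A\<^esub> = norm_element \<otimes>\<^bsub>E\<^esub> J \<one>\<^bsub>A\<^esub> (om a)"
  using arg_cong[OF casimir_right[of a], of al] by (simp add: al_J th_one norm_element_def om_def)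

lemma act_linear:
  assumes "left_module E P" "e \<in> carrier E"
  shows "(\<lambda>p. e \<odot>\<^bsub>P\<^esub> p) \<in> linear_maps k (restrict_scalars E P) (restrict_scalars E P)"
proof -
  interpret P: lmod E P using assms(1) by (rule lmod.intro)
  show ?thesis
    by (rule linear_mapsI)
      (use assms(2) in \<open>auto simp: P.smult_r_distr P.smult_assoc1[symmetric] E.scal_comm simp del: E.scal_mult\<close>)
qed

context
  fixes P :: "('e, 'm) module" assumes P: "left_module E P"
begin

interpretation P: lmod E P using P by (rule lmod.intro)

lemma rs_module: "left_module k (restrict_scalars E P)"
  by (rule E.restrict_scalars_module[OF P])

interpretation rsP: lmod k "restrict_scalars E P" using rs_module by (rule lmod.intro)

lemma coinv_submodule: "submodule (coinv_relations P) k (restrict_scalars E P)"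
  unfolding coinv_relations_def by (rule rsP.span_submodule) auto

lemma coinv_mem:
  "\<lbrakk>a \<in> carrier A; p \<in> carrier P\<rbrakk>
    \<Longrightarrow> J a \<one>\<^bsub>A\<^esub> \<odot>\<^bsub>P\<^esub> p \<ominus>\<^bsub>P\<^esub> J \<one>\<^bsub>A\<^esub> (om a) \<odot>\<^bsub>P\<^esub> p \<in> coinv_relations P"
  unfolding coinv_relations_def by (intro subsetD[OF span_superset]) blast

lemma coinv_functional:
  assumes N: "left_module k N" and f: "f \<in> linear_maps k (restrict_scalars E P) N"
    and "\<And>a p. \<lbrakk>a \<in> carrier A; p \<in> carrier P\<rbrakk> \<Longrightarrow> f (J a \<one>\<^bsub>A\<^esub> \<odot>\<^bsub>P\<^esub> p) = f (J \<one>\<^bsub>A\<^esub> (om a) \<odot>\<^bsub>P\<^esub> p)"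
    and "p \<in> coinv_relations P"
  shows "f p = \<zero>\<^bsub>N\<^esub>"
proof -
  interpret f: lmap k "restrict_scalars E P" N f by (rule lmapI[OF rs_module N f])
  have "coinv_relations P \<subseteq> {x \<in> carrier (restrict_scalars E P). f x \<in> {\<zero>\<^bsub>N\<^esub>}}"
    unfolding coinv_relations_def
  proof (rule span_least[OF f.vimage_submodule[OF f.N.submodule_zero]], safe)
    fix a p assume ap: "a \<in> carrier A" "p \<in> carrier P"
    then show "J a \<one>\<^bsub>A\<^esub> \<odot>\<^bsub>P\<^esub> p \<ominus>\<^bsub>P\<^esub> J \<one>\<^bsub>A\<^esub> (om a) \<odot>\<^bsub>P\<^esub> p \<in> carrier (restrict_scalars E P)" by simp
    show "f (J a \<one>\<^bsub>A\<^esub> \<odot>\<^bsub>P\<^esub> p \<ominus>\<^bsub>P\<^esub> J \<one>\<^bsub>A\<^esub> (om a) \<odot>\<^bsub>P\<^esub> p) = \<zero>\<^bsub>N\<^esub>"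
      using ap assms(3)[OF ap] f.map_diff[of "J a \<one>\<^bsub>A\<^esub> \<odot>\<^bsub>P\<^esub> p" "J \<one>\<^bsub>A\<^esub> (om a) \<odot>\<^bsub>P\<^esub> p"]
        f.N.diff_eq_zero_iff lin_closed[OF f] by simp
  qed
  then show ?thesis using assms(4) by auto
qed

lemma norm_coinv: "p \<in> coinv_relations P \<Longrightarrow> norm_element \<odot>\<^bsub>P\<^esub> p = \<zero>\<^bsub>P\<^esub>"
  using coinv_functional[OF rs_module act_linear[OF P norm_element_closed]]
  by (simp add: P.smult_assoc1[symmetric] norm_right)

lemma norm_invariant: "p \<in> carrier P \<Longrightarrow> norm_element \<odot>\<^bsub>P\<^esub> p \<in> invariants P"
  by (simp add: invariants_def P.smult_assoc1[symmetric] norm_left)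

lemma coinv_map:
  assumes N: "left_module E N" and f: "f \<in> linear_maps E P N" and p: "p \<in> coinv_relations P"
  shows "f p \<in> coinv_relations N"
proof -
  interpret N: lmod E N using N by (rule lmod.intro)
  interpret rf: lmap k "restrict_scalars E P" "restrict_scalars E N" f
    by (intro lmapI rs_module E.restrict_scalars_module N E.linear_maps_restrict_scalars f)
  interpret f: lmap E P N f by (rule lmapI[OF P N f])
  have sN: "submodule (coinv_relations N) k (restrict_scalars E N)"
    unfolding coinv_relations_def by (rule rf.N.span_submodule) auto
  have "coinv_relations P \<subseteq> {x \<in> carrier (restrict_scalars E P). f x \<in> coinv_relations N}"
    unfolding coinv_relations_def[of P]
  proof (rule span_least[OF rf.vimage_submodule[OF sN]], safe)
    fix a p assume ap: "a \<in> carrier A" "p \<in> carrier P"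
    then show "J a \<one>\<^bsub>A\<^esub> \<odot>\<^bsub>P\<^esub> p \<ominus>\<^bsub>P\<^esub> J \<one>\<^bsub>A\<^esub> (om a) \<odot>\<^bsub>P\<^esub> p \<in> carrier (restrict_scalars E P)" by simp
    have "f (J a \<one>\<^bsub>A\<^esub> \<odot>\<^bsub>P\<^esub> p \<ominus>\<^bsub>P\<^esub> J \<one>\<^bsub>A\<^esub> (om a) \<odot>\<^bsub>P\<^esub> p)
        = J a \<one>\<^bsub>A\<^esub> \<odot>\<^bsub>N\<^esub> f p \<ominus>\<^bsub>N\<^esub> J \<one>\<^bsub>A\<^esub> (om a) \<odot>\<^bsub>N\<^esub> f p"
      using ap by simp
    then show "f (J a \<one>\<^bsub>A\<^esub> \<odot>\<^bsub>P\<^esub> p \<ominus>\<^bsub>P\<^esub> J \<one>\<^bsub>A\<^esub> (om a) \<odot>\<^bsub>P\<^esub> p) \<in> coinv_relations N"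
      unfolding coinv_relations_def[of N] using ap lin_closed[OF f ap(2)] by (intro subsetD[OF span_superset] CollectI exI[of _ a] exI[of _ "f p"]) auto
  qed
  then show ?thesis using p by auto
qed

end

abbreviation "regE \<equiv> regular_module E"

lemma regE: "left_module E regE"
  by (rule regular_left_module[OF E.ring_axioms])

lemma a_minus_regE [simp]: "a_minus regE = a_minus E"
  by (simp add: fun_eq_iff a_minus_def a_inv_def m_inv_def)

text \<open>Modulo the relations \<open>J a b\<close> becomes \<open>J \<one> (b om(a))\<close>, so
  the right tensor factor represents all coinvariants of \<open>E\<close>.\<close>

lemma coinv_regular:
  assumes "e \<in> carrier E"
  shows "\<exists>v\<in>carrier A. e \<ominus>\<^bsub>E\<^esub> J \<one>\<^bsub>A\<^esub> v \<in> coinv_relations regE"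
  using assms
proof (induction e rule: E_induct)
  case (J a b)
  have "J a \<one>\<^bsub>A\<^esub> \<otimes>\<^bsub>E\<^esub> J \<one>\<^bsub>A\<^esub> b \<ominus>\<^bsub>E\<^esub> J \<one>\<^bsub>A\<^esub> (om a) \<otimes>\<^bsub>E\<^esub> J \<one>\<^bsub>A\<^esub> b \<in> coinv_relations regE"
    using coinv_mem[OF regE, of a "J \<one>\<^bsub>A\<^esub> b"] J by simp
  then show ?case using J by (intro bexI[of _ "b \<otimes>\<^bsub>A\<^esub> om a"]) simp_all
next
  case (add e f)
  then obtain u v where uv: "u \<in> carrier A" "v \<in> carrier A"
    "e \<ominus>\<^bsub>E\<^esub> J \<one>\<^bsub>A\<^esub> u \<in> coinv_relations regE" "f \<ominus>\<^bsub>E\<^esub> J \<one>\<^bsub>A\<^esub> v \<in> coinv_relations regE" by auto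
  have "(e \<oplus>\<^bsub>E\<^esub> f) \<ominus>\<^bsub>E\<^esub> J \<one>\<^bsub>A\<^esub> (u \<oplus>\<^bsub>A\<^esub> v) = (e \<ominus>\<^bsub>E\<^esub> J \<one>\<^bsub>A\<^esub> u) \<oplus>\<^bsub>E\<^esub> (f \<ominus>\<^bsub>E\<^esub> J \<one>\<^bsub>A\<^esub> v)"
    using add uv lin_add[OF J_right[OF A.one_closed]] by (simp add: a_minus_def E.minus_add E.a_ac)
  then show ?case
    using submodule_add_closed[OF coinv_submodule[OF regE] uv(3,4)] uv by (intro bexI[of _ "u \<oplus>\<^bsub>A\<^esub> v"]) simp_all
qed

text \<open>The norm element kills the relations, so it also kills the representative
  \<open>J \<one> v\<close> of \<open>e\<close>. Undoing \<open>al\<close> gives a multiple of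
  \<open>casimir\<close> that is zero, and \<open>casimir_annihilator\<close> forces
  \<open>v\<close> to vanish.\<close>

lemma norm_kernel_regular:
  assumes e: "e \<in> carrier E" "norm_element \<otimes>\<^bsub>E\<^esub> e = \<zero>\<^bsub>E\<^esub>"
  shows "e \<in> coinv_relations regE"
proof -
  interpret al: lmap k E E al by (intro lmapI E_module al)
  interpret reg: lmod E regE by (rule lmod.intro[OF regE])
  obtain v where v: "v \<in> carrier A" "e \<ominus>\<^bsub>E\<^esub> J \<one>\<^bsub>A\<^esub> v \<in> coinv_relations regE"
    using coinv_regular[OF e(1)] by auto
  have "norm_element \<otimes>\<^bsub>E\<^esub> (e \<ominus>\<^bsub>E\<^esub> J \<one>\<^bsub>A\<^esub> v) = \<zero>\<^bsub>E\<^esub>"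
    using norm_coinv[OF regE v(2)] by simp
  then have "norm_element \<otimes>\<^bsub>E\<^esub> J \<one>\<^bsub>A\<^esub> v = \<zero>\<^bsub>E\<^esub>"
    using e v reg.smult_r_diff[of norm_element e "J \<one>\<^bsub>A\<^esub> v"] E.minus_eq_zero_iff[of "\<zero>\<^bsub>E\<^esub>" "norm_element \<otimes>\<^bsub>E\<^esub> J \<one>\<^bsub>A\<^esub> v"]
    by simp
  then have "al (norm_element \<otimes>\<^bsub>E\<^esub> J \<one>\<^bsub>A\<^esub> v) = \<zero>\<^bsub>E\<^esub>" by simp
  then have "casimir \<otimes>\<^bsub>E\<^esub> J \<one>\<^bsub>A\<^esub> (th v) = \<zero>\<^bsub>E\<^esub>"
    using v by (simp add: norm_element_def al_al al_J)
  then have "th v = \<zero>\<^bsub>A\<^esub>" using casimir_annihilator v by simp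
  then have "v = \<zero>\<^bsub>A\<^esub>" using th_th[OF v(1)] lmap.map_zero[OF lmapI[OF A_module A_module th]] by simp
  then have "J \<one>\<^bsub>A\<^esub> v = \<zero>\<^bsub>E\<^esub>" using lmap.map_zero[OF J_right_lmap] by simp
  then show ?thesis using v(2) e reg.diff_zero by simp
qed

text \<open>Undoing \<open>al\<close> turns \<open>w\<close> into an invariant in the sense of
  \<open>casimir_invariant\<close>, hence into a multiple of \<open>casimir\<close>.\<close>

lemma invariants_regular:
  assumes "w \<in> invariants regE"
  shows "\<exists>e\<in>carrier E. w = norm_element \<otimes>\<^bsub>E\<^esub> e"
proof -
  have w: "w \<in> carrier E" "\<And>a. a \<in> carrier A \<Longrightarrow> J a \<one>\<^bsub>A\<^esub> \<otimes>\<^bsub>E\<^esub> w = J \<one>\<^bsub>A\<^esub> (th a) \<otimes>\<^bsub>E\<^esub> w"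
    using assms by (auto simp: invariants_def)
  have "J a \<one>\<^bsub>A\<^esub> \<otimes>\<^bsub>E\<^esub> al w = J \<one>\<^bsub>A\<^esub> a \<otimes>\<^bsub>E\<^esub> al w" if "a \<in> carrier A" for a
    using arg_cong[OF w(2)[OF that], of al] that w(1) by (simp add: al_J th_one th_th)
  then have "al w = casimir \<otimes>\<^bsub>E\<^esub> J \<one>\<^bsub>A\<^esub> (Lam (al w))"
    using casimir_invariant w(1) by simp
  then have "w = norm_element \<otimes>\<^bsub>E\<^esub> al (J \<one>\<^bsub>A\<^esub> (Lam (al w)))"
    using w(1) lin_closed[OF Lam] by (metis A.one_closed J_closed al_al al_closed al_mult casimir_closed norm_element_def)
  then show ?thesis using w(1) lin_closed[OF Lam] by (metis A.one_closed J_closed al_closed)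
qed

text \<open>Coordinates reduce the claim to \<open>E\<close>: each \<open>\<phi> s p\<close> is a
  relation there, and acting on \<open>q s\<close> maps the relations of \<open>E\<close> to
  relations of \<open>P\<close>.\<close>

lemma norm_kernel:
  assumes P: "left_module E P" "dual_basis E P S q \<phi>" and p: "p \<in> carrier P" "norm_element \<odot>\<^bsub>P\<^esub> p = \<zero>\<^bsub>P\<^esub>"
  shows "p \<in> coinv_relations P"
proof -
  note B = dual_basisD[OF P(2)]
  interpret rsP: lmod k "restrict_scalars E P" by (rule lmod.intro[OF rs_module[OF P(1)]])
  have "\<phi> s p \<odot>\<^bsub>P\<^esub> q s \<in> coinv_relations P" if s: "s \<in> S" for s
  proof -
    interpret f: lmap E P regE "\<phi> s" by (rule lmapI[OF P(1) regE B(3)[OF s]])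
    have "norm_element \<otimes>\<^bsub>E\<^esub> \<phi> s p = \<zero>\<^bsub>E\<^esub>"
      using f.map_zero lin_smult[OF B(3)[OF s], of norm_element p] p by simp
    then have "\<phi> s p \<in> coinv_relations regE" using norm_kernel_regular B(4) s p by auto
    then show ?thesis using coinv_map[OF regE P(1) orbit_linear[OF P(1) B(2)[OF s]]] by simp
  qed
  then have "(\<Oplus>\<^bsub>restrict_scalars E P\<^esub>s\<in>S. \<phi> s p \<odot>\<^bsub>P\<^esub> q s) \<in> coinv_relations P"
    by (intro rsP.submodule_finsum[OF coinv_submodule[OF P(1)] B(1)])
  moreover have "(\<Oplus>\<^bsub>restrict_scalars E P\<^esub>s\<in>S. \<phi> s p \<odot>\<^bsub>P\<^esub> q s) = (\<Oplus>\<^bsub>P\<^esub>s\<in>S. \<phi> s p \<odot>\<^bsub>P\<^esub> q s)"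
    by (simp add: finsum_def finprod_def)
  ultimately show ?thesis using B(5)[OF p(1)] by simp
qed

text \<open>The coordinates of an invariant are invariants of \<open>E\<close>, thus multiples of
  the norm element, which can be taken out of the sum. Together with \<open>norm_kernel\<close>,
  \<open>norm_coinv\<close> and \<open>norm_invariant\<close> this makes the norm an isomorphism
  from coinvariants to invariants.\<close>

lemma invariants_norm:
  assumes P: "left_module E P" "dual_basis E P S q \<phi>" and p: "p \<in> invariants P"
  shows "\<exists>u\<in>carrier P. p = norm_element \<odot>\<^bsub>P\<^esub> u"
proof -
  note B = dual_basisD[OF P(2)]
  interpret P: lmod E P by (rule lmod.intro[OF P(1)])
  have pc: "p \<in> carrier P" using p by (simp add: invariants_def)
  have "\<forall>s\<in>S. \<exists>e\<in>carrier E. \<phi> s p = norm_element \<otimes>\<^bsub>E\<^esub> e"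
  proof
    fix s assume s: "s \<in> S"
    have "\<phi> s p \<in> invariants regE"
      using p pc B(4)[OF s] lin_smult[OF B(3)[OF s]] unfolding invariants_def
      by (auto simp flip: regular_module_simps(4)) (metis A.one_closed J_closed th_closed)
    then show "\<exists>e\<in>carrier E. \<phi> s p = norm_element \<otimes>\<^bsub>E\<^esub> e" by (rule invariants_regular)
  qed
  then obtain e where e: "\<And>s. s \<in> S \<Longrightarrow> e s \<in> carrier E" "\<And>s. s \<in> S \<Longrightarrow> \<phi> s p = norm_element \<otimes>\<^bsub>E\<^esub> e s" by metis
  have "p = (\<Oplus>\<^bsub>P\<^esub>s\<in>S. \<phi> s p \<odot>\<^bsub>P\<^esub> q s)" using B(5)[OF pc] by simp
  also have "\<dots> = (\<Oplus>\<^bsub>P\<^esub>s\<in>S. norm_element \<odot>\<^bsub>P\<^esub> (e s \<odot>\<^bsub>P\<^esub> q s))"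
    using e B by (intro P.M.finsum_cong') (auto simp: P.smult_assoc1)
  also have "\<dots> = norm_element \<odot>\<^bsub>P\<^esub> (\<Oplus>\<^bsub>P\<^esub>s\<in>S. e s \<odot>\<^bsub>P\<^esub> q s)"
    using e B by (intro P.smult_finsum[symmetric]) auto
  moreover have "(\<Oplus>\<^bsub>P\<^esub>s\<in>S. e s \<odot>\<^bsub>P\<^esub> q s) \<in> carrier P"
    using e B by (intro P.M.finsum_closed) auto
  ultimately show ?thesis by auto
qed

end

context twisted_pair
begin

text \<open>The \<open>y i\<close> span \<open>A\<close> over \<open>k\<close>, so the
  \<open>J (y i) (y j)\<close> span \<open>E\<close> over \<open>k\<close>; their products with the
  \<open>q s\<close> span \<open>P\<close>.\<close>

lemma restrict_scalars_finite:
  assumes P: "left_module E P" "dual_basis E P S q \<phi>"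
  shows "finitely_generated k (restrict_scalars E P)"
proof -
  note B = dual_basisD[OF P(2)]
  interpret P: lmod E P by (rule lmod.intro[OF P(1)])
  interpret rsP: lmod k "restrict_scalars E P" by (rule lmod.intro[OF rs_module[OF P(1)]])
  define G where "G = (\<lambda>(i, j, s). J (y i) (y j) \<odot>\<^bsub>P\<^esub> q s) ` (I \<times> I \<times> S)"
  have G: "finite G" "G \<subseteq> carrier P" using I B by (auto simp: G_def)
  define H where "H = module_span k (restrict_scalars E P) G"
  have H: "submodule H k (restrict_scalars E P)"
    unfolding H_def by (rule rsP.span_submodule) (use G in auto)
  have GH: "J (y i) (y j) \<odot>\<^bsub>P\<^esub> q s \<in> H" if "i \<in> I" "j \<in> I" "s \<in> S" for i j s
    unfolding H_def by (rule subsetD[OF span_superset]) (use that in \<open>force simp: G_def\<close>)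
  have sum: "f a \<in> H"
    if f: "f \<in> linear_maps k A (restrict_scalars E P)" and "\<And>i. i \<in> I \<Longrightarrow> f (y i) \<in> H" and a: "a \<in> carrier A" for f a
  proof -
    interpret f: lmap k A "restrict_scalars E P" f by (rule lmapI[OF A_module rs_module[OF P(1)] f])
    have "f a = f (\<Oplus>\<^bsub>A\<^esub>i\<in>I. lam (a \<otimes>\<^bsub>A\<^esub> x i) \<odot>\<^bsub>A\<^esub> y i)" using dual_y[OF a] by simp
    also have "\<dots> = (\<Oplus>\<^bsub>restrict_scalars E P\<^esub>i\<in>I. f (lam (a \<otimes>\<^bsub>A\<^esub> x i) \<odot>\<^bsub>A\<^esub> y i))"
      using a I by (intro f.map_finsum) auto
    also have "\<dots> \<in> H"
      by (rule rsP.submodule_finsum[OF H I])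
        (use that lin_smult[OF f] submodule_smult_closed[OF H] in \<open>simp del: restrict_scalars_simps\<close>)
    finally show ?thesis .
  qed
  have Jq: "J a b \<odot>\<^bsub>P\<^esub> q s \<in> H" if ab: "a \<in> carrier A" "b \<in> carrier A" "s \<in> S" for a b s
  proof -
    have lin: "(\<lambda>e. e \<odot>\<^bsub>P\<^esub> q s) \<in> linear_maps k E (restrict_scalars E P)"
      by (rule linear_mapsI) (use B ab in \<open>auto simp: P.smult_l_distr P.smult_assoc1[symmetric] E.scal_mult\<close>)
    have *: "J (y i) b \<odot>\<^bsub>P\<^esub> q s \<in> H" if "i \<in> I" for i
      by (rule sum[OF linear_maps_comp[OF J_right lin]]) (use that ab GH in auto)
    show ?thesis
      by (rule sum[OF linear_maps_comp[OF J_left lin]]) (use * ab in auto)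
  qed
  have eq: "e \<odot>\<^bsub>P\<^esub> q s \<in> H" if "e \<in> carrier E" "s \<in> S" for e s
    using that(1)
  proof (induction e rule: E_induct)
    case (add e f)
    then show ?case
      using submodule_add_closed[OF H, of "e \<odot>\<^bsub>P\<^esub> q s" "f \<odot>\<^bsub>P\<^esub> q s"] B(2)[OF that(2)] by (simp add: P.smult_l_distr)
  qed (use Jq that in auto)
  have "p \<in> H" if p: "p \<in> carrier P" for p
  proof -
    have "(\<Oplus>\<^bsub>restrict_scalars E P\<^esub>s\<in>S. \<phi> s p \<odot>\<^bsub>P\<^esub> q s) \<in> H"
      by (rule rsP.submodule_finsum[OF H B(1)]) (use eq B p in auto)
    moreover have "(\<Oplus>\<^bsub>restrict_scalars E P\<^esub>s\<in>S. \<phi> s p \<odot>\<^bsub>P\<^esub> q s) = (\<Oplus>\<^bsub>P\<^esub>s\<in>S. \<phi> s p \<odot>\<^bsub>P\<^esub> q s)"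
      by (simp add: finsum_def finprod_def)
    ultimately show ?thesis using B(5)[OF p] by simp
  qed
  then have "module_span k (restrict_scalars E P) G = carrier (restrict_scalars E P)"
    using submodule_subset[OF H] by (auto simp: H_def)
  then show ?thesis using G by (auto simp: finitely_generated_def)
qed

section \<open>Bimodule maps into the twisted algebra as functionals on coinvariants\<close>

lemma twAL_smult: "\<lbrakk>a \<in> carrier A; b \<in> carrier A; c \<in> carrier A\<rbrakk>
  \<Longrightarrow> J a b \<odot>\<^bsub>twist AL\<^esub> c = a \<otimes>\<^bsub>A\<^esub> c \<otimes>\<^bsub>A\<^esub> th b"
  by (simp add: al_J AL_J)

text \<open>In bimodule notation \<open>lam (g (a p)) = lam (a g(p)) = lam (g(p) nu(a)) = lam (g (p
  om(a)))\<close>; the last equality holds because \<open>th (om a) = nu a\<close>.\<close>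

lemma lam_functional:
  assumes P: "left_module E P" and g: "g \<in> linear_maps E P (twist AL)"
  shows "(\<lambda>p. lam (g p)) \<in> functionals k (restrict_scalars E P)"
    and "p \<in> coinv_relations P \<Longrightarrow> lam (g p) = \<zero>\<^bsub>k\<^esub>"
proof -
  interpret l: lmap k A "regular_module k" lam by (rule lam_lmap)
  interpret P: lmod E P by (rule lmod.intro[OF P(1)])
  note gc = lin_closed[OF g, simplified AL_simps twist_simps]
  have gs: "g (J a b \<odot>\<^bsub>P\<^esub> p) = a \<otimes>\<^bsub>A\<^esub> g p \<otimes>\<^bsub>A\<^esub> th b"
    if "a \<in> carrier A" "b \<in> carrier A" "p \<in> carrier P" for a b p
    using lin_smult[OF g, of "J a b" p] that twAL_smult[of a b "g p"] gc by simp
  show 1: "(\<lambda>p. lam (g p)) \<in> functionals k (restrict_scalars E P)"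
  proof (rule linear_mapsI)
    fix p p' assume "p \<in> carrier (restrict_scalars E P)" "p' \<in> carrier (restrict_scalars E P)"
    then show "lam (g (p \<oplus>\<^bsub>restrict_scalars E P\<^esub> p')) = lam (g p) \<oplus>\<^bsub>regular_module k\<^esub> lam (g p')"
      using lin_add[OF g, of p p'] gc by (simp add: AL_simps)
  next
    fix r p assume "r \<in> carrier k" "p \<in> carrier (restrict_scalars E P)"
    then show "lam (g (r \<odot>\<^bsub>restrict_scalars E P\<^esub> p)) = r \<odot>\<^bsub>regular_module k\<^esub> lam (g p)"
      using gs[of "r \<odot>\<^bsub>A\<^esub> \<one>\<^bsub>A\<^esub>" "\<one>\<^bsub>A\<^esub>" p] gc by (simp add: scal_J(1) th_one A.smult_mult_left)
  qed (use gc in simp)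
  assume p: "p \<in> coinv_relations P"
  show "lam (g p) = \<zero>\<^bsub>k\<^esub>"
  proof -
    have "lam (g p) = \<zero>\<^bsub>regular_module k\<^esub>"
    proof (rule coinv_functional[OF P regular_left_module[OF A.K.ring_axioms] 1 _ p])
      fix a p assume "a \<in> carrier A" "p \<in> carrier P"
      then show "lam (g (J a \<one>\<^bsub>A\<^esub> \<odot>\<^bsub>P\<^esub> p)) = lam (g (J \<one>\<^bsub>A\<^esub> (om a) \<odot>\<^bsub>P\<^esub> p))"
        using gs gc by (simp add: th_one om_def th_th lam_nu)
    qed
    then show ?thesis by simp
  qed
qed

text \<open>Applied to \<open>J c \<one>\<close> times \<open>p\<close>, the hypothesis gives
  \<open>lam (c g(p)) = lam (c g'(p))\<close> for all \<open>c\<close>, and \<open>lam\<close> is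
  nondegenerate.\<close>

lemma lam_functional_inject:
  assumes P: "left_module E P" and g: "g \<in> linear_maps E P (twist AL)" "g' \<in> linear_maps E P (twist AL)"
    and eq: "\<And>p. p \<in> carrier P \<Longrightarrow> lam (g p) = lam (g' p)" and p: "p \<in> carrier P"
  shows "g p = g' p"
proof (rule nondegenerate)
  interpret P: lmod E P by (rule lmod.intro[OF P(1)])
  note gc = lin_closed[OF g(1), simplified AL_simps twist_simps]
    and gc' = lin_closed[OF g(2), simplified AL_simps twist_simps]
  show "g p \<in> carrier A" "g' p \<in> carrier A" using gc gc' p by auto
  fix c assume c: "c \<in> carrier A"
  show "lam (c \<otimes>\<^bsub>A\<^esub> g p) = lam (c \<otimes>\<^bsub>A\<^esub> g' p)"
    using eq[of "J c \<one>\<^bsub>A\<^esub> \<odot>\<^bsub>P\<^esub> p"] lin_smult[OF g(1), of "J c \<one>\<^bsub>A\<^esub>" p] lin_smult[OF g(2), of "J c \<one>\<^bsub>A\<^esub>" p]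
      twAL_smult[of c "\<one>\<^bsub>A\<^esub>"] c p gc gc' by (simp add: th_one)
qed

text \<open>The formula for \<open>g\<close> is forced: by \<open>dual_x\<close> the coefficients of
  \<open>g p\<close> must be \<open>lam (y_i g(p)) = f (y_i p)\<close>. With the two preceding
  lemmas, \<open>lam\<close> identifies the maps into \<open>twist AL\<close> with the dual of the
  coinvariants.\<close>

lemma functional_lift:
  assumes P: "left_module E P" and f: "f \<in> functionals k (restrict_scalars E P)"
    and 0: "\<And>p. p \<in> coinv_relations P \<Longrightarrow> f p = \<zero>\<^bsub>k\<^esub>"
  obtains g where "g \<in> linear_maps E P (twist AL)" "\<And>p. p \<in> carrier P \<Longrightarrow> lam (g p) = f p"
proof -
  interpret l: lmap k A "regular_module k" lam by (rule lam_lmap)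
  interpret P: lmod E P by (rule lmod.intro[OF P(1)])
  interpret f: lmap k "restrict_scalars E P" "regular_module k" f
    by (intro lmapI rs_module[OF P] regular_left_module A.K.ring_axioms f)
  interpret V: vspace k A by (intro vspace.intro lmod.intro A_module A.K.field_axioms)
  note fc = lin_closed[OF f, simplified] and fa = lin_add[OF f, simplified]
  define g where "g p = (\<Oplus>\<^bsub>A\<^esub>i\<in>I. f (J (y i) \<one>\<^bsub>A\<^esub> \<odot>\<^bsub>P\<^esub> p) \<odot>\<^bsub>A\<^esub> x i)" for p
  have gc: "g p \<in> carrier A" if "p \<in> carrier P" for p
    unfolding g_def using that fc by (intro A.KM.M.finsum_closed) auto
  have key: "lam (c \<otimes>\<^bsub>A\<^esub> g p) = f (J c \<one>\<^bsub>A\<^esub> \<odot>\<^bsub>P\<^esub> p)" if c: "c \<in> carrier A" and p: "p \<in> carrier P" for c p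
  proof -
    have lin: "(\<lambda>a. f (J a \<one>\<^bsub>A\<^esub> \<odot>\<^bsub>P\<^esub> p)) \<in> functionals k A"
    proof (rule linear_maps_comp[OF _ f], rule linear_maps_comp[OF J_left])
      show "(\<lambda>e. e \<odot>\<^bsub>P\<^esub> p) \<in> linear_maps k E (restrict_scalars E P)"
        by (rule linear_mapsI) (use p in \<open>auto simp: P.smult_l_distr P.smult_assoc1[symmetric] E.scal_mult\<close>)
    qed simp
    have "c \<otimes>\<^bsub>A\<^esub> g p = (\<Oplus>\<^bsub>A\<^esub>i\<in>I. c \<otimes>\<^bsub>A\<^esub> (f (J (y i) \<one>\<^bsub>A\<^esub> \<odot>\<^bsub>P\<^esub> p) \<odot>\<^bsub>A\<^esub> x i))"
      unfolding g_def using c p fc I by (intro A.finsum_rdistr) auto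
    also have "\<dots> = (\<Oplus>\<^bsub>A\<^esub>i\<in>I. f (J (y i) \<one>\<^bsub>A\<^esub> \<odot>\<^bsub>P\<^esub> p) \<odot>\<^bsub>A\<^esub> (c \<otimes>\<^bsub>A\<^esub> x i))"
      using c p fc by (intro A.KM.M.finsum_cong') (auto simp: A.smult_mult_right)
    finally have "lam (c \<otimes>\<^bsub>A\<^esub> g p) = (\<Oplus>\<^bsub>k\<^esub>i\<in>I. f (J (y i) \<one>\<^bsub>A\<^esub> \<odot>\<^bsub>P\<^esub> p) \<otimes>\<^bsub>k\<^esub> lam (c \<otimes>\<^bsub>A\<^esub> x i))"
      using lam_finsum[OF I, of "\<lambda>i. f (J (y i) \<one>\<^bsub>A\<^esub> \<odot>\<^bsub>P\<^esub> p)" "\<lambda>i. c \<otimes>\<^bsub>A\<^esub> x i"] c p fc by simp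
    also have "\<dots> = (\<Oplus>\<^bsub>k\<^esub>i\<in>I. lam (c \<otimes>\<^bsub>A\<^esub> x i) \<otimes>\<^bsub>k\<^esub> f (J (y i) \<one>\<^bsub>A\<^esub> \<odot>\<^bsub>P\<^esub> p))"
      using c p fc by (intro A.K.finsum_cong') (auto simp: A.K.m_comm)
    also have "\<dots> = f (J (\<Oplus>\<^bsub>A\<^esub>i\<in>I. lam (c \<otimes>\<^bsub>A\<^esub> x i) \<odot>\<^bsub>A\<^esub> y i) \<one>\<^bsub>A\<^esub> \<odot>\<^bsub>P\<^esub> p)"
      using V.functional_finsum[OF lin I, of "\<lambda>i. lam (c \<otimes>\<^bsub>A\<^esub> x i)" y] c p by simp
    finally show ?thesis using dual_y[OF c] by simp
  qed
  have lam_g: "lam (g p) = f p" if "p \<in> carrier P" for p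
    using key[OF A.one_closed that] that gc by (simp add: J_one)
  have inv: "f (J a \<one>\<^bsub>A\<^esub> \<odot>\<^bsub>P\<^esub> p) = f (J \<one>\<^bsub>A\<^esub> (om a) \<odot>\<^bsub>P\<^esub> p)" if "a \<in> carrier A" "p \<in> carrier P" for a p
  proof (rule iffD1[OF l.N.diff_eq_zero_iff])
    show "f (J a \<one>\<^bsub>A\<^esub> \<odot>\<^bsub>P\<^esub> p) \<ominus>\<^bsub>regular_module k\<^esub> f (J \<one>\<^bsub>A\<^esub> (om a) \<odot>\<^bsub>P\<^esub> p) = \<zero>\<^bsub>regular_module k\<^esub>"
      using 0[OF coinv_mem[OF P that]] that
        f.map_diff[of "J a \<one>\<^bsub>A\<^esub> \<odot>\<^bsub>P\<^esub> p" "J \<one>\<^bsub>A\<^esub> (om a) \<odot>\<^bsub>P\<^esub> p"] by simp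
  qed (use that fc in auto)
  have gJ: "g (J a b \<odot>\<^bsub>P\<^esub> p) = a \<otimes>\<^bsub>A\<^esub> g p \<otimes>\<^bsub>A\<^esub> th b"
    if ab: "a \<in> carrier A" "b \<in> carrier A" and p: "p \<in> carrier P" for a b p
  proof (rule nondegenerate)
    fix c assume c: "c \<in> carrier A"
    \<comment> \<open>This is the element whose \<open>om\<close> is \<open>b\<close>. As
      \<open>f\<close> vanishes on the relations, the action of \<open>b\<close> from the right can
      be replaced by the action of this element from the left.\<close>
    have om: "om (nu (th b)) = b" using ab by (simp add: om_def nu_nu th_th)
    have "lam (c \<otimes>\<^bsub>A\<^esub> g (J a b \<odot>\<^bsub>P\<^esub> p)) = f (J \<one>\<^bsub>A\<^esub> b \<odot>\<^bsub>P\<^esub> (J (c \<otimes>\<^bsub>A\<^esub> a) \<one>\<^bsub>A\<^esub> \<odot>\<^bsub>P\<^esub> p))"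
      using key[OF c, of "J a b \<odot>\<^bsub>P\<^esub> p"] ab c p by (simp add: P.smult_assoc1[symmetric])
    also have "\<dots> = f (J (nu (th b)) \<one>\<^bsub>A\<^esub> \<odot>\<^bsub>P\<^esub> (J (c \<otimes>\<^bsub>A\<^esub> a) \<one>\<^bsub>A\<^esub> \<odot>\<^bsub>P\<^esub> p))"
      using inv[of "nu (th b)" "J (c \<otimes>\<^bsub>A\<^esub> a) \<one>\<^bsub>A\<^esub> \<odot>\<^bsub>P\<^esub> p"] ab c p om by simp
    also have "\<dots> = lam (nu (th b) \<otimes>\<^bsub>A\<^esub> (c \<otimes>\<^bsub>A\<^esub> a) \<otimes>\<^bsub>A\<^esub> g p)"
      using key[of "nu (th b) \<otimes>\<^bsub>A\<^esub> (c \<otimes>\<^bsub>A\<^esub> a)" p] ab c p by (simp add: P.smult_assoc1[symmetric])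
    also have "\<dots> = lam (c \<otimes>\<^bsub>A\<^esub> (a \<otimes>\<^bsub>A\<^esub> g p \<otimes>\<^bsub>A\<^esub> th b))"
      using lam_nu'[of "c \<otimes>\<^bsub>A\<^esub> (a \<otimes>\<^bsub>A\<^esub> g p)" "th b"] ab c p gc by (simp add: A.m_assoc)
    finally show "lam (c \<otimes>\<^bsub>A\<^esub> g (J a b \<odot>\<^bsub>P\<^esub> p)) = lam (c \<otimes>\<^bsub>A\<^esub> (a \<otimes>\<^bsub>A\<^esub> g p \<otimes>\<^bsub>A\<^esub> th b))" .
  qed (use ab p gc in auto)
  have add: "g (p \<oplus>\<^bsub>P\<^esub> p') = g p \<oplus>\<^bsub>A\<^esub> g p'" if "p \<in> carrier P" "p' \<in> carrier P" for p p'
    by (rule nondegenerate) (use that gc key fa in \<open>auto simp: A.r_distr P.smult_r_distr\<close>)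
  interpret AL: lmod E "twist AL" by (rule lmod.intro[OF twist_module[OF AL_module]])
  have "g \<in> linear_maps E P (twist AL)"
  proof (rule linear_mapsI)
    fix e p assume "e \<in> carrier E" and p: "p \<in> carrier P"
    then show "g (e \<odot>\<^bsub>P\<^esub> p) = e \<odot>\<^bsub>twist AL\<^esub> g p"
    proof (induction e rule: E_induct)
      case (J a b)
      then show ?case using gJ[OF J(1,2) p] twAL_smult[OF J(1,2) gc[OF p]] by simp
    next
      case (add e e')
      then show ?case
        using \<open>\<And>p p'. _ \<Longrightarrow> _ \<Longrightarrow> g (p \<oplus>\<^bsub>P\<^esub> p') = g p \<oplus>\<^bsub>A\<^esub> g p'\<close>[of "e \<odot>\<^bsub>P\<^esub> p" "e' \<odot>\<^bsub>P\<^esub> p"]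
          AL.smult_l_distr[of e e' "g p"] gc[OF p]
        by (simp add: P.smult_l_distr AL_simps del: al_add)
    qed
  qed (use gc add in \<open>auto simp: AL_simps\<close>)
  then show thesis using that lam_g by blast
qed

section \<open>Bimodule maps out of the algebra as invariants\<close>

lemma AL_eval:
  assumes Q: "left_module E Q" and p: "p \<in> linear_maps E AL (twist Q)" and a: "a \<in> carrier A"
  shows "p a = J a \<one>\<^bsub>A\<^esub> \<odot>\<^bsub>Q\<^esub> p \<one>\<^bsub>A\<^esub>"
  using lin_smult[OF p, of "J a \<one>\<^bsub>A\<^esub>" "\<one>\<^bsub>A\<^esub>"] a by (simp add: AL_simps AL_J al_J th_one)

lemma AL_eval_invariant:
  assumes Q: "left_module E Q" and p: "p \<in> linear_maps E AL (twist Q)"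
  shows "p \<one>\<^bsub>A\<^esub> \<in> invariants Q"
proof -
  have "J a \<one>\<^bsub>A\<^esub> \<odot>\<^bsub>Q\<^esub> p \<one>\<^bsub>A\<^esub> = J \<one>\<^bsub>A\<^esub> (th a) \<odot>\<^bsub>Q\<^esub> p \<one>\<^bsub>A\<^esub>" if "a \<in> carrier A" for a
    using AL_eval[OF Q p that] lin_smult[OF p, of "J \<one>\<^bsub>A\<^esub> a" "\<one>\<^bsub>A\<^esub>"] that by (simp add: AL_simps AL_J al_J)
  then show ?thesis using lin_closed[OF p, of "\<one>\<^bsub>A\<^esub>"] by (simp add: invariants_def AL_simps)
qed

text \<open>In bimodule notation \<open>(a c b) u = a (c u) th(b)\<close> for an invariant
  \<open>u\<close>, which is linearity into the twist.\<close>

lemma invariant_AL_map: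
  assumes Q: "left_module E Q" and u: "u \<in> invariants Q"
  shows "(\<lambda>a. J a \<one>\<^bsub>A\<^esub> \<odot>\<^bsub>Q\<^esub> u) \<in> linear_maps E AL (twist Q)"
proof -
  interpret Q: lmod E Q by (rule lmod.intro[OF Q])
  interpret AL: lmod E AL by (rule lmod.intro[OF AL_module])
  interpret tQ: lmod E "twist Q" by (rule lmod.intro[OF twist_module[OF Q]])
  have u': "u \<in> carrier Q" "\<And>a. a \<in> carrier A \<Longrightarrow> J a \<one>\<^bsub>A\<^esub> \<odot>\<^bsub>Q\<^esub> u = J \<one>\<^bsub>A\<^esub> (th a) \<odot>\<^bsub>Q\<^esub> u"
    using u by (auto simp: invariants_def)
  have J: "J (a \<otimes>\<^bsub>A\<^esub> c \<otimes>\<^bsub>A\<^esub> b) \<one>\<^bsub>A\<^esub> \<odot>\<^bsub>Q\<^esub> u = J a (th b) \<odot>\<^bsub>Q\<^esub> (J c \<one>\<^bsub>A\<^esub> \<odot>\<^bsub>Q\<^esub> u)"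
    if "a \<in> carrier A" "b \<in> carrier A" "c \<in> carrier A" for a b c
  proof -
    have "J (a \<otimes>\<^bsub>A\<^esub> c \<otimes>\<^bsub>A\<^esub> b) \<one>\<^bsub>A\<^esub> \<odot>\<^bsub>Q\<^esub> u = (J (a \<otimes>\<^bsub>A\<^esub> c) \<one>\<^bsub>A\<^esub> \<otimes>\<^bsub>E\<^esub> J b \<one>\<^bsub>A\<^esub>) \<odot>\<^bsub>Q\<^esub> u"
      using that by simp
    also have "\<dots> = J (a \<otimes>\<^bsub>A\<^esub> c) \<one>\<^bsub>A\<^esub> \<odot>\<^bsub>Q\<^esub> (J \<one>\<^bsub>A\<^esub> (th b) \<odot>\<^bsub>Q\<^esub> u)"
      using that u'(1) by (simp only: Q.smult_assoc1 J_closed A.m_closed A.one_closed u'(2)[OF that(2)])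
    also have "\<dots> = J a (th b) \<odot>\<^bsub>Q\<^esub> (J c \<one>\<^bsub>A\<^esub> \<odot>\<^bsub>Q\<^esub> u)"
      using that u'(1) by (simp add: Q.smult_assoc1[symmetric])
    finally show ?thesis .
  qed
  have add: "J (a \<oplus>\<^bsub>A\<^esub> b) \<one>\<^bsub>A\<^esub> \<odot>\<^bsub>Q\<^esub> u = J a \<one>\<^bsub>A\<^esub> \<odot>\<^bsub>Q\<^esub> u \<oplus>\<^bsub>Q\<^esub> J b \<one>\<^bsub>A\<^esub> \<odot>\<^bsub>Q\<^esub> u"
    if "a \<in> carrier A" "b \<in> carrier A" for a b
    using that u' lin_add[OF J_left[OF A.one_closed]] by (simp add: Q.smult_l_distr)
  show ?thesis
  proof (rule linear_mapsI)
    fix e c assume "e \<in> carrier E" "c \<in> carrier AL"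
    then show "J (e \<odot>\<^bsub>AL\<^esub> c) \<one>\<^bsub>A\<^esub> \<odot>\<^bsub>Q\<^esub> u = e \<odot>\<^bsub>twist Q\<^esub> (J c \<one>\<^bsub>A\<^esub> \<odot>\<^bsub>Q\<^esub> u)"
    proof (induction e rule: E_induct)
      case (J a b)
      then show ?case using \<open>\<And>a b c. _ \<Longrightarrow> _ \<Longrightarrow> _ \<Longrightarrow> J (a \<otimes>\<^bsub>A\<^esub> c \<otimes>\<^bsub>A\<^esub> b) _ \<odot>\<^bsub>Q\<^esub> u = _\<close>[of a b c] by (simp add: AL_J al_J AL_simps)
    next
      case (add e f)
      have "e \<odot>\<^bsub>AL\<^esub> c \<in> carrier A" "f \<odot>\<^bsub>AL\<^esub> c \<in> carrier A"
        using AL.smult_closed[of e c] AL.smult_closed[of f c] add by (auto simp: AL_simps)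
      then show ?case
        using add AL.smult_l_distr[of e f c] u' \<open>\<And>a b. _ \<Longrightarrow> _ \<Longrightarrow> J (a \<oplus>\<^bsub>A\<^esub> b) _ \<odot>\<^bsub>Q\<^esub> u = _\<close>[of "e \<odot>\<^bsub>AL\<^esub> c" "f \<odot>\<^bsub>AL\<^esub> c"]
        by (simp add: AL_simps Q.smult_l_distr)
    qed
  qed (use add u' in \<open>auto simp: AL_simps\<close>)
qed

end

section \<open>Cohomology of a complete resolution through invariants and coinvariants\<close>

locale tate_complex = twisted_pair k A E J I x y lam nu Lam AL th al
  for k :: "'k ring" and A :: "('k, 'a) module" and E :: "('k, 'e) module"
    and J and I :: "'i set" and x y lam nu Lam AL th al +
  fixes T :: "int \<Rightarrow> ('e, 'm) module" and d :: "int \<Rightarrow> 'm \<Rightarrow> 'm" and \<eta> :: "'m \<Rightarrow> 'a"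
    and S :: "int \<Rightarrow> 's set" and q :: "int \<Rightarrow> 's \<Rightarrow> 'm" and \<phi> :: "int \<Rightarrow> 's \<Rightarrow> 'm \<Rightarrow> 'e"
  assumes T_mod: "left_module E (T n)" and dT: "d n \<in> linear_maps E (T n) (T (n - 1))"
    and proj: "dual_basis E (T n) (S n) (q n) (\<phi> n)"
    and exact: "t \<in> carrier (T n) \<Longrightarrow> d n t = \<zero>\<^bsub>T (n - 1)\<^esub> \<longleftrightarrow> t \<in> d (n + 1) ` carrier (T (n + 1))"
    and ext_reg: "\<lbrakk>u \<in> linear_maps E (T n) regE; \<And>t. t \<in> carrier (T (n + 1)) \<Longrightarrow> u (d (n + 1) t) = \<zero>\<^bsub>E\<^esub>\<rbrakk>
      \<Longrightarrow> \<exists>w\<in>linear_maps E (T (n - 1)) regE. \<forall>t\<in>carrier (T n). w (d n t) = u t"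
    and eta: "\<eta> \<in> linear_maps E (T 0) AL" and eta_onto: "\<eta> ` carrier (T 0) = carrier AL"
    and eta_kernel: "t \<in> carrier (T 0) \<Longrightarrow> \<eta> t = \<zero>\<^bsub>AL\<^esub> \<longleftrightarrow> t \<in> d 1 ` carrier (T 1)"
begin

lemma dT1: "d (n + 1) \<in> linear_maps E (T (n + 1)) (T n)"
  using dT[of "n + 1"] by simp

text \<open>The second complex is the twist of \<open>T\<close>, so that its augmentation lands in
  the coefficients \<open>twist AL\<close>. Lifting uses the dual bases of the source, extension
  uses the twisted dual bases of the target and \<open>ext_reg\<close>, and a map out of
  \<open>AL\<close> is determined by its value at \<open>\<one>\<close>.\<close>

sublocale B: balanced k E T "\<lambda>j. twist (T j)" d AL "twist AL" \<eta> "\<one>\<^bsub>A\<^esub>"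
proof (intro balanced.intro balanced_axioms.intro)
  show "k_algebra k E" by (rule E.k_algebra_axioms)
  show "d i \<in> linear_maps E (twist (T i)) (twist (T (i - 1)))" for i by (rule twist_linear[OF dT])
next
  fix g i j assume "g \<in> linear_maps E (T i) (twist (T j))"
    and "\<And>t. t \<in> carrier (T i) \<Longrightarrow> g t \<in> d (j + 1) ` carrier (twist (T (j + 1)))"
  then show "\<exists>f\<in>linear_maps E (T i) (twist (T (j + 1))). \<forall>t\<in>carrier (T i). d (j + 1) (f t) = g t"
    by (intro dual_basis_lift[OF proj T_mod twist_module[OF T_mod] twist_module[OF T_mod] twist_linear[OF dT1]])
next
  fix g i j assume g: "g \<in> linear_maps E (T i) (twist (T j))"
    and g0: "\<And>t. t \<in> carrier (T (i + 1)) \<Longrightarrow> g (d (i + 1) t) = \<zero>\<^bsub>twist (T j)\<^esub>"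
  show "\<exists>f\<in>linear_maps E (T (i - 1)) (twist (T j)). \<forall>t\<in>carrier (T i). f (d i t) = g t"
  proof (rule dual_basis_extend[OF dual_basis_twist[OF proj T_mod] twist_module[OF T_mod] T_mod T_mod dT g,
      where U = "d (i + 1) ` carrier (T (i + 1))"])
    fix t assume "t \<in> d (i + 1) ` carrier (T (i + 1))"
    then show "t \<in> carrier (T i) \<and> g t = \<zero>\<^bsub>twist (T j)\<^esub>" using g0 lin_closed[OF dT1] by auto
  qed (use ext_reg in auto)
next
  fix h i assume h: "h \<in> linear_maps E (T i) (twist AL)"
  show "\<exists>f\<in>linear_maps E (T i) (twist (T 0)). \<forall>t\<in>carrier (T i). \<eta> (f t) = h t"
    by (rule dual_basis_lift[OF proj T_mod twist_module[OF T_mod] twist_module[OF AL_module] twist_linear[OF eta] h])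
      (use lin_closed[OF h] eta_onto in auto)
next
  fix p p' j a assume *: "p \<in> linear_maps E AL (twist (T j))" "p' \<in> linear_maps E AL (twist (T j))"
    "p \<one>\<^bsub>A\<^esub> = p' \<one>\<^bsub>A\<^esub>" "a \<in> carrier AL"
  then show "p a = p' a"
    using AL_eval[OF T_mod *(1), of a] AL_eval[OF T_mod *(2), of a] by (simp add: AL_simps)
qed (use T_mod AL_module twist_module dT twist_linear eta eta_onto eta_kernel exact in
    \<open>auto simp: AL_simps\<close>)

text \<open>Every invariant \<open>u\<close> is the value at \<open>\<one>\<close> of the map
  \<open>a \<mapsto> a u\<close>, and every such value is invariant.\<close>

lemma point_values: "B.point_values j = invariants (T j)"
proof
  show "B.point_values j \<subseteq> invariants (T j)"
    using AL_eval_invariant[OF T_mod] by (auto simp: B.point_values_def)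
  show "invariants (T j) \<subseteq> B.point_values j"
  proof
    fix u assume u: "u \<in> invariants (T j)"
    interpret Tj: lmod E "T j" by (rule lmod.intro[OF T_mod])
    have "u = J \<one>\<^bsub>A\<^esub> \<one>\<^bsub>A\<^esub> \<odot>\<^bsub>T j\<^esub> u" using u by (simp add: J_one invariants_def)
    then show "u \<in> B.point_values j"
      unfolding B.point_values_def
      by (intro CollectI exI[of _ "\<lambda>a. J a \<one>\<^bsub>A\<^esub> \<odot>\<^bsub>T j\<^esub> u"] conjI invariant_AL_map[OF T_mod u])
  qed
qed

text \<open>Cycles of the complex of coinvariants, pulled back to \<open>T m\<close>. Since
  \<open>coinv_boundaries\<close> contains the relations as well, the homology of the coinvariants
  becomes a subquotient of \<open>T m\<close>.\<close>

definition coinv_cycles :: "int \<Rightarrow> 'm set" where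
  "coinv_cycles m = {t \<in> carrier (T m). d m t \<in> coinv_relations (T (m - 1))}"

definition coinv_boundaries :: "int \<Rightarrow> 'm set" where
  "coinv_boundaries m = {u \<oplus>\<^bsub>T m\<^esub> d (m + 1) t |u t. u \<in> coinv_relations (T m) \<and> t \<in> carrier (T (m + 1))}"

abbreviation rs :: "int \<Rightarrow> ('k, 'm) module" where
  "rs m \<equiv> restrict_scalars E (T m)"

lemma rs_mod: "left_module k (rs m)"
  by (rule rs_module[OF T_mod])

lemma d_rs: "lmap k (rs m) (rs (m - 1)) (d m)"
  by (intro lmapI rs_mod E.linear_maps_restrict_scalars dT)

lemma d_rs1: "lmap k (rs (m + 1)) (rs m) (d (m + 1))"
  by (intro lmapI rs_mod E.linear_maps_restrict_scalars dT1)

lemma coinv_carrier: "t \<in> coinv_relations (T m) \<Longrightarrow> t \<in> carrier (T m)"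
  using submodule_mem[OF coinv_submodule[OF T_mod]] by simp

lemma coinv_cycles_submodule: "submodule (coinv_cycles m) k (rs m)"
  using lmap.vimage_submodule[OF d_rs coinv_submodule[OF T_mod]] by (simp add: coinv_cycles_def)

lemma coinv_boundaries_mem:
  shows "t \<in> coinv_relations (T m) \<Longrightarrow> t \<in> coinv_boundaries m"
    and "t' \<in> carrier (T (m + 1)) \<Longrightarrow> d (m + 1) t' \<in> coinv_boundaries m"
proof -
  interpret Tm: lmod E "T m" by (rule lmod.intro[OF T_mod])
  interpret d: lmap E "T (m + 1)" "T m" "d (m + 1)" by (rule lmapI[OF T_mod T_mod dT1])
  show "t \<in> coinv_boundaries m" if t: "t \<in> coinv_relations (T m)"
    unfolding coinv_boundaries_def
    using coinv_carrier[OF t] t by (intro CollectI exI[of _ t] exI[of _ "\<zero>\<^bsub>T (m + 1)\<^esub>"]) simp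
  show "d (m + 1) t' \<in> coinv_boundaries m" if t: "t' \<in> carrier (T (m + 1))"
    unfolding coinv_boundaries_def
    using t submodule_zero_closed[OF coinv_submodule[OF T_mod[of m]]]
    by (intro CollectI exI[of _ "\<zero>\<^bsub>T m\<^esub>"] exI[of _ t']) simp
qed

lemma coinv_boundaries_submodule: "submodule (coinv_boundaries m) k (rs m)"
proof -
  interpret d: lmap k "rs (m + 1)" "rs m" "d (m + 1)" by (rule d_rs1)
  note C = submoduleD[OF coinv_submodule[OF T_mod[of m]]]
  show ?thesis
  proof (rule d.N.submodule_intro)
    show "coinv_boundaries m \<subseteq> carrier (rs m)"
      using lin_closed[OF dT1] coinv_carrier d.N.M.a_closed by (auto simp: coinv_boundaries_def)
    show "\<zero>\<^bsub>rs m\<^esub> \<in> coinv_boundaries m" using coinv_boundaries_mem(1)[OF C(3)] .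
  next
    fix t t' assume "t \<in> coinv_boundaries m" "t' \<in> coinv_boundaries m"
    then obtain u v u' v' where *: "u \<in> coinv_relations (T m)" "v \<in> carrier (T (m + 1))"
      "t = u \<oplus>\<^bsub>rs m\<^esub> d (m + 1) v" "u' \<in> coinv_relations (T m)" "v' \<in> carrier (T (m + 1))"
      "t' = u' \<oplus>\<^bsub>rs m\<^esub> d (m + 1) v'" by (auto simp: coinv_boundaries_def)
    have cl: "u \<in> carrier (rs m)" "u' \<in> carrier (rs m)" "d (m + 1) v \<in> carrier (rs m)" "d (m + 1) v' \<in> carrier (rs m)"
      using * coinv_carrier lin_closed[OF dT1] by auto
    have "t \<oplus>\<^bsub>rs m\<^esub> t' = (u \<oplus>\<^bsub>rs m\<^esub> u') \<oplus>\<^bsub>rs m\<^esub> d (m + 1) (v \<oplus>\<^bsub>rs (m + 1)\<^esub> v')"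
      using * cl d.N.M.a_ac d.N.M.a_closed lin_add[OF d.map, of v v'] by (simp del: restrict_scalars_simps(2))
    moreover have "v \<oplus>\<^bsub>rs (m + 1)\<^esub> v' \<in> carrier (T (m + 1))" using d.M.M.a_closed[of v v'] * by simp
    ultimately show "t \<oplus>\<^bsub>rs m\<^esub> t' \<in> coinv_boundaries m"
      using C(4)[OF *(1,4)] unfolding coinv_boundaries_def by auto
  next
    fix r t assume r: "r \<in> carrier k" "t \<in> coinv_boundaries m"
    then obtain u v where *: "u \<in> coinv_relations (T m)" "v \<in> carrier (T (m + 1))"
      "t = u \<oplus>\<^bsub>rs m\<^esub> d (m + 1) v" by (auto simp: coinv_boundaries_def)
    have cl: "u \<in> carrier (rs m)" "d (m + 1) v \<in> carrier (rs m)"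
      using * coinv_carrier lin_closed[OF dT1] by auto
    have "r \<odot>\<^bsub>rs m\<^esub> t = (r \<odot>\<^bsub>rs m\<^esub> u) \<oplus>\<^bsub>rs m\<^esub> d (m + 1) (r \<odot>\<^bsub>rs (m + 1)\<^esub> v)"
      using * cl r d.N.smult_r_distr lin_smult[OF d.map, of r v] by (simp del: restrict_scalars_simps(2,4))
    moreover have "r \<odot>\<^bsub>rs (m + 1)\<^esub> v \<in> carrier (T (m + 1))" using d.M.smult_closed[of r v] * r by simp
    ultimately show "r \<odot>\<^bsub>rs m\<^esub> t \<in> coinv_boundaries m"
      using C(7)[OF r(1) *(1)] unfolding coinv_boundaries_def by auto
  qed
qed

lemma dd: "t \<in> carrier (T (m + 1)) \<Longrightarrow> d m (d (m + 1) t) = \<zero>\<^bsub>T (m - 1)\<^esub>"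
  using exact[of "d (m + 1) t" m] lin_closed[OF dT1] by auto

text \<open>The isomorphism is multiplication by the norm element.\<close>

lemma invariants_coinv_iso:
  "subquotient_iso k (restrict_scalars E (twist (T m)))
     {t \<in> invariants (T m). d m t = \<zero>\<^bsub>T (m - 1)\<^esub>} (d (m + 1) ` invariants (T (m + 1)))
     (rs m) (coinv_cycles m) (coinv_boundaries m)"
proof (rule subquotient_isoI[where Q = "\<lambda>u t. t \<in> coinv_cycles m \<and> u = norm_element \<odot>\<^bsub>T m\<^esub> t"])
  interpret Tm: lmod E "T m" by (rule lmod.intro[OF T_mod])
  interpret Tm1: lmod E "T (m + 1)" by (rule lmod.intro[OF T_mod])
  interpret Tm': lmod E "T (m - 1)" by (rule lmod.intro[OF T_mod])
  have cyc: "t \<in> carrier (T m)" "d m t \<in> coinv_relations (T (m - 1))" if "t \<in> coinv_cycles m" for t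
    using that by (auto simp: coinv_cycles_def)
  have dn: "d m (norm_element \<odot>\<^bsub>T m\<^esub> t) = norm_element \<odot>\<^bsub>T (m - 1)\<^esub> d m t" if "t \<in> carrier (T m)" for t
    using lin_smult[OF dT] that by simp
  have dn1: "d (m + 1) (norm_element \<odot>\<^bsub>T (m + 1)\<^esub> t) = norm_element \<odot>\<^bsub>T m\<^esub> d (m + 1) t" if "t \<in> carrier (T (m + 1))" for t
    using lin_smult[OF dT1] that by simp
  {
    fix u t assume *: "t \<in> coinv_cycles m \<and> u = norm_element \<odot>\<^bsub>T m\<^esub> t"
    then show "u \<in> {t \<in> invariants (T m). d m t = \<zero>\<^bsub>T (m - 1)\<^esub>} \<and> t \<in> coinv_cycles m"
      using cyc norm_invariant[OF T_mod] norm_coinv[OF T_mod] dn by auto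
    have t: "t \<in> carrier (T m)" using * cyc by auto
    {
      assume "u \<in> d (m + 1) ` invariants (T (m + 1))"
      then obtain v where v: "v \<in> invariants (T (m + 1))" "u = d (m + 1) v" by auto
      obtain w where w: "w \<in> carrier (T (m + 1))" "v = norm_element \<odot>\<^bsub>T (m + 1)\<^esub> w"
        using invariants_norm[OF T_mod proj v(1)] by auto
      have dw: "d (m + 1) w \<in> carrier (T m)" using lin_closed[OF dT1 w(1)] .
      have "norm_element \<odot>\<^bsub>T m\<^esub> (t \<ominus>\<^bsub>T m\<^esub> d (m + 1) w) = \<zero>\<^bsub>T m\<^esub>"
        using * v w dn1 t dw by (simp add: Tm.smult_r_diff Tm.diff_eq_zero_iff)
      then have "t \<ominus>\<^bsub>T m\<^esub> d (m + 1) w \<in> coinv_relations (T m)"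
        using norm_kernel[OF T_mod proj] t dw by simp
      then have "(t \<ominus>\<^bsub>T m\<^esub> d (m + 1) w) \<oplus>\<^bsub>T m\<^esub> d (m + 1) w \<in> coinv_boundaries m"
        unfolding coinv_boundaries_def using w(1) by blast
      then show "t \<in> coinv_boundaries m" using Tm.add_diff_cancel[OF t dw] by simp
    next
      assume "t \<in> coinv_boundaries m"
      then obtain s w where w: "s \<in> coinv_relations (T m)" "w \<in> carrier (T (m + 1))" "t = s \<oplus>\<^bsub>T m\<^esub> d (m + 1) w"
        by (auto simp: coinv_boundaries_def)
      then have "u = d (m + 1) (norm_element \<odot>\<^bsub>T (m + 1)\<^esub> w)"
        using * dn1 norm_coinv[OF T_mod w(1)] coinv_carrier[OF w(1)] lin_closed[OF dT1 w(2)]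
        by (simp add: Tm.smult_r_distr)
      then show "u \<in> d (m + 1) ` invariants (T (m + 1))"
        using norm_invariant[OF T_mod w(2)] by blast
    }
  next
    fix u t u' t' assume "t \<in> coinv_cycles m \<and> u = norm_element \<odot>\<^bsub>T m\<^esub> t"
      "t' \<in> coinv_cycles m \<and> u' = norm_element \<odot>\<^bsub>T m\<^esub> t'"
    then show "t \<oplus>\<^bsub>rs m\<^esub> t' \<in> coinv_cycles m \<and>
      u \<oplus>\<^bsub>restrict_scalars E (twist (T m))\<^esub> u' = norm_element \<odot>\<^bsub>T m\<^esub> (t \<oplus>\<^bsub>rs m\<^esub> t')"
      using submodule_add_closed[OF coinv_cycles_submodule] cyc by (auto simp: Tm.smult_r_distr)
  next
    fix r u t assume r: "r \<in> carrier k" and "t \<in> coinv_cycles m \<and> u = norm_element \<odot>\<^bsub>T m\<^esub> t"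
    then show "r \<odot>\<^bsub>rs m\<^esub> t \<in> coinv_cycles m \<and>
      r \<odot>\<^bsub>restrict_scalars E (twist (T m))\<^esub> u = norm_element \<odot>\<^bsub>T m\<^esub> (r \<odot>\<^bsub>rs m\<^esub> t)"
      using submodule_smult_closed[OF coinv_cycles_submodule] cyc lin_smult[OF act_linear[OF T_mod norm_element_closed] r, of t m]
      by (auto simp: al_scal)
  next
    fix u assume "u \<in> {t \<in> invariants (T m). d m t = \<zero>\<^bsub>T (m - 1)\<^esub>}"
    then have u: "u \<in> invariants (T m)" "d m u = \<zero>\<^bsub>T (m - 1)\<^esub>" by auto
    obtain t where t: "t \<in> carrier (T m)" "u = norm_element \<odot>\<^bsub>T m\<^esub> t"
      using invariants_norm[OF T_mod proj u(1)] by auto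
    have "d m t \<in> coinv_relations (T (m - 1))"
      using norm_kernel[OF T_mod proj lin_closed[OF dT t(1)]] dn[OF t(1)] t u by simp
    then show "\<exists>t. t \<in> coinv_cycles m \<and> u = norm_element \<odot>\<^bsub>T m\<^esub> t"
      using t by (auto simp: coinv_cycles_def)
  }
qed auto

text \<open>\<open>lam\<close> turns \<open>g\<close> into a functional on the coinvariants, and
  coboundaries become functionals that factor through \<open>d m\<close>. Over a field a functional
  that vanishes on the kernel of a map factors through it: it descends to the image and extends from
  there.\<close>

lemma coboundary_iff:
  assumes g: "g \<in> linear_maps E (T m) (twist AL)" "g \<in> extensional (carrier (T m))"
  shows "g \<in> precompose (T m) (d m) ` carrier (hom_space E (T (m - 1)) (twist AL)) \<longleftrightarrow>
    (\<forall>t\<in>coinv_cycles m. lam (g t) = \<zero>\<^bsub>k\<^esub>)"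
proof -
  note bd = E.hom_boundaries_iff[OF T_mod T_mod dT]
  show ?thesis
  proof
    assume "g \<in> precompose (T m) (d m) ` carrier (hom_space E (T (m - 1)) (twist AL))"
    then obtain u where "u \<in> linear_maps E (T (m - 1)) (twist AL)" "\<And>t. t \<in> carrier (T m) \<Longrightarrow> g t = u (d m t)"
      unfolding bd by auto
    then show "\<forall>t\<in>coinv_cycles m. lam (g t) = \<zero>\<^bsub>k\<^esub>"
      using lam_functional(2)[OF T_mod] by (auto simp: coinv_cycles_def)
  next
    assume 0: "\<forall>t\<in>coinv_cycles m. lam (g t) = \<zero>\<^bsub>k\<^esub>"
    let ?X = "rs (m - 1)"
    interpret X: vspace k ?X by (intro vspace.intro lmod.intro rs_mod A.K.field_axioms)
    interpret V: vspace k "rs m" by (intro vspace.intro lmod.intro rs_mod A.K.field_axioms)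
    interpret d: lmap k "rs m" ?X "d m" by (rule d_rs)
    interpret rk: lmod k "regular_module k" by (intro lmod.intro regular_left_module A.K.ring_axioms)
    define D where "D = d m ` carrier (T m)"
    have D: "submodule D k ?X" using d.image_submodule[OF V.submodule_carrier] by (simp add: D_def)
    \<comment> \<open>A basis of the image of \<open>d m\<close> modulo the relations. Its
      coordinate functionals are defined on all of \<open>T (m - 1)\<close>, which provides the
      extension.\<close>
    obtain W \<psi> where "X.dual_family (coinv_relations (T (m - 1))) D W \<psi>"
      using X.dual_family_exists[OF restrict_scalars_finite[OF T_mod proj] coinv_submodule[OF T_mod] D] by auto
    then have W: "finite W" "W \<subseteq> D"
      and psi: "\<And>w. w \<in> W \<Longrightarrow> \<psi> w \<in> functionals k ?X" "\<And>w b. \<lbrakk>w \<in> W; b \<in> coinv_relations (T (m - 1))\<rbrakk> \<Longrightarrow> \<psi> w b = \<zero>\<^bsub>k\<^esub>"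
      and res: "\<And>z. z \<in> D \<Longrightarrow> X.residue W \<psi> z \<in> coinv_relations (T (m - 1))"
      unfolding X.dual_family_def by blast+
    have "\<forall>w\<in>W. \<exists>t\<in>carrier (T m). w = d m t" using W(2) by (auto simp: D_def)
    then obtain t where t: "\<And>w. w \<in> W \<Longrightarrow> t w \<in> carrier (T m)" "\<And>w. w \<in> W \<Longrightarrow> w = d m (t w)" by metis
    note f = lam_functional(1)[OF T_mod g(1)]
    have gA: "lam (g s) \<in> carrier k" if "s \<in> carrier (T m)" for s
      using lin_closed[OF f] that by simp
    have psic: "\<psi> w s \<in> carrier k" if "w \<in> W" "s \<in> carrier (T (m - 1))" for w s
      using lin_closed[OF psi(1)[OF that(1)], of s] that(2) by simp
    \<comment> \<open>The functional that takes the prescribed value \<open>lam (g (t w))\<close> at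
      each basis element \<open>w = d m (t w)\<close>.\<close>
    define h where "h s = (\<Oplus>\<^bsub>regular_module k\<^esub>w\<in>W. \<psi> w s \<otimes>\<^bsub>k\<^esub> lam (g (t w)))" for s
    have h_eq: "h s = (\<Oplus>\<^bsub>k\<^esub>w\<in>W. \<psi> w s \<otimes>\<^bsub>k\<^esub> lam (g (t w)))" for s
      unfolding h_def by (simp add: finsum_def finprod_def)
    have h: "h \<in> functionals k ?X" unfolding h_def
    proof (rule linear_maps_finsum[OF rk.left_module_axioms W(1)])
      fix w assume w: "w \<in> W"
      show "(\<lambda>s. \<psi> w s \<otimes>\<^bsub>k\<^esub> lam (g (t w))) \<in> functionals k ?X"
        using linear_maps_comp[OF psi(1)[OF w] orbit_linear[OF rk.left_module_axioms, of "lam (g (t w))"]]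
          gA t(1) w by simp
    qed
    have h0: "h b = \<zero>\<^bsub>k\<^esub>" if b: "b \<in> coinv_relations (T (m - 1))" for b
    proof -
      have "h b = (\<Oplus>\<^bsub>k\<^esub>w\<in>W. \<zero>\<^bsub>k\<^esub>)"
        unfolding h_eq using psi(2) b gA t by (intro A.K.finsum_cong') auto
      then show ?thesis by simp
    qed
    have key: "lam (g s) = h (d m s)" if s: "s \<in> carrier (T m)" for s
    proof -
      let ?c = "\<lambda>w. \<psi> w (d m s)"
      have ds: "d m s \<in> carrier (T (m - 1))" using lin_closed[OF dT s] .
      have c: "?c w \<in> carrier k" if "w \<in> W" for w using psic[OF that ds] .
      define s' where "s' = (\<Oplus>\<^bsub>rs m\<^esub>w\<in>W. ?c w \<odot>\<^bsub>rs m\<^esub> t w)"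
      have ct: "?c w \<odot>\<^bsub>rs m\<^esub> t w \<in> carrier (rs m)" if "w \<in> W" for w
        using V.smult_closed[OF c[OF that], of "t w"] t(1)[OF that] by simp
      have s': "s' \<in> carrier (rs m)" unfolding s'_def using ct by (intro V.M.finsum_closed) auto
      have "d m s' = (\<Oplus>\<^bsub>?X\<^esub>w\<in>W. d m (?c w \<odot>\<^bsub>rs m\<^esub> t w))"
        unfolding s'_def using ct by (intro d.map_finsum W) auto
      also have "\<dots> = (\<Oplus>\<^bsub>?X\<^esub>w\<in>W. ?c w \<odot>\<^bsub>?X\<^esub> w)"
      proof (intro X.M.finsum_cong' refl)
        fix w assume w: "w \<in> W"
        show "d m (?c w \<odot>\<^bsub>rs m\<^esub> t w) = ?c w \<odot>\<^bsub>?X\<^esub> w"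
          using lin_smult[OF d.map c[OF w], of "t w"] t[OF w] by simp
      next
        show "(\<lambda>w. ?c w \<odot>\<^bsub>?X\<^esub> w) \<in> W \<rightarrow> carrier ?X"
          using X.smult_closed[OF c] W(2) submodule_mem[OF D] by blast
      qed
      \<comment> \<open>The element \<open>s'\<close> accounts for the coordinates of
        \<open>d m s\<close>. What remains of \<open>s\<close> is a cycle modulo the relations,
        where \<open>lam g\<close> vanishes by assumption.\<close>
      finally have "d m (s \<ominus>\<^bsub>rs m\<^esub> s') = X.residue W \<psi> (d m s)"
        using d.map_diff[of s s'] s s' by (simp add: X.residue_def del: restrict_scalars_simps(2,4) a_minus_restrict_scalars)
      then have "s \<ominus>\<^bsub>rs m\<^esub> s' \<in> coinv_cycles m"
        using res[of "d m s"] s s' V.diff_closed[of s s'] by (auto simp: coinv_cycles_def D_def simp del: a_minus_restrict_scalars)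
      then have z: "lam (g (s \<ominus>\<^bsub>rs m\<^esub> s')) = \<zero>\<^bsub>k\<^esub>" using 0 by blast
      interpret f: lmap k "rs m" "regular_module k" "\<lambda>p. lam (g p)"
        by (rule lmapI[OF rs_mod rk.left_module_axioms f])
      have "lam (g s) = lam (g s')"
        by (rule iffD1[OF rk.diff_eq_zero_iff]) (use z f.map_diff[of s s'] s s' gA in auto)
      also have "\<dots> = h (d m s)"
        unfolding s'_def h_eq using V.functional_finsum[OF f W(1), of ?c t] c t(1) by simp
      finally show ?thesis .
    qed
    obtain u where u: "u \<in> linear_maps E (T (m - 1)) (twist AL)" "\<And>s. s \<in> carrier (T (m - 1)) \<Longrightarrow> lam (u s) = h s"
      using functional_lift[OF T_mod h h0] by blast
    have "g s = u (d m s)" if "s \<in> carrier (T m)" for s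
      by (rule lam_functional_inject[OF T_mod g(1) linear_maps_comp[OF dT u(1)] _ that])
        (use key u(2) lin_closed[OF dT] in auto)
    then show "g \<in> precompose (T m) (d m) ` carrier (hom_space E (T (m - 1)) (twist AL))"
      unfolding bd using g(2) u(1) by auto
  qed
qed

text \<open>Through \<open>lam\<close> the cohomology is the dual of the homology of the
  coinvariants, which is finite-dimensional. The dual family identifies that homology with its dual:
  \<open>g\<close> is related to \<open>z\<close> when the value of \<open>lam g\<close> at each
  \<open>w\<close> in \<open>W\<close> is the \<open>w\<close>-coordinate of
  \<open>z\<close>.\<close>

lemma cohomology_coinv_dual:
  "subquotient_iso k (hom_space E (T m) (twist AL))
     (cycles (hom_space E (T m) (twist AL)) (hom_space E (T (m + 1)) (twist AL)) (precompose (T (m + 1)) (d (m + 1))))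
     (precompose (T m) (d m) ` carrier (hom_space E (T (m - 1)) (twist AL)))
     (rs m) (coinv_cycles m) (coinv_boundaries m)"
proof -
  let ?H = "hom_space E (T m) (twist AL)"
  let ?Z = "cycles ?H (hom_space E (T (m + 1)) (twist AL)) (precompose (T (m + 1)) (d (m + 1)))"
  interpret V: vspace k "rs m" by (intro vspace.intro lmod.intro rs_mod A.K.field_axioms)
  interpret rk: lmod k "regular_module k" by (intro lmod.intro regular_left_module A.K.ring_axioms)
  interpret H: lmod k ?H by (intro lmod.intro E.hom_space_module T_mod twist_module AL_module)
  obtain W \<psi> where D: "V.dual_family (coinv_boundaries m) (coinv_cycles m) W \<psi>"
    using V.dual_family_exists[OF restrict_scalars_finite[OF T_mod proj] coinv_boundaries_submodule coinv_cycles_submodule] by auto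
  then have W: "finite W" "W \<subseteq> coinv_cycles m"
    and psi: "\<And>w. w \<in> W \<Longrightarrow> \<psi> w \<in> functionals k (rs m)"
      "\<And>w b. \<lbrakk>w \<in> W; b \<in> coinv_boundaries m\<rbrakk> \<Longrightarrow> \<psi> w b = \<zero>\<^bsub>k\<^esub>"
      "\<And>w v. \<lbrakk>w \<in> W; v \<in> W\<rbrakk> \<Longrightarrow> \<psi> w v = (if v = w then \<one>\<^bsub>k\<^esub> else \<zero>\<^bsub>k\<^esub>)"
    and res: "\<And>z. z \<in> coinv_cycles m \<Longrightarrow> V.residue W \<psi> z \<in> coinv_boundaries m"
    unfolding V.dual_family_def by blast+
  have Wc: "w \<in> carrier (T m)" if "w \<in> W" for w using that W(2) by (auto simp: coinv_cycles_def)
  have psic: "\<psi> w s \<in> carrier k" if "w \<in> W" "s \<in> carrier (T m)" for w s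
    using lin_closed[OF psi(1)[OF that(1)], of s] that(2) by simp
  have Zc: "coinv_cycles m \<subseteq> carrier (rs m)" by (auto simp: coinv_cycles_def)
  have cyc: "g \<in> ?Z \<longleftrightarrow> g \<in> linear_maps E (T m) (twist AL) \<and> g \<in> extensional (carrier (T m)) \<and>
      (\<forall>t\<in>carrier (T (m + 1)). g (d (m + 1) t) = \<zero>\<^bsub>twist AL\<^esub>)" for g
    by (rule E.hom_cycles_iff) (rule lin_closed[OF dT1])
  interpret lam: lmap k A "regular_module k" lam by (rule lam_lmap)
  \<comment> \<open>A cocycle induces a functional on homology: relations are killed by
    \<open>lam_functional\<close>, the image of the differential by the cocycle condition.\<close>
  have gB: "lam (g b) = \<zero>\<^bsub>k\<^esub>" if g: "g \<in> ?Z" and b: "b \<in> coinv_boundaries m" for g b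
  proof -
    obtain u t where ut: "b = u \<oplus>\<^bsub>T m\<^esub> d (m + 1) t" "u \<in> coinv_relations (T m)" "t \<in> carrier (T (m + 1))"
      using b by (auto simp: coinv_boundaries_def)
    have gl: "g \<in> linear_maps E (T m) (twist AL)" and gd: "g (d (m + 1) t) = \<zero>\<^bsub>A\<^esub>"
      using g ut(3) unfolding cyc by (auto simp: AL_simps)
    have "g b = g u \<oplus>\<^bsub>A\<^esub> \<zero>\<^bsub>A\<^esub>"
      using ut lin_add[OF gl coinv_carrier[OF ut(2)] lin_closed[OF dT1 ut(3)]] gd by (simp add: AL_simps)
    then show ?thesis
      using lam_functional(2)[OF T_mod gl ut(2)] lin_closed[OF gl coinv_carrier[OF ut(2)]] by (simp add: AL_simps)
  qed
  have gl: "g \<in> linear_maps E (T m) (twist AL)" if "g \<in> ?Z" for g using that unfolding cyc by auto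
  have gk: "lam (g s) \<in> carrier k" if "g \<in> ?Z" "s \<in> carrier (T m)" for g s
    using lin_closed[OF gl[OF that(1)] that(2)] by (simp add: AL_simps)
  have expand: "lam (g z) = (\<Oplus>\<^bsub>k\<^esub>w\<in>W. \<psi> w z \<otimes>\<^bsub>k\<^esub> lam (g w))" if "g \<in> ?Z" "z \<in> coinv_cycles m" for g z
    by (rule V.functional_expand[OF D Zc lam_functional(1)[OF T_mod gl[OF that(1)]] gB[OF that(1)] that(2)])
  have Z_sub: "submodule ?Z k ?H"
    by (rule lmap.cycles_submodule, rule lmapI)
      (intro E.hom_space_module E.precompose_linear T_mod twist_module AL_module dT1)+
  show ?thesis
  proof (rule subquotient_isoI[where Q = "\<lambda>g z. g \<in> ?Z \<and> z \<in> coinv_cycles m \<and> (\<forall>w\<in>W. \<psi> w z = lam (g w))"])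
    fix g z assume *: "g \<in> ?Z \<and> z \<in> coinv_cycles m \<and> (\<forall>w\<in>W. \<psi> w z = lam (g w))"
    have zc: "z \<in> carrier (T m)" using * Zc by auto
    have g: "g \<in> linear_maps E (T m) (twist AL)" "g \<in> extensional (carrier (T m))" using * unfolding cyc by auto
    {
      assume "g \<in> precompose (T m) (d m) ` carrier (hom_space E (T (m - 1)) (twist AL))"
      then have "\<psi> w z = \<zero>\<^bsub>k\<^esub>" if "w \<in> W" for w
        using * that W(2) unfolding coboundary_iff[OF g] by auto
      then have "V.residue W \<psi> z = z"
        using W Zc zc by (intro V.residue_trivial) auto
      then show "z \<in> coinv_boundaries m" using res[of z] * by simp
    next
      assume "z \<in> coinv_boundaries m"
      then have 0: "lam (g w) = \<zero>\<^bsub>k\<^esub>" if "w \<in> W" for w using psi(2)[OF that] * that by force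
      have "lam (g s) = \<zero>\<^bsub>k\<^esub>" if s: "s \<in> coinv_cycles m" for s
      proof -
        have "lam (g s) = (\<Oplus>\<^bsub>k\<^esub>w\<in>W. \<zero>\<^bsub>k\<^esub>)"
          unfolding expand[OF conjunct1[OF *] s] using 0 psic s Zc by (intro A.K.finsum_cong') auto
        then show ?thesis by simp
      qed
      then show "g \<in> precompose (T m) (d m) ` carrier (hom_space E (T (m - 1)) (twist AL))"
        unfolding coboundary_iff[OF g] by blast
    }
  next
    fix g z g' z' assume *: "g \<in> ?Z \<and> z \<in> coinv_cycles m \<and> (\<forall>w\<in>W. \<psi> w z = lam (g w))"
      "g' \<in> ?Z \<and> z' \<in> coinv_cycles m \<and> (\<forall>w\<in>W. \<psi> w z' = lam (g' w))"
    show "g \<oplus>\<^bsub>?H\<^esub> g' \<in> ?Z \<and> z \<oplus>\<^bsub>rs m\<^esub> z' \<in> coinv_cycles m \<and>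
       (\<forall>w\<in>W. \<psi> w (z \<oplus>\<^bsub>rs m\<^esub> z') = lam ((g \<oplus>\<^bsub>?H\<^esub> g') w))"
    proof (intro conjI ballI)
      fix w assume w: "w \<in> W"
      have "lam ((g \<oplus>\<^bsub>?H\<^esub> g') w) = lam (g w) \<oplus>\<^bsub>k\<^esub> lam (g' w)"
        using lin_closed[OF gl Wc[OF w]] * w Wc[OF w] by (simp add: AL_simps)
      then show "\<psi> w (z \<oplus>\<^bsub>rs m\<^esub> z') = lam ((g \<oplus>\<^bsub>?H\<^esub> g') w)"
        using lin_add[OF psi(1)[OF w], of z z'] * w Zc by (auto simp del: restrict_scalars_simps(2))
    qed (use * submodule_add_closed[OF Z_sub] submodule_add_closed[OF coinv_cycles_submodule] in \<open>auto simp del: hom_space_simps restrict_scalars_simps\<close>)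
  next
    fix r g z assume r: "r \<in> carrier k" and *: "g \<in> ?Z \<and> z \<in> coinv_cycles m \<and> (\<forall>w\<in>W. \<psi> w z = lam (g w))"
    show "r \<odot>\<^bsub>?H\<^esub> g \<in> ?Z \<and> r \<odot>\<^bsub>rs m\<^esub> z \<in> coinv_cycles m \<and>
       (\<forall>w\<in>W. \<psi> w (r \<odot>\<^bsub>rs m\<^esub> z) = lam ((r \<odot>\<^bsub>?H\<^esub> g) w))"
    proof (intro conjI ballI)
      fix w assume w: "w \<in> W"
      have "(r \<odot>\<^bsub>?H\<^esub> g) w = g (r \<odot>\<^bsub>rs m\<^esub> w)"
        using lin_smult[OF gl, of g "r \<odot>\<^bsub>E\<^esub> \<one>\<^bsub>E\<^esub>" w] * r Wc[OF w] by simp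
      then have "lam ((r \<odot>\<^bsub>?H\<^esub> g) w) = r \<otimes>\<^bsub>k\<^esub> lam (g w)"
        using lin_smult[OF lam_functional(1)[OF T_mod gl], of g r w] * r Wc[OF w] by simp
      then show "\<psi> w (r \<odot>\<^bsub>rs m\<^esub> z) = lam ((r \<odot>\<^bsub>?H\<^esub> g) w)"
        using lin_smult[OF psi(1)[OF w] r, of z] * w Zc by (auto simp del: restrict_scalars_simps(4))
    qed (use * r submodule_smult_closed[OF Z_sub] submodule_smult_closed[OF coinv_cycles_submodule] in \<open>auto simp del: hom_space_simps restrict_scalars_simps\<close>)
  next
    fix g assume g: "g \<in> ?Z"
    \<comment> \<open>The combination of basis elements whose coordinates are the values of
      \<open>lam g\<close>.\<close>
    define z where "z = (\<Oplus>\<^bsub>rs m\<^esub>w\<in>W. lam (g w) \<odot>\<^bsub>rs m\<^esub> w)"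
    have "z \<in> coinv_cycles m" unfolding z_def
      by (rule V.submodule_finsum[OF coinv_cycles_submodule W(1)])
        (use submodule_smult_closed[OF coinv_cycles_submodule] gk[OF g] Wc W(2) in auto)
    moreover have "\<psi> v z = lam (g v)" if v: "v \<in> W" for v
    proof -
      have "\<psi> v z = (\<Oplus>\<^bsub>k\<^esub>w\<in>W. lam (g w) \<otimes>\<^bsub>k\<^esub> \<psi> v w)"
        unfolding z_def using V.functional_finsum[OF psi(1)[OF v] W(1), of "\<lambda>w. lam (g w)" "\<lambda>w. w"] gk[OF g] Wc by simp
      also have "\<dots> = (\<Oplus>\<^bsub>k\<^esub>w\<in>W. lam (g w) \<otimes>\<^bsub>k\<^esub> (if w = v then \<one>\<^bsub>k\<^esub> else \<zero>\<^bsub>k\<^esub>))"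
        using psi(3)[OF v] gk[OF g] Wc by (intro A.K.finsum_cong') auto
      also have "\<dots> = lam (g v)" using gk[OF g] Wc by (intro V.finsum_delta W v) auto
      finally show ?thesis .
    qed
    ultimately show "\<exists>z. g \<in> ?Z \<and> z \<in> coinv_cycles m \<and> (\<forall>w\<in>W. \<psi> w z = lam (g w))" using g by blast
  next
    fix z assume z: "z \<in> coinv_cycles m"
    have zc: "z \<in> carrier (T m)" using z Zc by auto
    \<comment> \<open>The functional whose value at each basis element is the corresponding
      coordinate of \<open>z\<close>. It vanishes on boundaries, so it comes from a cocycle.\<close>
    define f where "f s = (\<Oplus>\<^bsub>regular_module k\<^esub>w\<in>W. \<psi> w s \<otimes>\<^bsub>k\<^esub> \<psi> w z)" for s
    have f_eq: "f s = (\<Oplus>\<^bsub>k\<^esub>w\<in>W. \<psi> w s \<otimes>\<^bsub>k\<^esub> \<psi> w z)" for s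
      unfolding f_def by (simp add: finsum_def finprod_def)
    have f: "f \<in> functionals k (rs m)" unfolding f_def
    proof (rule linear_maps_finsum[OF rk.left_module_axioms W(1)])
      fix w assume w: "w \<in> W"
      show "(\<lambda>s. \<psi> w s \<otimes>\<^bsub>k\<^esub> \<psi> w z) \<in> functionals k (rs m)"
        using linear_maps_comp[OF psi(1)[OF w] orbit_linear[OF rk.left_module_axioms, of "\<psi> w z"]] psic[OF w zc] by simp
    qed
    have f0: "f b = \<zero>\<^bsub>k\<^esub>" if b: "b \<in> coinv_boundaries m" for b
    proof -
      have "f b = (\<Oplus>\<^bsub>k\<^esub>w\<in>W. \<zero>\<^bsub>k\<^esub>)"
        unfolding f_eq using psi(2) b psic zc by (intro A.K.finsum_cong') auto
      then show ?thesis by simp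
    qed
    have fW: "f v = \<psi> v z" if v: "v \<in> W" for v
    proof -
      have "f v = (\<Oplus>\<^bsub>k\<^esub>w\<in>W. \<psi> w z \<otimes>\<^bsub>k\<^esub> (if w = v then \<one>\<^bsub>k\<^esub> else \<zero>\<^bsub>k\<^esub>))"
        unfolding f_eq using psi(3)[OF _ v] psic zc by (intro A.K.finsum_cong') auto
      also have "\<dots> = \<psi> v z" using psic zc by (intro V.finsum_delta W v) auto
      finally show ?thesis .
    qed
    obtain g where g: "g \<in> linear_maps E (T m) (twist AL)" "\<And>s. s \<in> carrier (T m) \<Longrightarrow> lam (g s) = f s"
      using functional_lift[OF T_mod f f0[OF coinv_boundaries_mem(1)]] by blast
    have "g (d (m + 1) t) = \<zero>\<^bsub>twist AL\<^esub>" if t: "t \<in> carrier (T (m + 1))" for t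
    proof (rule lam_functional_inject[OF T_mod linear_maps_comp[OF dT1 g(1)] linear_maps_zero[OF twist_module[OF AL_module]] _ t])
      fix p assume p: "p \<in> carrier (T (m + 1))"
      then show "lam (g (d (m + 1) p)) = lam \<zero>\<^bsub>twist AL\<^esub>"
        using g(2)[OF lin_closed[OF dT1 p]] f0[OF coinv_boundaries_mem(2)[OF p]] lam.map_zero by (simp add: AL_simps)
    qed
    then have "restrict g (carrier (T m)) \<in> ?Z"
      unfolding cyc using E.restrict_linear_map[OF T_mod g(1)] lin_closed[OF dT1] by auto
    then show "\<exists>g. g \<in> ?Z \<and> z \<in> coinv_cycles m \<and> (\<forall>w\<in>W. \<psi> w z = lam (g w))"
      using z g(2) fW Wc by (intro exI[of _ "restrict g (carrier (T m))"]) auto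
  qed auto
qed

text \<open>Balancing leads to invariants in degree \<open>-n - 1\<close>, and the inverse of the
  norm replaces them by coinvariants.\<close>

theorem cohomology_coinv:
  "subquotient_iso k (hom_space E (T n) (twist AL))
     (cycles (hom_space E (T n) (twist AL)) (hom_space E (T (n + 1)) (twist AL)) (precompose (T (n + 1)) (d (n + 1))))
     (precompose (T n) (d n) ` carrier (hom_space E (T (n - 1)) (twist AL)))
     (rs (- n - 1)) (coinv_cycles (- n - 1)) (coinv_boundaries (- n - 1))"
proof -
  have e: "- n - 1 + 1 = - n" "- n - 1 - 1 = - n - 2" by simp_all
  show ?thesis
    using subquotient_iso_trans[OF B.cohomology_point_values[of n, unfolded point_values twist_simps]
      invariants_coinv_iso[of "- n - 1", unfolded e]] .
qed

text \<open>The coinvariants in degree \<open>-n - 1\<close> compute the cohomology in degree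
  \<open>n\<close> by balancing and the cohomology in degree \<open>-n - 1\<close> by vector space
  duality.\<close>

theorem cohomology_duality:
  "subquotient_iso k (hom_space E (T n) (twist AL))
     (cycles (hom_space E (T n) (twist AL)) (hom_space E (T (n + 1)) (twist AL)) (precompose (T (n + 1)) (d (n + 1))))
     (precompose (T n) (d n) ` carrier (hom_space E (T (n - 1)) (twist AL)))
     (hom_space E (T (- n - 1)) (twist AL))
     (cycles (hom_space E (T (- n - 1)) (twist AL)) (hom_space E (T (- n)) (twist AL)) (precompose (T (- n)) (d (- n))))
     (precompose (T (- n - 1)) (d (- n - 1)) ` carrier (hom_space E (T (- n - 2)) (twist AL)))"
proof -
  have e: "- n - 1 + 1 = - n" "- n - 1 - 1 = - n - 2" by simp_all
  show ?thesis
    by (rule subquotient_iso_trans[OF cohomology_coinv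
        subquotient_iso_sym[OF cohomology_coinv_dual[of "- n - 1", unfolded e]]])
qed

text \<open>The cohomology in degree \<open>n\<close> is the intermediary: vector space duality ties
  it to the coinvariants in degree \<open>n\<close>, balancing to those in degree
  \<open>-n - 1\<close>.\<close>

theorem coinv_duality:
  "subquotient_iso k (rs n) (coinv_cycles n) (coinv_boundaries n)
     (rs (- n - 1)) (coinv_cycles (- n - 1)) (coinv_boundaries (- n - 1))"
  by (rule subquotient_iso_trans[OF subquotient_iso_sym[OF cohomology_coinv_dual] cohomology_coinv])

end

section \<open>Monoid algebras\<close>

lemma left_module_cong:
  fixes M N :: "('r, 'm) module"
  assumes "left_module R M" "carrier N = carrier M" "add N = add M" "zero N = zero M" "smult N = smult M"
  shows "left_module R N"
proof -
  interpret M: lmod R M using assms(1) by (rule lmod.intro)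
  show ?thesis
  proof (rule left_moduleI)
    show "abelian_group N" by (rule abelian_group_cong[OF M.M.abelian_group_axioms]) (simp_all add: assms)
  qed (auto simp: assms M.R.ring_axioms M.smult_l_distr M.smult_r_distr M.smult_assoc1)
qed

lemma linear_maps_cong_module:
  assumes "carrier M' = carrier M" "add M' = add M" "smult M' = smult M"
    and "carrier N' = carrier N" "add N' = add N" "smult N' = smult N"
  shows "linear_maps R M' N' = linear_maps R M N"
  using assms by (simp add: linear_maps_def)

lemma monoid_algebra_carrier: "carrier (monoid_algebra k G) = carrier (free_module k (carrier G))"
  by (simp add: monoid_algebra_def)

lemma monoid_algebra_simps [simp]:
  "add (monoid_algebra k G) = add (free_module k (carrier G))"
  "zero (monoid_algebra k G) = zero (free_module k (carrier G))"
  "smult (monoid_algebra k G) = smult (free_module k (carrier G))"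
  "one (monoid_algebra k G) = basis_vector k \<one>\<^bsub>G\<^esub>"
  by (simp_all add: monoid_algebra_def)

locale monoid_algebra_data = K?: field k + G: monoid G
  for k :: "'k ring" and G :: "('b, 'y) monoid_scheme"
begin

abbreviation "MA \<equiv> monoid_algebra k G"
abbreviation "FG \<equiv> free_module k (carrier G)"

lemma MA_module: "left_module k MA"
  by (rule left_module_cong[OF K.free_left_module]) (simp_all add: monoid_algebra_carrier)

sublocale M: lmod k MA by (rule lmod.intro[OF MA_module])

lemma MA_carrier: "f \<in> carrier MA \<longleftrightarrow>
    (\<forall>x. f x \<in> carrier k) \<and> finite (support k f) \<and> support k f \<subseteq> carrier G"
  by (simp add: monoid_algebra_carrier free_module_carrier)

lemma MA_mult:
  assumes "f \<in> carrier MA" "g \<in> carrier MA" "finite F" "finite F'" "support k f \<subseteq> F" "support k g \<subseteq> F'"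
  shows "(f \<otimes>\<^bsub>MA\<^esub> g) w
    = (\<Oplus>\<^bsub>k\<^esub>p\<in>{p \<in> F \<times> F'. fst p \<otimes>\<^bsub>G\<^esub> snd p = w}. f (fst p) \<otimes>\<^bsub>k\<^esub> g (snd p))"
proof -
  have "(f \<otimes>\<^bsub>MA\<^esub> g) w = (\<Oplus>\<^bsub>k\<^esub>p\<in>{p \<in> support k f \<times> support k g. fst p \<otimes>\<^bsub>G\<^esub> snd p = w}.
      f (fst p) \<otimes>\<^bsub>k\<^esub> g (snd p))"
    by (simp add: monoid_algebra_def)
  also have "\<dots> = (\<Oplus>\<^bsub>k\<^esub>p\<in>{p \<in> F \<times> F'. fst p \<otimes>\<^bsub>G\<^esub> snd p = w}. f (fst p) \<otimes>\<^bsub>k\<^esub> g (snd p))"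
    by (rule K.add.finprod_mono_neutral_cong_left)
      (use assms in \<open>auto simp: support_def MA_carrier\<close>)
  finally show ?thesis .
qed

lemma basis_MA [simp]: "x \<in> carrier G \<Longrightarrow> basis_vector k x \<in> carrier MA"
  using K.basis_vector_closed[of x "carrier G"] by (simp add: monoid_algebra_carrier)

lemma support_basis: "support k (basis_vector k x) = {x}"
  using K.one_not_zero by (auto simp: support_def basis_vector_def)

lemma MA_basis_mult:
  assumes "u \<in> carrier G" "v \<in> carrier G"
  shows "basis_vector k u \<otimes>\<^bsub>MA\<^esub> basis_vector k v = basis_vector k (u \<otimes>\<^bsub>G\<^esub> v)"
proof
  fix w
  have "(basis_vector k u \<otimes>\<^bsub>MA\<^esub> basis_vector k v) w
      = (\<Oplus>\<^bsub>k\<^esub>p\<in>{p \<in> {u} \<times> {v}. fst p \<otimes>\<^bsub>G\<^esub> snd p = w}. basis_vector k u (fst p) \<otimes>\<^bsub>k\<^esub> basis_vector k v (snd p))"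
    using assms by (intro MA_mult) (auto simp: support_basis)
  also have "{p \<in> {u} \<times> {v}. fst p \<otimes>\<^bsub>G\<^esub> snd p = w} = (if u \<otimes>\<^bsub>G\<^esub> v = w then {(u, v)} else {})" by auto
  finally show "(basis_vector k u \<otimes>\<^bsub>MA\<^esub> basis_vector k v) w = basis_vector k (u \<otimes>\<^bsub>G\<^esub> v) w"
    by (auto simp: basis_vector_def)
qed

lemma MA_mult_closed:
  assumes "f \<in> carrier MA" "g \<in> carrier MA"
  shows "f \<otimes>\<^bsub>MA\<^esub> g \<in> carrier MA"
proof -
  let ?S = "(\<lambda>p. fst p \<otimes>\<^bsub>G\<^esub> snd p) ` (support k f \<times> support k g)"
  have fg: "finite (support k f)" "finite (support k g)" "support k f \<subseteq> carrier G" "support k g \<subseteq> carrier G"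
    using assms by (auto simp: MA_carrier)
  have val: "(f \<otimes>\<^bsub>MA\<^esub> g) w
    = (\<Oplus>\<^bsub>k\<^esub>p\<in>{p \<in> support k f \<times> support k g. fst p \<otimes>\<^bsub>G\<^esub> snd p = w}. f (fst p) \<otimes>\<^bsub>k\<^esub> g (snd p))" for w
    by (rule MA_mult[OF assms fg(1,2)]) auto
  have "support k (f \<otimes>\<^bsub>MA\<^esub> g) \<subseteq> ?S"
  proof
    fix w assume "w \<in> support k (f \<otimes>\<^bsub>MA\<^esub> g)"
    then have "{p \<in> support k f \<times> support k g. fst p \<otimes>\<^bsub>G\<^esub> snd p = w} \<noteq> {}"
    proof (intro notI)
      assume "{p \<in> support k f \<times> support k g. fst p \<otimes>\<^bsub>G\<^esub> snd p = w} = {}"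
      then have "(f \<otimes>\<^bsub>MA\<^esub> g) w = \<zero>\<^bsub>k\<^esub>" unfolding val by (simp only: K.finsum_empty)
      then show False using \<open>w \<in> support k (f \<otimes>\<^bsub>MA\<^esub> g)\<close> by (simp add: support_def)
    qed
    then show "w \<in> ?S" by blast
  qed
  moreover have "?S \<subseteq> carrier G" using subsetD[OF fg(3)] subsetD[OF fg(4)] by auto
  moreover have "(f \<otimes>\<^bsub>MA\<^esub> g) w \<in> carrier k" for w
    unfolding val using assms by (intro K.finsum_closed) (auto simp: MA_carrier)
  moreover have "finite ?S" using fg by simp
  ultimately show ?thesis unfolding MA_carrier by (auto dest: finite_subset)
qed

lemma MA_mult_linear_left:
  assumes g: "g \<in> carrier MA"
  shows "(\<lambda>f. f \<otimes>\<^bsub>MA\<^esub> g) \<in> linear_maps k MA MA"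
proof (rule linear_mapsI)
  fix f f' assume f: "f \<in> carrier MA" "f' \<in> carrier MA"
  let ?F = "support k f \<union> support k f'" and ?G = "support k g"
  have fin: "finite ?F" "finite ?G" using f g by (auto simp: MA_carrier)
  show "(f \<oplus>\<^bsub>MA\<^esub> f') \<otimes>\<^bsub>MA\<^esub> g = f \<otimes>\<^bsub>MA\<^esub> g \<oplus>\<^bsub>MA\<^esub> f' \<otimes>\<^bsub>MA\<^esub> g"
  proof
    fix w
    let ?P = "{p \<in> ?F \<times> ?G. fst p \<otimes>\<^bsub>G\<^esub> snd p = w}"
    have "((f \<oplus>\<^bsub>MA\<^esub> f') \<otimes>\<^bsub>MA\<^esub> g) w = (\<Oplus>\<^bsub>k\<^esub>p\<in>?P. (f \<oplus>\<^bsub>MA\<^esub> f') (fst p) \<otimes>\<^bsub>k\<^esub> g (snd p))"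
      by (rule MA_mult[OF M.M.a_closed[OF f] g fin]) (use K.support_add[of f f'] in auto)
    also have "\<dots> = (\<Oplus>\<^bsub>k\<^esub>p\<in>?P. f (fst p) \<otimes>\<^bsub>k\<^esub> g (snd p) \<oplus>\<^bsub>k\<^esub> f' (fst p) \<otimes>\<^bsub>k\<^esub> g (snd p))"
      using f g by (intro K.finsum_cong') (auto simp: MA_carrier K.l_distr)
    also have "\<dots> = (\<Oplus>\<^bsub>k\<^esub>p\<in>?P. f (fst p) \<otimes>\<^bsub>k\<^esub> g (snd p)) \<oplus>\<^bsub>k\<^esub> (\<Oplus>\<^bsub>k\<^esub>p\<in>?P. f' (fst p) \<otimes>\<^bsub>k\<^esub> g (snd p))"
      using f g by (intro K.finsum_addf) (auto simp: MA_carrier)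
    also have "(\<Oplus>\<^bsub>k\<^esub>p\<in>?P. f (fst p) \<otimes>\<^bsub>k\<^esub> g (snd p)) = (f \<otimes>\<^bsub>MA\<^esub> g) w"
      by (rule MA_mult[symmetric, OF f(1) g fin]) auto
    also have "(\<Oplus>\<^bsub>k\<^esub>p\<in>?P. f' (fst p) \<otimes>\<^bsub>k\<^esub> g (snd p)) = (f' \<otimes>\<^bsub>MA\<^esub> g) w"
      by (rule MA_mult[symmetric, OF f(2) g fin]) auto
    finally show "((f \<oplus>\<^bsub>MA\<^esub> f') \<otimes>\<^bsub>MA\<^esub> g) w = (f \<otimes>\<^bsub>MA\<^esub> g \<oplus>\<^bsub>MA\<^esub> f' \<otimes>\<^bsub>MA\<^esub> g) w" by simp
  qed
next
  fix r f assume r: "r \<in> carrier k" and f: "f \<in> carrier MA"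
  have fin: "finite (support k f)" "finite (support k g)" using f g by (auto simp: MA_carrier)
  show "(r \<odot>\<^bsub>MA\<^esub> f) \<otimes>\<^bsub>MA\<^esub> g = r \<odot>\<^bsub>MA\<^esub> (f \<otimes>\<^bsub>MA\<^esub> g)"
  proof
    fix w
    let ?P = "{p \<in> support k f \<times> support k g. fst p \<otimes>\<^bsub>G\<^esub> snd p = w}"
    have "((r \<odot>\<^bsub>MA\<^esub> f) \<otimes>\<^bsub>MA\<^esub> g) w = (\<Oplus>\<^bsub>k\<^esub>p\<in>?P. (r \<odot>\<^bsub>MA\<^esub> f) (fst p) \<otimes>\<^bsub>k\<^esub> g (snd p))"
      by (rule MA_mult[OF M.smult_closed[OF r f] g fin]) (use K.support_smult[OF r, of f] in auto)
    also have "\<dots> = (\<Oplus>\<^bsub>k\<^esub>p\<in>?P. r \<otimes>\<^bsub>k\<^esub> (f (fst p) \<otimes>\<^bsub>k\<^esub> g (snd p)))"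
      using f g r by (intro K.finsum_cong') (auto simp: MA_carrier K.m_assoc)
    also have "\<dots> = r \<otimes>\<^bsub>k\<^esub> (\<Oplus>\<^bsub>k\<^esub>p\<in>?P. f (fst p) \<otimes>\<^bsub>k\<^esub> g (snd p))"
      using f g r fin by (intro K.finsum_rdistr[symmetric]) (auto simp: MA_carrier)
    also have "(\<Oplus>\<^bsub>k\<^esub>p\<in>?P. f (fst p) \<otimes>\<^bsub>k\<^esub> g (snd p)) = (f \<otimes>\<^bsub>MA\<^esub> g) w"
      by (rule MA_mult[symmetric, OF f(1) g fin]) auto
    finally show "((r \<odot>\<^bsub>MA\<^esub> f) \<otimes>\<^bsub>MA\<^esub> g) w = (r \<odot>\<^bsub>MA\<^esub> (f \<otimes>\<^bsub>MA\<^esub> g)) w" by simp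
  qed
qed (rule MA_mult_closed[OF _ g])

lemma MA_mult_linear_right:
  assumes f: "f \<in> carrier MA"
  shows "(\<lambda>g. f \<otimes>\<^bsub>MA\<^esub> g) \<in> linear_maps k MA MA"
proof (rule linear_mapsI)
  fix g g' assume g: "g \<in> carrier MA" "g' \<in> carrier MA"
  let ?F = "support k f" and ?G = "support k g \<union> support k g'"
  have fin: "finite ?F" "finite ?G" using f g by (auto simp: MA_carrier)
  show "f \<otimes>\<^bsub>MA\<^esub> (g \<oplus>\<^bsub>MA\<^esub> g') = f \<otimes>\<^bsub>MA\<^esub> g \<oplus>\<^bsub>MA\<^esub> f \<otimes>\<^bsub>MA\<^esub> g'"
  proof
    fix w
    let ?P = "{p \<in> ?F \<times> ?G. fst p \<otimes>\<^bsub>G\<^esub> snd p = w}"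
    have "(f \<otimes>\<^bsub>MA\<^esub> (g \<oplus>\<^bsub>MA\<^esub> g')) w = (\<Oplus>\<^bsub>k\<^esub>p\<in>?P. f (fst p) \<otimes>\<^bsub>k\<^esub> (g \<oplus>\<^bsub>MA\<^esub> g') (snd p))"
      by (rule MA_mult[OF f M.M.a_closed[OF g] fin]) (use K.support_add[of g g'] in auto)
    also have "\<dots> = (\<Oplus>\<^bsub>k\<^esub>p\<in>?P. f (fst p) \<otimes>\<^bsub>k\<^esub> g (snd p) \<oplus>\<^bsub>k\<^esub> f (fst p) \<otimes>\<^bsub>k\<^esub> g' (snd p))"
      using f g by (intro K.finsum_cong') (auto simp: MA_carrier K.r_distr)
    also have "\<dots> = (\<Oplus>\<^bsub>k\<^esub>p\<in>?P. f (fst p) \<otimes>\<^bsub>k\<^esub> g (snd p)) \<oplus>\<^bsub>k\<^esub> (\<Oplus>\<^bsub>k\<^esub>p\<in>?P. f (fst p) \<otimes>\<^bsub>k\<^esub> g' (snd p))"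
      using f g by (intro K.finsum_addf) (auto simp: MA_carrier)
    also have "(\<Oplus>\<^bsub>k\<^esub>p\<in>?P. f (fst p) \<otimes>\<^bsub>k\<^esub> g (snd p)) = (f \<otimes>\<^bsub>MA\<^esub> g) w"
      by (rule MA_mult[symmetric, OF f g(1) fin]) auto
    also have "(\<Oplus>\<^bsub>k\<^esub>p\<in>?P. f (fst p) \<otimes>\<^bsub>k\<^esub> g' (snd p)) = (f \<otimes>\<^bsub>MA\<^esub> g') w"
      by (rule MA_mult[symmetric, OF f g(2) fin]) auto
    finally show "(f \<otimes>\<^bsub>MA\<^esub> (g \<oplus>\<^bsub>MA\<^esub> g')) w = (f \<otimes>\<^bsub>MA\<^esub> g \<oplus>\<^bsub>MA\<^esub> f \<otimes>\<^bsub>MA\<^esub> g') w" by simp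
  qed
next
  fix r g assume r: "r \<in> carrier k" and g: "g \<in> carrier MA"
  have fin: "finite (support k f)" "finite (support k g)" using f g by (auto simp: MA_carrier)
  show "f \<otimes>\<^bsub>MA\<^esub> (r \<odot>\<^bsub>MA\<^esub> g) = r \<odot>\<^bsub>MA\<^esub> (f \<otimes>\<^bsub>MA\<^esub> g)"
  proof
    fix w
    let ?P = "{p \<in> support k f \<times> support k g. fst p \<otimes>\<^bsub>G\<^esub> snd p = w}"
    have "(f \<otimes>\<^bsub>MA\<^esub> (r \<odot>\<^bsub>MA\<^esub> g)) w = (\<Oplus>\<^bsub>k\<^esub>p\<in>?P. f (fst p) \<otimes>\<^bsub>k\<^esub> (r \<odot>\<^bsub>MA\<^esub> g) (snd p))"
      by (rule MA_mult[OF f M.smult_closed[OF r g] fin]) (use K.support_smult[OF r, of g] in auto)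
    also have "\<dots> = (\<Oplus>\<^bsub>k\<^esub>p\<in>?P. r \<otimes>\<^bsub>k\<^esub> (f (fst p) \<otimes>\<^bsub>k\<^esub> g (snd p)))"
      using f g r by (intro K.finsum_cong') (auto simp: MA_carrier K.m_lcomm)
    also have "\<dots> = r \<otimes>\<^bsub>k\<^esub> (\<Oplus>\<^bsub>k\<^esub>p\<in>?P. f (fst p) \<otimes>\<^bsub>k\<^esub> g (snd p))"
      using f g r fin by (intro K.finsum_rdistr[symmetric]) (auto simp: MA_carrier)
    also have "(\<Oplus>\<^bsub>k\<^esub>p\<in>?P. f (fst p) \<otimes>\<^bsub>k\<^esub> g (snd p)) = (f \<otimes>\<^bsub>MA\<^esub> g) w"
      by (rule MA_mult[symmetric, OF f g fin]) auto
    finally show "(f \<otimes>\<^bsub>MA\<^esub> (r \<odot>\<^bsub>MA\<^esub> g)) w = (r \<odot>\<^bsub>MA\<^esub> (f \<otimes>\<^bsub>MA\<^esub> g)) w" by simp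
  qed
qed (rule MA_mult_closed[OF f])

lemma MA_linear_eq:
  assumes "g \<in> linear_maps k MA N" "h \<in> linear_maps k MA N" "left_module k N"
    and "\<And>x. x \<in> carrier G \<Longrightarrow> g (basis_vector k x) = h (basis_vector k x)" "f \<in> carrier MA"
  shows "g f = h f"
proof -
  have e: "linear_maps k MA N = linear_maps k FG N"
    by (rule linear_maps_cong_module) (simp_all add: monoid_algebra_carrier)
  interpret N: lmod k N using assms(3) by (rule lmod.intro)
  show ?thesis using N.free_linear_eq[of g "carrier G" h f] assms e by (simp add: monoid_algebra_carrier)
qed

text \<open>Both sides of the associative law are linear in each argument. It is verified on basis
  vectors, where it is associativity in \<open>G\<close>, and the arguments are made general one at
  a time.\<close>

lemma MA_ring: "ring MA"
proof (rule ringI)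
  show "abelian_group MA" by (rule M.M.abelian_group_axioms)
  show "monoid MA"
  proof (rule monoidI)
    fix f g h assume f: "f \<in> carrier MA" and g: "g \<in> carrier MA" and h: "h \<in> carrier MA"
    note L = MA_mult_linear_left and R = MA_mult_linear_right and c = MA_mult_closed
    have 1: "(basis_vector k u \<otimes>\<^bsub>MA\<^esub> basis_vector k v) \<otimes>\<^bsub>MA\<^esub> h
        = basis_vector k u \<otimes>\<^bsub>MA\<^esub> (basis_vector k v \<otimes>\<^bsub>MA\<^esub> h)" if "u \<in> carrier G" "v \<in> carrier G" for u v
      by (rule MA_linear_eq[OF R linear_maps_comp[OF R R] MA_module _ h])
        (use that in \<open>simp_all add: MA_basis_mult c G.m_assoc\<close>)
    have 2: "(basis_vector k u \<otimes>\<^bsub>MA\<^esub> g) \<otimes>\<^bsub>MA\<^esub> h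
        = basis_vector k u \<otimes>\<^bsub>MA\<^esub> (g \<otimes>\<^bsub>MA\<^esub> h)" if u: "u \<in> carrier G" for u
      by (rule MA_linear_eq[OF linear_maps_comp[OF R[OF basis_MA[OF u]] L[OF h]]
            linear_maps_comp[OF L[OF h] R[OF basis_MA[OF u]]] MA_module _ g]) (rule 1[OF u])
    show "(f \<otimes>\<^bsub>MA\<^esub> g) \<otimes>\<^bsub>MA\<^esub> h = f \<otimes>\<^bsub>MA\<^esub> (g \<otimes>\<^bsub>MA\<^esub> h)"
      by (rule MA_linear_eq[OF linear_maps_comp[OF L[OF g] L[OF h]] L[OF c[OF g h]] MA_module _ f]) (rule 2)
  next
    fix f assume f: "f \<in> carrier MA"
    have id: "(\<lambda>f. f) \<in> linear_maps k MA MA" by (rule linear_mapsI) simp_all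
    have one: "\<one>\<^bsub>MA\<^esub> \<in> carrier MA" using basis_MA[OF G.one_closed] by simp
    show "\<one>\<^bsub>MA\<^esub> \<otimes>\<^bsub>MA\<^esub> f = f"
      by (rule MA_linear_eq[OF MA_mult_linear_right[OF one] id MA_module _ f])
        (simp add: MA_basis_mult)
    show "f \<otimes>\<^bsub>MA\<^esub> \<one>\<^bsub>MA\<^esub> = f"
      by (rule MA_linear_eq[OF MA_mult_linear_left[OF one] id MA_module _ f])
        (simp add: MA_basis_mult)
  qed (use MA_mult_closed basis_MA[OF G.one_closed] in \<open>simp_all\<close>)
next
  fix f g h assume "f \<in> carrier MA" "g \<in> carrier MA" "h \<in> carrier MA"
  then show "(f \<oplus>\<^bsub>MA\<^esub> g) \<otimes>\<^bsub>MA\<^esub> h = f \<otimes>\<^bsub>MA\<^esub> h \<oplus>\<^bsub>MA\<^esub> g \<otimes>\<^bsub>MA\<^esub> h"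
    "h \<otimes>\<^bsub>MA\<^esub> (f \<oplus>\<^bsub>MA\<^esub> g) = h \<otimes>\<^bsub>MA\<^esub> f \<oplus>\<^bsub>MA\<^esub> h \<otimes>\<^bsub>MA\<^esub> g"
    using lin_add[OF MA_mult_linear_left] lin_add[OF MA_mult_linear_right] by metis+
qed

end

section \<open>The enveloping algebra\<close>

lemma opposite_simps [simp]:
  "carrier (opposite A) = carrier A" "add (opposite A) = add A" "zero (opposite A) = zero A"
  "one (opposite A) = one A" "smult (opposite A) = smult A" "mult (opposite A) = (\<lambda>x y. mult A y x)"
  by (simp_all add: opposite_def)

text \<open>The assumption \<open>env_ring\<close> can be supplied from any left module over the
  enveloping algebra, because \<open>left_module\<close> includes the ring axioms for the
  scalars.\<close>

locale enveloping = k_algebra k A for k :: "'k ring" and A :: "('k, 'a) module" (structure) +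
  assumes env_ring: "ring (enveloping_algebra k A)"
begin

definition "FF = free_module k (carrier A \<times> carrier A)"
definition "NN = module_span k FF (bilinear_relations k A (opposite A))"
definition "Env = enveloping_algebra k A"

definition tens :: "'a \<Rightarrow> 'a \<Rightarrow> ('k, 'a) enveloping" where
  "tens a b = NN +>\<^bsub>FF\<^esub> basis_vector k (a, b)"

lemma op_monoid: "monoid (A \<times>\<times> opposite A)"
proof -
  have "monoid (opposite A)"
    by (rule monoidI) (simp_all add: A.m_assoc)
  then show ?thesis using DirProd_monoid A.monoid_axioms by blast
qed

sublocale MA: monoid_algebra_data k "A \<times>\<times> opposite A"
  by (intro monoid_algebra_data.intro op_monoid K.field_axioms)

lemma FF_module: "left_module k FF"
  unfolding FF_def by (rule K.free_left_module)

sublocale FF: lmod k FF by (rule lmod.intro[OF FF_module])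

lemma FF_basis [simp]: "\<lbrakk>a \<in> carrier A; b \<in> carrier A\<rbrakk> \<Longrightarrow> basis_vector k (a, b) \<in> carrier FF"
  unfolding FF_def by simp

lemma bilinear_relations_eq:
  "bilinear_relations k A (opposite A) =
    {basis_vector k (x \<oplus>\<^bsub>A\<^esub> x', y) \<ominus>\<^bsub>FF\<^esub> (basis_vector k (x, y) \<oplus>\<^bsub>FF\<^esub> basis_vector k (x', y)) |x x' y.
           x \<in> carrier A \<and> x' \<in> carrier A \<and> y \<in> carrier A} \<union>
    {basis_vector k (x, y \<oplus>\<^bsub>A\<^esub> y') \<ominus>\<^bsub>FF\<^esub> (basis_vector k (x, y) \<oplus>\<^bsub>FF\<^esub> basis_vector k (x, y')) |x y y'.
           x \<in> carrier A \<and> y \<in> carrier A \<and> y' \<in> carrier A} \<union>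
    {basis_vector k (r \<odot>\<^bsub>A\<^esub> x, y) \<ominus>\<^bsub>FF\<^esub> (r \<odot>\<^bsub>FF\<^esub> basis_vector k (x, y)) |r x y.
           r \<in> carrier k \<and> x \<in> carrier A \<and> y \<in> carrier A} \<union>
    {basis_vector k (x, r \<odot>\<^bsub>A\<^esub> y) \<ominus>\<^bsub>FF\<^esub> (r \<odot>\<^bsub>FF\<^esub> basis_vector k (x, y)) |r x y.
           r \<in> carrier k \<and> x \<in> carrier A \<and> y \<in> carrier A}"
  by (simp add: bilinear_relations_def Let_def FF_def[symmetric])

lemma bilinear_mem:
  "\<lbrakk>a \<in> carrier A; a' \<in> carrier A; b \<in> carrier A\<rbrakk>
    \<Longrightarrow> basis_vector k (a \<oplus>\<^bsub>A\<^esub> a', b) \<ominus>\<^bsub>FF\<^esub> (basis_vector k (a, b) \<oplus>\<^bsub>FF\<^esub> basis_vector k (a', b))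
      \<in> bilinear_relations k A (opposite A)"
  "\<lbrakk>a \<in> carrier A; b \<in> carrier A; b' \<in> carrier A\<rbrakk>
    \<Longrightarrow> basis_vector k (a, b \<oplus>\<^bsub>A\<^esub> b') \<ominus>\<^bsub>FF\<^esub> (basis_vector k (a, b) \<oplus>\<^bsub>FF\<^esub> basis_vector k (a, b'))
      \<in> bilinear_relations k A (opposite A)"
  "\<lbrakk>r \<in> carrier k; a \<in> carrier A; b \<in> carrier A\<rbrakk>
    \<Longrightarrow> basis_vector k (r \<odot>\<^bsub>A\<^esub> a, b) \<ominus>\<^bsub>FF\<^esub> (r \<odot>\<^bsub>FF\<^esub> basis_vector k (a, b))
      \<in> bilinear_relations k A (opposite A)"
  "\<lbrakk>r \<in> carrier k; a \<in> carrier A; b \<in> carrier A\<rbrakk>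
    \<Longrightarrow> basis_vector k (a, r \<odot>\<^bsub>A\<^esub> b) \<ominus>\<^bsub>FF\<^esub> (r \<odot>\<^bsub>FF\<^esub> basis_vector k (a, b))
      \<in> bilinear_relations k A (opposite A)"
  unfolding bilinear_relations_eq
  subgoal by (rule UnI1, rule UnI1, rule UnI1, rule CollectI, intro exI, rule conjI, rule refl, intro conjI)
  subgoal by (rule UnI1, rule UnI1, rule UnI2, rule CollectI, intro exI, rule conjI, rule refl, intro conjI)
  subgoal by (rule UnI1, rule UnI2, rule CollectI, intro exI, rule conjI, rule refl, intro conjI)
  subgoal by (rule UnI2, rule CollectI, intro exI, rule conjI, rule refl, intro conjI)
  done

lemma NN_submodule: "submodule NN k FF"
  unfolding NN_def bilinear_relations_eq by (rule FF.span_submodule) (auto simp: KM.M.a_closed)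

sublocale NN: submod k FF NN
  by (intro submod.intro submod_axioms.intro lmod.intro FF_module NN_submodule)

text \<open>A coset involves only carrier and addition, which the monoid algebra shares with the
  free module.\<close>

lemma coset_MA: "NN +>\<^bsub>MA.MA\<^esub> f = NN +>\<^bsub>FF\<^esub> f"
  by (simp add: a_r_coset_def' FF_def)

text \<open>As a vector space \<open>Env\<close> is a quotient of the free module; the monoid
  algebra enters through the multiplication and the unit.\<close>

lemma Env_simps:
  "carrier Env = carrier (quotient_module FF NN)" "add Env = add (quotient_module FF NN)"
  "zero Env = NN" "smult Env = smult (quotient_module FF NN)"
  "one Env = tens \<one> \<one>" "mult Env = rcoset_mult MA.MA NN"
proof -
  have e: "Env = quotient_module MA.MA NN"
    by (simp add: Env_def enveloping_algebra_def tensor_algebra_def NN_def FF_def)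
  show "carrier Env = carrier (quotient_module FF NN)"
    by (simp add: e quotient_module_simps FactRing_def A_RCOSETS_def' monoid_algebra_carrier coset_MA) (simp add: FF_def)
  show "add Env = add (quotient_module FF NN)"
    by (simp add: e quotient_module_simps set_add_def' fun_eq_iff FF_def)
  show "smult Env = smult (quotient_module FF NN)"
    by (simp add: e quotient_module_simps coset_MA) (simp add: FF_def)
  show "zero Env = NN" "mult Env = rcoset_mult MA.MA NN"
    by (simp_all add: e quotient_module_simps)
  show "one Env = tens \<one> \<one>"
    by (simp add: e quotient_module_simps coset_MA tens_def)
qed

lemma Env_module: "left_module k Env"
  by (rule left_module_cong[OF NN.quot_left_module]) (simp_all add: Env_simps)

sublocale Env: lmod k Env by (rule lmod.intro[OF Env_module])

sublocale EnvR: ring Env using env_ring by (simp add: Env_def)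

lemma tens_closed [simp]: "\<lbrakk>a \<in> carrier A; b \<in> carrier A\<rbrakk> \<Longrightarrow> tens a b \<in> carrier Env"
  by (simp add: tens_def Env_simps)

lemma coset_relation:
  assumes "u \<ominus>\<^bsub>FF\<^esub> v \<in> bilinear_relations k A (opposite A)" "u \<in> carrier FF" "v \<in> carrier FF"
  shows "NN +>\<^bsub>FF\<^esub> u = NN +>\<^bsub>FF\<^esub> v"
  using assms NN.coset_eq_iff[OF assms(2,3)] span_superset[of "bilinear_relations k A (opposite A)" k FF]
  by (auto simp: NN_def)

lemma tens_left: "b \<in> carrier A \<Longrightarrow> (\<lambda>a. tens a b) \<in> linear_maps k A Env"
proof (rule linear_mapsI)
  fix a a' assume *: "b \<in> carrier A" "a \<in> carrier A" "a' \<in> carrier A"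
  have "NN +>\<^bsub>FF\<^esub> basis_vector k (a \<oplus>\<^bsub>A\<^esub> a', b) = NN +>\<^bsub>FF\<^esub> (basis_vector k (a, b) \<oplus>\<^bsub>FF\<^esub> basis_vector k (a', b))"
    by (rule coset_relation) (use * bilinear_mem in \<open>auto simp: KM.M.a_closed\<close>)
  then show "tens (a \<oplus>\<^bsub>A\<^esub> a') b = tens a b \<oplus>\<^bsub>Env\<^esub> tens a' b"
    using * by (simp add: tens_def Env_simps NN.coset_add)
next
  fix r a assume *: "b \<in> carrier A" "r \<in> carrier k" "a \<in> carrier A"
  have "NN +>\<^bsub>FF\<^esub> basis_vector k (r \<odot>\<^bsub>A\<^esub> a, b) = NN +>\<^bsub>FF\<^esub> (r \<odot>\<^bsub>FF\<^esub> basis_vector k (a, b))"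
    by (rule coset_relation) (use * bilinear_mem in auto)
  then show "tens (r \<odot>\<^bsub>A\<^esub> a) b = r \<odot>\<^bsub>Env\<^esub> tens a b"
    using * by (simp add: tens_def Env_simps NN.coset_smult)
qed simp

lemma tens_right: "a \<in> carrier A \<Longrightarrow> tens a \<in> linear_maps k A Env"
proof (rule linear_mapsI)
  fix b b' assume *: "a \<in> carrier A" "b \<in> carrier A" "b' \<in> carrier A"
  have "NN +>\<^bsub>FF\<^esub> basis_vector k (a, b \<oplus>\<^bsub>A\<^esub> b') = NN +>\<^bsub>FF\<^esub> (basis_vector k (a, b) \<oplus>\<^bsub>FF\<^esub> basis_vector k (a, b'))"
    by (rule coset_relation) (use * bilinear_mem in \<open>auto simp: KM.M.a_closed\<close>)
  then show "tens a (b \<oplus>\<^bsub>A\<^esub> b') = tens a b \<oplus>\<^bsub>Env\<^esub> tens a b'"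
    using * by (simp add: tens_def Env_simps NN.coset_add)
next
  fix r b assume *: "a \<in> carrier A" "r \<in> carrier k" "b \<in> carrier A"
  have "NN +>\<^bsub>FF\<^esub> basis_vector k (a, r \<odot>\<^bsub>A\<^esub> b) = NN +>\<^bsub>FF\<^esub> (r \<odot>\<^bsub>FF\<^esub> basis_vector k (a, b))"
    by (rule coset_relation) (use * bilinear_mem in auto)
  then show "tens a (r \<odot>\<^bsub>A\<^esub> b) = r \<odot>\<^bsub>Env\<^esub> tens a b"
    using * by (simp add: tens_def Env_simps NN.coset_smult)
qed simp

text \<open>Scalars are absorbed into the first factor, as
  \<open>r (a \<otimes> b) = (r a) \<otimes> b\<close>, so sums of pure tensors exhaust
  \<open>Env\<close>. The empty sum is the tensor of two zeros.\<close>

lemma tens_generates: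
  assumes J: "\<And>a b. \<lbrakk>a \<in> carrier A; b \<in> carrier A\<rbrakk> \<Longrightarrow> tens a b \<in> H"
    and add: "\<And>e f. \<lbrakk>e \<in> carrier Env; f \<in> carrier Env; e \<in> H; f \<in> H\<rbrakk> \<Longrightarrow> e \<oplus>\<^bsub>Env\<^esub> f \<in> H"
  shows "carrier Env \<subseteq> H"
proof
  fix e assume "e \<in> carrier Env"
  then obtain f where f: "f \<in> carrier FF" "e = NN +>\<^bsub>FF\<^esub> f"
    unfolding Env_simps(1) by (rule NN.quot_cases)
  have "f \<in> carrier (free_module k (carrier A \<times> carrier A)) \<Longrightarrow> NN +>\<^bsub>FF\<^esub> f \<in> H" for f
  proof (induction f rule: K.free_module_induct)
    case zero
    have "tens \<zero>\<^bsub>A\<^esub> \<zero>\<^bsub>A\<^esub> = NN"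
      using lmap.map_zero[OF lmapI[OF KM.left_module_axioms Env_module tens_right]] by (simp add: Env_simps)
    then show ?case using J[of "\<zero>\<^bsub>A\<^esub>" "\<zero>\<^bsub>A\<^esub>"] NN.coset_zero by (simp add: FF_def)
  next
    case (add f r p)
    obtain a b where p: "p = (a, b)" "a \<in> carrier A" "b \<in> carrier A" using add(3) by auto
    have "tens (r \<odot>\<^bsub>A\<^esub> a) b = NN +>\<^bsub>FF\<^esub> (r \<odot>\<^bsub>FF\<^esub> basis_vector k p)"
      using lin_smult[OF tens_left[OF p(3)] add(2) p(2)] p add(2) NN.coset_smult[OF add(2), of "basis_vector k p"]
      by (simp add: tens_def Env_simps)
    moreover have "tens (r \<odot>\<^bsub>A\<^esub> a) b \<in> H" using J p add(2) by simp
    moreover have "tens (r \<odot>\<^bsub>A\<^esub> a) b \<in> carrier Env" using p add(2) by simp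
    moreover have "NN +>\<^bsub>FF\<^esub> f \<in> carrier Env" using add(1) by (simp add: Env_simps FF_def[symmetric])
    ultimately have "(NN +>\<^bsub>FF\<^esub> f) \<oplus>\<^bsub>Env\<^esub> (NN +>\<^bsub>FF\<^esub> (r \<odot>\<^bsub>FF\<^esub> basis_vector k p)) \<in> H"
      using assms(2) add(4) by simp
    then show ?case
      using NN.coset_add[of f "r \<odot>\<^bsub>FF\<^esub> basis_vector k p"] add(1,2) p
      by (simp add: Env_simps FF_def[symmetric]) (simp add: FF_def)
  qed
  then show "e \<in> H" using f by (simp add: FF_def)
qed

text \<open>\<open>rcoset_mult\<close> forms the union of the cosets of all products of
  representatives. Being an element of the ring, this union is a single coset, and it contains the
  product of the two basis vectors, which determines it.\<close>

lemma tens_mult: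
  assumes "a \<in> carrier A" "b \<in> carrier A" "a' \<in> carrier A" "b' \<in> carrier A"
  shows "tens a b \<otimes>\<^bsub>Env\<^esub> tens a' b' = tens (a \<otimes> a') (b' \<otimes> b)"
proof -
  let ?u = "basis_vector k (a, b)" and ?v = "basis_vector k (a', b')"
  have uv: "?u \<otimes>\<^bsub>MA.MA\<^esub> ?v = basis_vector k (a \<otimes> a', b' \<otimes> b)"
    using MA.MA_basis_mult[of "(a, b)" "(a', b')"] assms by simp
  have "tens a b \<otimes>\<^bsub>Env\<^esub> tens a' b' \<in> carrier Env" using assms by simp
  then obtain g where g: "g \<in> carrier FF" "tens a b \<otimes>\<^bsub>Env\<^esub> tens a' b' = NN +>\<^bsub>FF\<^esub> g"
    unfolding Env_simps(1) by (rule NN.quot_cases)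
  have "NN +>\<^bsub>FF\<^esub> (?u \<otimes>\<^bsub>MA.MA\<^esub> ?v) \<subseteq> tens a b \<otimes>\<^bsub>Env\<^esub> tens a' b'"
  proof -
    have u: "?u \<in> NN +>\<^bsub>FF\<^esub> ?u" and v: "?v \<in> NN +>\<^bsub>FF\<^esub> ?v"
      by (intro NN.coset_self; use assms in simp)+
    show ?thesis
      unfolding Env_simps rcoset_mult_def coset_MA tens_def
      by (rule subsetI, rule UN_I[OF u], rule UN_I[OF v])
  qed
  then have "basis_vector k (a \<otimes> a', b' \<otimes> b) \<in> NN +>\<^bsub>FF\<^esub> g"
    unfolding g uv using NN.coset_self[of "basis_vector k (a \<otimes> a', b' \<otimes> b)"] assms by auto
  then have "NN +>\<^bsub>FF\<^esub> g = tens (a \<otimes> a') (b' \<otimes> b)"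
    unfolding tens_def using NN.S.a_repr_independence'[OF _ g(1)] by simp
  then show ?thesis using g by simp
qed

lemma Env_induct [consumes 1, case_names J add]:
  assumes "e \<in> carrier Env" "\<And>a b. \<lbrakk>a \<in> carrier A; b \<in> carrier A\<rbrakk> \<Longrightarrow> P (tens a b)"
    and "\<And>e f. \<lbrakk>e \<in> carrier Env; f \<in> carrier Env; P e; P f\<rbrakk> \<Longrightarrow> P (e \<oplus>\<^bsub>Env\<^esub> f)"
  shows "P e"
  using tens_generates[of "Collect P"] assms by auto

lemma Env_k_algebra: "k_algebra k Env"
proof (intro k_algebra.intro k_algebra_axioms.intro lmod.intro Env_module K.field_axioms EnvR.ring_axioms)
  fix r e f assume r: "r \<in> carrier k" and e: "e \<in> carrier Env" and f: "f \<in> carrier Env"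
  note sl = lin_smult[OF tens_left, symmetric] and sr = lin_smult[OF tens_right, symmetric]
  have 1: "(r \<odot>\<^bsub>Env\<^esub> tens a b) \<otimes>\<^bsub>Env\<^esub> f = r \<odot>\<^bsub>Env\<^esub> (tens a b \<otimes>\<^bsub>Env\<^esub> f)" "tens a b \<otimes>\<^bsub>Env\<^esub> (r \<odot>\<^bsub>Env\<^esub> f) = r \<odot>\<^bsub>Env\<^esub> (tens a b \<otimes>\<^bsub>Env\<^esub> f)"
    if "a \<in> carrier A" "b \<in> carrier A" for a b
    using f that r
    by (induction f rule: Env_induct)
      (simp_all add: sl tens_mult smult_mult_left smult_mult_right EnvR.r_distr Env.smult_r_distr)
  show "(r \<odot>\<^bsub>Env\<^esub> e) \<otimes>\<^bsub>Env\<^esub> f = r \<odot>\<^bsub>Env\<^esub> (e \<otimes>\<^bsub>Env\<^esub> f)"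
    using e by (induction e rule: Env_induct) (use f r 1 in \<open>simp_all add: EnvR.l_distr Env.smult_r_distr\<close>)
  show "e \<otimes>\<^bsub>Env\<^esub> (r \<odot>\<^bsub>Env\<^esub> f) = r \<odot>\<^bsub>Env\<^esub> (e \<otimes>\<^bsub>Env\<^esub> f)"
    using e by (induction e rule: Env_induct) (use f r 1 in \<open>simp_all add: EnvR.l_distr Env.smult_r_distr\<close>)
qed

text \<open>Written with the same description over representatives as in
  \<open>regular_left\<close>, so that the actions on \<open>A\<close> unfold to instances of
  it.\<close>

definition env_ext :: "('k, 'v) module \<Rightarrow> ('a \<times> 'a \<Rightarrow> 'v) \<Rightarrow> ('k, 'a) enveloping \<Rightarrow> 'v" where
  "env_ext V \<beta> z = (THE y. \<exists>f\<in>z. y = lin_ext k V \<beta> f)"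

text \<open>Bilinearity says that the linear extension kills the generators of \<open>NN\<close>, so
  it has the same value on all representatives of a class.\<close>

lemma env_ext:
  assumes V: "left_module k V"
    and cl: "\<And>a b. \<lbrakk>a \<in> carrier A; b \<in> carrier A\<rbrakk> \<Longrightarrow> \<beta> (a, b) \<in> carrier V"
    and left: "\<And>b. b \<in> carrier A \<Longrightarrow> (\<lambda>a. \<beta> (a, b)) \<in> linear_maps k A V"
    and right: "\<And>a. a \<in> carrier A \<Longrightarrow> (\<lambda>b. \<beta> (a, b)) \<in> linear_maps k A V"
  shows env_ext_linear: "env_ext V \<beta> \<in> linear_maps k Env V"
    and env_ext_tens: "\<lbrakk>a \<in> carrier A; b \<in> carrier A\<rbrakk> \<Longrightarrow> env_ext V \<beta> (tens a b) = \<beta> (a, b)"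
proof -
  interpret V: lmod k V using V by (rule lmod.intro)
  let ?L = "lin_ext k V \<beta>"
  have L: "?L \<in> linear_maps k FF V"
    unfolding FF_def by (rule V.lin_ext_linear) (use cl in auto)
  interpret L: lmap k FF V ?L by (rule lmapI[OF FF_module V L])
  have Lb [simp]: "?L (basis_vector k (a, b)) = \<beta> (a, b)" if "a \<in> carrier A" "b \<in> carrier A" for a b
    using that cl by (intro V.lin_ext_basis) auto
  have "NN \<subseteq> {f \<in> carrier FF. ?L f \<in> {\<zero>\<^bsub>V\<^esub>}}"
    unfolding NN_def
  proof (rule span_least[OF L.vimage_submodule[OF V.submodule_zero]])
    show "bilinear_relations k A (opposite A) \<subseteq> {f \<in> carrier FF. ?L f \<in> {\<zero>\<^bsub>V\<^esub>}}"
      unfolding bilinear_relations_eq using cl lin_add[OF left] lin_add[OF right] lin_smult[OF left] lin_smult[OF right]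
      by (auto simp: V.diff_eq_zero_iff KM.M.a_closed)
  qed
  then have 0: "?L f = \<zero>\<^bsub>V\<^esub>" if "f \<in> NN" for f using that by auto
  have ext: "env_ext V \<beta> (NN +>\<^bsub>FF\<^esub> f) = ?L f" if f: "f \<in> carrier FF" for f
    unfolding env_ext_def
  proof (rule the_equality)
    show "\<exists>g\<in>NN +>\<^bsub>FF\<^esub> f. ?L f = ?L g" using NN.coset_self[OF f] by blast
    fix y assume "\<exists>g\<in>NN +>\<^bsub>FF\<^esub> f. y = ?L g"
    then obtain g where g: "g \<in> carrier FF" "g \<ominus>\<^bsub>FF\<^esub> f \<in> NN" "y = ?L g"
      using NN.mem_coset_iff[OF f] by auto
    then have "?L g \<ominus>\<^bsub>V\<^esub> ?L f = \<zero>\<^bsub>V\<^esub>" using 0[OF g(2)] f by simp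
    then show "y = ?L f" using g f V.diff_eq_zero_iff by simp
  qed
  show "env_ext V \<beta> \<in> linear_maps k Env V"
  proof (rule linear_mapsI)
    fix z assume "z \<in> carrier Env"
    then obtain f where f: "f \<in> carrier FF" "z = NN +>\<^bsub>FF\<^esub> f"
      unfolding Env_simps(1) by (rule NN.quot_cases)
    then show "env_ext V \<beta> z \<in> carrier V" by (simp add: ext)
    fix r assume r: "r \<in> carrier k"
    show "env_ext V \<beta> (r \<odot>\<^bsub>Env\<^esub> z) = r \<odot>\<^bsub>V\<^esub> env_ext V \<beta> z"
      using f r by (simp add: Env_simps NN.coset_smult ext)
  next
    fix z z' assume zz: "z \<in> carrier Env" "z' \<in> carrier Env"
    obtain f where f: "f \<in> carrier FF" "z = NN +>\<^bsub>FF\<^esub> f"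
      using zz(1) unfolding Env_simps(1) by (rule NN.quot_cases)
    obtain g where g: "g \<in> carrier FF" "z' = NN +>\<^bsub>FF\<^esub> g"
      using zz(2) unfolding Env_simps(1) by (rule NN.quot_cases)
    show "env_ext V \<beta> (z \<oplus>\<^bsub>Env\<^esub> z') = env_ext V \<beta> z \<oplus>\<^bsub>V\<^esub> env_ext V \<beta> z'"
      using f g by (simp add: Env_simps NN.coset_add ext)
  qed
  show "env_ext V \<beta> (tens a b) = \<beta> (a, b)" if "a \<in> carrier A" "b \<in> carrier A"
    using that by (simp add: tens_def ext)
qed

lemma regular_left_simps [simp]:
  "carrier (regular_left k A) = carrier A" "add (regular_left k A) = add A" "zero (regular_left k A) = zero A"
  "smult (regular_left k A) = (\<lambda>z b. env_ext A (\<lambda>p. fst p \<otimes> b \<otimes> snd p) z)"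
  by (simp_all add: regular_left_def ring.extend_def module.fields_def ring.truncate_def env_ext_def lin_ext_def fun_eq_iff)

lemma regular_right_simps [simp]:
  "carrier (regular_right k A) = carrier A" "add (regular_right k A) = add A" "zero (regular_right k A) = zero A"
  "smult (regular_right k A) = (\<lambda>z b. env_ext A (\<lambda>p. snd p \<otimes> b \<otimes> fst p) z)"
  by (simp_all add: regular_right_def ring.extend_def module.fields_def ring.truncate_def env_ext_def lin_ext_def fun_eq_iff)

lemma regular_left_action:
  assumes "c \<in> carrier A"
  shows "(\<lambda>e. e \<odot>\<^bsub>regular_left k A\<^esub> c) \<in> linear_maps k Env A"
    and "\<lbrakk>a \<in> carrier A; b \<in> carrier A\<rbrakk> \<Longrightarrow> tens a b \<odot>\<^bsub>regular_left k A\<^esub> c = a \<otimes> c \<otimes> b"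
proof -
  have *: "(\<lambda>a. a \<otimes> c \<otimes> b) \<in> linear_maps k A A" "(\<lambda>b'. b \<otimes> c \<otimes> b') \<in> linear_maps k A A" if "b \<in> carrier A" for b
    by (rule linear_mapsI;
      use assms that in \<open>simp add: A.l_distr A.r_distr smult_mult_left smult_mult_right\<close>)+
  note e = env_ext[OF KM.left_module_axioms, of "\<lambda>p. fst p \<otimes> c \<otimes> snd p"]
  show "(\<lambda>e. e \<odot>\<^bsub>regular_left k A\<^esub> c) \<in> linear_maps k Env A"
    using e(1) * assms by simp
  show "tens a b \<odot>\<^bsub>regular_left k A\<^esub> c = a \<otimes> c \<otimes> b" if "a \<in> carrier A" "b \<in> carrier A"
    using e(2)[OF _ _ _ that] * assms by simp
qed

lemma regular_right_action:
  assumes "c \<in> carrier A"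
  shows "(\<lambda>e. e \<odot>\<^bsub>regular_right k A\<^esub> c) \<in> linear_maps k Env A"
    and "\<lbrakk>a \<in> carrier A; b \<in> carrier A\<rbrakk> \<Longrightarrow> tens a b \<odot>\<^bsub>regular_right k A\<^esub> c = b \<otimes> c \<otimes> a"
proof -
  have *: "(\<lambda>a. b \<otimes> c \<otimes> a) \<in> linear_maps k A A" "(\<lambda>b'. b' \<otimes> c \<otimes> b) \<in> linear_maps k A A" if "b \<in> carrier A" for b
    by (rule linear_mapsI;
      use assms that in \<open>simp add: A.l_distr A.r_distr smult_mult_left smult_mult_right\<close>)+
  note e = env_ext[OF KM.left_module_axioms, of "\<lambda>p. snd p \<otimes> c \<otimes> fst p"]
  show "(\<lambda>e. e \<odot>\<^bsub>regular_right k A\<^esub> c) \<in> linear_maps k Env A"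
    using e(1) * assms by simp
  show "tens a b \<odot>\<^bsub>regular_right k A\<^esub> c = b \<otimes> c \<otimes> a" if "a \<in> carrier A" "b \<in> carrier A"
    using e(2)[OF _ _ _ that] * assms by simp
qed

end

section \<open>Tensor products as coinvariants\<close>

text \<open>By \<open>om_id\<close> the twist \<open>th\<close> cancels \<open>nu\<close>, and the
  coinvariant relations become \<open>a p - p a\<close>. These are the relations that remain in the
  tensor product of \<open>A\<close> and \<open>P\<close> over \<open>E\<close> once each tensor is
  written as \<open>1 \<otimes> m\<close>.\<close>

locale tate_homology = tate_complex k A E J I x y lam nu Lam AL th al T d \<eta> S q \<phi>
  for k :: "'k ring" and A :: "('k, 'a) module" and E :: "('k, 'e) module"
    and J and I :: "'i set" and x y lam nu Lam AL th al
    and T :: "int \<Rightarrow> ('e, 'm) module" and d and \<eta> and S :: "int \<Rightarrow> 's set" and q \<phi> +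
  fixes AR :: "('e, 'a) module"
  assumes om_id: "a \<in> carrier A \<Longrightarrow> om a = a"
    and AR_simps: "carrier AR = carrier A" "add AR = add A" "zero AR = zero A"
    and AR_linear: "b \<in> carrier A \<Longrightarrow> (\<lambda>e. e \<odot>\<^bsub>AR\<^esub> b) \<in> linear_maps k E A"
    and AR_J: "\<lbrakk>a \<in> carrier A; b \<in> carrier A; c \<in> carrier A\<rbrakk> \<Longrightarrow> J a b \<odot>\<^bsub>AR\<^esub> c = b \<otimes>\<^bsub>A\<^esub> c \<otimes>\<^bsub>A\<^esub> a"
begin

context
  fixes P :: "('e, 'm) module" assumes P: "left_module E P"
begin

interpretation P: lmod E P using P by (rule lmod.intro)

definition "TF = free_module k (carrier A \<times> carrier P)"
definition "TR = tensor_relations k E AR P"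

lemma TF_module: "left_module k TF"
  unfolding TF_def by (rule A.K.free_left_module)

interpretation TF: lmod k TF by (rule lmod.intro[OF TF_module])
interpretation rsP: lmod k "restrict_scalars E P" by (rule lmod.intro[OF rs_module[OF P]])

lemma TF_basis [simp]: "\<lbrakk>b \<in> carrier A; m \<in> carrier P\<rbrakk> \<Longrightarrow> basis_vector k (b, m) \<in> carrier TF"
  unfolding TF_def by simp

lemma AR_closed [simp]: "\<lbrakk>r \<in> carrier E; b \<in> carrier A\<rbrakk> \<Longrightarrow> r \<odot>\<^bsub>AR\<^esub> b \<in> carrier A"
  using lin_closed[OF AR_linear] by simp

lemma AR_scal: "\<lbrakk>r \<in> carrier k; b \<in> carrier A\<rbrakk> \<Longrightarrow> (r \<odot>\<^bsub>E\<^esub> \<one>\<^bsub>E\<^esub>) \<odot>\<^bsub>AR\<^esub> b = r \<odot>\<^bsub>A\<^esub> b"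
  by (simp add: scal_J(2) AR_J A.smult_mult_left)

definition "TG =
    {basis_vector k (b \<oplus>\<^bsub>A\<^esub> b', m) \<ominus>\<^bsub>TF\<^esub> (basis_vector k (b, m) \<oplus>\<^bsub>TF\<^esub> basis_vector k (b', m)) |b b' m.
       b \<in> carrier A \<and> b' \<in> carrier A \<and> m \<in> carrier P} \<union>
    {basis_vector k (b, m \<oplus>\<^bsub>P\<^esub> m') \<ominus>\<^bsub>TF\<^esub> (basis_vector k (b, m) \<oplus>\<^bsub>TF\<^esub> basis_vector k (b, m')) |b m m'.
       b \<in> carrier A \<and> m \<in> carrier P \<and> m' \<in> carrier P} \<union>
    {basis_vector k ((r \<odot>\<^bsub>E\<^esub> \<one>\<^bsub>E\<^esub>) \<odot>\<^bsub>AR\<^esub> b, m) \<ominus>\<^bsub>TF\<^esub> (r \<odot>\<^bsub>TF\<^esub> basis_vector k (b, m)) |r b m.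
       r \<in> carrier k \<and> b \<in> carrier A \<and> m \<in> carrier P} \<union>
    {basis_vector k (b, (r \<odot>\<^bsub>E\<^esub> \<one>\<^bsub>E\<^esub>) \<odot>\<^bsub>P\<^esub> m) \<ominus>\<^bsub>TF\<^esub> (r \<odot>\<^bsub>TF\<^esub> basis_vector k (b, m)) |r b m.
       r \<in> carrier k \<and> b \<in> carrier A \<and> m \<in> carrier P} \<union>
    {basis_vector k (r \<odot>\<^bsub>AR\<^esub> b, m) \<ominus>\<^bsub>TF\<^esub> basis_vector k (b, r \<odot>\<^bsub>P\<^esub> m) |r b m.
       r \<in> carrier E \<and> b \<in> carrier A \<and> m \<in> carrier P}"

lemma TR_eq: "TR = module_span k TF TG"
  by (simp add: TR_def TG_def tensor_relations_def bilinear_relations_def Let_def TF_def[symmetric] AR_simps)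

lemma TG_carrier: "TG \<subseteq> carrier TF"
  unfolding TG_def by (intro Un_least subsetI; clarsimp simp: A.KM.M.a_closed AR_scal)

lemma TR_submodule: "submodule TR k TF"
  unfolding TR_eq by (rule TF.span_submodule[OF TG_carrier])

interpretation TR: submod k TF TR
  by (intro submod.intro submod_axioms.intro lmod.intro TF_module TR_submodule)

abbreviation "TS \<equiv> tensor_space k E AR P"

lemma TS_eq: "TS = quotient_module TF TR"
  by (simp add: tensor_space_def TF_def TR_def AR_simps)

lemma TS_module: "left_module k TS"
  unfolding TS_eq by (rule TR.quot_left_module)

definition tens_one :: "'m \<Rightarrow> ('a \<times> 'm \<Rightarrow> 'k) set" where
  "tens_one m = TR +>\<^bsub>TF\<^esub> basis_vector k (\<one>\<^bsub>A\<^esub>, m)"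

text \<open>The map \<open>b \<otimes> m \<mapsto> b m\<close> on formal sums; modulo the relations
  it inverts \<open>tens_one\<close>.\<close>

definition collapse :: "('a \<times> 'm \<Rightarrow> 'k) \<Rightarrow> 'm" where
  "collapse = lin_ext k (restrict_scalars E P) (\<lambda>p. J (fst p) \<one>\<^bsub>A\<^esub> \<odot>\<^bsub>P\<^esub> snd p)"

lemma collapse_linear: "collapse \<in> linear_maps k TF (restrict_scalars E P)"
  unfolding TF_def collapse_def by (rule rsP.lin_ext_linear) auto

lemma collapse_basis: "\<lbrakk>b \<in> carrier A; m \<in> carrier P\<rbrakk> \<Longrightarrow> collapse (basis_vector k (b, m)) = J b \<one>\<^bsub>A\<^esub> \<odot>\<^bsub>P\<^esub> m"
  unfolding collapse_def by (subst rsP.lin_ext_basis) auto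

lemma coset_TG:
  assumes "u \<ominus>\<^bsub>TF\<^esub> v \<in> TG" "u \<in> carrier TF" "v \<in> carrier TF"
  shows "TR +>\<^bsub>TF\<^esub> u = TR +>\<^bsub>TF\<^esub> v"
  using assms TR.coset_eq_iff[OF assms(2,3)] span_superset[of TG k TF] by (auto simp: TR_eq)

lemma tens_one_balanced:
  assumes "r \<in> carrier E" "b \<in> carrier A" "m \<in> carrier P"
  shows "TR +>\<^bsub>TF\<^esub> basis_vector k (r \<odot>\<^bsub>AR\<^esub> b, m) = TR +>\<^bsub>TF\<^esub> basis_vector k (b, r \<odot>\<^bsub>P\<^esub> m)"
proof (rule coset_TG)
  show "basis_vector k (r \<odot>\<^bsub>AR\<^esub> b, m) \<ominus>\<^bsub>TF\<^esub> basis_vector k (b, r \<odot>\<^bsub>P\<^esub> m) \<in> TG"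
    unfolding TG_def by (rule UnI2, rule CollectI, intro exI, rule conjI, rule refl) (use assms in auto)
qed (use assms in auto)

text \<open>\<open>J b \<one>\<close> sends \<open>\<one>\<close> to \<open>b\<close> in the right
  module, and the tensor product moves this action over to \<open>m\<close>.\<close>

lemma tens_one_basis:
  assumes "b \<in> carrier A" "m \<in> carrier P"
  shows "TR +>\<^bsub>TF\<^esub> basis_vector k (b, m) = tens_one (J b \<one>\<^bsub>A\<^esub> \<odot>\<^bsub>P\<^esub> m)"
  using tens_one_balanced[of "J b \<one>\<^bsub>A\<^esub>" "\<one>\<^bsub>A\<^esub>" m] assms by (simp add: AR_J tens_one_def)

lemma tens_one_linear: "tens_one \<in> linear_maps k (restrict_scalars E P) TS"
proof (rule linear_mapsI)
  fix m assume "m \<in> carrier (restrict_scalars E P)"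
  then show "tens_one m \<in> carrier TS" unfolding TS_eq tens_one_def by simp
  fix r assume r: "r \<in> carrier k"
  have "TR +>\<^bsub>TF\<^esub> basis_vector k (\<one>\<^bsub>A\<^esub>, (r \<odot>\<^bsub>E\<^esub> \<one>\<^bsub>E\<^esub>) \<odot>\<^bsub>P\<^esub> m) = TR +>\<^bsub>TF\<^esub> (r \<odot>\<^bsub>TF\<^esub> basis_vector k (\<one>\<^bsub>A\<^esub>, m))"
  proof (rule coset_TG)
    show "basis_vector k (\<one>\<^bsub>A\<^esub>, (r \<odot>\<^bsub>E\<^esub> \<one>\<^bsub>E\<^esub>) \<odot>\<^bsub>P\<^esub> m) \<ominus>\<^bsub>TF\<^esub> (r \<odot>\<^bsub>TF\<^esub> basis_vector k (\<one>\<^bsub>A\<^esub>, m)) \<in> TG"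
      unfolding TG_def by (rule UnI1, rule UnI2, rule CollectI, intro exI, rule conjI, rule refl)
        (use r \<open>m \<in> carrier (restrict_scalars E P)\<close> in auto)
  qed (use r \<open>m \<in> carrier (restrict_scalars E P)\<close> in auto)
  then show "tens_one (r \<odot>\<^bsub>restrict_scalars E P\<^esub> m) = r \<odot>\<^bsub>TS\<^esub> tens_one m"
    unfolding TS_eq tens_one_def using r \<open>m \<in> carrier (restrict_scalars E P)\<close> by (simp add: TR.coset_smult)
next
  fix m m' assume m: "m \<in> carrier (restrict_scalars E P)" "m' \<in> carrier (restrict_scalars E P)"
  have "TR +>\<^bsub>TF\<^esub> basis_vector k (\<one>\<^bsub>A\<^esub>, m \<oplus>\<^bsub>P\<^esub> m')
      = TR +>\<^bsub>TF\<^esub> (basis_vector k (\<one>\<^bsub>A\<^esub>, m) \<oplus>\<^bsub>TF\<^esub> basis_vector k (\<one>\<^bsub>A\<^esub>, m'))"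
  proof (rule coset_TG)
    show "basis_vector k (\<one>\<^bsub>A\<^esub>, m \<oplus>\<^bsub>P\<^esub> m') \<ominus>\<^bsub>TF\<^esub> (basis_vector k (\<one>\<^bsub>A\<^esub>, m) \<oplus>\<^bsub>TF\<^esub> basis_vector k (\<one>\<^bsub>A\<^esub>, m')) \<in> TG"
      unfolding TG_def by (rule UnI1, rule UnI1, rule UnI1, rule UnI2, rule CollectI, intro exI, rule conjI, rule refl)
        (use m in auto)
  qed (use m in auto)
  then show "tens_one (m \<oplus>\<^bsub>restrict_scalars E P\<^esub> m') = tens_one m \<oplus>\<^bsub>TS\<^esub> tens_one m'"
    unfolding TS_eq tens_one_def using m by (simp add: TR.coset_add)
qed

lemma tens_one_collapse:
  assumes "f \<in> carrier TF" shows "TR +>\<^bsub>TF\<^esub> f = tens_one (collapse f)"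
proof -
  interpret TS: lmod k TS by (rule lmod.intro[OF TS_module])
  have "(\<lambda>f. TR +>\<^bsub>TF\<^esub> f) \<in> linear_maps k TF TS" unfolding TS_eq by (rule TR.coset_linear)
  then show ?thesis
    using TS.free_linear_eq[of "\<lambda>f. TR +>\<^bsub>TF\<^esub> f" "carrier A \<times> carrier P" "\<lambda>f. tens_one (collapse f)" f]
      linear_maps_comp[OF collapse_linear tens_one_linear] tens_one_basis assms
    by (auto simp: collapse_basis TF_def[symmetric])
qed

lemma tens_one_surj:
  assumes "z \<in> carrier TS" obtains m where "m \<in> carrier P" "z = tens_one m"
proof -
  obtain f where f: "f \<in> carrier TF" "z = TR +>\<^bsub>TF\<^esub> f"
    using assms unfolding TS_eq by (rule TR.quot_cases)
  then show thesis
    using that[of "collapse f"] tens_one_collapse lin_closed[OF collapse_linear] by auto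
qed

text \<open>For the balancing relation of the scalar \<open>J a c\<close> the difference is
  \<open>c (b a m) - (b a m) c\<close> in bimodule notation, which is a coinvariant relation because
  \<open>om\<close> is the identity. The bilinear relations are sent to zero.\<close>

lemma collapse_TR:
  assumes "f \<in> TR" shows "collapse f \<in> coinv_relations P"
proof -
  interpret c: lmap k TF "restrict_scalars E P" collapse
    by (rule lmapI[OF TF_module rs_module[OF P] collapse_linear])
  note C = coinv_submodule[OF P]
  have bal: "J (r \<odot>\<^bsub>AR\<^esub> b) \<one>\<^bsub>A\<^esub> \<odot>\<^bsub>P\<^esub> m \<ominus>\<^bsub>P\<^esub> J b \<one>\<^bsub>A\<^esub> \<odot>\<^bsub>P\<^esub> (r \<odot>\<^bsub>P\<^esub> m) \<in> coinv_relations P"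
    if r: "r \<in> carrier E" and b: "b \<in> carrier A" and m: "m \<in> carrier P" for r b m
    using r
  proof (induction r rule: E_induct)
    case (J a c)
    have "J c \<one>\<^bsub>A\<^esub> \<odot>\<^bsub>P\<^esub> (J (b \<otimes>\<^bsub>A\<^esub> a) \<one>\<^bsub>A\<^esub> \<odot>\<^bsub>P\<^esub> m) \<ominus>\<^bsub>P\<^esub> J \<one>\<^bsub>A\<^esub> (om c) \<odot>\<^bsub>P\<^esub> (J (b \<otimes>\<^bsub>A\<^esub> a) \<one>\<^bsub>A\<^esub> \<odot>\<^bsub>P\<^esub> m)
        \<in> coinv_relations P" using J b m by (intro coinv_mem[OF P]) auto
    then show ?case
      using J b m by (simp add: om_id AR_J P.smult_assoc1[symmetric] A.m_assoc)
  next
    case (add e f)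
    have eq: "J ((e \<oplus>\<^bsub>E\<^esub> f) \<odot>\<^bsub>AR\<^esub> b) \<one>\<^bsub>A\<^esub> \<odot>\<^bsub>P\<^esub> m \<ominus>\<^bsub>P\<^esub> J b \<one>\<^bsub>A\<^esub> \<odot>\<^bsub>P\<^esub> ((e \<oplus>\<^bsub>E\<^esub> f) \<odot>\<^bsub>P\<^esub> m)
      = (J (e \<odot>\<^bsub>AR\<^esub> b) \<one>\<^bsub>A\<^esub> \<odot>\<^bsub>P\<^esub> m \<ominus>\<^bsub>P\<^esub> J b \<one>\<^bsub>A\<^esub> \<odot>\<^bsub>P\<^esub> (e \<odot>\<^bsub>P\<^esub> m)) \<oplus>\<^bsub>P\<^esub>
        (J (f \<odot>\<^bsub>AR\<^esub> b) \<one>\<^bsub>A\<^esub> \<odot>\<^bsub>P\<^esub> m \<ominus>\<^bsub>P\<^esub> J b \<one>\<^bsub>A\<^esub> \<odot>\<^bsub>P\<^esub> (f \<odot>\<^bsub>P\<^esub> m))"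
      using add(1,2) b m lin_add[OF AR_linear[OF b] add(1,2)] lin_add[OF J_left[OF A.one_closed]]
      by (simp add: P.smult_l_distr P.smult_r_distr a_minus_def P.M.minus_add P.M.a_ac)
    show ?case
      unfolding eq using submodule_add_closed[OF C add(3,4)] by simp
  qed
  have "TR \<subseteq> {f \<in> carrier TF. collapse f \<in> coinv_relations P}"
    unfolding TR_eq
  proof (rule span_least[OF c.vimage_submodule[OF C]])
    have z: "u \<ominus>\<^bsub>P\<^esub> u \<in> coinv_relations P" if "u \<in> carrier P" for u
      using submodule_zero_closed[OF C] P.diff_eq_zero_iff[OF that that] by simp
    note Jl = lin_add[OF J_left[OF A.one_closed]] and Js = J_scal(1)[OF _ _ A.one_closed]
    have "collapse g \<in> coinv_relations P" if "g \<in> TG" for g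
      using that unfolding TG_def
    proof (elim UnE CollectE exE conjE, goal_cases)
      case (1 b b' m)
      then show ?case
        using z[of "(J b \<one>\<^bsub>A\<^esub> \<oplus>\<^bsub>E\<^esub> J b' \<one>\<^bsub>A\<^esub>) \<odot>\<^bsub>P\<^esub> m"] c.map_diff[of "basis_vector k (b \<oplus>\<^bsub>A\<^esub> b', m)" "basis_vector k (b, m) \<oplus>\<^bsub>TF\<^esub> basis_vector k (b', m)"]
        by (simp add: collapse_basis Jl P.smult_l_distr)
    next
      case (2 b m m')
      then show ?case
        using z[of "J b \<one>\<^bsub>A\<^esub> \<odot>\<^bsub>P\<^esub> (m \<oplus>\<^bsub>P\<^esub> m')"] c.map_diff[of "basis_vector k (b, m \<oplus>\<^bsub>P\<^esub> m')" "basis_vector k (b, m) \<oplus>\<^bsub>TF\<^esub> basis_vector k (b, m')"]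
        by (simp add: collapse_basis P.smult_r_distr)
    next
      case (3 r b m)
      then have "J (r \<odot>\<^bsub>A\<^esub> b) \<one>\<^bsub>A\<^esub> \<odot>\<^bsub>P\<^esub> m = (r \<odot>\<^bsub>E\<^esub> \<one>\<^bsub>E\<^esub>) \<odot>\<^bsub>P\<^esub> (J b \<one>\<^bsub>A\<^esub> \<odot>\<^bsub>P\<^esub> m)"
        by (simp add: P.smult_assoc1[symmetric] E.scal_mult Js)
      then show ?case
        using 3 z[of "J (r \<odot>\<^bsub>A\<^esub> b) \<one>\<^bsub>A\<^esub> \<odot>\<^bsub>P\<^esub> m"] c.map_diff[of "basis_vector k (r \<odot>\<^bsub>A\<^esub> b, m)" "r \<odot>\<^bsub>TF\<^esub> basis_vector k (b, m)"]
        by (simp add: collapse_basis AR_scal)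
    next
      case (4 r b m)
      then have "J b \<one>\<^bsub>A\<^esub> \<odot>\<^bsub>P\<^esub> ((r \<odot>\<^bsub>E\<^esub> \<one>\<^bsub>E\<^esub>) \<odot>\<^bsub>P\<^esub> m) = (r \<odot>\<^bsub>E\<^esub> \<one>\<^bsub>E\<^esub>) \<odot>\<^bsub>P\<^esub> (J b \<one>\<^bsub>A\<^esub> \<odot>\<^bsub>P\<^esub> m)"
        by (simp add: P.smult_assoc1[symmetric] E.scal_mult E.scal_mult_right)
      then show ?case
        using 4 z[of "(r \<odot>\<^bsub>E\<^esub> \<one>\<^bsub>E\<^esub>) \<odot>\<^bsub>P\<^esub> (J b \<one>\<^bsub>A\<^esub> \<odot>\<^bsub>P\<^esub> m)"]
          c.map_diff[of "basis_vector k (b, (r \<odot>\<^bsub>E\<^esub> \<one>\<^bsub>E\<^esub>) \<odot>\<^bsub>P\<^esub> m)" "r \<odot>\<^bsub>TF\<^esub> basis_vector k (b, m)"]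
        by (simp add: collapse_basis)
    next
      case (5 r b m)
      then show ?case
        using bal[of r b m] c.map_diff[of "basis_vector k (r \<odot>\<^bsub>AR\<^esub> b, m)" "basis_vector k (b, r \<odot>\<^bsub>P\<^esub> m)"]
        by (simp add: collapse_basis)
    qed
    then show "TG \<subseteq> {f \<in> carrier TF. collapse f \<in> coinv_relations P}" using TG_carrier by auto
  qed
  then show ?thesis using assms by auto
qed

text \<open>One direction recovers the difference by \<open>collapse\<close>. For the other,
  \<open>1 \<otimes> a p\<close> and \<open>1 \<otimes> p a\<close> are both equal to
  \<open>a \<otimes> p\<close>. So the tensor product over \<open>E\<close> is \<open>P\<close>
  modulo the relations.\<close>

lemma tens_one_eq_iff:
  assumes m: "m \<in> carrier P" "m' \<in> carrier P"
  shows "tens_one m = tens_one m' \<longleftrightarrow> m \<ominus>\<^bsub>P\<^esub> m' \<in> coinv_relations P"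
proof
  interpret c: lmap k TF "restrict_scalars E P" collapse
    by (rule lmapI[OF TF_module rs_module[OF P] collapse_linear])
  assume "tens_one m = tens_one m'"
  then have "basis_vector k (\<one>\<^bsub>A\<^esub>, m) \<ominus>\<^bsub>TF\<^esub> basis_vector k (\<one>\<^bsub>A\<^esub>, m') \<in> TR"
    unfolding tens_one_def using m by (simp add: TR.coset_eq_iff)
  from collapse_TR[OF this] show "m \<ominus>\<^bsub>P\<^esub> m' \<in> coinv_relations P"
    using m by (simp add: collapse_basis J_one)
next
  interpret t: lmap k "restrict_scalars E P" TS tens_one
    by (rule lmapI[OF rs_module[OF P] TS_module tens_one_linear])
  assume *: "m \<ominus>\<^bsub>P\<^esub> m' \<in> coinv_relations P"
  have "tens_one (m \<ominus>\<^bsub>P\<^esub> m') = \<zero>\<^bsub>TS\<^esub>"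
  proof (rule coinv_functional[OF P TS_module tens_one_linear _ *])
    fix a p assume ap: "a \<in> carrier A" "p \<in> carrier P"
    then show "tens_one (J a \<one>\<^bsub>A\<^esub> \<odot>\<^bsub>P\<^esub> p) = tens_one (J \<one>\<^bsub>A\<^esub> (om a) \<odot>\<^bsub>P\<^esub> p)"
      using tens_one_balanced[of "J a \<one>\<^bsub>A\<^esub>" "\<one>\<^bsub>A\<^esub>" p] tens_one_balanced[of "J \<one>\<^bsub>A\<^esub> a" "\<one>\<^bsub>A\<^esub>" p]
      by (simp add: AR_J om_id tens_one_def)
  qed
  then have "tens_one m \<ominus>\<^bsub>TS\<^esub> tens_one m' = \<zero>\<^bsub>TS\<^esub>" using t.map_diff[of m m'] m by simp
  then show "tens_one m = tens_one m'"
    using t.N.diff_eq_zero_iff[of "tens_one m" "tens_one m'"] lin_closed[OF tens_one_linear, simplified, OF m(1)] lin_closed[OF tens_one_linear, simplified, OF m(2)] by blast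
qed

end

text \<open>\<open>tensor_map\<close> takes a union over all representatives of a class. Each of
  them collapses to \<open>m\<close> modulo the relations, and \<open>f\<close> preserves relations,
  so the united cosets are equal.\<close>

lemma tensor_map_tens_one:
  fixes P P' :: "('e, 'm) module"
  assumes P: "left_module E P" and P': "left_module E P'" and f: "f \<in> linear_maps E P P'" and m: "m \<in> carrier P"
  shows "tensor_map k E AR P' f (tens_one P m) = tens_one P' (f m)"
proof -
  interpret TR: submod k "TF P" "TR P"
    by (intro submod.intro submod_axioms.intro lmod.intro TF_module[OF P] TR_submodule[OF P])
  interpret TF': lmod k "TF P'" by (rule lmod.intro[OF TF_module[OF P']])
  interpret P: lmod E P by (rule lmod.intro[OF P])
  interpret P': lmod E P' by (rule lmod.intro[OF P'])
  interpret f: lmap E P P' f by (rule lmapI[OF P P' f])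
  interpret rsP': lmod k "restrict_scalars E P'" by (rule lmod.intro[OF rs_module[OF P']])
  let ?g = "free_module_map k (map_prod id f)"
  have g: "?g \<in> linear_maps k (TF P) (TF P')"
    unfolding TF_def[OF P] TF_def[OF P'] by (rule A.K.free_module_map_linear) auto
  have comm: "collapse P' (?g h) = f (collapse P h)" if "h \<in> carrier (TF P)" for h
  proof -
    have "f \<in> linear_maps k (restrict_scalars E P) (restrict_scalars E P')"
      by (rule E.linear_maps_restrict_scalars[OF f])
    from linear_maps_comp[OF collapse_linear[OF P] this] linear_maps_comp[OF g collapse_linear[OF P']]
    show ?thesis
      using rsP'.free_linear_eq[of "\<lambda>h. collapse P' (?g h)" "carrier A \<times> carrier P" "\<lambda>h. f (collapse P h)" h] that
      by (auto simp: TF_def[OF P, symmetric] collapse_basis[OF P] collapse_basis[OF P'])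
  qed
  have c: "TR P' +>\<^bsub>TF P'\<^esub> ?g h = tens_one P' (f m)" if h: "h \<in> tens_one P m" for h
  proof -
    have hF: "h \<in> carrier (TF P)" and "TR P +>\<^bsub>TF P\<^esub> h = tens_one P m"
      using h m TR.mem_coset_iff[of "basis_vector k (\<one>\<^bsub>A\<^esub>, m)" h]
        TR.S.a_repr_independence'[of h "basis_vector k (\<one>\<^bsub>A\<^esub>, m)"]
      unfolding tens_one_def[OF P] by (auto simp: TF_basis[OF P])
    then have "collapse P h \<ominus>\<^bsub>P\<^esub> m \<in> coinv_relations P"
      using tens_one_collapse[OF P hF] tens_one_eq_iff[OF P _ m] lin_closed[OF collapse_linear[OF P] hF] by simp
    from coinv_map[OF P P' f this]
    have "tens_one P' (f (collapse P h)) = tens_one P' (f m)"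
      using tens_one_eq_iff[OF P'] m lin_closed[OF collapse_linear[OF P] hF] by simp
    then show ?thesis
      using tens_one_collapse[OF P' lin_closed[OF g hF]] comm[OF hF] by simp
  qed
  have "tensor_map k E AR P' f (tens_one P m) = (\<Union>h\<in>tens_one P m. TR P' +>\<^bsub>TF P'\<^esub> ?g h)"
    by (simp add: tensor_map_def TF_def[OF P'] TR_def[OF P'] AR_simps)
  also have "\<dots> = (\<Union>h\<in>tens_one P m. tens_one P' (f m))" using c by (intro SUP_cong) auto
  also have "\<dots> = tens_one P' (f m)"
    using TR.coset_self[of "basis_vector k (\<one>\<^bsub>A\<^esub>, m)"] m unfolding tens_one_def[OF P]
    by (auto simp: TF_basis[OF P])
  finally show ?thesis .
qed

abbreviation "TST m \<equiv> tensor_space k E AR (T m)"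

lemma tens_one_zero: "left_module E P \<Longrightarrow> m \<in> carrier P \<Longrightarrow>
  tens_one P m = \<zero>\<^bsub>tensor_space k E AR P\<^esub> \<longleftrightarrow> m \<in> coinv_relations P"
proof -
  assume P: "left_module E P" and m: "m \<in> carrier P"
  interpret P: lmod E P by (rule lmod.intro[OF P])
  interpret t: lmap k "restrict_scalars E P" "tensor_space k E AR P" "tens_one P"
    by (rule lmapI[OF rs_module[OF P] TS_module[OF P] tens_one_linear[OF P]])
  show ?thesis
    using tens_one_eq_iff[OF P m P.M.zero_closed] t.map_zero P.diff_zero[OF m] by simp
qed

lemma tensor_map_linear:
  fixes P P' :: "('e, 'm) module"
  assumes P: "left_module E P" and P': "left_module E P'" and f: "f \<in> linear_maps E P P'"
  shows "tensor_map k E AR P' f \<in> linear_maps k (tensor_space k E AR P) (tensor_space k E AR P')"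
proof (rule linear_mapsI)
  interpret P: lmod E P by (rule lmod.intro[OF P])
  interpret rsP: lmod k "restrict_scalars E P" by (rule lmod.intro[OF rs_module[OF P]])
  note t = tens_one_linear[OF P] and t' = tens_one_linear[OF P']
  note fr = E.linear_maps_restrict_scalars[OF f]
  fix z assume z: "z \<in> carrier (tensor_space k E AR P)"
  obtain m where m: "m \<in> carrier P" "z = tens_one P m" using tens_one_surj[OF P z] by blast
  show "tensor_map k E AR P' f z \<in> carrier (tensor_space k E AR P')"
    using m lin_closed[OF t'] lin_closed[OF f] by (simp add: tensor_map_tens_one[OF P P' f])
  { fix r assume r: "r \<in> carrier k"
    have "r \<odot>\<^bsub>restrict_scalars E P\<^esub> m \<in> carrier P" using rsP.smult_closed[OF r, of m] m by simp
    then show "tensor_map k E AR P' f (r \<odot>\<^bsub>tensor_space k E AR P\<^esub> z) = r \<odot>\<^bsub>tensor_space k E AR P'\<^esub> tensor_map k E AR P' f z"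
      using m lin_smult[OF t r, of m, symmetric] lin_smult[OF fr r, of m] lin_smult[OF t' r, of "f m"] lin_closed[OF f]
      by (simp add: tensor_map_tens_one[OF P P' f] del: restrict_scalars_simps(4)) }
  fix z' assume z': "z' \<in> carrier (tensor_space k E AR P)"
  obtain m' where m': "m' \<in> carrier P" "z' = tens_one P m'" using tens_one_surj[OF P z'] by blast
  show "tensor_map k E AR P' f (z \<oplus>\<^bsub>tensor_space k E AR P\<^esub> z')
      = tensor_map k E AR P' f z \<oplus>\<^bsub>tensor_space k E AR P'\<^esub> tensor_map k E AR P' f z'"
    using m m' lin_add[OF t, of m m', symmetric] lin_add[OF f, of m m'] lin_add[OF t', of "f m" "f m'"] lin_closed[OF f]
    by (simp add: tensor_map_tens_one[OF P P' f])
qed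

text \<open>Every tensor is of the form \<open>1 \<otimes> m\<close> and vanishes exactly when
  \<open>m\<close> is a relation, so cycles and boundaries correspond under
  \<open>z = 1 \<otimes> m\<close>.\<close>

lemma tensor_coinv:
  "subquotient_iso k (TST n) (cycles (TST n) (TST (n - 1)) (tensor_map k E AR (T (n - 1)) (d n)))
     (tensor_map k E AR (T n) (d (n + 1)) ` carrier (TST (n + 1)))
     (rs n) (coinv_cycles n) (coinv_boundaries n)"
proof (rule subquotient_isoI[where Q = "\<lambda>z m. m \<in> coinv_cycles n \<and> z = tens_one (T n) m"])
  note t = tens_one_linear[OF T_mod[of n]]
  note md = tensor_map_tens_one[OF T_mod T_mod dT] and md1 = tensor_map_tens_one[OF T_mod T_mod dT1]
  interpret Tn: lmod E "T n" by (rule lmod.intro[OF T_mod])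
  have cyc: "m \<in> carrier (T n)" "d n m \<in> coinv_relations (T (n - 1))" if "m \<in> coinv_cycles n" for m
    using that by (auto simp: coinv_cycles_def)
  {
    fix z m assume *: "m \<in> coinv_cycles n \<and> z = tens_one (T n) m"
    then show "z \<in> cycles (TST n) (TST (n - 1)) (tensor_map k E AR (T (n - 1)) (d n)) \<and> m \<in> coinv_cycles n"
      using cyc lin_closed[OF t] tens_one_zero[OF T_mod] coinv_carrier by (auto simp: cycles_def md)
    have m: "m \<in> carrier (T n)" using * cyc by auto
    {
      assume "z \<in> tensor_map k E AR (T n) (d (n + 1)) ` carrier (TST (n + 1))"
      then obtain z' where z': "z' \<in> carrier (TST (n + 1))" "z = tensor_map k E AR (T n) (d (n + 1)) z'" by auto
      obtain u where "u \<in> carrier (T (n + 1))" "z' = tens_one (T (n + 1)) u"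
        using tens_one_surj[OF T_mod z'(1)] by blast
      with z' have u: "u \<in> carrier (T (n + 1))" "z = tensor_map k E AR (T n) (d (n + 1)) (tens_one (T (n + 1)) u)"
        by auto
      have du: "d (n + 1) u \<in> carrier (T n)" using lin_closed[OF dT1 u(1)] .
      have "m \<ominus>\<^bsub>T n\<^esub> d (n + 1) u \<in> coinv_relations (T n)"
        using u * m du tens_one_eq_iff[OF T_mod m du] by (simp add: md1)
      then have "(m \<ominus>\<^bsub>T n\<^esub> d (n + 1) u) \<oplus>\<^bsub>T n\<^esub> d (n + 1) u \<in> coinv_boundaries n"
        unfolding coinv_boundaries_def using u(1) by blast
      then show "m \<in> coinv_boundaries n" using Tn.add_diff_cancel[OF m du] by simp
    next
      assume "m \<in> coinv_boundaries n"
      then obtain s u where u: "s \<in> coinv_relations (T n)" "u \<in> carrier (T (n + 1))" "m = s \<oplus>\<^bsub>T n\<^esub> d (n + 1) u"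
        by (auto simp: coinv_boundaries_def)
      have du: "d (n + 1) u \<in> carrier (T n)" using lin_closed[OF dT1 u(2)] .
      have "m \<ominus>\<^bsub>T n\<^esub> d (n + 1) u = s"
        using u du coinv_carrier[OF u(1)] by (simp add: a_minus_def Tn.M.a_assoc Tn.M.r_neg)
      then have "z = tensor_map k E AR (T n) (d (n + 1)) (tens_one (T (n + 1)) u)"
        using * u tens_one_eq_iff[OF T_mod m du] by (simp add: md1)
      then show "z \<in> tensor_map k E AR (T n) (d (n + 1)) ` carrier (TST (n + 1))"
        using lin_closed[OF tens_one_linear[OF T_mod]] u(2) by auto
    }
  next
    fix z assume "z \<in> cycles (TST n) (TST (n - 1)) (tensor_map k E AR (T (n - 1)) (d n))"
    then have z: "z \<in> carrier (TST n)" "tensor_map k E AR (T (n - 1)) (d n) z = \<zero>\<^bsub>TST (n - 1)\<^esub>"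
      by (auto simp: cycles_def)
    obtain m where m: "m \<in> carrier (T n)" "z = tens_one (T n) m" using tens_one_surj[OF T_mod z(1)] by blast
    then have "m \<in> coinv_cycles n"
      using z(2) tens_one_zero[OF T_mod lin_closed[OF dT m(1)]] by (simp add: md coinv_cycles_def)
    then show "\<exists>m. m \<in> coinv_cycles n \<and> z = tens_one (T n) m" using m by blast
  next
    fix z m z' m' assume "m \<in> coinv_cycles n \<and> z = tens_one (T n) m" "m' \<in> coinv_cycles n \<and> z' = tens_one (T n) m'"
    then show "m \<oplus>\<^bsub>rs n\<^esub> m' \<in> coinv_cycles n \<and> z \<oplus>\<^bsub>TST n\<^esub> z' = tens_one (T n) (m \<oplus>\<^bsub>rs n\<^esub> m')"
      using submodule_add_closed[OF coinv_cycles_submodule] lin_add[OF t, of m m'] cyc by auto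
  next
    fix r z m assume "r \<in> carrier k" "m \<in> coinv_cycles n \<and> z = tens_one (T n) m"
    then show "r \<odot>\<^bsub>rs n\<^esub> m \<in> coinv_cycles n \<and> r \<odot>\<^bsub>TST n\<^esub> z = tens_one (T n) (r \<odot>\<^bsub>rs n\<^esub> m)"
      using submodule_smult_closed[OF coinv_cycles_submodule] lin_smult[OF t, of r m] cyc by auto
  }
qed auto

theorem homology_duality:
  "subquotient_iso k (TST n) (cycles (TST n) (TST (n - 1)) (tensor_map k E AR (T (n - 1)) (d n)))
     (tensor_map k E AR (T n) (d (n + 1)) ` carrier (TST (n + 1)))
     (TST (- n - 1)) (cycles (TST (- n - 1)) (TST (- n - 2)) (tensor_map k E AR (T (- n - 2)) (d (- n - 1))))
     (tensor_map k E AR (T (- n - 1)) (d (- n)) ` carrier (TST (- n)))"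
proof -
  have e: "- n - 1 + 1 = - n" "- n - 1 - 1 = - n - 2" by simp_all
  show ?thesis
    by (rule subquotient_iso_trans[OF tensor_coinv subquotient_iso_trans[OF coinv_duality
        subquotient_iso_sym[OF tensor_coinv[of "- n - 1", unfolded e]]]])
qed

end

section \<open>The exterior algebra is a Frobenius algebra\<close>

lemma (in submod) factor_through_quotient:
  assumes N: "left_module R N" and f: "f \<in> linear_maps R M N" and 0: "\<And>x. x \<in> H \<Longrightarrow> f x = \<zero>\<^bsub>N\<^esub>"
  shows "\<exists>g\<in>linear_maps R (quotient_module M H) N. \<forall>x\<in>carrier M. g (H +>\<^bsub>M\<^esub> x) = f x"
proof -
  interpret f: lmap R M N f by (rule lmapI[OF left_module_axioms N f])
  define g where "g z = f (SOME x. x \<in> z)" for z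
  have g: "g (H +>\<^bsub>M\<^esub> x) = f x" if x: "x \<in> carrier M" for x
  proof -
    have "(SOME y. y \<in> H +>\<^bsub>M\<^esub> x) \<in> H +>\<^bsub>M\<^esub> x" using coset_self[OF x] by (rule someI)
    then obtain y where y: "y \<in> carrier M" "y \<ominus>\<^bsub>M\<^esub> x \<in> H" "g (H +>\<^bsub>M\<^esub> x) = f y"
      unfolding g_def mem_coset_iff[OF x] by auto
    then have "f y \<ominus>\<^bsub>N\<^esub> f x = \<zero>\<^bsub>N\<^esub>" using 0[OF y(2)] x by simp
    then have "f y = f x" using f.N.diff_eq_zero_iff[OF lin_closed[OF f y(1)] lin_closed[OF f x]] by blast
    then show ?thesis using y by simp
  qed
  have "g \<in> linear_maps R (quotient_module M H) N"
  proof (rule linear_mapsI)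
    fix X assume "X \<in> carrier (quotient_module M H)"
    then obtain x where x: "x \<in> carrier M" "X = H +>\<^bsub>M\<^esub> x" by (rule quot_cases)
    then show "g X \<in> carrier N" by (simp add: g)
    fix r assume "r \<in> carrier R"
    then show "g (r \<odot>\<^bsub>quotient_module M H\<^esub> X) = r \<odot>\<^bsub>N\<^esub> g X" using x by (simp add: coset_smult g)
  next
    fix X Y assume XY: "X \<in> carrier (quotient_module M H)" "Y \<in> carrier (quotient_module M H)"
    obtain x where x: "x \<in> carrier M" "X = H +>\<^bsub>M\<^esub> x" using XY(1) by (rule quot_cases)
    obtain y where y: "y \<in> carrier M" "Y = H +>\<^bsub>M\<^esub> y" using XY(2) by (rule quot_cases)
    show "g (X \<oplus>\<^bsub>quotient_module M H\<^esub> Y) = g X \<oplus>\<^bsub>N\<^esub> g Y" using x y by (simp add: coset_add g)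
  qed
  then show ?thesis using g by blast
qed

section \<open>Parity of inversions\<close>

fun inversions :: "nat list \<Rightarrow> nat" where
  "inversions [] = 0"
| "inversions (x # xs) = length (filter (\<lambda>y. y < x) xs) + inversions xs"

lemma inversions_swap:
  "i \<noteq> j \<Longrightarrow> even (inversions (u @ i # j # v)) \<longleftrightarrow> odd (inversions (u @ j # i # v))"
  by (induction u) auto

lemma inversions_move:
  "i \<notin> set v \<Longrightarrow> even (inversions (u @ i # v) + inversions (u @ v @ [i]) + length v)"
proof (induction v arbitrary: u)
  case (Cons j v)
  then show ?case using Cons.IH[of "u @ [j]"] inversions_swap[of i j u v] by auto
qed simp

text \<open>Moving \<open>u\<close> past \<open>v\<close> takes \<open>length u * length v\<close>
  transpositions of neighbours, each of which changes the parity.\<close>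

lemma inversions_rotate:
  "distinct (u @ v) \<Longrightarrow> even (inversions (u @ v) + inversions (v @ u) + length u * length v)"
proof (induction u arbitrary: v)
  case (Cons i u)
  have "even (inversions (u @ (v @ [i])) + inversions ((v @ [i]) @ u) + length u * length (v @ [i]))"
    by (rule Cons.IH) (use Cons.prems in auto)
  moreover have "even (inversions ([] @ i # (u @ v)) + inversions ([] @ (u @ v) @ [i]) + length (u @ v))"
    by (rule inversions_move) (use Cons.prems in auto)
  ultimately show ?case by (auto simp: algebra_simps)
qed simp

section \<open>Words in the exterior algebra\<close>

locale exterior = K?: field k for k :: "'k ring" (structure) + fixes c :: nat
begin

definition words :: "nat list monoid" where
  "words = \<lparr>carrier = lists {1..c}, mult = (@), one = []\<rparr>"

lemma words_simps [simp]:
  "carrier words = lists {1..c}" "u \<otimes>\<^bsub>words\<^esub> v = u @ v" "\<one>\<^bsub>words\<^esub> = []"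
  by (simp_all add: words_def)

sublocale FA: monoid_algebra_data k words
proof (intro monoid_algebra_data.intro K.field_axioms)
  show "monoid words" by (rule monoidI) auto
qed

abbreviation "FA \<equiv> monoid_algebra k words"
abbreviation "gen w \<equiv> basis_vector k (w :: nat list)"

definition "relators =
  {gen [i] \<otimes>\<^bsub>FA\<^esub> gen [i] |i. i \<in> {1..c}} \<union>
  {gen [i] \<otimes>\<^bsub>FA\<^esub> gen [j] \<oplus>\<^bsub>FA\<^esub> gen [j] \<otimes>\<^bsub>FA\<^esub> gen [i] |i j. i \<in> {1..c} \<and> j \<in> {1..c} \<and> i \<noteq> j}"

definition "II = Idl\<^bsub>FA\<^esub> relators"
definition "Ext = exterior_algebra k c"

lemma Ext_eq: "Ext = quotient_module FA II"
  by (simp add: Ext_def exterior_algebra_def free_algebra_def II_def relators_def Let_def words_def)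

interpretation FR: ring FA by (rule FA.MA_ring)

lemma gen_closed [simp]: "w \<in> lists {1..c} \<Longrightarrow> gen w \<in> carrier FA"
  by simp

lemma gen_mult: "\<lbrakk>u \<in> lists {1..c}; v \<in> lists {1..c}\<rbrakk> \<Longrightarrow> gen u \<otimes>\<^bsub>FA\<^esub> gen v = gen (u @ v)"
  using FA.MA_basis_mult[of u v] by simp

lemma relators_eq:
  "relators = {gen [i, i] |i. i \<in> {1..c}} \<union> {gen [i, j] \<oplus>\<^bsub>FA\<^esub> gen [j, i] |i j. i \<in> {1..c} \<and> j \<in> {1..c} \<and> i \<noteq> j}"
proof -
  have e: "gen [i] \<otimes>\<^bsub>FA\<^esub> gen [j] = gen [i, j]" if "i \<in> {1..c}" "j \<in> {1..c}" for i j
    using gen_mult[of "[i]" "[j]"] that by simp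
  have "{gen [i] \<otimes>\<^bsub>FA\<^esub> gen [i] |i. i \<in> {1..c}} = {gen [i, i] |i. i \<in> {1..c}}"
    using e by (intro Collect_cong ex_cong1) auto
  moreover have "{gen [i] \<otimes>\<^bsub>FA\<^esub> gen [j] \<oplus>\<^bsub>FA\<^esub> gen [j] \<otimes>\<^bsub>FA\<^esub> gen [i] |i j. i \<in> {1..c} \<and> j \<in> {1..c} \<and> i \<noteq> j}
     = {gen [i, j] \<oplus>\<^bsub>FA\<^esub> gen [j, i] |i j. i \<in> {1..c} \<and> j \<in> {1..c} \<and> i \<noteq> j}"
    using e by (intro Collect_cong ex_cong1) auto
  ultimately show ?thesis unfolding relators_def by simp
qed

lemma relators_carrier: "relators \<subseteq> carrier FA"
proof -
  have "gen [i, j] \<in> carrier FA" if "i \<in> {1..c}" "j \<in> {1..c}" for i j using that by (intro gen_closed) auto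
  then show ?thesis unfolding relators_eq using FA.M.M.a_closed by blast
qed

lemma II_ideal: "ideal II FA"
  unfolding II_def by (rule FR.genideal_ideal[OF relators_carrier])

interpretation II: ideal II FA by (rule II_ideal)

lemma FA_scal: "\<lbrakk>r \<in> carrier k; f \<in> carrier FA\<rbrakk> \<Longrightarrow> (r \<odot>\<^bsub>FA\<^esub> \<one>\<^bsub>FA\<^esub>) \<otimes>\<^bsub>FA\<^esub> f = r \<odot>\<^bsub>FA\<^esub> f"
  using lin_smult[OF FA.MA_mult_linear_left[of f], of r "\<one>\<^bsub>FA\<^esub>"] FR.l_one[of f] FR.one_closed by (simp only:)

lemma II_submodule: "submodule II k FA"
proof (rule FA.M.submodule_intro)
  show "II \<subseteq> carrier FA" by (rule II.a_subset)
  show "\<zero>\<^bsub>FA\<^esub> \<in> II" by (rule II.zero_closed)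
  show "f \<oplus>\<^bsub>FA\<^esub> g \<in> II" if "f \<in> II" "g \<in> II" for f g by (rule II.a_closed[OF that])
  show "r \<odot>\<^bsub>FA\<^esub> f \<in> II" if "r \<in> carrier k" "f \<in> II" for r f
    using II.I_l_closed[OF that(2) FA.M.smult_closed[OF that(1) FR.one_closed]]
      FA_scal[OF that(1) II.a_Hcarr[OF that(2)]] by simp
qed

sublocale Q: submod k FA II
  by (intro submod.intro submod_axioms.intro lmod.intro FA.MA_module II_submodule)

definition word :: "nat list \<Rightarrow> 'k exterior" where
  "word w = II +>\<^bsub>FA\<^esub> gen w"

lemma Ext_module: "left_module k Ext"
  unfolding Ext_eq by (rule Q.quot_left_module)

lemma Ext_mult: "\<lbrakk>f \<in> carrier FA; g \<in> carrier FA\<rbrakk>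
    \<Longrightarrow> (II +>\<^bsub>FA\<^esub> f) \<otimes>\<^bsub>Ext\<^esub> (II +>\<^bsub>FA\<^esub> g) = II +>\<^bsub>FA\<^esub> (f \<otimes>\<^bsub>FA\<^esub> g)"
  by (simp add: Ext_eq quotient_module_simps II.rcoset_mult_add)

lemma Ext_cases:
  assumes "z \<in> carrier Ext" obtains f where "f \<in> carrier FA" "z = II +>\<^bsub>FA\<^esub> f"
  using assms unfolding Ext_eq by (rule Q.quot_cases)

lemma coset_Ext [simp]: "f \<in> carrier FA \<Longrightarrow> II +>\<^bsub>FA\<^esub> f \<in> carrier Ext"
  unfolding Ext_eq by simp

lemma Ext_add: "\<lbrakk>f \<in> carrier FA; g \<in> carrier FA\<rbrakk>
    \<Longrightarrow> (II +>\<^bsub>FA\<^esub> f) \<oplus>\<^bsub>Ext\<^esub> (II +>\<^bsub>FA\<^esub> g) = II +>\<^bsub>FA\<^esub> (f \<oplus>\<^bsub>FA\<^esub> g)"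
  unfolding Ext_eq by (rule Q.coset_add)

lemma Ext_smult: "\<lbrakk>r \<in> carrier k; f \<in> carrier FA\<rbrakk>
    \<Longrightarrow> r \<odot>\<^bsub>Ext\<^esub> (II +>\<^bsub>FA\<^esub> f) = II +>\<^bsub>FA\<^esub> (r \<odot>\<^bsub>FA\<^esub> f)"
  unfolding Ext_eq by (rule Q.coset_smult)

lemma Ext_one: "\<one>\<^bsub>Ext\<^esub> = II +>\<^bsub>FA\<^esub> \<one>\<^bsub>FA\<^esub>"
  by (simp add: Ext_eq quotient_module_simps)

lemma Ext_ring: "ring Ext"
proof (rule ringI)
  show "abelian_group Ext"
    by (rule abelian_group_cong[OF left_module.axioms(2)[OF Ext_module]]) simp_all
  show "monoid Ext"
    by (rule monoidI)
      (use FR.one_closed FR.m_closed in \<open>auto elim!: Ext_cases simp: Ext_mult Ext_one FR.m_assoc FR.l_one FR.r_one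
        simp del: monoid_algebra_simps\<close>)
next
  fix x y z assume "x \<in> carrier Ext" "y \<in> carrier Ext" "z \<in> carrier Ext"
  then obtain f g h where fgh: "f \<in> carrier FA" "g \<in> carrier FA" "h \<in> carrier FA"
    "x = II +>\<^bsub>FA\<^esub> f" "y = II +>\<^bsub>FA\<^esub> g" "z = II +>\<^bsub>FA\<^esub> h" by (meson Ext_cases)
  then show "(x \<oplus>\<^bsub>Ext\<^esub> y) \<otimes>\<^bsub>Ext\<^esub> z = x \<otimes>\<^bsub>Ext\<^esub> z \<oplus>\<^bsub>Ext\<^esub> y \<otimes>\<^bsub>Ext\<^esub> z"
    "z \<otimes>\<^bsub>Ext\<^esub> (x \<oplus>\<^bsub>Ext\<^esub> y) = z \<otimes>\<^bsub>Ext\<^esub> x \<oplus>\<^bsub>Ext\<^esub> z \<otimes>\<^bsub>Ext\<^esub> y"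
    using FA.M.M.a_closed[of f g] FR.m_closed[of f h] FR.m_closed[of g h] FR.m_closed[of h f] FR.m_closed[of h g]
      FR.l_distr[of f g h] FR.r_distr[of f g h]
    by (simp_all add: Ext_add Ext_mult del: monoid_algebra_simps)
qed

lemma Ext_k_algebra: "k_algebra k Ext"
proof (intro k_algebra.intro k_algebra_axioms.intro lmod.intro Ext_module K.field_axioms Ext_ring)
  fix r x y assume r: "r \<in> carrier k" and xy: "x \<in> carrier Ext" "y \<in> carrier Ext"
  obtain f where f: "f \<in> carrier FA" "x = II +>\<^bsub>FA\<^esub> f" using xy(1) by (rule Ext_cases)
  obtain g where g: "g \<in> carrier FA" "y = II +>\<^bsub>FA\<^esub> g" using xy(2) by (rule Ext_cases)
  note fg = FR.m_closed[OF f(1) g(1)] FA.M.smult_closed[OF r f(1)] FA.M.smult_closed[OF r g(1)]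
  show "(r \<odot>\<^bsub>Ext\<^esub> x) \<otimes>\<^bsub>Ext\<^esub> y = r \<odot>\<^bsub>Ext\<^esub> (x \<otimes>\<^bsub>Ext\<^esub> y)"
    using f g r fg lin_smult[OF FA.MA_mult_linear_left[OF g(1)] r f(1)]
    by (simp add: Ext_smult Ext_mult del: monoid_algebra_simps)
  show "x \<otimes>\<^bsub>Ext\<^esub> (r \<odot>\<^bsub>Ext\<^esub> y) = r \<odot>\<^bsub>Ext\<^esub> (x \<otimes>\<^bsub>Ext\<^esub> y)"
    using f g r fg lin_smult[OF FA.MA_mult_linear_right[OF f(1)] r g(1)]
    by (simp add: Ext_smult Ext_mult del: monoid_algebra_simps)
qed

sublocale X: k_algebra k Ext by (rule Ext_k_algebra)

lemma word_closed [simp]: "w \<in> lists {1..c} \<Longrightarrow> word w \<in> carrier Ext"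
  by (simp add: word_def)

lemma word_mult: "\<lbrakk>u \<in> lists {1..c}; v \<in> lists {1..c}\<rbrakk> \<Longrightarrow> word u \<otimes>\<^bsub>Ext\<^esub> word v = word (u @ v)"
  by (simp add: word_def Ext_mult gen_mult)

lemma word_zero: "gen w \<in> II \<Longrightarrow> word w = \<zero>\<^bsub>Ext\<^esub>"
  using II.a_rcos_const[of "gen w"] by (simp add: word_def Ext_eq)

lemma word_square: "i \<in> {1..c} \<Longrightarrow> word [i, i] = \<zero>\<^bsub>Ext\<^esub>"
  using FR.genideal_self[OF relators_carrier] by (intro word_zero) (auto simp: II_def relators_eq)

lemma word_swap:
  assumes "i \<in> {1..c}" "j \<in> {1..c}" "i \<noteq> j"
  shows "word [i, j] = \<ominus>\<^bsub>Ext\<^esub> word [j, i]"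
proof -
  have c: "gen [i, j] \<in> carrier FA" "gen [j, i] \<in> carrier FA" using assms by (auto intro!: gen_closed)
  have "gen [i, j] \<oplus>\<^bsub>FA\<^esub> gen [j, i] \<in> II"
    unfolding II_def by (rule subsetD[OF FR.genideal_self[OF relators_carrier]]) (use assms in \<open>auto simp: relators_eq\<close>)
  then have "II +>\<^bsub>FA\<^esub> (gen [i, j] \<oplus>\<^bsub>FA\<^esub> gen [j, i]) = II" by (rule II.a_rcos_const)
  then have "word [i, j] \<oplus>\<^bsub>Ext\<^esub> word [j, i] = \<zero>\<^bsub>Ext\<^esub>"
    using Ext_add[OF c] by (simp add: word_def Ext_eq)
  then show ?thesis using assms X.KM.M.minus_equality[of "word [i, j]" "word [j, i]"] by simp
qed

lemma Ext_linear_eq_words: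
  assumes g: "g \<in> linear_maps k Ext N" and h: "h \<in> linear_maps k Ext N" and N: "left_module k N"
    and eq: "\<And>w. w \<in> lists {1..c} \<Longrightarrow> g (word w) = h (word w)" and z: "z \<in> carrier Ext"
  shows "g z = h z"
proof -
  obtain f where f: "f \<in> carrier FA" "z = II +>\<^bsub>FA\<^esub> f" using z by (rule Ext_cases)
  have l: "(\<lambda>f. II +>\<^bsub>FA\<^esub> f) \<in> linear_maps k FA Ext" unfolding Ext_eq by (rule Q.coset_linear)
  show ?thesis
    using FA.MA_linear_eq[OF linear_maps_comp[OF l g] linear_maps_comp[OF l h] N _ f(1)] eq f
    by (simp add: word_def)
qed

text \<open>Insertion sort: passing \<open>i\<close> over a smaller letter costs a sign, and a
  repeated letter gives zero. The bound on \<open>set l'\<close> is carried along because it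
  guarantees that \<open>j # l'\<close> is again sorted.\<close>

lemma straighten_insert:
  "\<lbrakk>l \<in> lists {1..c}; sorted_wrt (<) l; i \<in> {1..c}\<rbrakk>
    \<Longrightarrow> \<exists>t\<in>carrier k. \<exists>l'\<in>lists {1..c}. sorted_wrt (<) l' \<and> set l' \<subseteq> insert i (set l) \<and> word (i # l) = t \<odot>\<^bsub>Ext\<^esub> word l'"
proof (induction l)
  case Nil
  then show ?case by (intro bexI[of _ "\<one>"] bexI[of _ "[i]"]) auto
next
  case (Cons j l)
  then have l: "l \<in> lists {1..c}" "sorted_wrt (<) l" "i \<in> {1..c}" "j \<in> {1..c}" by auto
  consider "i < j" | "i = j" | "j < i" by linarith
  then show ?case
  proof cases
    case 1
    then show ?thesis using Cons.prems by (intro bexI[of _ "\<one>"] bexI[of _ "i # j # l"]) auto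
  next
    case 2
    have "word (i # j # l) = word [i, i] \<otimes>\<^bsub>Ext\<^esub> word l"
      using word_mult[of "[i, i]" l] l 2 by simp
    \<comment> \<open>With coefficient zero any sorted word will do; the empty one is taken.\<close>
    also have "\<dots> = \<zero> \<odot>\<^bsub>Ext\<^esub> word []" using l word_square by simp
    finally show ?thesis by (intro bexI[of _ "\<zero>"] bexI[of _ "[]"]) auto
  next
    case 3
    obtain t l' where t: "t \<in> carrier k" "l' \<in> lists {1..c}" "sorted_wrt (<) l'" "set l' \<subseteq> insert i (set l)"
      "word (i # l) = t \<odot>\<^bsub>Ext\<^esub> word l'" using Cons.IH[OF l(1-3)] by auto
    have "word (i # j # l) = word [i, j] \<otimes>\<^bsub>Ext\<^esub> word l" using word_mult[of "[i, j]" l] l by simp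
    also have "\<dots> = \<ominus>\<^bsub>Ext\<^esub> (word [j, i] \<otimes>\<^bsub>Ext\<^esub> word l)" using l 3 word_swap[of i j] by (simp add: X.A.l_minus)
    also have "word [j, i] \<otimes>\<^bsub>Ext\<^esub> word l = word [j] \<otimes>\<^bsub>Ext\<^esub> word (i # l)"
      using word_mult[of "[j, i]" l] word_mult[of "[j]" "i # l"] l by simp
    also have "\<dots> = t \<odot>\<^bsub>Ext\<^esub> word (j # l')"
      using t l word_mult[of "[j]" l'] X.smult_mult_right[of t "word [j]" "word l'"] by simp
    also have "\<ominus>\<^bsub>Ext\<^esub> (t \<odot>\<^bsub>Ext\<^esub> word (j # l')) = (\<ominus> t) \<odot>\<^bsub>Ext\<^esub> word (j # l')"
      using t l by (simp add: X.KM.smult_l_minus)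
    finally show ?thesis
      using t l 3 Cons.prems(2) by (intro bexI[of _ "\<ominus> t"] bexI[of _ "j # l'"]) auto
  qed
qed

lemma straighten:
  "w \<in> lists {1..c} \<Longrightarrow> \<exists>t\<in>carrier k. \<exists>B. B \<subseteq> {1..c} \<and> word w = t \<odot>\<^bsub>Ext\<^esub> word (sorted_list_of_set B)"
proof -
  assume "w \<in> lists {1..c}"
  then have "\<exists>t\<in>carrier k. \<exists>l\<in>lists {1..c}. sorted_wrt (<) l \<and> word w = t \<odot>\<^bsub>Ext\<^esub> word l"
  proof (induction w)
    case Nil
    show ?case by (intro bexI[of _ "\<one>"] bexI[of _ "[]"]) auto
  next
    case (Cons i w)
    then obtain t l where t: "t \<in> carrier k" "l \<in> lists {1..c}" "sorted_wrt (<) l" "word w = t \<odot>\<^bsub>Ext\<^esub> word l" by auto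
    obtain s l' where s: "s \<in> carrier k" "l' \<in> lists {1..c}" "sorted_wrt (<) l'" "word (i # l) = s \<odot>\<^bsub>Ext\<^esub> word l'"
      using straighten_insert[of l i] t Cons by auto
    have "word (i # w) = word [i] \<otimes>\<^bsub>Ext\<^esub> word w" using word_mult[of "[i]" w] Cons by simp
    also have "\<dots> = t \<odot>\<^bsub>Ext\<^esub> word (i # l)"
      using t Cons word_mult[of "[i]" l] X.smult_mult_right[of t "word [i]" "word l"] by simp
    also have "\<dots> = (t \<otimes> s) \<odot>\<^bsub>Ext\<^esub> word l'" using t s by (simp add: X.KM.smult_assoc1)
    finally show ?case using t s by blast
  qed
  then obtain t l where t: "t \<in> carrier k" "l \<in> lists {1..c}" "sorted_wrt (<) l" "word w = t \<odot>\<^bsub>Ext\<^esub> word l" by auto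
  have "sorted_list_of_set (set l) = l"
    using t(3) by (simp add: strict_sorted_iff sorted_list_of_set.idem_if_sorted_distinct)
  then show ?thesis using t by (intro bexI[of _ t] exI[of _ "set l"]) auto
qed

lemma sorted_words [simp]: "B \<subseteq> {1..c} \<Longrightarrow> sorted_list_of_set B \<in> lists {1..c}"
  using finite_subset[of B "{1..c}"] by auto

lemma Ext_linear_eq:
  assumes g: "g \<in> linear_maps k Ext N" and h: "h \<in> linear_maps k Ext N" and N: "left_module k N"
    and eq: "\<And>B. B \<subseteq> {1..c} \<Longrightarrow> g (word (sorted_list_of_set B)) = h (word (sorted_list_of_set B))"
    and z: "z \<in> carrier Ext"
  shows "g z = h z"
proof (rule Ext_linear_eq_words[OF g h N _ z])
  fix w assume "w \<in> lists {1..c}"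
  from straighten[OF this] obtain t B where t: "t \<in> carrier k" "B \<subseteq> {1..c}"
    "word w = t \<odot>\<^bsub>Ext\<^esub> word (sorted_list_of_set B)" by auto
  then show "g (word w) = h (word w)" using lin_smult[OF g t(1) word_closed[OF sorted_words[OF t(2)]]]
      lin_smult[OF h t(1) word_closed[OF sorted_words[OF t(2)]]] eq[OF t(2)] by simp
qed

section \<open>The top coefficient as a Frobenius form\<close>

definition sign :: "nat \<Rightarrow> 'k" where
  "sign n = (if even n then \<one> else \<ominus> \<one>)"

text \<open>The coefficient of a word at \<open>X_1 ... X_c\<close>: the sign of the permutation if
  each letter occurs exactly once, and zero otherwise.\<close>

definition top_sign :: "nat list \<Rightarrow> 'k" where
  "top_sign w = (if distinct w \<and> set w = {1..c} then sign (inversions w) else \<zero>)"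

lemma sign_closed [simp]: "sign n \<in> carrier k" and top_sign_closed [simp]: "top_sign w \<in> carrier k"
  by (auto simp: sign_def top_sign_def)

lemma sign_square: "sign n \<otimes> sign n = \<one>"
  by (simp add: sign_def l_minus r_minus)

lemma sign_mult: "sign m \<otimes> sign n = sign (m + n)"
  by (simp add: sign_def l_minus r_minus)

lemma sign_cong: "even (m + n) \<Longrightarrow> sign m = sign n"
  by (auto simp: sign_def)

lemma top_sign_square: "top_sign (u @ [i, i] @ v) = \<zero>"
  by (simp add: top_sign_def)

lemma top_sign_swap:
  assumes "i \<noteq> j" shows "top_sign (u @ [i, j] @ v) \<oplus> top_sign (u @ [j, i] @ v) = \<zero>"
proof -
  have d: "distinct (u @ [i, j] @ v) \<longleftrightarrow> distinct (u @ [j, i] @ v)" "set (u @ [i, j] @ v) = set (u @ [j, i] @ v)" by auto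
  show ?thesis
    unfolding top_sign_def d using inversions_swap[OF assms, of u v] by (auto simp: sign_def l_neg r_neg)
qed

text \<open>Rotation costs \<open>length u * length v\<close> transpositions. Here
  \<open>length v = c - length u\<close>, and a number has the parity of its square, so this agrees
  with \<open>length u * (c + 1)\<close> modulo 2.\<close>

lemma top_sign_rotate:
  "top_sign (u @ v) = sign (length u * (c + 1)) \<otimes> top_sign (v @ u)"
proof (cases "distinct (u @ v) \<and> set (u @ v) = {1..c}")
  case True
  then have "length (u @ v) = c" using distinct_card[of "u @ v"] by simp
  then have "even (length u * length v + length u * (c + 1))" by auto
  then have "even (inversions (u @ v) + (length u * (c + 1) + inversions (v @ u)))"
    using inversions_rotate[of u v] True by auto
  then show ?thesis using True by (auto simp: top_sign_def sign_mult intro: sign_cong)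
next
  case False
  then show ?thesis by (auto simp: top_sign_def)
qed

definition lam0 :: "(nat list \<Rightarrow> 'k) \<Rightarrow> 'k" where
  "lam0 = lin_ext k (regular_module k) top_sign"

lemma k_module: "left_module k (regular_module k)"
  by (rule regular_left_module[OF K.ring_axioms])

lemma lam0_linear: "lam0 \<in> functionals k FA"
proof -
  interpret rk: lmod k "regular_module k" by (rule lmod.intro[OF k_module])
  have "lam0 \<in> functionals k (free_module k (lists {1..c}))"
    unfolding lam0_def by (rule rk.lin_ext_linear) simp
  moreover have "functionals k FA = functionals k (free_module k (lists {1..c}))"
    by (rule linear_maps_cong_module) (simp_all add: monoid_algebra_carrier)
  ultimately show ?thesis by simp
qed

lemma lam0_gen: "lam0 (gen w) = top_sign w"
proof -
  interpret rk: lmod k "regular_module k" by (rule lmod.intro[OF k_module])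
  show ?thesis unfolding lam0_def by (rule rk.lin_ext_basis) simp
qed

text \<open>The expression is linear in \<open>u\<close> and in \<open>v\<close>, so it suffices to
  let them be words.\<close>

lemma lam0_sandwich:
  assumes g: "g \<in> carrier FA"
    and 0: "\<And>a b. \<lbrakk>a \<in> lists {1..c}; b \<in> lists {1..c}\<rbrakk> \<Longrightarrow> lam0 (gen a \<otimes>\<^bsub>FA\<^esub> g \<otimes>\<^bsub>FA\<^esub> gen b) = \<zero>"
    and uv: "u \<in> carrier FA" "v \<in> carrier FA"
  shows "lam0 (u \<otimes>\<^bsub>FA\<^esub> g \<otimes>\<^bsub>FA\<^esub> v) = \<zero>"
proof -
  note z = linear_maps_zero[OF k_module, simplified]
  have 1: "lam0 (gen a \<otimes>\<^bsub>FA\<^esub> g \<otimes>\<^bsub>FA\<^esub> v) = \<zero>" if a: "a \<in> lists {1..c}" for a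
    by (rule FA.MA_linear_eq[OF linear_maps_comp[OF FA.MA_mult_linear_right[OF FR.m_closed[OF gen_closed[OF a] g]] lam0_linear]
          z k_module _ uv(2)]) (use 0[OF a] in simp)
  show ?thesis
    by (rule FA.MA_linear_eq[OF linear_maps_comp[OF linear_maps_comp[OF FA.MA_mult_linear_left[OF g]
            FA.MA_mult_linear_left[OF uv(2)]] lam0_linear] z k_module _ uv(1)]) (use 1 in simp)
qed

text \<open>The largest ideal contained in the kernel of \<open>lam0\<close> contains the relators.\<close>

lemma lam0_II: "f \<in> II \<Longrightarrow> lam0 f = \<zero>"
proof -
  interpret l: lmap k FA "regular_module k" lam0 by (rule lmapI[OF FA.MA_module k_module lam0_linear])
  let ?K = "{f \<in> carrier FA. \<forall>u\<in>carrier FA. \<forall>v\<in>carrier FA. lam0 (u \<otimes>\<^bsub>FA\<^esub> f \<otimes>\<^bsub>FA\<^esub> v) = \<zero>}"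
  have lin: "(\<lambda>f. lam0 (u \<otimes>\<^bsub>FA\<^esub> f \<otimes>\<^bsub>FA\<^esub> v)) \<in> functionals k FA" if "u \<in> carrier FA" "v \<in> carrier FA" for u v
    by (rule linear_maps_comp[OF linear_maps_comp[OF FA.MA_mult_linear_right[OF that(1)]
          FA.MA_mult_linear_left[OF that(2)]] lam0_linear])
  have "submodule ?K k FA"
  proof (rule FA.M.submodule_intro)
    show "\<zero>\<^bsub>FA\<^esub> \<in> ?K"
      using lmap.map_zero[OF lmapI[OF FA.MA_module k_module lin]] FA.M.M.zero_closed by simp
    show "f \<oplus>\<^bsub>FA\<^esub> g \<in> ?K" if "f \<in> ?K" "g \<in> ?K" for f g
      using that lin_add[OF lin, of _ _ f g] FA.M.M.a_closed[of f g] by (simp del: monoid_algebra_simps)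
    show "r \<odot>\<^bsub>FA\<^esub> f \<in> ?K" if "r \<in> carrier k" "f \<in> ?K" for r f
      using that lin_smult[OF lin, of _ _ r f] FA.M.smult_closed[of r f] by (simp del: monoid_algebra_simps)
  qed auto
  then have sg: "subgroup ?K (add_monoid FA)" by (rule submodule.axioms(1))
  have "ideal ?K FA"
  proof (rule idealI[OF FA.MA_ring sg])
    fix a f assume a: "a \<in> ?K" and f: "f \<in> carrier FA"
    have "lam0 (u \<otimes>\<^bsub>FA\<^esub> (f \<otimes>\<^bsub>FA\<^esub> a) \<otimes>\<^bsub>FA\<^esub> v) = \<zero>" if uv: "u \<in> carrier FA" "v \<in> carrier FA" for u v
    proof -
      have "lam0 (u \<otimes>\<^bsub>FA\<^esub> f \<otimes>\<^bsub>FA\<^esub> a \<otimes>\<^bsub>FA\<^esub> v) = \<zero>" using a FR.m_closed[OF uv(1) f] uv(2) by blast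
      then show ?thesis using FR.m_assoc[of u f a] a f uv by simp
    qed
    then show "f \<otimes>\<^bsub>FA\<^esub> a \<in> ?K" using a f FR.m_closed by auto
    have "lam0 (u \<otimes>\<^bsub>FA\<^esub> (a \<otimes>\<^bsub>FA\<^esub> f) \<otimes>\<^bsub>FA\<^esub> v) = \<zero>" if uv: "u \<in> carrier FA" "v \<in> carrier FA" for u v
    proof -
      have "lam0 (u \<otimes>\<^bsub>FA\<^esub> a \<otimes>\<^bsub>FA\<^esub> (f \<otimes>\<^bsub>FA\<^esub> v)) = \<zero>" using a FR.m_closed[OF f uv(2)] uv(1) by blast
      then show ?thesis
        using FR.m_assoc[of u a f] FR.m_assoc[of "u \<otimes>\<^bsub>FA\<^esub> a" f v] FR.m_closed[of u a] a f uv by simp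
    qed
    then show "a \<otimes>\<^bsub>FA\<^esub> f \<in> ?K" using a f FR.m_closed by auto
  qed
  moreover have "relators \<subseteq> ?K"
  proof
    fix g assume gr: "g \<in> relators"
    then have g: "g \<in> carrier FA" using relators_carrier by auto
    have "lam0 (gen a \<otimes>\<^bsub>FA\<^esub> g \<otimes>\<^bsub>FA\<^esub> gen b) = \<zero>" if ab: "a \<in> lists {1..c}" "b \<in> lists {1..c}" for a b
      using gr unfolding relators_eq
    proof (elim UnE CollectE exE conjE)
      fix i assume "g = gen [i, i]" "i \<in> {1..c}"
      then show ?thesis using ab gen_mult[of a "[i, i]"] gen_mult[of "a @ [i, i]" b] top_sign_square[of a i b] by (simp add: lam0_gen)
    next
      fix i j assume ij: "g = gen [i, j] \<oplus>\<^bsub>FA\<^esub> gen [j, i]" "i \<in> {1..c}" "j \<in> {1..c}" "i \<noteq> j"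
      have w: "[i, j] \<in> lists {1..c}" "[j, i] \<in> lists {1..c}" using ij by auto
      have "gen a \<otimes>\<^bsub>FA\<^esub> g \<otimes>\<^bsub>FA\<^esub> gen b = gen (a @ [i, j] @ b) \<oplus>\<^bsub>FA\<^esub> gen (a @ [j, i] @ b)"
        using ab w gen_closed[of a] gen_closed[of b] gen_closed[OF w(1)] gen_closed[OF w(2)]
        by (simp add: ij(1) FR.r_distr FR.l_distr gen_mult del: monoid_algebra_simps)
      moreover have "gen (a @ [i, j] @ b) \<in> carrier FA" "gen (a @ [j, i] @ b) \<in> carrier FA"
        using ab w by (auto intro!: gen_closed)
      ultimately show ?thesis
        using lin_add[OF lam0_linear, of "gen (a @ [i, j] @ b)" "gen (a @ [j, i] @ b)"] top_sign_swap[OF ij(4), of a b]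
        by (simp add: lam0_gen)
    qed
    then show "g \<in> ?K" using lam0_sandwich[OF g] g by auto
  qed
  ultimately have "II \<subseteq> ?K" unfolding II_def by (rule FR.genideal_minimal)
  moreover assume "f \<in> II"
  ultimately have "f \<in> carrier FA" "lam0 (\<one>\<^bsub>FA\<^esub> \<otimes>\<^bsub>FA\<^esub> f \<otimes>\<^bsub>FA\<^esub> \<one>\<^bsub>FA\<^esub>) = \<zero>"
    using FR.one_closed by blast+
  then show "lam0 f = \<zero>" using FR.l_one FR.r_one by simp
qed

definition lam :: "'k exterior \<Rightarrow> 'k" where
  "lam = (SOME g. g \<in> functionals k Ext \<and> (\<forall>f\<in>carrier FA. g (II +>\<^bsub>FA\<^esub> f) = lam0 f))"

lemma lam_linear: "lam \<in> functionals k Ext"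
  and lam_word: "w \<in> lists {1..c} \<Longrightarrow> lam (word w) = top_sign w"
proof -
  have "\<exists>g. g \<in> functionals k Ext \<and> (\<forall>f\<in>carrier FA. g (II +>\<^bsub>FA\<^esub> f) = lam0 f)"
    using Q.factor_through_quotient[OF k_module lam0_linear] lam0_II unfolding Ext_eq by auto
  from someI_ex[OF this] have *: "lam \<in> functionals k Ext" "\<And>f. f \<in> carrier FA \<Longrightarrow> lam (II +>\<^bsub>FA\<^esub> f) = lam0 f"
    unfolding lam_def by auto
  show "lam \<in> functionals k Ext" by (rule *(1))
  show "lam (word w) = top_sign w" if "w \<in> lists {1..c}"
    using *(2)[OF gen_closed[OF that]] by (simp add: word_def lam0_gen)
qed

section \<open>Dual bases of monomials\<close>

abbreviation "sl B \<equiv> sorted_list_of_set (B :: nat set)"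
abbreviation "co B \<equiv> {1..c} - (B :: nat set)"

definition dy :: "nat set \<Rightarrow> 'k exterior" where
  "dy B = word (sl B)"

text \<open>The complementary monomial, with the sign that makes its pairing with
  \<open>dy B\<close> equal to one.\<close>

definition dx :: "nat set \<Rightarrow> 'k exterior" where
  "dx B = top_sign (sl B @ sl (co B)) \<odot>\<^bsub>Ext\<^esub> word (sl (co B))"

lemma sl_co: "co B \<subseteq> {1..c}" by auto

lemma dy_closed [simp]: "B \<subseteq> {1..c} \<Longrightarrow> dy B \<in> carrier Ext"
  unfolding dy_def by (rule word_closed[OF sorted_words])

lemma dx_closed [simp]: "B \<subseteq> {1..c} \<Longrightarrow> dx B \<in> carrier Ext"
  unfolding dx_def by (intro X.KM.smult_closed word_closed sorted_words sl_co top_sign_closed)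

text \<open>The letters of \<open>B\<close> and of the complement of \<open>D\<close> make up
  \<open>{1..c}\<close> without repetition only if \<open>B = D\<close>.\<close>

lemma lam_pairing:
  assumes "B \<subseteq> {1..c}" "D \<subseteq> {1..c}"
  shows "lam (dy B \<otimes>\<^bsub>Ext\<^esub> dx D) = (if B = D then \<one> else \<zero>)"
proof -
  have fin: "finite B" "finite (co D)" using assms finite_subset[of B "{1..c}"] by auto
  have w: "sl B \<in> lists {1..c}" "sl (co D) \<in> lists {1..c}" using sorted_words[OF assms(1)] sorted_words[OF sl_co] by blast+
  have "dy B \<otimes>\<^bsub>Ext\<^esub> dx D = top_sign (sl D @ sl (co D)) \<odot>\<^bsub>Ext\<^esub> word (sl B @ sl (co D))"
    unfolding dy_def dx_def using w by (simp only: X.smult_mult_right word_closed word_mult top_sign_closed)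
  then have e: "lam (dy B \<otimes>\<^bsub>Ext\<^esub> dx D) = top_sign (sl D @ sl (co D)) \<otimes> top_sign (sl B @ sl (co D))"
    using lin_smult[OF lam_linear top_sign_closed, of "word (sl B @ sl (co D))"] w lam_word[of "sl B @ sl (co D)"]
    by (simp del: set_sorted_list_of_set)
  show ?thesis
  proof (cases "B = D")
    case True
    then have "distinct (sl B @ sl (co D)) \<and> set (sl B @ sl (co D)) = {1..c}" using fin assms by auto
    then show ?thesis using True e by (simp add: top_sign_def sign_square)
  next
    case False
    have "\<not> (distinct (sl B @ sl (co D)) \<and> set (sl B @ sl (co D)) = {1..c})"
    proof
      assume *: "distinct (sl B @ sl (co D)) \<and> set (sl B @ sl (co D)) = {1..c}"
      then have "B \<inter> co D = {}" "B \<union> co D = {1..c}" using fin by auto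
      then show False using False assms by blast
    qed
    then have "top_sign (sl B @ sl (co D)) = \<zero>" by (simp only: top_sign_def if_False)
    then show ?thesis using e False by simp
  qed
qed

abbreviation "PI \<equiv> Pow {1..c}"

lemma lam_closed [simp]: "a \<in> carrier Ext \<Longrightarrow> lam a \<in> carrier k"
  using lin_closed[OF lam_linear] by simp

lemma mult_linear:
  shows "b \<in> carrier Ext \<Longrightarrow> (\<lambda>a. a \<otimes>\<^bsub>Ext\<^esub> b) \<in> linear_maps k Ext Ext"
    and "b \<in> carrier Ext \<Longrightarrow> (\<lambda>a. b \<otimes>\<^bsub>Ext\<^esub> a) \<in> linear_maps k Ext Ext"
  by (rule linear_mapsI; simp add: X.A.l_distr X.A.r_distr X.smult_mult_left X.smult_mult_right)+

lemma combination_linear: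
  assumes "\<And>B. B \<subseteq> {1..c} \<Longrightarrow> f B \<in> functionals k Ext" "\<And>B. B \<subseteq> {1..c} \<Longrightarrow> v B \<in> carrier Ext"
  shows "(\<lambda>a. \<Oplus>\<^bsub>Ext\<^esub>B\<in>PI. f B a \<odot>\<^bsub>Ext\<^esub> v B) \<in> linear_maps k Ext Ext"
proof (rule linear_maps_finsum[OF Ext_module])
  fix B assume B: "B \<in> PI"
  show "(\<lambda>a. f B a \<odot>\<^bsub>Ext\<^esub> v B) \<in> linear_maps k Ext Ext"
    by (rule linear_maps_comp[OF assms(1) orbit_linear[OF Ext_module assms(2)]]) (use B in auto)
qed simp

lemma delta_sum:
  assumes "D \<subseteq> {1..c}" "\<And>B. B \<subseteq> {1..c} \<Longrightarrow> v B \<in> carrier Ext"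
  shows "(\<Oplus>\<^bsub>Ext\<^esub>B\<in>PI. (if B = D then \<one> else \<zero>) \<odot>\<^bsub>Ext\<^esub> v B) = v D"
proof -
  have "(\<Oplus>\<^bsub>Ext\<^esub>B\<in>PI. (if B = D then \<one> else \<zero>) \<odot>\<^bsub>Ext\<^esub> v B) = (\<Oplus>\<^bsub>Ext\<^esub>B\<in>PI. if D = B then v B else \<zero>\<^bsub>Ext\<^esub>)"
    using assms by (intro X.KM.M.finsum_cong') auto
  also have "\<dots> = v D" using assms by (intro X.KM.M.add.finprod_singleton) auto
  finally show ?thesis .
qed

lemma dual_dy:
  assumes a: "a \<in> carrier Ext" shows "(\<Oplus>\<^bsub>Ext\<^esub>B\<in>PI. lam (a \<otimes>\<^bsub>Ext\<^esub> dx B) \<odot>\<^bsub>Ext\<^esub> dy B) = a"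
proof (rule Ext_linear_eq[OF _ _ Ext_module _ a])
  show "(\<lambda>a. \<Oplus>\<^bsub>Ext\<^esub>B\<in>PI. lam (a \<otimes>\<^bsub>Ext\<^esub> dx B) \<odot>\<^bsub>Ext\<^esub> dy B) \<in> linear_maps k Ext Ext"
    by (rule combination_linear[OF linear_maps_comp[OF mult_linear(1) lam_linear]]) auto
  show "(\<lambda>a. a) \<in> linear_maps k Ext Ext" by (rule linear_mapsI) auto
  fix D assume D: "D \<subseteq> {1..c}"
  have "(\<Oplus>\<^bsub>Ext\<^esub>B\<in>PI. lam (dy D \<otimes>\<^bsub>Ext\<^esub> dx B) \<odot>\<^bsub>Ext\<^esub> dy B) = (\<Oplus>\<^bsub>Ext\<^esub>B\<in>PI. (if B = D then \<one> else \<zero>) \<odot>\<^bsub>Ext\<^esub> dy B)"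
    using D by (intro X.KM.M.finsum_cong') (auto simp: lam_pairing)
  then show "(\<Oplus>\<^bsub>Ext\<^esub>B\<in>PI. lam (word (sl D) \<otimes>\<^bsub>Ext\<^esub> dx B) \<odot>\<^bsub>Ext\<^esub> dy B) = word (sl D)"
    using delta_sum[OF D, of dy] by (simp add: dy_def[of D])
qed

lemma dual_dx:
  assumes a: "a \<in> carrier Ext" shows "(\<Oplus>\<^bsub>Ext\<^esub>B\<in>PI. lam (dy B \<otimes>\<^bsub>Ext\<^esub> a) \<odot>\<^bsub>Ext\<^esub> dx B) = a"
proof (rule Ext_linear_eq[OF _ _ Ext_module _ a])
  show lin: "(\<lambda>a. \<Oplus>\<^bsub>Ext\<^esub>B\<in>PI. lam (dy B \<otimes>\<^bsub>Ext\<^esub> a) \<odot>\<^bsub>Ext\<^esub> dx B) \<in> linear_maps k Ext Ext"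
    by (rule combination_linear[OF linear_maps_comp[OF mult_linear(2) lam_linear]]) auto
  show "(\<lambda>a. a) \<in> linear_maps k Ext Ext" by (rule linear_mapsI) auto
  fix B0 assume B0: "B0 \<subseteq> {1..c}"
  \<comment> \<open>Up to the sign \<open>?s\<close> the monomial of \<open>B0\<close> is
    \<open>dx\<close> of the complement, for which all pairings are known.\<close>
  define D where "D = co B0"
  have D: "D \<subseteq> {1..c}" "co D = B0" using B0 by (auto simp: D_def)
  let ?s = "top_sign (sl D @ sl (co D))"
  have "distinct (sl D @ sl (co D)) \<and> set (sl D @ sl (co D)) = {1..c}"
    using D finite_subset[of D "{1..c}"] by auto
  then have ss: "?s \<otimes> ?s = \<one>" by (simp add: top_sign_def sign_square)
  have w: "word (sl B0) \<in> carrier Ext" by (rule word_closed[OF sorted_words[OF B0]])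
  have "?s \<odot>\<^bsub>Ext\<^esub> dx D = (?s \<otimes> ?s) \<odot>\<^bsub>Ext\<^esub> word (sl B0)"
    using w D X.KM.smult_assoc1[OF top_sign_closed top_sign_closed w, of "sl D @ sl (co D)" "sl D @ sl (co D)"] by (simp add: dx_def)
  then have eq: "word (sl B0) = ?s \<odot>\<^bsub>Ext\<^esub> dx D" using ss w by simp
  have "(\<Oplus>\<^bsub>Ext\<^esub>B\<in>PI. lam (dy B \<otimes>\<^bsub>Ext\<^esub> dx D) \<odot>\<^bsub>Ext\<^esub> dx B) = (\<Oplus>\<^bsub>Ext\<^esub>B\<in>PI. (if B = D then \<one> else \<zero>) \<odot>\<^bsub>Ext\<^esub> dx B)"
    using D by (intro X.KM.M.finsum_cong') (auto simp: lam_pairing)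
  then have "(\<Oplus>\<^bsub>Ext\<^esub>B\<in>PI. lam (dy B \<otimes>\<^bsub>Ext\<^esub> dx D) \<odot>\<^bsub>Ext\<^esub> dx B) = dx D"
    using delta_sum[OF D(1), of dx] by simp
  then show "(\<Oplus>\<^bsub>Ext\<^esub>B\<in>PI. lam (dy B \<otimes>\<^bsub>Ext\<^esub> word (sl B0)) \<odot>\<^bsub>Ext\<^esub> dx B) = word (sl B0)"
    unfolding eq using lin_smult[OF lin top_sign_closed dx_closed[OF D(1)]] by simp
qed

text \<open>The formula is forced: by \<open>dual_dx\<close> the coefficients of the Nakayama image
  of \<open>a\<close> are its pairings with the \<open>dy B\<close>, and these have to equal
  \<open>lam\<close> of \<open>a\<close> times \<open>dy B\<close>.\<close>

definition nak :: "'k exterior \<Rightarrow> 'k exterior" where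
  "nak a = (\<Oplus>\<^bsub>Ext\<^esub>B\<in>PI. lam (a \<otimes>\<^bsub>Ext\<^esub> dy B) \<odot>\<^bsub>Ext\<^esub> dx B)"

lemma nak_linear: "nak \<in> linear_maps k Ext Ext"
  unfolding nak_def by (rule combination_linear[OF linear_maps_comp[OF mult_linear(1) lam_linear]]) auto

lemma lam_combination:
  assumes b: "b \<in> carrier Ext" and r: "\<And>B. B \<subseteq> {1..c} \<Longrightarrow> r B \<in> carrier k" and v: "\<And>B. B \<subseteq> {1..c} \<Longrightarrow> v B \<in> carrier Ext"
  shows "lam (b \<otimes>\<^bsub>Ext\<^esub> (\<Oplus>\<^bsub>Ext\<^esub>B\<in>PI. r B \<odot>\<^bsub>Ext\<^esub> v B)) = (\<Oplus>B\<in>PI. r B \<otimes> lam (b \<otimes>\<^bsub>Ext\<^esub> v B))"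
  by (rule vspace.functional_finsum[OF _ linear_maps_comp[OF mult_linear(2)[OF b] lam_linear]])
    (use r v in \<open>auto intro!: vspace.intro lmod.intro Ext_module K.field_axioms\<close>)

text \<open>Exchanging the two scalar factors turns the sum over \<open>dx\<close> into the
  expansion of \<open>b\<close> along \<open>dy\<close>.\<close>

lemma lam_nak:
  assumes a: "a \<in> carrier Ext" and b: "b \<in> carrier Ext"
  shows "lam (a \<otimes>\<^bsub>Ext\<^esub> b) = lam (b \<otimes>\<^bsub>Ext\<^esub> nak a)"
proof -
  have "lam (b \<otimes>\<^bsub>Ext\<^esub> nak a) = (\<Oplus>B\<in>PI. lam (a \<otimes>\<^bsub>Ext\<^esub> dy B) \<otimes> lam (b \<otimes>\<^bsub>Ext\<^esub> dx B))"
    unfolding nak_def using a by (intro lam_combination[OF b]) auto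
  also have "\<dots> = (\<Oplus>B\<in>PI. lam (b \<otimes>\<^bsub>Ext\<^esub> dx B) \<otimes> lam (a \<otimes>\<^bsub>Ext\<^esub> dy B))"
    using a b by (intro K.finsum_cong') (auto simp: K.m_comm)
  also have "\<dots> = lam (a \<otimes>\<^bsub>Ext\<^esub> (\<Oplus>\<^bsub>Ext\<^esub>B\<in>PI. lam (b \<otimes>\<^bsub>Ext\<^esub> dx B) \<odot>\<^bsub>Ext\<^esub> dy B))"
    using b by (intro lam_combination[OF a, symmetric]) auto
  finally show ?thesis using dual_dy[OF b] by simp
qed

text \<open>By \<open>top_sign_rotate\<close>, moving \<open>word w\<close> to the other side of
  \<open>b\<close> under \<open>lam\<close> costs the same sign for every \<open>b\<close>. So
  \<open>nak\<close> is the identity for odd \<open>c\<close> and negates each generator for even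
  \<open>c\<close>.\<close>

lemma nak_word:
  assumes w: "w \<in> lists {1..c}"
  shows "nak (word w) = sign (length w * (c + 1)) \<odot>\<^bsub>Ext\<^esub> word w"
proof -
  let ?s = "sign (length w * (c + 1))"
  have key: "lam (word w \<otimes>\<^bsub>Ext\<^esub> b) = ?s \<otimes> lam (b \<otimes>\<^bsub>Ext\<^esub> word w)" if b: "b \<in> carrier Ext" for b
  proof -
    have "(\<lambda>b. lam (word w \<otimes>\<^bsub>Ext\<^esub> b)) \<in> functionals k Ext"
      by (rule linear_maps_comp[OF mult_linear(2)[OF word_closed[OF w]] lam_linear])
    moreover have "(\<lambda>b. lam (b \<otimes>\<^bsub>Ext\<^esub> (?s \<odot>\<^bsub>Ext\<^esub> word w))) \<in> functionals k Ext"
      by (rule linear_maps_comp[OF mult_linear(1) lam_linear]) (use w in simp)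
    ultimately have "lam (word w \<otimes>\<^bsub>Ext\<^esub> b) = lam (b \<otimes>\<^bsub>Ext\<^esub> (?s \<odot>\<^bsub>Ext\<^esub> word w))"
    proof (rule Ext_linear_eq_words[OF _ _ k_module _ b])
      fix v assume v: "v \<in> lists {1..c}"
      have vw: "v @ w \<in> lists {1..c}" "w @ v \<in> lists {1..c}" using v w by auto
      have "lam (word v \<otimes>\<^bsub>Ext\<^esub> (?s \<odot>\<^bsub>Ext\<^esub> word w)) = ?s \<otimes> top_sign (v @ w)"
        using v w lin_smult[OF lam_linear sign_closed word_closed[OF vw(1)]] lam_word[OF vw(1)]
        by (simp only: X.smult_mult_right word_closed word_mult sign_closed regular_module_simps)
      then show "lam (word w \<otimes>\<^bsub>Ext\<^esub> word v) = lam (word v \<otimes>\<^bsub>Ext\<^esub> (?s \<odot>\<^bsub>Ext\<^esub> word w))"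
        using lam_word[OF vw(2)] top_sign_rotate[of w v] word_mult[OF w v] by simp
    qed
    then show ?thesis
      using b w lin_smult[OF lam_linear sign_closed, of "b \<otimes>\<^bsub>Ext\<^esub> word w"] by (simp add: X.smult_mult_right)
  qed
  have "nak (word w) = (\<Oplus>\<^bsub>Ext\<^esub>B\<in>PI. ?s \<odot>\<^bsub>Ext\<^esub> (lam (dy B \<otimes>\<^bsub>Ext\<^esub> word w) \<odot>\<^bsub>Ext\<^esub> dx B))"
    unfolding nak_def using w by (intro X.KM.M.finsum_cong') (auto simp: key X.KM.smult_assoc1 simp del: in_lists_conv_set)
  also have "\<dots> = ?s \<odot>\<^bsub>Ext\<^esub> (\<Oplus>\<^bsub>Ext\<^esub>B\<in>PI. lam (dy B \<otimes>\<^bsub>Ext\<^esub> word w) \<odot>\<^bsub>Ext\<^esub> dx B)"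
    using w by (intro X.KM.smult_finsum[symmetric]) (auto simp del: in_lists_conv_set)
  finally show ?thesis using dual_dx[OF word_closed[OF w]] by simp
qed

text \<open>\<open>nak\<close> multiplies each word by a sign, and signs square to one.\<close>

lemma nak_nak: "a \<in> carrier Ext \<Longrightarrow> nak (nak a) = a"
proof (rule Ext_linear_eq_words[OF linear_maps_comp[OF nak_linear nak_linear] _ Ext_module])
  show "(\<lambda>a. a) \<in> linear_maps k Ext Ext" by (rule linear_mapsI) auto
  fix w assume w: "w \<in> lists {1..c}"
  have ww: "word w \<in> carrier Ext" by (rule word_closed[OF w])
  show "nak (nak (word w)) = word w"
    using lin_smult[OF nak_linear sign_closed ww, of "length w * (c + 1)"] nak_word[OF w]
      X.KM.smult_assoc1[OF sign_closed sign_closed ww, of "length w * (c + 1)" "length w * (c + 1)"] ww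
    by (simp only: sign_square X.KM.smult_one)
qed

end

section \<open>Duality for Tate-Hochschild homology and cohomology\<close>

context tate_complex
begin

lemma cohomology_isomorphic:
  "isomorphic_modules k
     (homology_at (hom_space E (T (n - 1)) (twist AL)) (hom_space E (T n) (twist AL))
        (hom_space E (T (n + 1)) (twist AL)) (precompose (T n) (d n)) (precompose (T (n + 1)) (d (n + 1))))
     (homology_at (hom_space E (T (- n - 2)) (twist AL)) (hom_space E (T (- n - 1)) (twist AL))
        (hom_space E (T (- n)) (twist AL)) (precompose (T (- n - 1)) (d (- n - 1))) (precompose (T (- n)) (d (- n))))"
proof -
  have H: "left_module k (hom_space E (T m) (twist AL))" for m
    by (intro E.hom_space_module T_mod twist_module AL_module)
  have dm: "precompose (T m) (d m) \<in> linear_maps k (hom_space E (T (m - 1)) (twist AL)) (hom_space E (T m) (twist AL))" for m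
    by (rule E.precompose_linear[OF T_mod T_mod dT])
  have d1: "precompose (T (m + 1)) (d (m + 1)) \<in> linear_maps k (hom_space E (T m) (twist AL)) (hom_space E (T (m + 1)) (twist AL))" for m
    by (rule E.precompose_linear[OF T_mod T_mod dT1])
  have 0: "precompose (T (m + 1)) (d (m + 1)) (precompose (T m) (d m) u) = \<zero>\<^bsub>hom_space E (T (m + 1)) (twist AL)\<^esub>"
    if "u \<in> carrier (hom_space E (T (m - 1)) (twist AL))" for u m
  proof -
    have "u \<zero>\<^bsub>T (m - 1)\<^esub> = \<zero>\<^bsub>twist AL\<^esub>"
      using lmap.map_zero[OF lmapI[OF T_mod twist_module[OF AL_module]]] that by simp
    then show ?thesis
      using dd lin_closed[OF dT1] by (auto simp: precompose_def fun_eq_iff restrict_def)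
  qed
  have e: "- n - 1 + 1 = - n" "- n - 1 - 1 = - n - 2" by simp_all
  show ?thesis
    by (rule homology_isomorphic[OF H H H dm d1 0 H H H dm[of "- n - 1", unfolded e] d1[of "- n - 1", unfolded e]
          0[of _ "- n - 1", unfolded e] cohomology_duality])
qed

end

lemma (in tate_homology) homology_isomorphic':
  "isomorphic_modules k
     (homology_at (TST (n + 1)) (TST n) (TST (n - 1))
        (tensor_map k E AR (T n) (d (n + 1))) (tensor_map k E AR (T (n - 1)) (d n)))
     (homology_at (TST (- n)) (TST (- n - 1)) (TST (- n - 2))
        (tensor_map k E AR (T (- n - 1)) (d (- n))) (tensor_map k E AR (T (- n - 2)) (d (- n - 1))))"
proof -
  have H: "left_module k (TST m)" for m by (rule TS_module[OF T_mod])
  have d0: "tensor_map k E AR (T (m - 1)) (d m) \<in> linear_maps k (TST m) (TST (m - 1))" for m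
    by (rule tensor_map_linear[OF T_mod T_mod dT])
  have d1: "tensor_map k E AR (T m) (d (m + 1)) \<in> linear_maps k (TST (m + 1)) (TST m)" for m
    by (rule tensor_map_linear[OF T_mod T_mod dT1])
  have 0: "tensor_map k E AR (T (m - 1)) (d m) (tensor_map k E AR (T m) (d (m + 1)) u) = \<zero>\<^bsub>TST (m - 1)\<^esub>"
    if u: "u \<in> carrier (TST (m + 1))" for u m
  proof -
    obtain t where t: "t \<in> carrier (T (m + 1))" "u = tens_one (T (m + 1)) t"
      using tens_one_surj[OF T_mod u] by blast
    have "tens_one (T (m - 1)) \<zero>\<^bsub>T (m - 1)\<^esub> = \<zero>\<^bsub>TST (m - 1)\<^esub>"
      using lmap.map_zero[OF lmapI[OF rs_mod H tens_one_linear[OF T_mod]]] by simp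
    then show ?thesis
      using t dd[OF t(1)] lin_closed[OF dT1 t(1)]
      by (simp add: tensor_map_tens_one[OF T_mod T_mod dT1] tensor_map_tens_one[OF T_mod T_mod dT])
  qed
  have e: "- n - 1 + 1 = - n" "- n - 1 - 1 = - n - 2" by simp_all
  show ?thesis
    by (rule homology_isomorphic[OF H H H d1 d0 0 H H H d1[of "- n - 1", unfolded e] d0[of "- n - 1", unfolded e]
          0[of _ "- n - 1", unfolded e] homology_duality])
qed

text \<open>Eliminates the projective resolution: \<open>\<eta>\<close> is its augmentation composed
  with \<open>f 0\<close>, and bijectivity of \<open>f 0\<close> and \<open>f 1\<close> carries
  exactness at \<open>P 0\<close> over to \<open>T 0\<close>. Acyclicity of \<open>Hom(T, E)\<close>
  is restated as an extension property of maps that are not restricted to the carrier.\<close>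

lemma complete_resolution_data:
  fixes T :: "int \<Rightarrow> (('k, 'a) enveloping, 'm) module"
  assumes "complete_resolution k A T d"
  defines "E \<equiv> enveloping_algebra k A"
  obtains \<eta> :: "'m \<Rightarrow> 'a" and S :: "int \<Rightarrow> 'm set" and q \<phi> where
    "\<And>n. left_module E (T n)" "\<And>n. d n \<in> linear_maps E (T n) (T (n - 1))"
    "\<And>n. dual_basis E (T n) (S n) (q n) (\<phi> n)"
    "\<And>t n. t \<in> carrier (T n) \<Longrightarrow> d n t = \<zero>\<^bsub>T (n - 1)\<^esub> \<longleftrightarrow> t \<in> d (n + 1) ` carrier (T (n + 1))"
    "\<And>u n. \<lbrakk>u \<in> linear_maps E (T n) (regular_module E); \<And>t. t \<in> carrier (T (n + 1)) \<Longrightarrow> u (d (n + 1) t) = \<zero>\<^bsub>E\<^esub>\<rbrakk>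
      \<Longrightarrow> \<exists>w\<in>linear_maps E (T (n - 1)) (regular_module E). \<forall>t\<in>carrier (T n). w (d n t) = u t"
    "\<eta> \<in> linear_maps E (T 0) (regular_left k A)" "\<eta> ` carrier (T 0) = carrier (regular_left k A)"
    "\<And>t. t \<in> carrier (T 0) \<Longrightarrow> \<eta> t = \<zero>\<^bsub>regular_left k A\<^esub> \<longleftrightarrow> t \<in> d 1 ` carrier (T 1)"
proof -
  let ?R = "regular_module E"
  note * = assms(1)[unfolded complete_resolution_def Let_def, folded E_def]
  have cc: "chain_complex E T d" and fp: "\<And>n. finitely_generated E (T n)" "\<And>n. projective_module E (T n)"
    and ex: "\<And>n. exact_at (T (n + 1)) (T n) (T (n - 1)) (d (n + 1)) (d n)"
    and exh: "\<And>n. exact_at (hom_space E (T (n - 1)) ?R) (hom_space E (T n) ?R) (hom_space E (T (n + 1)) ?R)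
             (precompose (T n) (d n)) (precompose (T (n + 1)) (d (n + 1)))"
    using * by auto
  obtain P :: "int \<Rightarrow> (('k, 'a) enveloping, 'm) module" and \<delta> \<epsilon> f where
    pr: "projective_resolution E (regular_left k A) P \<delta> \<epsilon>" and cm: "chain_map E T d P \<delta> f"
    and bij: "\<And>n. n \<ge> 0 \<Longrightarrow> bij_betw (f n) (carrier (T n)) (carrier (P n))"
    using * by auto
  have T: "left_module E (T n)" and d: "d n \<in> linear_maps E (T n) (T (n - 1))" for n
    using cc by (auto simp: chain_complex_def)
  have dT1: "d (n + 1) \<in> linear_maps E (T (n + 1)) (T n)" for n using d[of "n + 1"] by simp
  have "\<forall>n. \<exists>S :: 'm set. \<exists>q \<phi>. dual_basis E (T n) S q \<phi>"
    using projective_dual_basis[OF fp] by metis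
  then obtain S :: "int \<Rightarrow> 'm set" and q \<phi> where B: "\<And>n. dual_basis E (T n) (S n) (q n) (\<phi> n)" by metis
  have exact: "d n t = \<zero>\<^bsub>T (n - 1)\<^esub> \<longleftrightarrow> t \<in> d (n + 1) ` carrier (T (n + 1))" if "t \<in> carrier (T n)" for t n
    using ex[of n] that by (auto simp: exact_at_def cycles_def)
  have ext: "\<exists>w\<in>linear_maps E (T (n - 1)) ?R. \<forall>t\<in>carrier (T n). w (d n t) = u t"
    if u: "u \<in> linear_maps E (T n) ?R" and 0: "\<And>t. t \<in> carrier (T (n + 1)) \<Longrightarrow> u (d (n + 1) t) = \<zero>\<^bsub>E\<^esub>" for u n
  proof -
    have "restrict u (carrier (T n)) \<in> linear_maps E (T n) ?R"
      by (rule linear_maps_cong[OF u _ T]) simp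
    then have "restrict u (carrier (T n)) \<in> cycles (hom_space E (T n) ?R) (hom_space E (T (n + 1)) ?R)
        (precompose (T (n + 1)) (d (n + 1)))"
      using 0 lin_closed[OF dT1] by (auto simp: cycles_def precompose_def intro!: restrict_ext)
    then have "restrict u (carrier (T n)) \<in> precompose (T n) (d n) ` carrier (hom_space E (T (n - 1)) ?R)"
      using exh[of n] by (simp add: exact_at_def)
    then obtain w where w: "w \<in> linear_maps E (T (n - 1)) ?R" "restrict u (carrier (T n)) = precompose (T n) (d n) w" by auto
    have "w (d n t) = u t" if "t \<in> carrier (T n)" for t
      using fun_cong[OF w(2), of t] that by (simp add: precompose_def)
    then show ?thesis using w(1) by blast
  qed
  have f: "f n \<in> linear_maps E (T n) (P n)" and fd: "\<And>t. t \<in> carrier (T n) \<Longrightarrow> f (n - 1) (d n t) = \<delta> n (f n t)" for n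
    using cm by (auto simp: chain_map_def)
  have eps: "\<epsilon> \<in> linear_maps E (P 0) (regular_left k A)" "\<delta> 1 ` carrier (P 1) = cycles (P 0) (regular_left k A) \<epsilon>"
    "\<epsilon> ` carrier (P 0) = carrier (regular_left k A)"
    using pr by (auto simp: projective_resolution_def exact_at_def)
  have b0: "f 0 ` carrier (T 0) = carrier (P 0)" "inj_on (f 0) (carrier (T 0))" and b1: "f 1 ` carrier (T 1) = carrier (P 1)"
    using bij[of 0] bij[of 1] by (auto simp: bij_betw_def)
  show thesis
  proof (rule that[OF T d B exact ext, of "\<lambda>t. \<epsilon> (f 0 t)"])
    show "(\<lambda>t. \<epsilon> (f 0 t)) \<in> linear_maps E (T 0) (regular_left k A)" by (rule linear_maps_comp[OF f eps(1)])
    show "(\<lambda>t. \<epsilon> (f 0 t)) ` carrier (T 0) = carrier (regular_left k A)"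
      using b0 eps(3) by (simp add: image_image[symmetric])
    fix t assume t: "t \<in> carrier (T 0)"
    have "\<epsilon> (f 0 t) = \<zero>\<^bsub>regular_left k A\<^esub> \<longleftrightarrow> f 0 t \<in> \<delta> 1 ` carrier (P 1)"
      unfolding eps(2) using lin_closed[OF f t] by (simp add: cycles_def)
    also have "\<dots> \<longleftrightarrow> (\<exists>s\<in>carrier (T 1). f 0 t = f 0 (d 1 s))"
      unfolding b1[symmetric] using fd[of _ 1] by auto
    also have "\<dots> \<longleftrightarrow> t \<in> d 1 ` carrier (T 1)"
      using b0(2) t lin_closed[OF dT1[of 0]] by (auto simp: inj_on_def image_iff)
    finally show "\<epsilon> (f 0 t) = \<zero>\<^bsub>regular_left k A\<^esub> \<longleftrightarrow> t \<in> d 1 ` carrier (T 1)" .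
  qed
qed

locale exterior_enveloping = exterior k c + V: enveloping k Ext for k :: "'k ring" (structure) and c
begin

text \<open>This is \<open>id \<otimes> h\<close>; for \<open>h = nak\<close> it is the automorphism
  \<open>al\<close> that belongs to homology.\<close>

definition twisting :: "('k exterior \<Rightarrow> 'k exterior) \<Rightarrow> ('k, 'k exterior) enveloping \<Rightarrow> ('k, 'k exterior) enveloping" where
  "twisting h = V.env_ext V.Env (\<lambda>p. V.tens (fst p) (h (snd p)))"

lemma twisting:
  assumes h: "h \<in> linear_maps k Ext Ext"
  shows "twisting h \<in> linear_maps k V.Env V.Env"
    and "\<lbrakk>a \<in> carrier Ext; b \<in> carrier Ext\<rbrakk> \<Longrightarrow> twisting h (V.tens a b) = V.tens a (h b)"
proof -
  have 1: "(\<lambda>a. V.tens a (h b)) \<in> linear_maps k Ext V.Env" if "b \<in> carrier Ext" for b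
    by (rule V.tens_left[OF lin_closed[OF h that]])
  have 2: "(\<lambda>b. V.tens a (h b)) \<in> linear_maps k Ext V.Env" if "a \<in> carrier Ext" for a
    by (rule linear_maps_comp[OF h V.tens_right[OF that]])
  note e = V.env_ext[OF V.Env_module, of "\<lambda>p. V.tens (fst p) (h (snd p))"]
  show "twisting h \<in> linear_maps k V.Env V.Env"
    unfolding twisting_def using e(1) 1 2 lin_closed[OF h] by simp
  show "twisting h (V.tens a b) = V.tens a (h b)" if "a \<in> carrier Ext" "b \<in> carrier Ext"
    unfolding twisting_def using e(2)[OF _ _ _ that] 1 2 lin_closed[OF h] by simp
qed

definition lam_left :: "('k, 'k exterior) enveloping \<Rightarrow> 'k exterior" where
  "lam_left = V.env_ext Ext (\<lambda>p. lam (fst p) \<odot>\<^bsub>Ext\<^esub> snd p)"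

lemma lam_left:
  shows "lam_left \<in> linear_maps k V.Env Ext"
    and "\<lbrakk>a \<in> carrier Ext; b \<in> carrier Ext\<rbrakk> \<Longrightarrow> lam_left (V.tens a b) = lam a \<odot>\<^bsub>Ext\<^esub> b"
proof -
  have 1: "(\<lambda>a. lam a \<odot>\<^bsub>Ext\<^esub> b) \<in> linear_maps k Ext Ext" if "b \<in> carrier Ext" for b
    by (rule linear_maps_comp[OF lam_linear orbit_linear[OF Ext_module that]])
  have 2: "(\<lambda>b. lam a \<odot>\<^bsub>Ext\<^esub> b) \<in> linear_maps k Ext Ext" if "a \<in> carrier Ext" for a
    by (rule linear_mapsI)
      (use that lam_closed[OF that] in \<open>auto simp: X.KM.smult_r_distr X.KM.smult_assoc1[symmetric] K.m_comm\<close>)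
  note e = V.env_ext[OF Ext_module, of "\<lambda>p. lam (fst p) \<odot>\<^bsub>Ext\<^esub> snd p"]
  show "lam_left \<in> linear_maps k V.Env Ext"
    unfolding lam_left_def using e(1) 1 2 by simp
  show "lam_left (V.tens a b) = lam a \<odot>\<^bsub>Ext\<^esub> b" if "a \<in> carrier Ext" "b \<in> carrier Ext"
    unfolding lam_left_def using e(2)[OF _ _ _ that] 1 2 by simp
qed

sublocale FP: frobenius_pair k Ext V.Env V.tens PI dx dy lam nak lam_left "regular_left k Ext"
proof (intro frobenius_pair.intro frobenius_pair_axioms.intro Ext_k_algebra V.Env_k_algebra)
  show "carrier V.Env \<subseteq> H"
    if "\<And>a b. \<lbrakk>a \<in> carrier Ext; b \<in> carrier Ext\<rbrakk> \<Longrightarrow> V.tens a b \<in> H"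
      "\<And>e f. \<lbrakk>e \<in> carrier V.Env; f \<in> carrier V.Env; e \<in> H; f \<in> H\<rbrakk> \<Longrightarrow> e \<oplus>\<^bsub>V.Env\<^esub> f \<in> H" for H
    using that by (rule V.tens_generates)
  show "(\<lambda>e. e \<odot>\<^bsub>regular_left k Ext\<^esub> b) \<in> linear_maps k V.Env Ext" if "b \<in> carrier Ext" for b
    by (rule V.regular_left_action(1)[OF that])
  show "(\<lambda>a. V.tens a b) \<in> linear_maps k Ext V.Env" if "b \<in> carrier Ext" for b
    by (rule V.tens_left[OF that])
  show "V.tens a \<in> linear_maps k Ext V.Env" if "a \<in> carrier Ext" for a
    by (rule V.tens_right[OF that])
  show "V.tens a b \<otimes>\<^bsub>V.Env\<^esub> V.tens a' b' = V.tens (a \<otimes>\<^bsub>Ext\<^esub> a') (b' \<otimes>\<^bsub>Ext\<^esub> b)"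
    if "a \<in> carrier Ext" "b \<in> carrier Ext" "a' \<in> carrier Ext" "b' \<in> carrier Ext" for a b a' b'
    by (rule V.tens_mult[OF that])
  show "V.tens \<one>\<^bsub>Ext\<^esub> \<one>\<^bsub>Ext\<^esub> = \<one>\<^bsub>V.Env\<^esub>" by (rule V.Env_simps(5)[symmetric])
  show "finite PI" by simp
  show "dx B \<in> carrier Ext" "dy B \<in> carrier Ext" if "B \<in> PI" for B
    using that dx_closed dy_closed by blast+
  show "nak a \<in> carrier Ext" if "a \<in> carrier Ext" for a by (rule lin_closed[OF nak_linear that])
  show "V.tens a b \<odot>\<^bsub>regular_left k Ext\<^esub> c' = a \<otimes>\<^bsub>Ext\<^esub> c' \<otimes>\<^bsub>Ext\<^esub> b"
    if "a \<in> carrier Ext" "b \<in> carrier Ext" "c' \<in> carrier Ext" for a b c'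
    by (rule V.regular_left_action(2)[OF that(3,1,2)])
qed (fact lam_linear dual_dy dual_dx lam_nak nak_nak lam_left V.regular_left_simps)+

end

theorem theorem4p2:
  fixes k :: "'k ring"
    and c :: nat
    and T :: "int \<Rightarrow> (('k, 'k exterior) enveloping, 'm) module"
    and d :: "int \<Rightarrow> 'm \<Rightarrow> 'm"
  assumes "field k"
    and "c \<ge> 1"
    and "complete_resolution k (exterior_algebra k c) T d"
  shows "\<forall>n :: int.
      isomorphic_modules k
        (tate_hochschild_homology k (exterior_algebra k c) T d n)
        (tate_hochschild_homology k (exterior_algebra k c) T d (- (n + 1))) \<and>
      isomorphic_modules k
        (tate_hochschild_cohomology k (exterior_algebra k c) T d n)
        (tate_hochschild_cohomology k (exterior_algebra k c) T d (- (n + 1)))"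
proof -
  interpret X: exterior k c by (intro exterior.intro assms(1))
  have cr: "complete_resolution k X.Ext T d" using assms(3) by (simp add: X.Ext_def)
  show ?thesis
  proof (rule complete_resolution_data[OF cr])
  fix \<eta> and S :: "int \<Rightarrow> 'm set" and q \<phi>
  assume T:
    "\<And>n. left_module (enveloping_algebra k X.Ext) (T n)" and data:
    "\<And>n. d n \<in> linear_maps (enveloping_algebra k X.Ext) (T n) (T (n - 1))"
    "\<And>n. dual_basis (enveloping_algebra k X.Ext) (T n) (S n) (q n) (\<phi> n)"
    "\<And>t n. t \<in> carrier (T n) \<Longrightarrow> d n t = \<zero>\<^bsub>T (n - 1)\<^esub> \<longleftrightarrow> t \<in> d (n + 1) ` carrier (T (n + 1))"
    "\<And>u n. \<lbrakk>u \<in> linear_maps (enveloping_algebra k X.Ext) (T n) (regular_module (enveloping_algebra k X.Ext));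
        \<And>t. t \<in> carrier (T (n + 1)) \<Longrightarrow> u (d (n + 1) t) = \<zero>\<^bsub>enveloping_algebra k X.Ext\<^esub>\<rbrakk>
      \<Longrightarrow> \<exists>w\<in>linear_maps (enveloping_algebra k X.Ext) (T (n - 1)) (regular_module (enveloping_algebra k X.Ext)).
        \<forall>t\<in>carrier (T n). w (d n t) = u t"
    "\<eta> \<in> linear_maps (enveloping_algebra k X.Ext) (T 0) (regular_left k X.Ext)"
    "\<eta> ` carrier (T 0) = carrier (regular_left k X.Ext)"
    "\<And>t. t \<in> carrier (T 0) \<Longrightarrow> \<eta> t = \<zero>\<^bsub>regular_left k X.Ext\<^esub> \<longleftrightarrow> t \<in> d 1 ` carrier (T 1)"
  \<comment> \<open>The ring axioms for the enveloping algebra are contained in the statement that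
    \<open>T n\<close> is a module over it.\<close>
  have "ring (enveloping_algebra k X.Ext)" using left_module.axioms(1)[OF T] .
  then interpret W: exterior_enveloping k c
    by (intro exterior_enveloping.intro exterior.intro assms(1) enveloping.intro enveloping_axioms.intro X.Ext_k_algebra)
  note T' = T[folded W.V.Env_def] and data' = data[folded W.V.Env_def]
  have id: "(\<lambda>a. a) \<in> linear_maps k X.Ext X.Ext" "(\<lambda>e. e) \<in> linear_maps k W.V.Env W.V.Env"
    by (rule linear_mapsI; simp)+
  \<comment> \<open>Untwisted coefficients, for cohomology.\<close>
  interpret C: tate_complex k X.Ext W.V.Env W.V.tens X.PI X.dx X.dy X.lam X.nak W.lam_left "regular_left k X.Ext"
    "\<lambda>a. a" "\<lambda>e. e" T d \<eta> S q \<phi>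
    by (intro tate_complex.intro tate_complex_axioms.intro twisted_pair.intro twisted_pair_axioms.intro
        W.FP.frobenius_pair_axioms id T' data' refl)
  \<comment> \<open>Coefficients twisted by the Nakayama automorphism, for homology.\<close>
  interpret N: twisted_pair k X.Ext W.V.Env W.V.tens X.PI X.dx X.dy X.lam X.nak W.lam_left "regular_left k X.Ext"
    X.nak "W.twisting X.nak"
    by (intro twisted_pair.intro twisted_pair_axioms.intro W.FP.frobenius_pair_axioms X.nak_linear X.nak_nak
        W.FP.nu_one W.FP.nu_mult W.twisting[OF X.nak_linear])
  \<comment> \<open>Here \<open>om\<close> is \<open>nak\<close> applied twice, hence the identity,
    as \<open>om_id\<close> demands.\<close>
  interpret H: tate_homology k X.Ext W.V.Env W.V.tens X.PI X.dx X.dy X.lam X.nak W.lam_left "regular_left k X.Ext"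
    X.nak "W.twisting X.nak" T d \<eta> S q \<phi> "regular_right k X.Ext"
    by (intro tate_homology.intro tate_homology_axioms.intro tate_complex.intro tate_complex_axioms.intro
        N.twisted_pair_axioms T' data' W.V.regular_right_simps W.V.regular_right_action)
      (simp_all add: N.om_def X.nak_nak)
  \<comment> \<open>Twisting by the identity leaves the record unchanged, so the coefficients are
    literally \<open>regular_left\<close>.\<close>
  have tw: "C.twist M = M" for M :: "(('k, 'k exterior) enveloping, 'b) module"
    by (cases M) (simp add: C.twist_def)
  show ?thesis
  proof (intro allI conjI)
    fix n :: int
    have e: "- (n + 1) = - n - 1" "- n - 1 + 1 = - n" "- n - 1 - 1 = - n - 2" by simp_all
    show "isomorphic_modules k
        (tate_hochschild_homology k (exterior_algebra k c) T d n)
        (tate_hochschild_homology k (exterior_algebra k c) T d (- (n + 1)))"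
      unfolding tate_hochschild_homology_def Let_def X.Ext_def[symmetric] W.V.Env_def[symmetric] e
      by (rule H.homology_isomorphic')
    show "isomorphic_modules k
        (tate_hochschild_cohomology k (exterior_algebra k c) T d n)
        (tate_hochschild_cohomology k (exterior_algebra k c) T d (- (n + 1)))"
      unfolding tate_hochschild_cohomology_def Let_def X.Ext_def[symmetric] W.V.Env_def[symmetric] e
      by (rule C.cohomology_isomorphic[unfolded tw])
  qed
  qed
qed

end
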